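(* Suppose that: (1) $(Y_i(0),Y_i(1),X_i)$ are i.i.d. across $i$ and $\mathbb{E}\left(Y(0)^2+Y(1)^2+\|X\|^2\right)<\infty$; (2) for each $n$, the assignment $(D_1,\dots,D_n)$ is independent of $(Y_1(0),Y_1(1),\dots,Y_n(0),Y_n(1))$ conditionally on $X_1,\dots,X_n$, and for every $i$, $\mathbb{P}(D_i=1\mid X_1,\dots,X_n)=p(X_i)\in[c,1-c]$ for a function $p(\cdot)$ chosen by the researcher and a constant $c>0$; write $\pi_i=p(X_i)$; (3) with $Z_{1i}=\left(1,\frac{\pi_i}{1-\pi_i},\pi_i,\frac{X_i'}{1-\pi_i}\right)'$ and $Z_{0i}=\frac{1-\pi_i}{\pi_i}Z_{1i}=\left(\frac{1-\pi_i}{\pi_i},1,1-\pi_i,\frac{X_i'}{\pi_i}\right)'$, for $d\in\{0,1\}$ one has $Y_i(d)=Z_{di}'\beta_d+\varepsilon_i(d)$ with $\mathbb{E}[\varepsilon_i(d)\mid Z_{di}]=0$; (4) (Poisson approximation, assumed for the cube design) for every integer $k\ge1$, with probability one, $$\lim_{n\to\infty}\ \sup_{i_1,\dots,i_k}\left|\mathbb{E}\left(\prod_{j=1}^k(D_{i_j}-\pi_{i_j})\,\Big|\,X_1,\dots,X_n\right)\right|=0,$$ the supremum being over distinct indices $i_1,\dots,i_k\in\{1,\dots,n\}$. Let $\theta_0=\frac1n\sum_{i=1}^n\left(Y_i(1)-Y_i(0)\right)$, $\theta_0^\ast=\mathbb{E}[Y_i(1)-Y_i(0)]$, and let $\widehat\theta$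 be either the Horvitz–Thompson estimator $\widehat\theta_{HT}$ or the Hájek estimator $\widehat\theta_H$. If the assignment is generated by the cube method with balancing variables $Z_{1i}$, then $$\sqrt n\left(\widehat\theta-\theta_0\right)\stackrel{d}{\longrightarrow}\mathcal{N}(0,V_0)\quad\text{and}\quad\sqrt n\left(\widehat\theta-\theta_0^\ast\right)\stackrel{d}{\longrightarrow}\mathcal{N}(0,V_0^\ast),$$ where $$V_0=\mathbb{E}\left(\pi_i(1-\pi_i)\left(\frac{\varepsilon_i(1)}{\pi_i}+\frac{\varepsilon_i(0)}{1-\pi_i}\right)^2\right),\qquad V_0^\ast=\mathbb{V}(Z_{1i}'\beta_1-Z_{0i}'\beta_0)+\mathbb{E}\left[\frac{\varepsilon_i(1)^2}{\pi_i}\right]+\mathbb{E}\left[\frac{\varepsilon_i(0)^2}{1-\pi_i}\right].$$ If a coin toss is used instead, then $$\sqrt n\left(\widehat\theta-\theta_0\right)\stackrel{d}{\longrightarrow}\mathcal{N}(0,V_0+\Sigma_0)\quad\text{and}\quad\sqrt n\left(\widehat\theta-\theta_0^\ast\right)\stackrel{d}{\longrightarrow}\mathcal{N}(0,V_0^\ast+\Sigma_0),$$ with $\Sigma_0=\mathbb{E}\left[\frac{\pi_i}{1-\pi_i}\left(Z_{0i}'(\beta_1+\beta_0)\right)^2\right]\ge0$.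
   Context: Setting. $Y_i(0),Y_i(1)$ are potential outcomes, $X_i\in\mathbb{R}^p$ covariates ($p$ fixed), $D_i\in\{0,1\}$ the treatment indicator, and $Y_i=Y_i(1)D_i+Y_i(0)(1-D_i)$ the observed outcome. Estimators. $$\widehat\theta_{HT}=\frac1n\sum_{i=1}^n\left(\frac{Y_iD_i}{\pi_i}-\frac{Y_i(1-D_i)}{1-\pi_i}\right),\qquad \widehat\theta_H=\frac{\sum_{i=1}^n Y_iD_i/\pi_i}{\sum_{i=1}^n D_i/\pi_i}-\frac{\sum_{i=1}^n Y_i(1-D_i)/(1-\pi_i)}{\sum_{i=1}^n(1-D_i)/(1-\pi_i)}.$$ Coin toss: conditionally on $X_1,\dots,X_n$, the $D_i$ are independent Bernoulli variables with means $\pi_i$. Cube method. Given $\boldsymbol{\pi}=(\pi_1,\dots,\pi_n)\in(0,1)^n$ and balancing vectors $Z_1,\dots,Z_n\in\mathbb{R}^q$ (here $Z_i=Z_{1i}$, redundant collinear components being dropped), let $C=[0,1]^n$, let $A$ be the $q\times n$ matrix with columns $Z_i/\pi_i$, and let $K=C\cap(\boldsymbol{\pi}+\ker A)$, the set of $s\in C$ with $\sum_i Z_is_i/\pi_i=\sum_i Z_i$. Flight phase: starting from $\boldsymbol{\pi}(0)=\boldsymbol{\pi}$, one builds a random sequence $\boldsymbol{\pi}(t)\in K$; at each step a random direction in $\ker A$ is chosen (coordinates already equal to $0$ or $1$ are kept fixed) and one moves along it up to a facet of the current face of $K$, in such a way that $\mathbb{E}[\boldsymbol{\pi}(t+1)\mid\boldsymbol{\pi}(t)]=\boldsymbol{\pi}(t)$;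 each step fixes at least one more coordinate to $0$ or $1$. It ends at a vertex $\boldsymbol{\pi}^\ast$ of $K$, at which at most $q$ coordinates are not in $\{0,1\}$. Units with $\pi^\ast_i\in\{0,1\}$ get $D_i=\pi_i^\ast$. Landing phase: the remaining (at most $q$) units are randomly assigned so that $\mathbb{E}[D_i\mid\boldsymbol{\pi}^\ast]=\pi^\ast_i$.
   Formalization: For the Hájek estimator under a coin toss, the claim with Σ_0 is false (e.g. Y(0)=Y(1)=1, X=0, π=1/2); there Σ_0 is replaced by the same formula with β_1, β_0 shifted to those of the outcomes centred at their means E[Y(1)], E[Y(0)]. *)

theory Defs
  imports "HOL-Probability.Probability"
begin

section \<open>Conditioning and convergence in distribution\<close>

text \<open>The sub-sigma-algebra generated by the first \<open>n\<close> terms of a sequence (units are numbered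
  \<open>0, \<dots>, n - 1\<close>).\<close>

definition sigma_upto :: "'a measure \<Rightarrow> nat \<Rightarrow> (nat \<Rightarrow> 'a \<Rightarrow> 'b::topological_space) \<Rightarrow> 'a measure" where
  "sigma_upto M n X =
     vimage_algebra (space M) (\<lambda>\<omega>. \<lambda>i\<in>{..<n}. X i \<omega>) (Pi\<^sub>M {..<n} (\<lambda>_. borel))"

definition cond_indep_pair ::
  "'a measure \<Rightarrow> 'a measure \<Rightarrow> 'b measure \<Rightarrow> ('a \<Rightarrow> 'b) \<Rightarrow> 'c measure \<Rightarrow> ('a \<Rightarrow> 'c) \<Rightarrow> bool" where
  "cond_indep_pair M F N U N' V \<longleftrightarrow>
     (\<forall>A\<in>sets N. \<forall>B\<in>sets N'. AE \<omega> in M.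
        real_cond_exp M F (\<lambda>\<omega>. indicator A (U \<omega>) * indicator B (V \<omega>)) \<omega> =
        real_cond_exp M F (\<lambda>\<omega>. indicator A (U \<omega>)) \<omega> * real_cond_exp M F (\<lambda>\<omega>. indicator B (V \<omega>)) \<omega>)"

text \<open>Conditional independence of a finite family; subfamilies are covered by letting some of the
  \<open>A i\<close> be the whole space.\<close>

definition cond_indep_family ::
  "'a measure \<Rightarrow> 'a measure \<Rightarrow> nat \<Rightarrow> (nat \<Rightarrow> 'a \<Rightarrow> real) \<Rightarrow> bool" where
  "cond_indep_family M F n U \<longleftrightarrow>
     (\<forall>A :: nat \<Rightarrow> real set. (\<forall>i<n. A i \<in> sets borel) \<longrightarrow> (AE \<omega> in M.
        real_cond_exp M F (\<lambda>\<omega>. \<Prod>i<n. indicator (A i) (U i \<omega>)) \<omega> =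
        (\<Prod>i<n. real_cond_exp M F (\<lambda>\<omega>. indicator (A i) (U i \<omega>)) \<omega>)))"

text \<open>\<open>normal_density \<mu> 0\<close> vanishes identically, so the degenerate case needs a point mass.\<close>

definition normal_law :: "real \<Rightarrow> real \<Rightarrow> real measure" where
  "normal_law \<mu> v =
     (if v = 0 then return borel \<mu>
      else density lborel (\<lambda>x. ennreal (normal_density \<mu> (sqrt v) x)))"

definition converges_to_normal :: "'a measure \<Rightarrow> (nat \<Rightarrow> 'a \<Rightarrow> real) \<Rightarrow> real \<Rightarrow> bool" where
  "converges_to_normal M T v \<longleftrightarrow> weak_conv_m (\<lambda>n. distr M borel (T n)) (normal_law 0 v)"


section \<open>Balancing variables and estimators\<close>

definition balance1 :: "real \<Rightarrow> 'x::real_vector \<Rightarrow> real \<times> real \<times> real \<times> 'x" where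
  "balance1 q x = (1, q / (1 - q), q, (1 / (1 - q)) *\<^sub>R x)"

definition balance0 :: "real \<Rightarrow> 'x::real_vector \<Rightarrow> real \<times> real \<times> real \<times> 'x" where
  "balance0 q x = ((1 - q) / q) *\<^sub>R balance1 q x"

definition observed :: "(nat \<Rightarrow> real) \<Rightarrow> (nat \<Rightarrow> real) \<Rightarrow> (nat \<Rightarrow> real) \<Rightarrow> nat \<Rightarrow> real" where
  "observed y0 y1 d i = y1 i * d i + y0 i * (1 - d i)"

definition horvitz_thompson :: "nat \<Rightarrow> (nat \<Rightarrow> real) \<Rightarrow> (nat \<Rightarrow> real) \<Rightarrow> (nat \<Rightarrow> real) \<Rightarrow> real" where
  "horvitz_thompson n q y d =
     (1 / real n) * (\<Sum>i<n. y i * d i / q i - y i * (1 - d i) / (1 - q i))"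

definition hajek :: "nat \<Rightarrow> (nat \<Rightarrow> real) \<Rightarrow> (nat \<Rightarrow> real) \<Rightarrow> (nat \<Rightarrow> real) \<Rightarrow> real" where
  "hajek n q y d =
     (\<Sum>i<n. y i * d i / q i) / (\<Sum>i<n. d i / q i) -
     (\<Sum>i<n. y i * (1 - d i) / (1 - q i)) / (\<Sum>i<n. (1 - d i) / (1 - q i))"


section \<open>Coin toss and cube method\<close>

text \<open>In both designs \<open>X\<close> is the sequence of covariates that is conditioned on, \<open>q\<close> the assignment
  probabilities and \<open>D\<close> the assignment, of which only the first \<open>n\<close> terms matter.\<close>

definition coin_toss ::
  "'a measure \<Rightarrow> nat \<Rightarrow> (nat \<Rightarrow> 'a \<Rightarrow> 'x::topological_space) \<Rightarrow> (nat \<Rightarrow> 'a \<Rightarrow> real) \<Rightarrow>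
   (nat \<Rightarrow> 'a \<Rightarrow> real) \<Rightarrow> bool" where
  "coin_toss M n X q D \<longleftrightarrow>
     (\<forall>i<n. D i \<in> borel_measurable M \<and> (\<forall>\<omega>\<in>space M. D i \<omega> \<in> {0, 1})) \<and>
     cond_indep_family M (sigma_upto M n X) n D \<and>
     (\<forall>i<n. AE \<omega> in M. real_cond_exp M (sigma_upto M n X) (D i) \<omega> = q i \<omega>)"

text \<open>Points of \<open>[0,1]\<^sup>n\<close> are functions on \<open>nat\<close> of which only the values below \<open>n\<close> are looked at.
  Dropping redundant components of the balancing vectors \<open>Z\<close> changes neither the polytope nor
  the set of directions below, so all components are kept.\<close>

definition cube_polytope ::
  "nat \<Rightarrow> (nat \<Rightarrow> real) \<Rightarrow> (nat \<Rightarrow> 'z::real_vector) \<Rightarrow> (nat \<Rightarrow> real) set" where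
  "cube_polytope n q Z =
     {s. (\<forall>i<n. 0 \<le> s i \<and> s i \<le> 1) \<and> (\<Sum>i<n. (s i / q i) *\<^sub>R Z i) = (\<Sum>i<n. Z i)}"

definition cube_vertex ::
  "nat \<Rightarrow> (nat \<Rightarrow> real) \<Rightarrow> (nat \<Rightarrow> 'z::real_vector) \<Rightarrow> (nat \<Rightarrow> real) \<Rightarrow> bool" where
  "cube_vertex n q Z s \<longleftrightarrow> s \<in> cube_polytope n q Z \<and>
     \<not> (\<exists>a\<in>cube_polytope n q Z. \<exists>b\<in>cube_polytope n q Z.
          (\<exists>i<n. a i \<noteq> b i) \<and> (\<forall>i<n. s i = (a i + b i) / 2))"

definition flight_directions ::
  "nat \<Rightarrow> (nat \<Rightarrow> real) \<Rightarrow> (nat \<Rightarrow> 'z::real_vector) \<Rightarrow> (nat \<Rightarrow> real) \<Rightarrow> (nat \<Rightarrow> real) set" where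
  "flight_directions n q Z s =
     {u. (\<exists>i<n. u i \<noteq> 0) \<and> (\<Sum>i<n. (u i / q i) *\<^sub>R Z i) = 0 \<and> (\<forall>i<n. s i \<in> {0, 1} \<longrightarrow> u i = 0)}"

text \<open>One moves from \<open>s\<close> along a direction \<open>u\<close> as far as the polytope permits, which makes a
  further coordinate \<open>0\<close> or \<open>1\<close>; a path that has reached a vertex stays there.\<close>

definition flight_step ::
  "nat \<Rightarrow> (nat \<Rightarrow> real) \<Rightarrow> (nat \<Rightarrow> 'z::real_vector) \<Rightarrow> (nat \<Rightarrow> real) \<Rightarrow> (nat \<Rightarrow> real) \<Rightarrow> bool" where
  "flight_step n q Z s s' \<longleftrightarrow>
     (if cube_vertex n q Z s then \<forall>i<n. s' i = s i
      else \<exists>u\<in>flight_directions n q Z s. \<exists>r>0.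
             (\<lambda>i. s i + r * u i) \<in> cube_polytope n q Z \<and>
             (\<forall>r'>r. (\<lambda>i. s i + r' * u i) \<notin> cube_polytope n q Z) \<and>
             (\<forall>i<n. s' i = s i + r * u i))"

text \<open>\<open>s t i\<close> is the \<open>i\<close>-th coordinate of the flight path at time \<open>t\<close>. Every step before a vertex is
  reached makes at least one more of the \<open>n\<close> coordinates \<open>0\<close> or \<open>1\<close>, so the path is at a vertex at
  time \<open>n\<close> at the latest, and \<open>s n\<close> is the end point of the flight phase. The last two conditions
  are the landing phase.\<close>

definition cube_method ::
  "'a measure \<Rightarrow> nat \<Rightarrow> (nat \<Rightarrow> 'a \<Rightarrow> 'x::topological_space) \<Rightarrow> (nat \<Rightarrow> 'a \<Rightarrow> real) \<Rightarrow>
   (nat \<Rightarrow> 'a \<Rightarrow> 'z::real_vector) \<Rightarrow> (nat \<Rightarrow> 'a \<Rightarrow> real) \<Rightarrow> bool" where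
  "cube_method M n X q Z D \<longleftrightarrow>
     (\<forall>i<n. D i \<in> borel_measurable M \<and> (\<forall>\<omega>\<in>space M. D i \<omega> \<in> {0, 1})) \<and>
     (\<exists>s :: nat \<Rightarrow> nat \<Rightarrow> 'a \<Rightarrow> real.
        (\<forall>t. \<forall>i<n. s t i \<in> borel_measurable M) \<and>
        (AE \<omega> in M. \<forall>i<n. s 0 i \<omega> = q i \<omega>) \<and>
        (AE \<omega> in M. \<forall>t. flight_step n (\<lambda>i. q i \<omega>) (\<lambda>i. Z i \<omega>) (\<lambda>i. s t i \<omega>) (\<lambda>i. s (Suc t) i \<omega>)) \<and>
        (\<forall>t. \<forall>i<n. AE \<omega> in M.
           real_cond_exp M (sigma_upto M n (\<lambda>j \<omega>. (X j \<omega>, s t j \<omega>))) (s (Suc t) i) \<omega> = s t i \<omega>) \<and>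
        (AE \<omega> in M. \<forall>i<n. s n i \<omega> \<in> {0, 1} \<longrightarrow> D i \<omega> = s n i \<omega>) \<and>
        (\<forall>i<n. AE \<omega> in M.
           real_cond_exp M (sigma_upto M n (\<lambda>j \<omega>. (X j \<omega>, s n j \<omega>))) (D i) \<omega> = s n i \<omega>))"

text \<open>The product does not depend on the order of the \<open>k\<close> distinct indices, so they are given
  as a set. For the finitely many \<open>n < k\<close> there are none and the supremum is irrelevant.\<close>

definition poisson_approximation ::
  "'a measure \<Rightarrow> (nat \<Rightarrow> 'a \<Rightarrow> 'x::topological_space) \<Rightarrow> (nat \<Rightarrow> 'a \<Rightarrow> real) \<Rightarrow>
   (nat \<Rightarrow> nat \<Rightarrow> 'a \<Rightarrow> real) \<Rightarrow> bool" where
  "poisson_approximation M X q D \<longleftrightarrow>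
     (\<forall>k\<ge>1. AE \<omega> in M.
        (\<lambda>n. SUP I\<in>{I. I \<subseteq> {..<n} \<and> card I = k}.
               \<bar>real_cond_exp M (sigma_upto M n X) (\<lambda>\<omega>. \<Prod>i\<in>I. (D n i \<omega> - q i \<omega>)) \<omega>\<bar>) \<longlonglongrightarrow> 0)"


section \<open>The additional variance under a coin toss\<close>

definition coin_toss_variance ::
  "'a measure \<Rightarrow> ('a \<Rightarrow> real) \<Rightarrow> ('a \<Rightarrow> 'z::real_inner) \<Rightarrow> 'z \<Rightarrow> 'z \<Rightarrow> real" where
  "coin_toss_variance M q Z0 b1 b0 =
     (\<integral>\<omega>. q \<omega> / (1 - q \<omega>) * (Z0 \<omega> \<bullet> (b1 + b0))\<^sup>2 \<partial>M)"

text \<open>Subtracting constants \<open>m1\<close> and \<open>m0\<close> from the outcomes \<open>Y(1)\<close> and \<open>Y(0)\<close> changes the Hajek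
  estimator by exactly \<open>m1 - m0\<close> when neither arm is empty. This fails for the Horvitz-Thompson
  estimator unless the design balances the constants, which a coin toss does not: with
  \<open>Y(1) = Y(0) = 1\<close> the Hajek estimator is \<open>0\<close> but \<open>coin_toss_variance\<close> is positive. The additional
  variance of the Hajek estimator is that of the outcomes centred at their means. As the first
  component of the balancing vector for treated units and the second one of that for untreated
  units are \<open>1\<close>, centring shifts these coefficients.\<close>

definition coin_toss_variance_hajek ::
  "'a measure \<Rightarrow> ('a \<Rightarrow> real) \<Rightarrow> ('a \<Rightarrow> real \<times> real \<times> real \<times> 'x::real_inner) \<Rightarrow>
   real \<times> real \<times> real \<times> 'x \<Rightarrow> real \<times> real \<times> real \<times> 'x \<Rightarrow> real \<Rightarrow> real \<Rightarrow> real" where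
  "coin_toss_variance_hajek M q Z0 b1 b0 m1 m0 =
     coin_toss_variance M q Z0 (b1 - (m1, 0, 0, 0)) (b0 - (0, m0, 0, 0))"

end

(* With W i = (Y0 i, Y1 i, X i), both standardised errors of the Horvitz-Thompson estimator are, up to a
   balance error, sums of terms U i = D i * a (W i) + (1 - D i) * b (W i) divided by sqrt n. For the cube method
   a and b have the same conditional mean given X, because balancing removes the linear part of the outcomes;
   hence all mixed moments of the U i vanish, as D may be replaced by its conditional law given X. For a coin
   toss they vanish because the U i are i.i.d. and centred. McLeish's argument for the central limit theorem
   needs only these moments and a law of large numbers for the squares of the U i, which follows from the
   Poisson approximation for pairs. A vertex of the cube polytope has no more fractional coordinates than
   there are balancing variables, so only boundedly many units are left to the landing phase and the balance
   error is of smaller order than sqrt n. The Hajek estimator is the Horvitz-Thompson estimator of centred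
   outcomes with each arm divided by a weight mean that tends to 1. *)

theory Submission
  imports Defs
begin

section \<open>Convergence in probability and Slutsky's theorem\<close>

text \<open>The joint law of the cube assignments is unknown beyond conditional means and assumed
  asymptotics, so neither independence nor a martingale structure can carry a central limit theorem.
  McLeish's method asks for less: with x_i = t U_i / sqrt n, the product of the 1 + i x_i expands
  over subsets of units into mixed moments, so its mean is exactly 1, and its L2 norm stays bounded
  because |U_i| is dominated by a function of the i.i.d. triple W_i. Balancing works because Z_0 =
  (1 - pi) / pi Z_1: the two weighted linear predictors Z_1' beta_1 / pi and Z_0' beta_0 / (1 - pi)
  add up to Z_1' (beta_1 + beta_0) / pi, a linear functional of the columns Z_1 / pi whose total the
  cube polytope keeps fixed. The single vector beta_1 + beta_0 therefore governs both the balance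
  error of the cube method and the additional variance of a coin toss. The limits are proved for
  arbitrary outcome functions of W_i rather than for the given outcomes, since the Hajek estimator
  calls for them again with centred outcomes and with either arm taken alone.\<close>

definition null_in_prob :: "'a measure \<Rightarrow> (nat \<Rightarrow> 'a \<Rightarrow> real) \<Rightarrow> bool" where
  "null_in_prob M R \<longleftrightarrow> (\<lambda>n. \<integral>\<omega>. min 1 \<bar>R n \<omega>\<bar> \<partial>M) \<longlonglongrightarrow> 0"

text \<open>For fixed \<delta> the limit in n is taken first, and then \<delta> tends to 0: the
  common frame of the truncation and Young-type estimates below. With \<delta> < 1, exceeding
  \<delta> still implies that a quantity truncated at 1 is at least \<delta>.\<close>

lemma tendsto_zero_eps:
  fixes f :: "nat \<Rightarrow> real"
  assumes "\<And>n. 0 \<le> f n" and u: "\<And>\<delta>. \<delta> > 0 \<Longrightarrow> u \<delta> \<longlonglongrightarrow> 0"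
    and le: "\<And>n \<delta>. 0 < \<delta> \<Longrightarrow> \<delta> < 1 \<Longrightarrow> f n \<le> \<delta> * C + u \<delta> n" and C: "C \<ge> 0"
  shows "f \<longlonglongrightarrow> 0"
proof (rule order_tendstoI)
  fix a :: real assume "a < 0"
  then show "\<forall>\<^sub>F n in sequentially. a < f n"
    by (intro always_eventually allI less_le_trans[OF _ assms(1)])
next
  fix a :: real assume a: "0 < a"
  \<comment> \<open>Half of \<open>a\<close> pays for \<open>\<delta> * C\<close> and the other half
    for \<open>u \<delta> n\<close>. The summand 1 avoids a zero denominator, and 1/2 keeps \<delta>
    below 1.\<close>
  define \<delta> where "\<delta> = min (1/2) (a / (2 * (C + 1)))"
  have \<delta>: "0 < \<delta>" "\<delta> < 1" using a C by (auto simp: \<delta>_def)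
  have "\<delta> * C \<le> a / (2 * (C + 1)) * C" using C by (intro mult_right_mono) (auto simp: \<delta>_def)
  also have "\<dots> \<le> a / 2" using a C by (simp add: field_simps)
  finally have "\<delta> * C \<le> a / 2" .
  moreover have "\<forall>\<^sub>F n in sequentially. u \<delta> n < a / 2"
    using order_tendstoD(2)[OF u[OF \<delta>(1)], of "a / 2"] a by auto
  ultimately show "\<forall>\<^sub>F n in sequentially. f n < a"
    by (auto elim!: eventually_mono) (smt (verit) le[OF \<delta>] field_sum_of_halves)
qed

context prob_space
begin

lemma integrable_min_one:
  assumes [measurable]: "f \<in> borel_measurable M"
  shows "integrable M (\<lambda>\<omega>. min 1 \<bar>f \<omega>\<bar> :: real)"
  by (rule integrable_const_bound[where B = 1]) auto

lemma integrable_square_imp: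
  assumes [measurable]: "f \<in> borel_measurable M" and "integrable M (\<lambda>\<omega>. (f \<omega>)\<^sup>2 :: real)"
  shows "integrable M f"
proof (rule Bochner_Integration.integrable_bound[of _ "\<lambda>\<omega>. 1 + (f \<omega>)\<^sup>2"])
  have "\<bar>x\<bar> \<le> 1 + x\<^sup>2" for x :: real
  proof -
    have "2 * \<bar>x\<bar> \<le> x\<^sup>2 + 1" using sum_squares_bound[of "\<bar>x\<bar>" 1] by simp
    then show ?thesis using abs_ge_zero[of x] by linarith
  qed
  then show "AE \<omega> in M. norm (f \<omega>) \<le> norm (1 + (f \<omega>)\<^sup>2)" by (auto simp: abs_of_nonneg)
qed (use assms in auto)

text \<open>Truncation at 1 makes every measurable sequence integrable, so convergence in
  probability is the convergence of one integral and its closure properties become comparisons of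
  integrals.\<close>

lemma null_in_prob_squeeze:
  assumes S[measurable]: "\<And>n. S n \<in> borel_measurable M"
    and le: "\<And>n. (\<integral>\<omega>. min 1 \<bar>S n \<omega>\<bar> \<partial>M) \<le> u n" and u: "u \<longlonglongrightarrow> 0"
  shows "null_in_prob M S"
  unfolding null_in_prob_def
proof (rule tendsto_sandwich[OF _ _ tendsto_const u])
  show "\<forall>\<^sub>F n in sequentially. 0 \<le> (\<integral>\<omega>. min 1 \<bar>S n \<omega>\<bar> \<partial>M)"
    by (auto intro!: always_eventually integral_nonneg_AE)
qed (use le in auto)

lemma null_in_prob_add:
  assumes [measurable]: "\<And>n. R n \<in> borel_measurable M" "\<And>n. S n \<in> borel_measurable M"
    and R: "null_in_prob M R" and S: "null_in_prob M S"
  shows "null_in_prob M (\<lambda>n \<omega>. R n \<omega> + S n \<omega>)"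
proof (rule null_in_prob_squeeze)
  fix n
  have "(\<integral>\<omega>. min 1 \<bar>R n \<omega> + S n \<omega>\<bar> \<partial>M) \<le> (\<integral>\<omega>. min 1 \<bar>R n \<omega>\<bar> + min 1 \<bar>S n \<omega>\<bar> \<partial>M)"
    by (intro integral_mono integrable_min_one Bochner_Integration.integrable_add) auto
  also have "\<dots> = (\<integral>\<omega>. min 1 \<bar>R n \<omega>\<bar> \<partial>M) + (\<integral>\<omega>. min 1 \<bar>S n \<omega>\<bar> \<partial>M)"
    by (intro Bochner_Integration.integral_add integrable_min_one) auto
  finally show "(\<integral>\<omega>. min 1 \<bar>R n \<omega> + S n \<omega>\<bar> \<partial>M)
    \<le> (\<integral>\<omega>. min 1 \<bar>R n \<omega>\<bar> \<partial>M) + (\<integral>\<omega>. min 1 \<bar>S n \<omega>\<bar> \<partial>M)" .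
next
  show "(\<lambda>n. (\<integral>\<omega>. min 1 \<bar>R n \<omega>\<bar> \<partial>M) + (\<integral>\<omega>. min 1 \<bar>S n \<omega>\<bar> \<partial>M)) \<longlonglongrightarrow> 0"
    using tendsto_add[OF R[unfolded null_in_prob_def] S[unfolded null_in_prob_def]] by simp
qed measurable

lemma null_in_prob_mono:
  assumes [measurable]: "\<And>n. R n \<in> borel_measurable M" "\<And>n. S n \<in> borel_measurable M"
    and R: "null_in_prob M R" and le: "\<And>n. AE \<omega> in M. min 1 \<bar>S n \<omega>\<bar> \<le> K * min 1 \<bar>R n \<omega>\<bar>"
  shows "null_in_prob M S"
proof (rule null_in_prob_squeeze)
  fix n
  have "(\<integral>\<omega>. min 1 \<bar>S n \<omega>\<bar> \<partial>M) \<le> (\<integral>\<omega>. K * min 1 \<bar>R n \<omega>\<bar> \<partial>M)"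
    by (intro integral_mono_AE le integrable_min_one integrable_mult_right) auto
  then show "(\<integral>\<omega>. min 1 \<bar>S n \<omega>\<bar> \<partial>M) \<le> K * (\<integral>\<omega>. min 1 \<bar>R n \<omega>\<bar> \<partial>M)" by simp
next
  show "(\<lambda>n. K * (\<integral>\<omega>. min 1 \<bar>R n \<omega>\<bar> \<partial>M)) \<longlonglongrightarrow> 0"
    using tendsto_mult_left[OF R[unfolded null_in_prob_def], of K] by simp
qed measurable

lemma null_in_prob_cong_AE:
  assumes "\<And>n. R n \<in> borel_measurable M" "\<And>n. S n \<in> borel_measurable M" "null_in_prob M R"
    and eq: "\<And>n. AE \<omega> in M. S n \<omega> = R n \<omega>"
  shows "null_in_prob M S"
proof (rule null_in_prob_mono[OF assms(1-3), where K = 1])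
  show "AE \<omega> in M. min 1 \<bar>S n \<omega>\<bar> \<le> 1 * min 1 \<bar>R n \<omega>\<bar>" for n
    using eq[of n] by eventually_elim simp
qed

lemma null_in_prob_L1:
  assumes R: "\<And>n. integrable M (R n)" and lim: "(\<lambda>n. \<integral>\<omega>. \<bar>R n \<omega>\<bar> \<partial>M) \<longlonglongrightarrow> 0"
  shows "null_in_prob M R"
proof (rule null_in_prob_squeeze[OF _ _ lim])
  fix n
  have [measurable]: "R n \<in> borel_measurable M" using R by auto
  show "(\<integral>\<omega>. min 1 \<bar>R n \<omega>\<bar> \<partial>M) \<le> (\<integral>\<omega>. \<bar>R n \<omega>\<bar> \<partial>M)"
    by (intro integral_mono integrable_min_one integrable_abs R) auto
qed (use R in auto)

text \<open>If |b - 1| <= 1/2 then b >= 1/2, and inversion at most doubles the distance to 1;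
  otherwise twice the truncated distance is already at least 1. The second case includes b = 0,
  where the quotient is 0.\<close>

lemma null_in_prob_inverse:
  assumes [measurable]: "\<And>n. B n \<in> borel_measurable M"
    and B: "null_in_prob M (\<lambda>n \<omega>. B n \<omega> - 1)"
  shows "null_in_prob M (\<lambda>n \<omega>. 1 / B n \<omega> - 1)"
proof (rule null_in_prob_mono[OF _ _ B, where K = 2])
  have *: "min 1 \<bar>1 / b - 1\<bar> \<le> 2 * min 1 \<bar>b - 1\<bar>" for b :: real
  proof (cases "\<bar>b - 1\<bar> \<le> 1 / 2")
    case True
    then have b: "b \<ge> 1 / 2" by linarith
    then have "\<bar>1 / b - 1\<bar> = \<bar>b - 1\<bar> / b" by (auto simp: abs_if field_simps)
    also have "\<dots> \<le> \<bar>b - 1\<bar> / (1 / 2)" using b by (intro divide_left_mono) auto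
    finally show ?thesis using True by auto
  qed auto
  show "\<And>n. AE \<omega> in M. min 1 \<bar>1 / B n \<omega> - 1\<bar> \<le> 2 * min 1 \<bar>B n \<omega> - 1\<bar>"
    using * by auto
qed auto

lemma null_in_prob_mult:
  assumes [measurable]: "\<And>n. R n \<in> borel_measurable M" "\<And>n. S n \<in> borel_measurable M"
    and R: "null_in_prob M R" and S: "null_in_prob M S"
  shows "null_in_prob M (\<lambda>n \<omega>. R n \<omega> * S n \<omega>)"
proof (rule null_in_prob_squeeze)
  fix n
  have *: "min 1 \<bar>r * s\<bar> \<le> min 1 \<bar>r\<bar> + min 1 \<bar>s\<bar>" for r s :: real
  proof (cases "\<bar>s\<bar> \<le> 1")
    case True
    then have "\<bar>r * s\<bar> \<le> \<bar>r\<bar>" by (simp add: abs_mult mult_left_le)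
    then show ?thesis by auto
  qed auto
  have "(\<integral>\<omega>. min 1 \<bar>R n \<omega> * S n \<omega>\<bar> \<partial>M) \<le> (\<integral>\<omega>. min 1 \<bar>R n \<omega>\<bar> + min 1 \<bar>S n \<omega>\<bar> \<partial>M)"
    by (intro integral_mono integrable_min_one Bochner_Integration.integrable_add *) auto
  also have "\<dots> = (\<integral>\<omega>. min 1 \<bar>R n \<omega>\<bar> \<partial>M) + (\<integral>\<omega>. min 1 \<bar>S n \<omega>\<bar> \<partial>M)"
    by (intro Bochner_Integration.integral_add integrable_min_one) auto
  finally show "(\<integral>\<omega>. min 1 \<bar>R n \<omega> * S n \<omega>\<bar> \<partial>M)
    \<le> (\<integral>\<omega>. min 1 \<bar>R n \<omega>\<bar> \<partial>M) + (\<integral>\<omega>. min 1 \<bar>S n \<omega>\<bar> \<partial>M)" .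
next
  show "(\<lambda>n. (\<integral>\<omega>. min 1 \<bar>R n \<omega>\<bar> \<partial>M) + (\<integral>\<omega>. min 1 \<bar>S n \<omega>\<bar> \<partial>M)) \<longlonglongrightarrow> 0"
    using tendsto_add[OF R[unfolded null_in_prob_def] S[unfolded null_in_prob_def]] by simp
qed measurable

text \<open>Bounded second moments act as tightness. Where |r| <= \<delta> the product is at most
  \<delta> (1 + x^2), whose mean is of order \<delta>; elsewhere the truncated |r| divided by
  \<delta> is at least 1.\<close>

lemma null_in_prob_mult_L2:
  assumes [measurable]: "\<And>n. R n \<in> borel_measurable M" "\<And>n. T n \<in> borel_measurable M"
    and R: "null_in_prob M R" and T: "\<And>n. integrable M (\<lambda>\<omega>. (T n \<omega>)\<^sup>2)"
      "\<And>n. (\<integral>\<omega>. (T n \<omega>)\<^sup>2 \<partial>M) \<le> C"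
  shows "null_in_prob M (\<lambda>n \<omega>. T n \<omega> * R n \<omega>)"
  unfolding null_in_prob_def
proof (rule tendsto_zero_eps)
  have C: "C \<ge> 0" using T(2)[of 0] by (smt (verit) integral_nonneg_AE AE_I2 zero_le_power2)
  then show "1 + C \<ge> 0" by simp
  show "0 \<le> (\<integral>\<omega>. min 1 \<bar>T n \<omega> * R n \<omega>\<bar> \<partial>M)" for n by (auto intro: integral_nonneg_AE)
  show "(\<lambda>n. (\<integral>\<omega>. min 1 \<bar>R n \<omega>\<bar> \<partial>M) / \<delta>) \<longlonglongrightarrow> 0" for \<delta> :: real
    using tendsto_divide[OF R[unfolded null_in_prob_def] tendsto_const, of \<delta>] by (cases "\<delta> = 0") auto
  fix n and \<delta> :: real assume \<delta>: "0 < \<delta>" "\<delta> < 1"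
  have *: "min 1 \<bar>x * r\<bar> \<le> \<delta> * (1 + x\<^sup>2) + min 1 \<bar>r\<bar> / \<delta>" for x r :: real
  proof (cases "\<bar>r\<bar> \<le> \<delta>")
    case True
    have "2 * \<bar>x\<bar> \<le> 1 + x\<^sup>2" using sum_squares_bound[of "\<bar>x\<bar>" 1] by simp
    then have "\<bar>x\<bar> \<le> 1 + x\<^sup>2" by (smt (verit) zero_le_power2)
    then have "\<bar>x * r\<bar> \<le> (1 + x\<^sup>2) * \<delta>" unfolding abs_mult using True \<delta> by (intro mult_mono) auto
    moreover have "0 \<le> min 1 \<bar>r\<bar> / \<delta>" using \<delta> by auto
    ultimately show ?thesis by (simp add: mult.commute)
  next
    case False
    then have "1 \<le> min 1 \<bar>r\<bar> / \<delta>" using \<delta> by (auto simp: field_simps)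
    moreover have "0 \<le> \<delta> * (1 + x\<^sup>2)" using \<delta> by auto
    ultimately show ?thesis by linarith
  qed
  have "(\<integral>\<omega>. min 1 \<bar>T n \<omega> * R n \<omega>\<bar> \<partial>M) \<le> (\<integral>\<omega>. \<delta> * (1 + (T n \<omega>)\<^sup>2) + min 1 \<bar>R n \<omega>\<bar> / \<delta> \<partial>M)"
    by (intro integral_mono * integrable_min_one Bochner_Integration.integrable_add
        integrable_mult_right integrable_divide T) auto
  also have "\<dots> = \<delta> * (1 + (\<integral>\<omega>. (T n \<omega>)\<^sup>2 \<partial>M)) + (\<integral>\<omega>. min 1 \<bar>R n \<omega>\<bar> \<partial>M) / \<delta>"
    by (subst Bochner_Integration.integral_add)
       (auto intro!: integrable_min_one T simp: prob_space Bochner_Integration.integral_add[OF integrable_const T(1)])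
  also have "\<dots> \<le> \<delta> * (1 + C) + (\<integral>\<omega>. min 1 \<bar>R n \<omega>\<bar> \<partial>M) / \<delta>"
    using T(2)[of n] \<delta> by auto
  finally show "(\<integral>\<omega>. min 1 \<bar>T n \<omega> * R n \<omega>\<bar> \<partial>M) \<le> \<dots>" .
qed

end

section \<open>Characteristic functions of normal laws, and Slutsky's theorem\<close>

lemma real_distribution_normal_law:
  assumes "v \<ge> 0" shows "real_distribution (normal_law \<mu> v)"
proof (cases "v = 0")
  case True
  have "prob_space (return borel \<mu>)" by (rule prob_space_return) simp
  then show ?thesis using True by (auto simp: normal_law_def real_distribution_def real_distribution_axioms_def)
next
  case False
  then show ?thesis using assms prob_space_normal_density[of "sqrt v" \<mu>]
    by (auto simp: normal_law_def real_distribution_def real_distribution_axioms_def)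
qed

text \<open>For positive v the law is the image of the standard normal law under x -> sqrt v * x;
  for v = 0 it is the point mass at 0, whose characteristic function 1 fits the same
  formula.\<close>

lemma char_normal_law:
  assumes "v \<ge> 0" shows "char (normal_law 0 v) t = complex_of_real (exp (- (t\<^sup>2 * v) / 2))"
proof (cases "v = 0")
  case True
  then show ?thesis by (simp add: normal_law_def char_def integral_return)
next
  case False
  then have v: "v > 0" using assms by simp
  interpret N: prob_space std_normal_distribution
    by (rule prob_space_normal_density) simp
  have id: "distributed std_normal_distribution lborel (\<lambda>x. x) (\<lambda>x. ennreal (std_normal_density x))"
    unfolding distributed_def by (auto simp: distr_id2)
  have "distributed std_normal_distribution lborel (\<lambda>x. 0 + sqrt v * x)
      (\<lambda>x. ennreal (normal_density (0 + sqrt v * 0) (\<bar>sqrt v\<bar> * 1) x))"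
    by (rule N.normal_density_affine[OF id]) (use v in auto)
  then have eq: "normal_law 0 v = distr std_normal_distribution lborel (\<lambda>x. sqrt v * x)"
    using v by (simp add: distributed_def normal_law_def)
  have "char (normal_law 0 v) t = char std_normal_distribution (t * sqrt v)"
    unfolding char_def eq by (subst integral_distr) (auto simp: mult.assoc)
  also have "\<dots> = exp (- (t\<^sup>2 * v) / 2)"
    using v by (simp add: char_std_normal_distribution power_mult_distrib)
  finally show ?thesis .
qed

context prob_space
begin

lemma char_distr:
  assumes [measurable]: "f \<in> borel_measurable M"
  shows "char (distr M borel f) t = (CLINT \<omega>|M. iexp (t * f \<omega>))"
  unfolding char_def by (subst integral_distr) auto

text \<open>Levy's continuity theorem. The closed form of the limit covers v = 0, so degenerate
  variances need no separate argument later.\<close>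

lemma converges_to_normalI:
  assumes [measurable]: "\<And>n. T n \<in> borel_measurable M" and v: "v \<ge> 0"
    and lim: "\<And>t. (\<lambda>n. CLINT \<omega>|M. iexp (t * T n \<omega>)) \<longlonglongrightarrow> complex_of_real (exp (- (t\<^sup>2 * v) / 2))"
  shows "converges_to_normal M T v"
  unfolding converges_to_normal_def
proof (rule levy_continuity)
  show "real_distribution (distr M borel (T n))" for n
    by (rule real_distribution_distr) simp
  show "real_distribution (normal_law 0 v)" by (rule real_distribution_normal_law[OF v])
  show "(\<lambda>n. char (distr M borel (T n)) t) \<longlonglongrightarrow> char (normal_law 0 v) t" for t
    using lim[of t] by (simp add: char_distr char_normal_law[OF v])
qed

text \<open>Slutsky's theorem by characteristic functions: x -> exp (i t x) is bounded and
  Lipschitz, so the two characteristic functions differ at t by at most (2 + |t|) E min 1 |T -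
  S|.\<close>

lemma converges_to_normal_cong:
  assumes "converges_to_normal M S v" and v: "v \<ge> 0"
    and [measurable]: "\<And>n. S n \<in> borel_measurable M" "\<And>n. T n \<in> borel_measurable M"
    and null: "null_in_prob M (\<lambda>n \<omega>. T n \<omega> - S n \<omega>)"
  shows "converges_to_normal M T v"
proof (rule converges_to_normalI[OF _ v])
  fix t :: real
  have "(\<lambda>n. char (distr M borel (S n)) t) \<longlonglongrightarrow> char (normal_law 0 v) t"
    using assms(1) unfolding converges_to_normal_def
    by (intro levy_continuity1 real_distribution_distr real_distribution_normal_law v) auto
  then have S: "(\<lambda>n. CLINT \<omega>|M. iexp (t * S n \<omega>)) \<longlonglongrightarrow> complex_of_real (exp (- (t\<^sup>2 * v) / 2))"
    by (simp add: char_distr char_normal_law[OF v])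
  have int: "integrable M (\<lambda>\<omega>. iexp (t * f \<omega>))" if [measurable]: "f \<in> borel_measurable M" for f
    by (rule integrable_const_bound[where B = 1]) (auto simp: norm_exp_i_times)
  have *: "cmod (iexp (t * x) - iexp (t * y)) \<le> (2 + \<bar>t\<bar>) * min 1 \<bar>x - y\<bar>" for x y
  proof -
    have eq: "iexp (t * x) - iexp (t * y) = iexp (t * y) * (iexp (t * (x - y)) - 1)"
      by (simp add: right_diff_distrib exp_diff)
    have 1: "cmod (iexp (t * x) - iexp (t * y)) = cmod (iexp (t * (x - y)) - 1)"
      unfolding eq norm_mult by simp
    have "cmod (iexp (t * (x - y)) - 1) \<le> \<bar>t\<bar> * \<bar>x - y\<bar>"
      using iexp_approx1[of "t * (x - y)" 0] by (simp add: abs_mult)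
    moreover have "cmod (iexp (t * (x - y)) - 1) \<le> 2"
      using norm_triangle_ineq4[of "iexp (t * (x - y))" 1] by simp
    ultimately show ?thesis unfolding 1
      by (cases "\<bar>x - y\<bar> \<le> 1") (auto simp: algebra_simps, smt (verit) mult_nonneg_nonneg)
  qed
  have "(\<lambda>n. (CLINT \<omega>|M. iexp (t * T n \<omega>)) - (CLINT \<omega>|M. iexp (t * S n \<omega>))) \<longlonglongrightarrow> 0"
  proof (rule Lim_null_comparison)
    show "(\<lambda>n. (2 + \<bar>t\<bar>) * (\<integral>\<omega>. min 1 \<bar>T n \<omega> - S n \<omega>\<bar> \<partial>M)) \<longlonglongrightarrow> 0"
      using tendsto_mult_left[OF null[unfolded null_in_prob_def], of "2 + \<bar>t\<bar>"] by simp
    have "cmod ((CLINT \<omega>|M. iexp (t * T n \<omega>)) - (CLINT \<omega>|M. iexp (t * S n \<omega>)))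
        \<le> (2 + \<bar>t\<bar>) * (\<integral>\<omega>. min 1 \<bar>T n \<omega> - S n \<omega>\<bar> \<partial>M)" for n
    proof -
      have "cmod ((CLINT \<omega>|M. iexp (t * T n \<omega>)) - (CLINT \<omega>|M. iexp (t * S n \<omega>)))
          = cmod (CLINT \<omega>|M. iexp (t * T n \<omega>) - iexp (t * S n \<omega>))"
        by (subst Bochner_Integration.integral_diff[OF int int]) simp_all
      also have "\<dots> \<le> (\<integral>\<omega>. cmod (iexp (t * T n \<omega>) - iexp (t * S n \<omega>)) \<partial>M)" by simp
      also have "\<dots> \<le> (\<integral>\<omega>. (2 + \<bar>t\<bar>) * min 1 \<bar>T n \<omega> - S n \<omega>\<bar> \<partial>M)"
        by (intro integral_mono * integrable_norm Bochner_Integration.integrable_diff int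
            integrable_mult_right integrable_min_one) auto
      finally show ?thesis by simp
    qed
    then show "\<forall>\<^sub>F n in sequentially. cmod ((CLINT \<omega>|M. iexp (t * T n \<omega>)) - (CLINT \<omega>|M. iexp (t * S n \<omega>)))
        \<le> (2 + \<bar>t\<bar>) * (\<integral>\<omega>. min 1 \<bar>T n \<omega> - S n \<omega>\<bar> \<partial>M)" by auto
  qed
  from tendsto_add[OF this S]
  show "(\<lambda>n. CLINT \<omega>|M. iexp (t * T n \<omega>)) \<longlonglongrightarrow> complex_of_real (exp (- (t\<^sup>2 * v) / 2))" by simp
qed simp

end

section \<open>McLeish's central limit theorem\<close>

text \<open>As log (1 + i x) = i x + x^2 / 2 + O(x^3), the quotient exp (i x) / (1 + i x) agrees
  with exp (- x^2 / 2) up to third order. Multiplying through by 1 + i x avoids the complex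
  logarithm. The alternative x^2 in the minimum serves large x, where only second moments are at
  hand.\<close>

lemma norm_iexp_mult_exp_diff:
  fixes x :: real
  shows "cmod (iexp x - (1 + \<i> * x) * exp (- (x\<^sup>2 / 2))) \<le> cmod (1 + \<i> * x) * (2 * min (x\<^sup>2) (\<bar>x\<bar> ^ 3))"
proof -
  have n1: "cmod (1 + \<i> * x) \<ge> 1"
    using complex_Re_le_cmod[of "1 + \<i> * x"] by simp
  show ?thesis
  proof (cases "\<bar>x\<bar> \<le> 1")
    case True
    let ?e = "exp (- (x\<^sup>2 / 2)) :: real"
    have a: "cmod (iexp x - (1 + \<i> * x - x\<^sup>2 / 2)) \<le> \<bar>x\<bar> ^ 3 / 6"
      using iexp_approx1[of x 2]
      by (simp add: numeral_2_eq_2 fact_numeral power2_eq_square algebra_simps numeral_3_eq_3 flip: of_real_mult)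
    have "?e \<ge> 1 - x\<^sup>2 / 2" using exp_ge_add_one_self[of "- (x\<^sup>2 / 2)"] by simp
    moreover have "?e \<le> 1 - x\<^sup>2 / 2 + (x\<^sup>2 / 2)\<^sup>2 / 2"
    proof -
      have "\<bar>exp (- (x\<^sup>2 / 2)) - (\<Sum>k<2. (- (x\<^sup>2 / 2)) ^ k / fact k)\<bar> \<le> (x\<^sup>2 / 2)\<^sup>2 / 2"
      proof -
        \<comment> \<open>Lagrange remainder of order two; x = 0 is set apart because
          \<open>Maclaurin_minus\<close> expands at a strictly negative argument.\<close>
        obtain s where s: "- (x\<^sup>2 / 2) \<le> s" "s \<le> 0" and
          eq: "exp (- (x\<^sup>2 / 2)) = (\<Sum>k<2. (- (x\<^sup>2 / 2)) ^ k / fact k) + exp s / fact 2 * (- (x\<^sup>2 / 2)) ^ 2"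
        proof (cases "x = 0")
          case True then show ?thesis using that[of 0] by (simp add: numeral_2_eq_2)
        next
          case False
          then show ?thesis
            using Maclaurin_minus[of "- (x\<^sup>2 / 2)" 2 "\<lambda>_. exp" exp] that
            by (force simp: less_imp_le)
        qed
        have "exp s \<le> 1" using s by simp
        then have "exp s / fact 2 * (- (x\<^sup>2 / 2)) ^ 2 \<le> 1 / 2 * (x\<^sup>2 / 2)\<^sup>2"
          by (intro mult_mono) auto
        then show ?thesis unfolding eq by simp
      qed
      moreover have "(\<Sum>k<2. y ^ k / fact k) = 1 + y" for y :: real by (simp add: numeral_2_eq_2)
      ultimately show ?thesis by (simp only: abs_le_iff) linarith
    qed
    ultimately have c: "\<bar>(1 - x\<^sup>2 / 2) - ?e\<bar> \<le> \<bar>x\<bar> ^ 3 / 8"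
    proof -
      assume "?e \<ge> 1 - x\<^sup>2 / 2" "?e \<le> 1 - x\<^sup>2 / 2 + (x\<^sup>2 / 2)\<^sup>2 / 2"
      moreover have "(x\<^sup>2 / 2)\<^sup>2 / 2 = \<bar>x\<bar> ^ 4 / 8" by (simp add: power_divide)
      moreover have "\<bar>x\<bar> ^ 4 \<le> \<bar>x\<bar> ^ 3" using True by (intro power_decreasing) auto
      ultimately show ?thesis by (simp add: abs_le_iff)
    qed
    \<comment> \<open>The product of 1 + i x and 1 - x^2 / 2 differs from the Taylor polynomial 1 +
      i x - x^2 / 2 by the cubic term i x^3 / 2, which is split off; what remains compares 1 - x^2 /
      2 with exp (- x^2 / 2).\<close>
    have split: "iexp x - (1 + \<i> * x) * exp (- (x\<^sup>2 / 2))
      = (iexp x - (1 + \<i> * x - x\<^sup>2 / 2)) + \<i> * of_real (x ^ 3 / 2) + (1 + \<i> * x) * of_real ((1 - x\<^sup>2 / 2) - ?e)"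
      by (simp add: algebra_simps power2_eq_square power3_eq_cube exp_of_real flip: exp_of_real)
    have "cmod (iexp x - (1 + \<i> * x) * exp (- (x\<^sup>2 / 2)))
      \<le> \<bar>x\<bar> ^ 3 / 6 + \<bar>x\<bar> ^ 3 / 2 + cmod (1 + \<i> * x) * (\<bar>x\<bar> ^ 3 / 8)"
      unfolding split
    proof (intro norm_triangle_mono)
      show "cmod (\<i> * of_real (x ^ 3 / 2)) \<le> \<bar>x\<bar> ^ 3 / 2"
        unfolding norm_mult norm_of_real by (simp add: power_abs)
      show "cmod ((1 + \<i> * x) * of_real ((1 - x\<^sup>2 / 2) - ?e)) \<le> cmod (1 + \<i> * x) * (\<bar>x\<bar> ^ 3 / 8)"
        unfolding norm_mult norm_of_real using c by (intro mult_left_mono) auto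
    qed (rule a)
    also have "\<dots> \<le> cmod (1 + \<i> * x) * (\<bar>x\<bar> ^ 3 / 6) + cmod (1 + \<i> * x) * (\<bar>x\<bar> ^ 3 / 2) + cmod (1 + \<i> * x) * (\<bar>x\<bar> ^ 3 / 8)"
      using mult_right_mono[OF n1, of "\<bar>x\<bar> ^ 3"] by (intro add_mono) auto
    also have "\<dots> \<le> cmod (1 + \<i> * x) * (2 * \<bar>x\<bar> ^ 3)"
    proof -
      have "0 \<le> cmod (1 + \<i> * x) * \<bar>x\<bar> ^ 3" by simp
      then show ?thesis by simp
    qed
    also have "\<bar>x\<bar> ^ 3 = min (x\<^sup>2) (\<bar>x\<bar> ^ 3)"
      using power_decreasing[of 2 3 "\<bar>x\<bar>"] True by simp
    finally show ?thesis .
  next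
    case False
    then have "\<bar>x\<bar> \<ge> 1" by simp
    have "1 \<le> min (x\<^sup>2) (\<bar>x\<bar> ^ 3)"
      using one_le_power[OF \<open>\<bar>x\<bar> \<ge> 1\<close>, of 2] one_le_power[OF \<open>\<bar>x\<bar> \<ge> 1\<close>, of 3] by simp
    \<comment> \<open>For |x| > 1 the two terms are bounded separately by 1 and |1 + i x|. This case
      is where the factor 2 of the bound comes from; for small x the constants 1/6, 1/2 and 1/8 add
      up to less than 1.\<close>
    have "cmod (iexp x - (1 + \<i> * x) * exp (- (x\<^sup>2 / 2))) \<le> 1 + cmod (1 + \<i> * x) * 1"
    proof (rule order_trans[OF norm_triangle_ineq4 add_mono])
      show "cmod (iexp x) \<le> 1" by simp
      show "cmod ((1 + \<i> * x) * exp (- (x\<^sup>2 / 2))) \<le> cmod (1 + \<i> * x) * 1"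
        unfolding norm_mult mult_1_right by (intro mult_left_le) (auto simp: norm_exp_eq_Re)
    qed
    also have "\<dots> \<le> cmod (1 + \<i> * x) * (2 * 1)" using n1 by simp
    also have "\<dots> \<le> cmod (1 + \<i> * x) * (2 * min (x\<^sup>2) (\<bar>x\<bar> ^ 3))"
      using \<open>1 \<le> min (x\<^sup>2) (\<bar>x\<bar> ^ 3)\<close> by (intro mult_left_mono) auto
    finally show ?thesis .
  qed
qed

text \<open>Since |1 + i x| >= 1, all factors of both products have modulus at most 1, and the
  difference of the products is at most the sum of the differences of the factors.\<close>

lemma prod_iexp_div_diff:
  fixes x :: "nat \<Rightarrow> real"
  shows "cmod ((\<Prod>i<n. iexp (x i) / (1 + \<i> * x i)) - exp (- (\<Sum>i<n. (x i)\<^sup>2) / 2))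
    \<le> (\<Sum>i<n. 2 * min ((x i)\<^sup>2) (\<bar>x i\<bar> ^ 3))"
    and "cmod (\<Prod>i<n. iexp (x i) / (1 + \<i> * x i)) \<le> 1"
proof -
  have n1: "cmod (1 + \<i> * y) \<ge> 1" for y :: real
    using complex_Re_le_cmod[of "1 + \<i> * y"] by simp
  have n2: "cmod (iexp y / (1 + \<i> * y)) \<le> 1" for y :: real
    using n1[of y] by (subst norm_divide) (simp add: divide_le_eq_1)
  show "cmod (\<Prod>i<n. iexp (x i) / (1 + \<i> * x i)) \<le> 1"
    unfolding prod_norm[symmetric] by (intro prod_le_1) (use n2 in auto)
  have eq: "exp (- (\<Sum>i<n. (x i)\<^sup>2) / 2) = (\<Prod>i<n. exp (- ((x i)\<^sup>2 / 2)))"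
    by (simp add: exp_sum[symmetric] sum_negf sum_divide_distrib)
  have "cmod ((\<Prod>i<n. iexp (x i) / (1 + \<i> * x i)) - exp (- (\<Sum>i<n. (x i)\<^sup>2) / 2))
    \<le> (\<Sum>i<n. cmod (iexp (x i) / (1 + \<i> * x i) - exp (- ((x i)\<^sup>2 / 2))))"
    unfolding eq of_real_prod by (rule norm_prod_diff) (use n2 in \<open>auto simp: norm_exp_eq_Re\<close>)
  also have "\<dots> \<le> (\<Sum>i<n. 2 * min ((x i)\<^sup>2) (\<bar>x i\<bar> ^ 3))"
  proof (rule sum_mono)
    fix i
    have "1 + \<i> * x i \<noteq> 0" using n1[of "x i"] by auto
    then have "iexp (x i) / (1 + \<i> * x i) - exp (- ((x i)\<^sup>2 / 2))
      = (iexp (x i) - (1 + \<i> * x i) * exp (- ((x i)\<^sup>2 / 2))) / (1 + \<i> * x i)"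
      by (simp add: field_simps)
    also have "cmod \<dots> \<le> 2 * min ((x i)\<^sup>2) (\<bar>x i\<bar> ^ 3)"
      using norm_iexp_mult_exp_diff[of "x i"] n1[of "x i"]
      by (simp add: norm_divide divide_le_eq mult.commute del: of_real_exp)
    finally show "cmod (iexp (x i) / (1 + \<i> * x i) - exp (- ((x i)\<^sup>2 / 2))) \<le> 2 * min ((x i)\<^sup>2) (\<bar>x i\<bar> ^ 3)" .
  qed
  finally show "cmod ((\<Prod>i<n. iexp (x i) / (1 + \<i> * x i)) - exp (- (\<Sum>i<n. (x i)\<^sup>2) / 2))
    \<le> (\<Sum>i<n. 2 * min ((x i)\<^sup>2) (\<bar>x i\<bar> ^ 3))" .
qed

lemma abs_exp_minus_diff_le:
  fixes a b :: real
  assumes "0 \<le> a" "0 \<le> b"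
  shows "\<bar>exp (- a) - exp (- b)\<bar> \<le> min 1 \<bar>a - b\<bar>"
proof -
  have *: "\<bar>exp (- a) - exp (- b)\<bar> \<le> min 1 \<bar>a - b\<bar>" if "0 \<le> a" "a \<le> b" for a b :: real
  proof -
    have "exp (- a) - exp (- b) = exp (- a) * (1 - exp (- (b - a)))"
      by (simp add: right_diff_distrib exp_add[symmetric])
    also have "\<dots> \<le> 1 * (1 - exp (- (b - a)))" using that by (intro mult_right_mono) auto
    also have "\<dots> \<le> min 1 (b - a)" 
      using exp_ge_add_one_self[of "- (b - a)"] exp_gt_zero[of "- (b - a)"]
      unfolding min.bounded_iff mult_1 by (intro conjI) linarith+
    finally show ?thesis using that by simp
  qed
  show ?thesis using *[of a b] *[of b a] assms by (cases "a \<le> b") (auto simp: abs_minus_commute)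
qed

text \<open>McLeish's argument: with \<open>T = \<Prod>(1 + i x)\<close> one has \<open>exp (i \<Sum>x) = T * U\<close>, where \<open>|U| \<le> 1\<close> and
  \<open>U\<close> is close to \<open>exp (- v / 2)\<close>. As \<open>T\<close> has mean \<open>1\<close> and is bounded in \<open>L\<^sup>2\<close>, so is
  \<open>E (T * U)\<close>.\<close>

lemma (in prob_space) mcleish_clt:
  fixes x :: "nat \<Rightarrow> nat \<Rightarrow> 'a \<Rightarrow> real"
  assumes meas[measurable]: "\<And>n i. i < n \<Longrightarrow> x n i \<in> borel_measurable M"
    and mean: "\<And>n. (CLINT \<omega>|M. (\<Prod>i<n. 1 + \<i> * x n i \<omega>)) = 1"
    and int: "\<And>n. integrable M (\<lambda>\<omega>. \<Prod>i<n. 1 + (x n i \<omega>)\<^sup>2)"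
    and bound: "\<And>n. (\<integral>\<omega>. (\<Prod>i<n. 1 + (x n i \<omega>)\<^sup>2) \<partial>M) \<le> C"
    and small_int: "\<And>n. integrable M (\<lambda>\<omega>. \<Sum>i<n. min ((x n i \<omega>)\<^sup>2) (\<bar>x n i \<omega>\<bar> ^ 3))"
    and small: "(\<lambda>n. \<integral>\<omega>. (\<Sum>i<n. min ((x n i \<omega>)\<^sup>2) (\<bar>x n i \<omega>\<bar> ^ 3)) \<partial>M) \<longlonglongrightarrow> 0"
    and lln: "null_in_prob M (\<lambda>n \<omega>. (\<Sum>i<n. (x n i \<omega>)\<^sup>2) - v)"
    and v: "v \<ge> 0"
  shows "(\<lambda>n. CLINT \<omega>|M. iexp (\<Sum>i<n. x n i \<omega>)) \<longlonglongrightarrow> exp (- v / 2)"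
proof -
  define T where "T n \<omega> = (\<Prod>i<n. 1 + \<i> * x n i \<omega>)" for n \<omega>
  define U where "U n \<omega> = (\<Prod>i<n. iexp (x n i \<omega>) / (1 + \<i> * x n i \<omega>))" for n \<omega>
  define L where "L = (exp (- v / 2) :: real)"
  define P where "P n \<omega> = (\<Prod>i<n. 1 + (x n i \<omega>)\<^sup>2)" for n \<omega>
  define B where "B n \<omega> = 2 * (\<Sum>i<n. min ((x n i \<omega>)\<^sup>2) (\<bar>x n i \<omega>\<bar> ^ 3))
    + min 1 \<bar>(\<Sum>i<n. (x n i \<omega>)\<^sup>2) - v\<bar>" for n \<omega>
  have [measurable]: "T n \<in> borel_measurable M" "U n \<in> borel_measurable M" "P n \<in> borel_measurable M"
     "B n \<in> borel_measurable M" "(\<lambda>\<omega>. \<Sum>i<n. (x n i \<omega>)\<^sup>2) \<in> borel_measurable M" for n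
    unfolding T_def U_def P_def B_def by measurable
  have n1: "cmod (1 + \<i> * y) \<ge> 1" for y :: real
    using complex_Re_le_cmod[of "1 + \<i> * y"] by simp
  have nz: "1 + \<i> * y \<noteq> 0" for y :: real using n1[of y] by auto
  have TU: "iexp (\<Sum>i<n. x n i \<omega>) = T n \<omega> * U n \<omega>" for n \<omega>
    unfolding T_def U_def prod.distrib[symmetric] using nz by (simp add: sum_distrib_left exp_sum)
  \<comment> \<open>The squared modulus of 1 + i y is 1 + y^2, so the moment hypothesis
    \<open>bound\<close> is exactly an L2 bound on T.\<close>
  have T2: "(cmod (T n \<omega>))\<^sup>2 = P n \<omega>" for n \<omega>
  proof -
    have "(cmod (1 + \<i> * y))\<^sup>2 = 1 + y\<^sup>2" for y :: real by (simp add: cmod_def)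
    then show ?thesis unfolding T_def P_def prod_norm[symmetric] prod_power_distrib by simp
  qed
  have L: "0 \<le> L" "L \<le> 1" using v by (auto simp: L_def)
  have U1: "cmod (U n \<omega>) \<le> 1" for n \<omega> unfolding U_def by (rule prod_iexp_div_diff)
  have U2: "cmod (U n \<omega> - L) \<le> 2" for n \<omega>
    using norm_triangle_ineq4[of "U n \<omega>" "complex_of_real L"] U1[of n \<omega>] L by simp
  \<comment> \<open>U is close to exp (- (sum of squares) / 2) up to the factorwise remainder, and
    the law of large numbers carries this exponential to \<open>L\<close>. \<open>B\<close> collects
    both errors and has vanishing mean.\<close>
  have UL: "cmod (U n \<omega> - L) \<le> B n \<omega>" for n \<omega>
  proof -
    have s: "0 \<le> (\<Sum>i<n. (x n i \<omega>)\<^sup>2)" by (simp add: sum_nonneg)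
    have "cmod (complex_of_real (exp (- (\<Sum>i<n. (x n i \<omega>)\<^sup>2) / 2)) - L)
      = \<bar>exp (- ((\<Sum>i<n. (x n i \<omega>)\<^sup>2) / 2)) - exp (- (v / 2))\<bar>"
      unfolding L_def of_real_diff[symmetric] norm_of_real by simp
    also have "\<dots> \<le> min 1 \<bar>(\<Sum>i<n. (x n i \<omega>)\<^sup>2) / 2 - v / 2\<bar>"
      by (rule abs_exp_minus_diff_le) (use s v in auto)
    also have "\<dots> \<le> min 1 \<bar>(\<Sum>i<n. (x n i \<omega>)\<^sup>2) - v\<bar>" 
      unfolding diff_divide_distrib[symmetric] by (rule min.mono) (simp_all add: abs_divide)
    finally have "cmod (complex_of_real (exp (- (\<Sum>i<n. (x n i \<omega>)\<^sup>2) / 2)) - L)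
      \<le> min 1 \<bar>(\<Sum>i<n. (x n i \<omega>)\<^sup>2) - v\<bar>" .
    from norm_triangle_mono[OF prod_iexp_div_diff(1)[of "\<lambda>i. x n i \<omega>" n] this]
    show ?thesis by (simp add: U_def B_def sum_distrib_left)
  qed
  have intP: "integrable M (P n)" for n using int[of n] unfolding P_def .
  have intB: "integrable M (B n)" for n
    unfolding B_def by (intro Bochner_Integration.integrable_add integrable_mult_right small_int integrable_min_one) measurable
  have sq: "y \<le> 1 + y\<^sup>2" for y :: real
    using sum_squares_bound[of y 1] by (smt (verit) zero_le_power2 power_one)
  have intT: "integrable M (T n)" for n
  proof (rule Bochner_Integration.integrable_bound[of _ "\<lambda>\<omega>. 1 + P n \<omega>"])
    show "AE \<omega> in M. norm (T n \<omega>) \<le> norm (1 + P n \<omega>)"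
      using sq[of "cmod (T n _)"] by (auto simp: T2 intro!: order_trans[OF _ abs_ge_self])
  qed (use intP in auto)
  have intTU: "integrable M (\<lambda>\<omega>. T n \<omega> * (U n \<omega> - L))" for n
  proof (rule Bochner_Integration.integrable_bound[of _ "\<lambda>\<omega>. 2 * T n \<omega>"])
    show "AE \<omega> in M. norm (T n \<omega> * (U n \<omega> - L)) \<le> norm (2 * T n \<omega>)"
      by (intro AE_I2) (simp add: norm_mult, subst mult.commute[of 2], intro mult_left_mono U2 norm_ge_zero)
  qed (use intT in auto)
  have C: "C \<ge> 0"
    using bound[of 0] by (simp add: prob_space)
  have B0: "(\<lambda>n. \<integral>\<omega>. B n \<omega> \<partial>M) \<longlonglongrightarrow> 0"
  proof -
    have "(\<integral>\<omega>. B n \<omega> \<partial>M) = 2 * (\<integral>\<omega>. (\<Sum>i<n. min ((x n i \<omega>)\<^sup>2) (\<bar>x n i \<omega>\<bar> ^ 3)) \<partial>M)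
      + (\<integral>\<omega>. min 1 \<bar>(\<Sum>i<n. (x n i \<omega>)\<^sup>2) - v\<bar> \<partial>M)" for n
      unfolding B_def
      by (subst Bochner_Integration.integral_add)
         (auto intro!: small_int integrable_min_one integrable_mult_right simp del: Bochner_Integration.integral_sum)
    then show ?thesis
      using tendsto_add[OF tendsto_mult_left[OF small, of 2] lln[unfolded null_in_prob_def]] by simp
  qed
  have "(\<lambda>n. cmod (CLINT \<omega>|M. T n \<omega> * (U n \<omega> - L))) \<longlonglongrightarrow> 0"
  proof (rule tendsto_zero_eps)
    show "(\<lambda>n. (\<integral>\<omega>. B n \<omega> \<partial>M) / \<delta>) \<longlonglongrightarrow> 0" for \<delta> :: real
      using tendsto_divide[OF B0 tendsto_const, of \<delta>] by (cases "\<delta> = 0") auto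
    fix n and \<delta> :: real assume \<delta>: "0 < \<delta>" "\<delta> < 1"
    \<comment> \<open>Young's inequality with weight sqrt \<delta> separates T, known to be bounded
      in L2, from U - L. The square of the latter is at most 2 B because |U - L| is bounded both by
      2 and by B.\<close>
    have pw: "cmod (T n \<omega> * (U n \<omega> - L)) \<le> \<delta> * P n \<omega> + B n \<omega> / \<delta>" for \<omega>
    proof -
      let ?a = "cmod (T n \<omega>)" and ?b = "cmod (U n \<omega> - L)"
      have "2 * (sqrt \<delta> * ?a) * (?b / sqrt \<delta>) \<le> (sqrt \<delta> * ?a)\<^sup>2 + (?b / sqrt \<delta>)\<^sup>2"
        by (rule sum_squares_bound)
      then have "2 * (?a * ?b) \<le> \<delta> * P n \<omega> + ?b\<^sup>2 / \<delta>"
        using \<delta> by (simp add: power_mult_distrib power_divide T2)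
      moreover have "?b\<^sup>2 \<le> 2 * B n \<omega>"
        unfolding power2_eq_square using U2 UL by (intro mult_mono) auto
      then have "?b\<^sup>2 / \<delta> \<le> 2 * B n \<omega> / \<delta>" using \<delta> by (intro divide_right_mono) auto
      moreover have "0 \<le> \<delta> * P n \<omega>" using \<delta> by (auto simp: P_def intro!: mult_nonneg_nonneg prod_nonneg)
      ultimately show ?thesis unfolding norm_mult by linarith
    qed
    have "cmod (CLINT \<omega>|M. T n \<omega> * (U n \<omega> - L)) \<le> (\<integral>\<omega>. cmod (T n \<omega> * (U n \<omega> - L)) \<partial>M)" by simp
    also have "\<dots> \<le> (\<integral>\<omega>. \<delta> * P n \<omega> + B n \<omega> / \<delta> \<partial>M)"
      by (intro integral_mono pw integrable_norm intTU Bochner_Integration.integrable_add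
          integrable_mult_right integrable_divide intP intB)
    also have "\<dots> = \<delta> * (\<integral>\<omega>. P n \<omega> \<partial>M) + (\<integral>\<omega>. B n \<omega> \<partial>M) / \<delta>"
      using intP intB by simp
    also have "\<dots> \<le> \<delta> * C + (\<integral>\<omega>. B n \<omega> \<partial>M) / \<delta>"
      using bound[of n] \<delta> by (simp add: P_def)
    finally show "cmod (CLINT \<omega>|M. T n \<omega> * (U n \<omega> - L)) \<le> \<dots>" .
  qed (use C in auto)
  then have "(\<lambda>n. CLINT \<omega>|M. T n \<omega> * (U n \<omega> - L)) \<longlonglongrightarrow> 0"
    by (simp only: tendsto_norm_zero_iff)
  \<comment> \<open>Here E T = 1 enters: E (T U) = E (T (U - L)) + L.\<close>
  moreover have "(CLINT \<omega>|M. iexp (\<Sum>i<n. x n i \<omega>)) = (CLINT \<omega>|M. T n \<omega> * (U n \<omega> - L)) + L" for n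
  proof -
    have "iexp (\<Sum>i<n. x n i \<omega>) = T n \<omega> * (U n \<omega> - L) + T n \<omega> * L" for \<omega>
      unfolding TU by (simp add: algebra_simps)
    then have "(CLINT \<omega>|M. iexp (\<Sum>i<n. x n i \<omega>)) = (CLINT \<omega>|M. T n \<omega> * (U n \<omega> - L) + T n \<omega> * L)"
      by (simp only:)
    also have "\<dots> = (CLINT \<omega>|M. T n \<omega> * (U n \<omega> - L)) + (CLINT \<omega>|M. T n \<omega>) * L"
      by (subst Bochner_Integration.integral_add) (auto intro!: intTU integrable_mult_left intT)
    finally show ?thesis using mean[of n] by (simp add: T_def)
  qed
  ultimately show ?thesis
    using tendsto_add[OF \<open>(\<lambda>n. CLINT \<omega>|M. T n \<omega> * (U n \<omega> - L)) \<longlonglongrightarrow> 0\<close> tendsto_const[of "complex_of_real L"]]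
    by (simp add: L_def)
qed

section \<open>Conditioning on the covariates\<close>

text \<open>A Dynkin argument: integrals that vanish over an intersection-stable generator vanish
  over all of F, so the conditional expectation of f given F is zero and an F-measurable factor can
  be pulled out. Q may be unbounded as long as the product is integrable.\<close>

lemma (in prob_space) integral_mult_zero_generated:
  fixes f Q :: "'a \<Rightarrow> real"
  assumes sub: "subalgebra M F" and gen: "sets F = sigma_sets (space M) G"
    and G: "Int_stable G" "G \<subseteq> Pow (space M)" "space M \<in> G"
    and f: "integrable M f" and zero: "\<And>A. A \<in> G \<Longrightarrow> (\<integral>\<omega>. indicator A \<omega> * f \<omega> \<partial>M) = 0"
    and Q: "Q \<in> borel_measurable F" "integrable M (\<lambda>\<omega>. Q \<omega> * f \<omega>)"
  shows "(\<integral>\<omega>. Q \<omega> * f \<omega> \<partial>M) = 0"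
proof -
  interpret F: finite_measure_subalgebra M F
    by unfold_locales (use sub in auto)
  have subM: "A \<in> sets M" if "A \<in> sigma_sets (space M) G" for A
    using that sub by (auto simp: subalgebra_def gen[symmetric])
  have int: "integrable M (\<lambda>\<omega>. indicator A \<omega> * f \<omega>)" if "A \<in> sigma_sets (space M) G" for A
    using integrable_mult_indicator[OF subM[OF that] f] by simp
  \<comment> \<open>The mean of f is needed for complements; it comes from the whole space being a
    member of G.\<close>
  have f0: "(\<integral>\<omega>. f \<omega> \<partial>M) = 0"
  proof -
    have "(\<integral>\<omega>. f \<omega> \<partial>M) = (\<integral>\<omega>. indicator (space M) \<omega> * f \<omega> \<partial>M)"
      by (rule Bochner_Integration.integral_cong) auto
    then show ?thesis using zero[OF G(3)] by simp
  qed
  have all: "(\<integral>\<omega>. indicator A \<omega> * f \<omega> \<partial>M) = 0" if "A \<in> sigma_sets (space M) G" for A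
    using G(1,2) that
  proof (induction rule: sigma_sets_induct_disjoint)
    case (basic A) then show ?case by (rule zero)
  next
    case empty then show ?case by simp
  next
    case (compl A)
    have "(\<integral>\<omega>. indicator (space M - A) \<omega> * f \<omega> \<partial>M) = (\<integral>\<omega>. f \<omega> - indicator A \<omega> * f \<omega> \<partial>M)"
      by (rule Bochner_Integration.integral_cong) (auto simp: indicator_def)
    also have "\<dots> = 0" using compl f0 int[OF compl(1)] f by simp
    finally show ?case .
  next
    case (union A)
    have "(\<integral>\<omega>\<in>(\<Union>i. A i). f \<omega> \<partial>M) = (\<Sum>i. \<integral>\<omega>\<in>A i. f \<omega> \<partial>M)"
    proof (rule lebesgue_integral_countable_add)
      show "\<And>i. A i \<in> sets M" using union subM by blast
      show "\<And>i j. i \<noteq> j \<Longrightarrow> A i \<inter> A j = {}" using union(1) by (auto simp: disjoint_family_on_def)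
      have "(\<Union>i. A i) \<in> sigma_sets (space M) G" using union(2) by (intro sigma_sets.Union) auto
      then show "set_integrable M (\<Union>i. A i) f"
        using int by (simp add: set_integrable_def)
    qed
    then show ?case using union(3) by (simp add: set_lebesgue_integral_def)
  qed
  have "AE \<omega> in M. real_cond_exp M F f \<omega> = (\<lambda>_. 0) \<omega>"
    by (rule F.real_cond_exp_charact) (use all f in \<open>auto simp: gen set_lebesgue_integral_def\<close>)
  then have "(\<integral>\<omega>. Q \<omega> * real_cond_exp M F f \<omega> \<partial>M) = (\<integral>\<omega>. 0 \<partial>M)"
    using measurable_from_subalg[OF sub Q(1)] by (intro integral_cong_AE) (auto elim!: eventually_mono)
  then show ?thesis
    using F.real_cond_exp_intg(2)[OF Q(2) Q(1)] f by auto
qed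

section \<open>Sigma-algebras generated by the first n units\<close>

lemma space_sigma_upto [simp]: "space (sigma_upto M n Z) = space M"
  by (simp add: sigma_upto_def)

lemma measurable_sigma_upto:
  assumes "i < n" shows "Z i \<in> borel_measurable (sigma_upto M n Z)"
proof -
  have "(\<lambda>\<omega>. \<lambda>i\<in>{..<n}. Z i \<omega>) \<in> measurable (sigma_upto M n Z) (Pi\<^sub>M {..<n} (\<lambda>_. borel))"
    unfolding sigma_upto_def by (rule measurable_vimage_algebra1) (auto simp: space_PiM)
  from measurable_compose[OF this measurable_component_singleton[of i]]
  show ?thesis using assms by simp
qed

text \<open>Universal property of a generated sigma-algebra: any sigma-algebra on the same space
  that makes the first n terms measurable contains it.\<close>

lemma measurable_sigma_upto_subset:
  assumes Z: "\<And>i. i < n \<Longrightarrow> Z i \<in> borel_measurable N" and sp: "space N = space M"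
    and f: "f \<in> measurable (sigma_upto M n Z) K"
  shows "f \<in> measurable N K"
proof (rule measurable_mono[THEN subsetD, OF order.refl refl _ _ f])
  have *: "(\<lambda>\<omega>. \<lambda>i\<in>{..<n}. Z i \<omega>) \<in> measurable N (Pi\<^sub>M {..<n} (\<lambda>_. borel))"
    by (rule measurable_restrict) (use Z in auto)
  show "sets (sigma_upto M n Z) \<subseteq> sets N"
    unfolding sigma_upto_def
    using measurable_sets[OF *] sp by (auto simp: sets_vimage_algebra2 space_PiM)
  show "space (sigma_upto M n Z) = space N" using sp by simp
qed

lemma subalgebra_sigma_upto:
  assumes Z: "\<And>i. i < n \<Longrightarrow> Z i \<in> borel_measurable M"
  shows "subalgebra M (sigma_upto M n Z)"
proof -
  have "(\<lambda>\<omega>. \<lambda>i\<in>{..<n}. Z i \<omega>) \<in> measurable M (Pi\<^sub>M {..<n} (\<lambda>_. borel))"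
    by (rule measurable_restrict) (use Z in auto)
  from measurable_sets[OF this] show ?thesis
    unfolding subalgebra_def sigma_upto_def by (auto simp: sets_vimage_algebra2 space_PiM)
qed

section \<open>The randomized design and the replacement of the assignment by its conditional
  law\<close>

lemma measurable_covariate [measurable]:
  "(\<lambda>w :: real \<times> real \<times> 'x::euclidean_space. snd (snd w)) \<in> borel_measurable borel"
  by (intro borel_measurable_continuous_onI continuous_intros)

lemma measurable_outcomes [measurable]:
  "(\<lambda>w :: real \<times> real \<times> 'x::euclidean_space. (fst w, fst (snd w))) \<in> borel_measurable borel"
  by (intro borel_measurable_continuous_onI continuous_intros)

text \<open>Outcomes and covariate of a unit are packed into one triple, so that independence across
  units concerns a single sequence and integrands are functions of a point of the product space.
  \<open>X\<close> and \<open>q\<close> are parameters fixed by equations, which lets an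
  interpretation identify them with covariates and probabilities that already have names.\<close>

locale randomized_design = prob_space M for M :: "'a measure" +
  fixes W :: "nat \<Rightarrow> 'a \<Rightarrow> real \<times> real \<times> 'x::euclidean_space"
    and D :: "nat \<Rightarrow> nat \<Rightarrow> 'a \<Rightarrow> real" and p :: "'x \<Rightarrow> real" and c :: real
    and X :: "nat \<Rightarrow> 'a \<Rightarrow> 'x" and q :: "nat \<Rightarrow> 'a \<Rightarrow> real"
  defines "X \<equiv> \<lambda>i \<omega>. snd (snd (W i \<omega>))"
    and "q \<equiv> \<lambda>i \<omega>. p (snd (snd (W i \<omega>)))"
  assumes indep_W: "indep_vars (\<lambda>_. borel) W UNIV"
    and distr_W: "\<And>i. distr M borel (W i) = distr M borel (W 0)"
    and D_measurable: "\<And>n i. i < n \<Longrightarrow> D n i \<in> borel_measurable M"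
    and D_binary: "\<And>n i \<omega>. i < n \<Longrightarrow> \<omega> \<in> space M \<Longrightarrow> D n i \<omega> \<in> {0, 1}"
    and unconfounded: "\<And>n. cond_indep_pair M (sigma_upto M n X)
          (Pi\<^sub>M {..<n} (\<lambda>_. borel)) (\<lambda>\<omega>. \<lambda>i\<in>{..<n}. D n i \<omega>)
          (Pi\<^sub>M {..<n} (\<lambda>_. borel)) (\<lambda>\<omega>. \<lambda>i\<in>{..<n}. (fst (W i \<omega>), fst (snd (W i \<omega>))))"
    and p_measurable [measurable]: "p \<in> borel_measurable borel"
    and propensity: "\<And>n i. i < n \<Longrightarrow> AE \<omega> in M. real_cond_exp M (sigma_upto M n X) (D n i) \<omega> = q i \<omega>"
    and c_pos: "c > 0"
    and overlap: "\<And>i. AE \<omega> in M. q i \<omega> \<in> {c..1 - c}"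
begin

lemma W_measurable [measurable]: "W i \<in> borel_measurable M"
  using indep_W by (auto simp: indep_vars_def)

lemma measurable_p_covariate [measurable]:
  "(\<lambda>w :: real \<times> real \<times> 'x. p (snd (snd w))) \<in> borel_measurable borel"
  by (rule measurable_compose[OF measurable_covariate p_measurable])

lemma X_measurable [measurable]: "X i \<in> borel_measurable M"
  unfolding X_def by (rule measurable_compose[OF W_measurable measurable_covariate])

lemma q_measurable [measurable]: "q i \<in> borel_measurable M"
  unfolding q_def by (rule measurable_compose[OF W_measurable measurable_p_covariate])

lemma subalgebra_X: "subalgebra M (sigma_upto M n X)"
  by (rule subalgebra_sigma_upto) simp

lemma finite_measure_subalgebra_X: "finite_measure_subalgebra M (sigma_upto M n X)"
  by unfold_locales (rule subalgebra_X)

lemma integral_W: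
  fixes h :: "_ \<Rightarrow> 'b :: {banach, second_countable_topology}"
  assumes [measurable]: "h \<in> borel_measurable borel"
  shows "(\<integral>\<omega>. h (W i \<omega>) \<partial>M) = (\<integral>\<omega>. h (W 0 \<omega>) \<partial>M)"
proof -
  have "(\<integral>\<omega>. h (W i \<omega>) \<partial>M) = integral\<^sup>L (distr M borel (W i)) h"
    by (rule integral_distr[symmetric]) auto
  also have "\<dots> = (\<integral>\<omega>. h (W 0 \<omega>) \<partial>M)" unfolding distr_W[of i] by (rule integral_distr) auto
  finally show ?thesis .
qed

lemma integrable_W:
  fixes h :: "_ \<Rightarrow> 'b :: {banach, second_countable_topology}"
  assumes [measurable]: "h \<in> borel_measurable borel" and "integrable M (\<lambda>\<omega>. h (W 0 \<omega>))"
  shows "integrable M (\<lambda>\<omega>. h (W i \<omega>))"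
proof -
  have "integrable (distr M borel (W 0)) h" using assms(2) by (subst integrable_distr_eq) auto
  then have "integrable (distr M borel (W i)) h" unfolding distr_W[of i] .
  then show ?thesis by (subst (asm) integrable_distr_eq) auto
qed

lemma prod_W:
  fixes h :: "nat \<Rightarrow> _ \<Rightarrow> real"
  assumes I: "finite I" and h[measurable]: "\<And>i. i \<in> I \<Longrightarrow> h i \<in> borel_measurable borel"
    and int: "\<And>i. i \<in> I \<Longrightarrow> integrable M (\<lambda>\<omega>. h i (W 0 \<omega>))"
  shows "integrable M (\<lambda>\<omega>. \<Prod>i\<in>I. h i (W i \<omega>))"
    and "(\<integral>\<omega>. (\<Prod>i\<in>I. h i (W i \<omega>)) \<partial>M) = (\<Prod>i\<in>I. \<integral>\<omega>. h i (W 0 \<omega>) \<partial>M)"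
proof -
  have ind: "indep_vars (\<lambda>_. borel) (\<lambda>i \<omega>. h i (W i \<omega>)) I"
    by (rule indep_vars_compose2[OF indep_vars_subset[OF indep_W]]) (use h in auto)
  have int': "integrable M (\<lambda>\<omega>. h i (W i \<omega>))" if "i \<in> I" for i
    by (rule integrable_W[OF h[OF that] int[OF that]])
  show "integrable M (\<lambda>\<omega>. \<Prod>i\<in>I. h i (W i \<omega>))"
    by (rule indep_vars_integrable[OF I ind int'])
  have "(\<integral>\<omega>. (\<Prod>i\<in>I. h i (W i \<omega>)) \<partial>M) = (\<Prod>i\<in>I. \<integral>\<omega>. h i (W i \<omega>) \<partial>M)"
    by (rule indep_vars_lebesgue_integral[OF I ind int'])
  also have "\<dots> = (\<Prod>i\<in>I. \<integral>\<omega>. h i (W 0 \<omega>) \<partial>M)"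
    by (intro prod.cong refl integral_W h)
  finally show "(\<integral>\<omega>. (\<Prod>i\<in>I. h i (W i \<omega>)) \<partial>M) = (\<Prod>i\<in>I. \<integral>\<omega>. h i (W 0 \<omega>) \<partial>M)" .
qed

lemma prod_D_bounds:
  assumes "I \<subseteq> {..<n}" "\<omega> \<in> space M"
  shows "(\<Prod>i\<in>I. D n i \<omega>) \<in> {0, 1}"
  using finite_subset[OF assms(1) finite_lessThan] assms
proof (induction I)
  case (insert i I)
  then have "D n i \<omega> \<in> {0, 1}" "(\<Prod>i\<in>I. D n i \<omega>) \<in> {0, 1}" using D_binary by auto
  moreover have "x * y \<in> {0, 1}" if "x \<in> {0, 1}" "y \<in> {0, 1}" for x y :: real using that by auto
  ultimately show ?case unfolding prod.insert[OF insert(1,2)] by blast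
qed simp

lemma prod_D_le:
  assumes "I \<subseteq> {..<n}" "\<omega> \<in> space M"
  shows "0 \<le> (\<Prod>i\<in>I. D n i \<omega>)" "(\<Prod>i\<in>I. D n i \<omega>) \<le> 1" "\<bar>\<Prod>i\<in>I. D n i \<omega>\<bar> \<le> 1"
  using prod_D_bounds[OF assms] by (auto simp only: insert_iff empty_iff)

lemma prod_D_measurable:
  assumes "I \<subseteq> {..<n}" shows "(\<lambda>\<omega>. \<Prod>i\<in>I. D n i \<omega>) \<in> borel_measurable M"
  using assms D_measurable by (intro borel_measurable_prod) auto

lemma prod_D_integrable:
  assumes "I \<subseteq> {..<n}" shows "integrable M (\<lambda>\<omega>. \<Prod>i\<in>I. D n i \<omega>)"
  using prod_D_le(3)[OF assms] prod_D_measurable[OF assms]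
  by (intro integrable_const_bound[where B = 1] AE_I2) (auto simp only: real_norm_def)

text \<open>Unconfoundedness in integrated form. The factor Q may involve the outcomes, yet
  conditioning on the covariates alone suffices, because given these the outcomes carry no further
  information on the assignment.\<close>

lemma integral_prod_D:
  fixes Q :: "'a \<Rightarrow> real"
  assumes I: "I \<subseteq> {..<n}" and Q: "Q \<in> borel_measurable (sigma_upto M n W)" "integrable M Q"
  defines "w \<equiv> real_cond_exp M (sigma_upto M n X) (\<lambda>\<omega>. \<Prod>i\<in>I. D n i \<omega>)"
  shows "(\<integral>\<omega>. Q \<omega> * (\<Prod>i\<in>I. D n i \<omega>) \<partial>M) = (\<integral>\<omega>. Q \<omega> * w \<omega> \<partial>M)"
    and "AE \<omega> in M. w \<omega> \<in> {0..1}"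
    and "integrable M (\<lambda>\<omega>. Q \<omega> * (\<Prod>i\<in>I. D n i \<omega>))" "integrable M (\<lambda>\<omega>. Q \<omega> * w \<omega>)"
proof -
  interpret FX: finite_measure_subalgebra M "sigma_upto M n X" by (rule finite_measure_subalgebra_X)
  let ?D = "\<lambda>\<omega>. \<Prod>i\<in>I. D n i \<omega>"
  note [measurable] = prod_D_measurable[OF I]
  have Q'[measurable]: "Q \<in> borel_measurable M" using Q(2) by auto
  have w[measurable]: "w \<in> borel_measurable M" "w \<in> borel_measurable (sigma_upto M n X)"
    unfolding w_def by auto
  note intD = prod_D_integrable[OF I]
  have w0: "AE \<omega> in M. 0 \<le> w \<omega>"
    unfolding w_def by (rule FX.real_cond_exp_ge_c[OF intD]) (use prod_D_le(1)[OF I] in \<open>auto simp only: intro!: AE_I2\<close>)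
  have w1: "AE \<omega> in M. w \<omega> \<le> 1"
    unfolding w_def by (rule FX.real_cond_exp_le_c[OF intD]) (use prod_D_le(2)[OF I] in \<open>auto simp only: intro!: AE_I2\<close>)
  show w01: "AE \<omega> in M. w \<omega> \<in> {0..1}" using w0 w1 by auto
  show intQD: "integrable M (\<lambda>\<omega>. Q \<omega> * ?D \<omega>)"
    by (rule Bochner_Integration.integrable_bound[OF Q(2)])
       (use prod_D_le(3)[OF I] in \<open>auto intro!: AE_I2 mult_left_le simp only: real_norm_def abs_mult abs_ge_zero\<close>, measurable)
  show intQw: "integrable M (\<lambda>\<omega>. Q \<omega> * w \<omega>)"
    by (rule Bochner_Integration.integrable_bound[OF Q(2)])
       (measurable, use w01 in eventually_elim, auto simp: abs_mult intro!: mult_left_le)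
  have intw: "integrable M w" unfolding w_def by (rule FX.real_cond_exp_int[OF intD])
  define Y where "Y \<omega> = (\<lambda>i\<in>{..<n}. (fst (W i \<omega>), fst (snd (W i \<omega>))))" for \<omega>
  define XX where "XX \<omega> = (\<lambda>i\<in>{..<n}. X i \<omega>)" for \<omega>
  let ?P = "Pi\<^sub>M {..<n} (\<lambda>_. borel) :: (nat \<Rightarrow> real \<times> real) measure"
  let ?R = "Pi\<^sub>M {..<n} (\<lambda>_. borel) :: (nat \<Rightarrow> 'x) measure"
  have Y_meas[measurable]: "Y \<in> measurable M ?P"
    unfolding Y_def by (rule measurable_restrict, rule measurable_compose[OF W_measurable measurable_outcomes])
  have XX_meas[measurable]: "XX \<in> measurable M ?R"
    unfolding XX_def by (rule measurable_restrict) measurable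
  \<comment> \<open>Rectangles of outcome and covariate events are stable under intersection and
    make every \<open>W i\<close> with i < n measurable. On them the conditional independence
    hypothesis can be applied directly.\<close>
  define G where "G = {{\<omega> \<in> space M. Y \<omega> \<in> B \<and> XX \<omega> \<in> C} |B C. B \<in> sets ?P \<and> C \<in> sets ?R}"
  have GM: "G \<subseteq> sets M"
    unfolding G_def by (auto simp: pred_def[symmetric])
  have GP: "G \<subseteq> Pow (space M)" unfolding G_def by auto
  define F where "F = sigma (space M) G"
  have F: "sets F = sigma_sets (space M) G" "space F = space M" unfolding F_def using GP by auto
  have subF: "subalgebra M F"
    unfolding subalgebra_def F using sets.sigma_sets_subset[OF GM] by auto
  have Gint: "Int_stable G"
  proof (rule Int_stableI)
    fix a b assume "a \<in> G" "b \<in> G"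
    then obtain B C B' C' where "a = {\<omega> \<in> space M. Y \<omega> \<in> B \<and> XX \<omega> \<in> C}" "B \<in> sets ?P" "C \<in> sets ?R"
      "b = {\<omega> \<in> space M. Y \<omega> \<in> B' \<and> XX \<omega> \<in> C'}" "B' \<in> sets ?P" "C' \<in> sets ?R" unfolding G_def by auto
    then show "a \<inter> b \<in> G" unfolding G_def
      by (intro CollectI exI[of _ "B \<inter> B'"] exI[of _ "C \<inter> C'"]) auto
  qed
  have Ysp: "Y \<omega> \<in> space ?P" "XX \<omega> \<in> space ?R" for \<omega> by (auto simp: Y_def XX_def space_PiM)
  have spG: "space M \<in> G"
    unfolding G_def using Ysp by (intro CollectI exI[of _ "space ?P"] exI[of _ "space ?R"]) auto
  have YF: "Y \<in> measurable F ?P"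
  proof (rule measurableI)
    fix B assume B: "B \<in> sets ?P"
    have "Y -` B \<inter> space F = {\<omega> \<in> space M. Y \<omega> \<in> B \<and> XX \<omega> \<in> space ?R}" using Ysp F by auto
    also have "\<dots> \<in> G" using B unfolding G_def by blast
    finally show "Y -` B \<inter> space F \<in> sets F" unfolding F by auto
  qed (use Ysp in auto)
  have XF: "XX \<in> measurable F ?R"
  proof (rule measurableI)
    fix C assume C: "C \<in> sets ?R"
    have "XX -` C \<inter> space F = {\<omega> \<in> space M. Y \<omega> \<in> space ?P \<and> XX \<omega> \<in> C}" using Ysp F by auto
    also have "\<dots> \<in> G" using C unfolding G_def by blast
    finally show "XX -` C \<inter> space F \<in> sets F" unfolding F by auto
  qed (use Ysp in auto)
  have QF: "Q \<in> borel_measurable F"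
  proof (rule measurable_sigma_upto_subset[OF _ F(2) Q(1)])
    fix i assume i: "i < n"
    have Yi: "(\<lambda>\<omega>. Y \<omega> i) \<in> borel_measurable F"
      by (rule measurable_compose[OF YF measurable_component_singleton]) (use i in auto)
    have Xi: "(\<lambda>\<omega>. XX \<omega> i) \<in> borel_measurable F"
      by (rule measurable_compose[OF XF measurable_component_singleton]) (use i in auto)
    have "(\<lambda>\<omega>. (fst (Y \<omega> i), snd (Y \<omega> i), XX \<omega> i)) \<in> borel_measurable F"
    proof (intro borel_measurable_Pair Xi)
      have "(\<lambda>y. fst y) \<in> borel_measurable (borel :: (real \<times> real) measure)"
        "(\<lambda>y. snd y) \<in> borel_measurable (borel :: (real \<times> real) measure)"
        by (intro borel_measurable_continuous_onI continuous_intros)+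
      from this[THEN measurable_compose[OF Yi]]
      show "(\<lambda>\<omega>. fst (Y \<omega> i)) \<in> borel_measurable F" "(\<lambda>\<omega>. snd (Y \<omega> i)) \<in> borel_measurable F" .
    qed
    also have "(\<lambda>\<omega>. (fst (Y \<omega> i), snd (Y \<omega> i), XX \<omega> i)) = W i"
      using i by (auto simp: Y_def XX_def X_def)
    finally show "W i \<in> borel_measurable F" .
  qed
  \<comment> \<open>A product of binary variables is the indicator that all of them are 1; in this
    form it is an event of the assignment vector, as the conditional independence hypothesis
    requires.\<close>
  define AD where "AD = {d \<in> space (Pi\<^sub>M {..<n} (\<lambda>_. borel) :: (nat \<Rightarrow> real) measure). \<forall>i\<in>I. d i = 1}"
  have AD: "AD \<in> sets (Pi\<^sub>M {..<n} (\<lambda>_. borel))"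
    unfolding AD_def
  proof (rule sets.sets_Collect_finite_All)
    let ?PD = "Pi\<^sub>M {..<n} (\<lambda>_. borel) :: (nat \<Rightarrow> real) measure"
    fix i assume "i \<in> I"
    then have "(\<lambda>d. d i) \<in> borel_measurable ?PD" using I by (intro measurable_component_singleton) auto
    then have "(\<lambda>d. d i) -` {1} \<inter> space ?PD \<in> sets ?PD" by (rule measurable_sets) simp
    also have "(\<lambda>d. d i) -` {1} \<inter> space ?PD = {d \<in> space ?PD. d i = 1}" by auto
    finally show "{d \<in> space ?PD. d i = 1} \<in> sets ?PD" .
  qed (use I finite_subset in auto)
  have Dind: "?D \<omega> = indicator AD (\<lambda>i\<in>{..<n}. D n i \<omega>)" if "\<omega> \<in> space M" for \<omega>
  proof (cases "\<forall>i\<in>I. D n i \<omega> = 1")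
    case True
    then show ?thesis using I by (auto simp: AD_def space_PiM subset_eq indicator_def)
  next
    case False
    then obtain i where i: "i \<in> I" "D n i \<omega> \<noteq> 1" by auto
    then have "D n i \<omega> = 0" using D_binary[of i n \<omega>] I that by auto
    then have "?D \<omega> = 0" using i finite_subset[OF I] by (intro prod_zero) auto
    moreover have "(\<lambda>i\<in>{..<n}. D n i \<omega>) \<notin> AD" using i I by (auto simp: AD_def)
    ultimately show ?thesis by simp
  qed
  have "(\<integral>\<omega>. Q \<omega> * (?D \<omega> - w \<omega>) \<partial>M) = 0"
  proof (rule integral_mult_zero_generated[OF subF F(1) Gint GP spG])
    show "integrable M (\<lambda>\<omega>. ?D \<omega> - w \<omega>)" using intD intw by simp
    show "integrable M (\<lambda>\<omega>. Q \<omega> * (?D \<omega> - w \<omega>))"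
      using intQD intQw by (simp add: right_diff_distrib)
    fix A assume "A \<in> G"
    then obtain B C where A: "A = {\<omega> \<in> space M. Y \<omega> \<in> B \<and> XX \<omega> \<in> C}" and
      BC[measurable]: "B \<in> sets ?P" "C \<in> sets ?R" unfolding G_def by auto
    let ?b = "\<lambda>\<omega>. indicator B (Y \<omega>) :: real"
    let ?cc = "\<lambda>\<omega>. indicator C (XX \<omega>) :: real"
    have AM[measurable]: "A \<in> sets M" using \<open>A \<in> G\<close> GM by auto
    have XXF: "XX \<in> measurable (sigma_upto M n X) ?R"
      unfolding XX_def by (rule measurable_restrict) (auto intro: measurable_sigma_upto)
    have cF[measurable]: "?cc \<in> borel_measurable (sigma_upto M n X)"
      by (rule measurable_compose[OF XXF]) measurable
    have cM[measurable]: "?cc \<in> borel_measurable M" by measurable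
    have [measurable]: "?b \<in> borel_measurable M" by measurable
    have bD: "AE \<omega> in M. real_cond_exp M (sigma_upto M n X) (\<lambda>\<omega>. ?D \<omega> * ?b \<omega>) \<omega>
        = w \<omega> * real_cond_exp M (sigma_upto M n X) ?b \<omega>"
    proof -
      let ?i = "\<lambda>\<omega>. indicator AD (\<lambda>i\<in>{..<n}. D n i \<omega>) :: real"
      have [measurable]: "(\<lambda>\<omega>. \<lambda>i\<in>{..<n}. D n i \<omega>) \<in> measurable M (Pi\<^sub>M {..<n} (\<lambda>_. borel))"
        by (rule measurable_restrict) (use D_measurable in auto)
      have [measurable]: "?i \<in> borel_measurable M" using AD by measurable
      have 1: "AE \<omega> in M. real_cond_exp M (sigma_upto M n X) (\<lambda>\<omega>. ?i \<omega> * ?b \<omega>) \<omega>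
        = real_cond_exp M (sigma_upto M n X) ?i \<omega> * real_cond_exp M (sigma_upto M n X) ?b \<omega>"
        using unconfounded[of n] AD BC(1) unfolding cond_indep_pair_def Y_def by blast
      have 2: "AE \<omega> in M. real_cond_exp M (sigma_upto M n X) ?i \<omega> = w \<omega>"
        unfolding w_def by (rule FX.real_cond_exp_cong) (auto simp: Dind)
      have 3: "AE \<omega> in M. real_cond_exp M (sigma_upto M n X) (\<lambda>\<omega>. ?D \<omega> * ?b \<omega>) \<omega>
        = real_cond_exp M (sigma_upto M n X) (\<lambda>\<omega>. ?i \<omega> * ?b \<omega>) \<omega>"
        by (rule FX.real_cond_exp_cong) (auto simp: Dind)
      from 1 2 3 show ?thesis by eventually_elim simp
    qed
    have int1: "integrable M (\<lambda>\<omega>. ?cc \<omega> * (?D \<omega> * ?b \<omega>))"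
      by (rule Bochner_Integration.integrable_bound[OF intD]) (auto simp: indicator_def)
    have int2: "integrable M (\<lambda>\<omega>. (?cc \<omega> * w \<omega>) * ?b \<omega>)"
      by (rule Bochner_Integration.integrable_bound[OF intw]) (auto simp: indicator_def)
    have "(\<integral>\<omega>. indicator A \<omega> * (?D \<omega> - w \<omega>) \<partial>M)
      = (\<integral>\<omega>. ?cc \<omega> * (?D \<omega> * ?b \<omega>) - (?cc \<omega> * w \<omega>) * ?b \<omega> \<partial>M)"
      by (rule Bochner_Integration.integral_cong) (auto simp: A indicator_def)
    also have "\<dots> = (\<integral>\<omega>. ?cc \<omega> * (?D \<omega> * ?b \<omega>) \<partial>M) - (\<integral>\<omega>. (?cc \<omega> * w \<omega>) * ?b \<omega> \<partial>M)"
      by (rule Bochner_Integration.integral_diff[OF int1 int2])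
    \<comment> \<open>The covariate indicator passes through the conditioning, the conditional
      expectation factorises, and since \<open>w\<close> is a function of the covariates too, the
      conditioning of the outcome indicator can be undone.\<close>
    also have "(\<integral>\<omega>. ?cc \<omega> * (?D \<omega> * ?b \<omega>) \<partial>M)
      = (\<integral>\<omega>. ?cc \<omega> * real_cond_exp M (sigma_upto M n X) (\<lambda>\<omega>. ?D \<omega> * ?b \<omega>) \<omega> \<partial>M)"
      by (rule FX.real_cond_exp_intg(2)[symmetric, OF int1]) auto
    also have "\<dots> = (\<integral>\<omega>. (?cc \<omega> * w \<omega>) * real_cond_exp M (sigma_upto M n X) ?b \<omega> \<partial>M)"
      by (rule integral_cong_AE) (use bD in \<open>auto elim!: eventually_mono\<close>)
    also have "\<dots> = (\<integral>\<omega>. (?cc \<omega> * w \<omega>) * ?b \<omega> \<partial>M)"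
      by (rule FX.real_cond_exp_intg(2)[OF int2]) auto
    finally show "(\<integral>\<omega>. indicator A \<omega> * (?D \<omega> - w \<omega>) \<partial>M) = 0" by simp
  qed (rule QF)
  then show "(\<integral>\<omega>. Q \<omega> * ?D \<omega> \<partial>M) = (\<integral>\<omega>. Q \<omega> * w \<omega> \<partial>M)"
    using intQD intQw by (simp add: right_diff_distrib)
qed

text \<open>All triples with the outcomes of unit j erased but its covariate kept; 0 is a
  placeholder. The sigma-algebra of these variables holds everything except what is random about
  unit j given its covariate.\<close>

definition masked :: "nat \<Rightarrow> nat \<Rightarrow> 'a \<Rightarrow> real \<times> real \<times> 'x" where
  "masked j i \<omega> = (if i = j then (0, 0, X i \<omega>) else W i \<omega>)"

lemma masked_measurable [measurable]: "masked j i \<in> borel_measurable M"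
proof (cases "i = j")
  case True
  then have "masked j i = (\<lambda>\<omega>. (0, 0, X i \<omega>))" by (auto simp: masked_def)
  then show ?thesis by (auto intro!: borel_measurable_Pair)
next
  case False
  then have "masked j i = W i" by (auto simp: masked_def)
  then show ?thesis by simp
qed

text \<open>A function of unit j with conditional mean zero given its own covariate also has mean
  zero given all other units, which are independent of it. On product events the integral factorises
  over units and the factor of unit j vanishes.\<close>

lemma integral_masked_zero:
  fixes Q :: "'a \<Rightarrow> real"
  assumes a[measurable]: "a \<in> borel_measurable borel" and int: "integrable M (\<lambda>\<omega>. a (W 0 \<omega>))"
    and zero: "\<And>A. A \<in> sets borel \<Longrightarrow> (\<integral>\<omega>. indicator A (X 0 \<omega>) * a (W 0 \<omega>) \<partial>M) = 0"
    and j: "j < n"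
    and Q: "Q \<in> borel_measurable (sigma_upto M n (masked j))" "integrable M (\<lambda>\<omega>. Q \<omega> * a (W j \<omega>))"
  shows "(\<integral>\<omega>. Q \<omega> * a (W j \<omega>) \<partial>M) = 0"
proof -
  define G where "G = {{\<omega> \<in> space M. \<forall>i<n. masked j i \<omega> \<in> A i} |A. \<forall>i. A i \<in> sets borel}"
  have GM: "G \<subseteq> sets M"
  proof
    fix a assume "a \<in> G"
    then obtain A where A: "a = {\<omega> \<in> space M. \<forall>i<n. masked j i \<omega> \<in> A i}" "\<forall>i. A i \<in> sets borel"
      unfolding G_def by auto
    have "{\<omega> \<in> space M. masked j i \<omega> \<in> A i} \<in> sets M" for i
      using measurable_sets[OF masked_measurable, of "A i" j i] A(2) by (simp add: vimage_def Int_def conj_commute)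
    then have "{\<omega> \<in> space M. \<forall>i\<in>{..<n}. masked j i \<omega> \<in> A i} \<in> sets M"
      by (intro sets.sets_Collect_finite_All) simp_all
    then show "a \<in> sets M" by (simp only: A(1) lessThan_iff Ball_def)
  qed
  have GP: "G \<subseteq> Pow (space M)" unfolding G_def by auto
  define F where "F = sigma (space M) G"
  have F: "sets F = sigma_sets (space M) G" "space F = space M" unfolding F_def using GP by auto
  have subF: "subalgebra M F"
    unfolding subalgebra_def F using sets.sigma_sets_subset[OF GM] by auto
  have Gint: "Int_stable G"
  proof (rule Int_stableI)
    fix a b assume "a \<in> G" "b \<in> G"
    then obtain A B where "a = {\<omega> \<in> space M. \<forall>i<n. masked j i \<omega> \<in> A i}" "\<forall>i. A i \<in> sets borel"
      "b = {\<omega> \<in> space M. \<forall>i<n. masked j i \<omega> \<in> B i}" "\<forall>i. B i \<in> sets borel"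
      unfolding G_def by auto
    then show "a \<inter> b \<in> G" unfolding G_def
      by (intro CollectI exI[of _ "\<lambda>i. A i \<inter> B i"]) auto
  qed
  have spG: "space M \<in> G"
    unfolding G_def by (intro CollectI exI[of _ "\<lambda>i. UNIV"]) auto
  have QF: "Q \<in> borel_measurable F"
  proof (rule measurable_sigma_upto_subset[OF _ F(2) Q(1)])
    fix i assume i: "i < n"
    show "masked j i \<in> borel_measurable F"
    proof (rule measurableI)
      fix B :: "(real \<times> real \<times> 'x) set" assume B: "B \<in> sets borel"
      have "masked j i -` B \<inter> space F
        = {\<omega> \<in> space M. \<forall>k<n. masked j k \<omega> \<in> (if k = i then B else UNIV)}" using i F by auto
      also have "\<dots> \<in> G" unfolding G_def using B by (intro CollectI exI conjI refl) auto
      finally show "masked j i -` B \<inter> space F \<in> sets F" unfolding F by auto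
    qed auto
  qed
  show ?thesis
  proof (rule integral_mult_zero_generated[OF subF F(1) Gint GP spG _ _ QF Q(2)])
    show "integrable M (\<lambda>\<omega>. a (W j \<omega>))" by (rule integrable_W[OF a int])
    fix S assume "S \<in> G"
    then obtain A where S: "S = {\<omega> \<in> space M. \<forall>i<n. masked j i \<omega> \<in> A i}" and A[measurable]: "\<And>i. A i \<in> sets borel"
      unfolding G_def by auto
    \<comment> \<open>The masked triple of unit j has constant outcomes, so its event restricts the
      covariate only; \<open>a\<close> is attached to that factor, and all other units contribute
      plain indicators.\<close>
    define h where "h i w = (if i = j then indicator (A j) (0, 0, snd (snd w)) * a w else indicator (A i) w)"
      for i :: nat and w :: "real \<times> real \<times> 'x"
    have Am: "(\<lambda>w :: real \<times> real \<times> 'x. indicator (A j) (0, 0, snd (snd w)) :: real) \<in> borel_measurable borel"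
    proof -
      have "(\<lambda>w :: real \<times> real \<times> 'x. (0, 0, snd (snd w)) :: real \<times> real \<times> 'x) \<in> borel_measurable borel"
        by (intro borel_measurable_Pair) measurable
      moreover have "(indicator (A j) :: _ \<Rightarrow> real) \<in> borel_measurable borel"
        by (rule borel_measurable_indicator[OF A])
      ultimately show ?thesis by (rule measurable_compose)
    qed
    have h[measurable]: "h i \<in> borel_measurable borel" for i
      unfolding h_def using Am by (cases "i = j") auto
    have inth: "integrable M (\<lambda>\<omega>. h i (W 0 \<omega>))" for i
    proof (cases "i = j")
      case True
      show ?thesis
        by (rule Bochner_Integration.integrable_bound[OF int]) (use True in \<open>auto simp: h_def indicator_def\<close>)
    next
      case False
      show ?thesis
        by (rule integrable_const_bound[where B = 1]) (use False in \<open>auto simp: h_def indicator_def\<close>)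
    qed
    have "(\<integral>\<omega>. indicator S \<omega> * a (W j \<omega>) \<partial>M) = (\<integral>\<omega>. (\<Prod>i<n. h i (W i \<omega>)) \<partial>M)"
    proof (rule Bochner_Integration.integral_cong[OF refl])
      fix \<omega> assume \<omega>: "\<omega> \<in> space M"
      have "(\<Prod>i<n. h i (W i \<omega>)) = h j (W j \<omega>) * (\<Prod>i\<in>{..<n} - {j}. h i (W i \<omega>))"
        using j by (subst prod.remove[of _ j]) auto
      also have "(\<Prod>i\<in>{..<n} - {j}. h i (W i \<omega>)) = (\<Prod>i\<in>{..<n} - {j}. indicator (A i) (masked j i \<omega>))"
        by (rule prod.cong) (auto simp: h_def masked_def)
      also have "h j (W j \<omega>) = indicator (A j) (masked j j \<omega>) * a (W j \<omega>)"
        by (simp add: h_def masked_def X_def)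
      also have "\<dots> * (\<Prod>i\<in>{..<n} - {j}. indicator (A i) (masked j i \<omega>))
        = (\<Prod>i<n. indicator (A i) (masked j i \<omega>)) * a (W j \<omega>)"
        using j by (subst prod.remove[of "{..<n}" j]) auto
      also have "(\<Prod>i<n. indicator (A i) (masked j i \<omega>)) = (indicator S \<omega> :: real)"
      proof (cases "\<omega> \<in> S")
        case True then show ?thesis using S by auto
      next
        case False
        then obtain i where "i < n" "masked j i \<omega> \<notin> A i" using S \<omega> by auto
        then have "(\<Prod>i<n. indicator (A i) (masked j i \<omega>)) = (0 :: real)"
          by (intro prod_zero) (auto intro!: bexI[of _ i])
        then show ?thesis using False by simp
      qed
      finally show "indicator S \<omega> * a (W j \<omega>) = (\<Prod>i<n. h i (W i \<omega>))" by simp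
    qed
    also have "\<dots> = (\<Prod>i<n. \<integral>\<omega>. h i (W 0 \<omega>) \<partial>M)"
      by (rule prod_W(2)[OF finite_lessThan h inth])
    also have "\<dots> = 0"
    proof (rule prod_zero)
      have "(\<lambda>x :: 'x. (0, 0, x) :: real \<times> real \<times> 'x) \<in> borel_measurable borel"
        by (intro borel_measurable_Pair) measurable
      from measurable_sets[OF this A[of j]]
      have B: "{x :: 'x. (0, 0, x) \<in> A j} \<in> sets borel" by (simp add: vimage_def)
      have "(\<integral>\<omega>. h j (W 0 \<omega>) \<partial>M) = (\<integral>\<omega>. indicator {x. (0, 0, x) \<in> A j} (X 0 \<omega>) * a (W 0 \<omega>) \<partial>M)"
        by (rule Bochner_Integration.integral_cong) (auto simp: h_def X_def indicator_def)
      also have "\<dots> = 0" by (rule zero[OF B])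
      finally show "\<exists>i\<in>{..<n}. (\<integral>\<omega>. h i (W 0 \<omega>) \<partial>M) = 0" using j by auto
    qed auto
    finally show "(\<integral>\<omega>. indicator S \<omega> * a (W j \<omega>) \<partial>M) = 0" .
  qed
qed

end

section \<open>Laws of large numbers\<close>

context randomized_design
begin

lemma q_unit: "AE \<omega> in M. 0 \<le> q i \<omega> \<and> q i \<omega> \<le> 1"
  using overlap[of i] by eventually_elim (use c_pos in auto)

lemma q_sigma_upto: "i < n \<Longrightarrow> q i \<in> borel_measurable (sigma_upto M n X)"
  using measurable_compose[OF measurable_sigma_upto[of i n X M] p_measurable]
  unfolding q_def X_def by simp

lemma sigma_upto_X_W: "f \<in> measurable (sigma_upto M n X) K \<Longrightarrow> f \<in> measurable (sigma_upto M n W) K"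
proof (rule measurable_sigma_upto_subset[where Z = X and n = n and M = M])
  fix i assume "i < n"
  show "X i \<in> borel_measurable (sigma_upto M n W)"
    unfolding X_def by (rule measurable_compose[OF measurable_sigma_upto[OF \<open>i < n\<close>] measurable_covariate])
qed auto

lemma h_W_sigma_upto:
  assumes "h \<in> borel_measurable borel" "i < n"
  shows "(\<lambda>\<omega>. h (W i \<omega>)) \<in> borel_measurable (sigma_upto M n W)"
  by (rule measurable_compose[OF measurable_sigma_upto[OF assms(2)] assms(1)])

lemma integrable_mult_q:
  assumes "integrable M f" shows "integrable M (\<lambda>\<omega>. f \<omega> * q i \<omega>)"
proof (rule Bochner_Integration.integrable_bound[OF assms])
  show "(\<lambda>\<omega>. f \<omega> * q i \<omega>) \<in> borel_measurable M" using assms by auto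
  show "AE \<omega> in M. norm (f \<omega> * q i \<omega>) \<le> norm (f \<omega>)"
    using q_unit[of i] by eventually_elim (auto simp: abs_mult intro!: mult_left_le)
qed

lemma integral_D_single:
  assumes j: "j < n" and Q: "Q \<in> borel_measurable (sigma_upto M n W)" "integrable M Q"
  shows "(\<integral>\<omega>. Q \<omega> * D n j \<omega> \<partial>M) = (\<integral>\<omega>. Q \<omega> * q j \<omega> \<partial>M)" "integrable M (\<lambda>\<omega>. Q \<omega> * D n j \<omega>)"
proof -
  have I: "{j} \<subseteq> {..<n}" using j by auto
  show "integrable M (\<lambda>\<omega>. Q \<omega> * D n j \<omega>)"
    using integral_prod_D(3)[OF I Q] by simp
  have "(\<integral>\<omega>. Q \<omega> * D n j \<omega> \<partial>M) = (\<integral>\<omega>. Q \<omega> * real_cond_exp M (sigma_upto M n X) (D n j) \<omega> \<partial>M)"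
    using integral_prod_D(1)[OF I Q] by simp
  also have "\<dots> = (\<integral>\<omega>. Q \<omega> * q j \<omega> \<partial>M)"
    using Q(2) propensity[OF j] by (intro integral_cong_AE) (auto elim!: eventually_mono)
  finally show "(\<integral>\<omega>. Q \<omega> * D n j \<omega> \<partial>M) = (\<integral>\<omega>. Q \<omega> * q j \<omega> \<partial>M)" .
qed

text \<open>\<open>r\<close> is the conditional covariance of two assignments given the covariates.
  It may replace the product of centred assignments even against a Q that depends on outcomes, and
  it is the quantity that the Poisson approximation bounds.\<close>

lemma integral_D_pair:
  assumes ij: "i < n" "j < n" "i \<noteq> j" and Q: "Q \<in> borel_measurable (sigma_upto M n W)" "integrable M Q"
  defines "r \<equiv> real_cond_exp M (sigma_upto M n X) (\<lambda>\<omega>. (D n i \<omega> - q i \<omega>) * (D n j \<omega> - q j \<omega>))"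
  shows "(\<integral>\<omega>. Q \<omega> * ((D n i \<omega> - q i \<omega>) * (D n j \<omega> - q j \<omega>)) \<partial>M) = (\<integral>\<omega>. Q \<omega> * r \<omega> \<partial>M)"
    and "AE \<omega> in M. r \<omega> = real_cond_exp M (sigma_upto M n X) (\<lambda>\<omega>. D n i \<omega> * D n j \<omega>) \<omega> - q i \<omega> * q j \<omega>"
proof -
  interpret FX: finite_measure_subalgebra M "sigma_upto M n X" by (rule finite_measure_subalgebra_X)
  have I: "{i, j} \<subseteq> {..<n}" using ij by auto
  define w where "w = real_cond_exp M (sigma_upto M n X) (\<lambda>\<omega>. D n i \<omega> * D n j \<omega>)"
  have w_eq: "w = real_cond_exp M (sigma_upto M n X) (\<lambda>\<omega>. \<Prod>k\<in>{i, j}. D n k \<omega>)"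
    unfolding w_def using ij(3) by simp
  have [measurable]: "w \<in> borel_measurable M" unfolding w_def by simp
  have [measurable]: "D n i \<in> borel_measurable M" "D n j \<in> borel_measurable M" using D_measurable ij by auto
  have qW: "q i \<in> borel_measurable (sigma_upto M n W)" "q j \<in> borel_measurable (sigma_upto M n W)"
    by (rule sigma_upto_X_W[OF q_sigma_upto]; use ij in simp)+
  have expand: "integrable M (\<lambda>\<omega>. Q \<omega> * ((D n i \<omega> - q i \<omega>) * (D n j \<omega> - q j \<omega>))) \<and>
    integrable M (\<lambda>\<omega>. Q \<omega> * (w \<omega> - q i \<omega> * q j \<omega>)) \<and>
    (\<integral>\<omega>. Q \<omega> * ((D n i \<omega> - q i \<omega>) * (D n j \<omega> - q j \<omega>)) \<partial>M) = (\<integral>\<omega>. Q \<omega> * (w \<omega> - q i \<omega> * q j \<omega>) \<partial>M)"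
    if Q: "Q \<in> borel_measurable (sigma_upto M n W)" "integrable M Q" for Q
  proof -
    have 1: "(\<integral>\<omega>. Q \<omega> * (D n i \<omega> * D n j \<omega>) \<partial>M) = (\<integral>\<omega>. Q \<omega> * w \<omega> \<partial>M)"
      "integrable M (\<lambda>\<omega>. Q \<omega> * (D n i \<omega> * D n j \<omega>))" "integrable M (\<lambda>\<omega>. Q \<omega> * w \<omega>)"
      using integral_prod_D[OF I Q] ij(3) unfolding w_eq by simp_all
    have Qq: "(\<lambda>\<omega>. Q \<omega> * q i \<omega>) \<in> borel_measurable (sigma_upto M n W)" "integrable M (\<lambda>\<omega>. Q \<omega> * q i \<omega>)"
      "(\<lambda>\<omega>. Q \<omega> * q j \<omega>) \<in> borel_measurable (sigma_upto M n W)" "integrable M (\<lambda>\<omega>. Q \<omega> * q j \<omega>)"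
      using Q qW integrable_mult_q by auto
    note 2 = integral_D_single[OF ij(2) Qq(1,2)] and 3 = integral_D_single[OF ij(1) Qq(3,4)]
    have 4: "integrable M (\<lambda>\<omega>. Q \<omega> * q i \<omega> * q j \<omega>)" by (rule integrable_mult_q[OF Qq(2)])
    have eq: "Q \<omega> * ((D n i \<omega> - q i \<omega>) * (D n j \<omega> - q j \<omega>)) = Q \<omega> * (D n i \<omega> * D n j \<omega>)
        - Q \<omega> * q i \<omega> * D n j \<omega> - Q \<omega> * q j \<omega> * D n i \<omega> + Q \<omega> * q i \<omega> * q j \<omega>" for \<omega>
      by (simp add: algebra_simps)
    have eq2: "Q \<omega> * (w \<omega> - q i \<omega> * q j \<omega>) = Q \<omega> * w \<omega> - Q \<omega> * q i \<omega> * q j \<omega>" for \<omega>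
      by (simp add: algebra_simps)
    have "(\<integral>\<omega>. Q \<omega> * q j \<omega> * q i \<omega> \<partial>M) = (\<integral>\<omega>. Q \<omega> * q i \<omega> * q j \<omega> \<partial>M)"
      by (simp add: mult.assoc mult.commute[of "q i _"])
    then show ?thesis
      unfolding eq eq2 using 1 2 3 4 by simp
  qed
  have r: "AE \<omega> in M. r \<omega> = w \<omega> - q i \<omega> * q j \<omega>"
    unfolding r_def
  proof (rule FX.real_cond_exp_charact)
    \<comment> \<open>Q = 1 provides integrability, and Q the indicator of a covariate event
      provides the defining property of the conditional expectation.\<close>
    have one: "(\<lambda>_. 1 :: real) \<in> borel_measurable (sigma_upto M n W)" "integrable M (\<lambda>_. 1 :: real)" by auto
    from expand[OF one]
    show "integrable M (\<lambda>\<omega>. (D n i \<omega> - q i \<omega>) * (D n j \<omega> - q j \<omega>))"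
      "integrable M (\<lambda>\<omega>. w \<omega> - q i \<omega> * q j \<omega>)" by auto
    show "(\<lambda>\<omega>. w \<omega> - q i \<omega> * q j \<omega>) \<in> borel_measurable (sigma_upto M n X)"
      unfolding w_def using q_sigma_upto ij by auto
    fix A assume A: "A \<in> sets (sigma_upto M n X)"
    have 1: "indicator A \<in> borel_measurable (sigma_upto M n W)"
      by (rule sigma_upto_X_W) (use A in simp)
    have "A \<in> sets M" using A subalgebra_X by (auto simp: subalgebra_def)
    then have 2: "integrable M (indicator A :: 'a \<Rightarrow> real)" by (simp add: emeasure_eq_measure)
    show "(\<integral>\<omega>\<in>A. (D n i \<omega> - q i \<omega>) * (D n j \<omega> - q j \<omega>) \<partial>M)
      = (\<integral>\<omega>\<in>A. w \<omega> - q i \<omega> * q j \<omega> \<partial>M)"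
      using expand[OF 1 2] by (simp add: set_lebesgue_integral_def)
  qed
  show "AE \<omega> in M. r \<omega> = real_cond_exp M (sigma_upto M n X) (\<lambda>\<omega>. D n i \<omega> * D n j \<omega>) \<omega> - q i \<omega> * q j \<omega>"
    using r unfolding w_def .
  have [measurable]: "r \<in> borel_measurable M" unfolding r_def by simp
  have "(\<integral>\<omega>. Q \<omega> * (w \<omega> - q i \<omega> * q j \<omega>) \<partial>M) = (\<integral>\<omega>. Q \<omega> * r \<omega> \<partial>M)"
    using Q(2) r by (intro integral_cong_AE) (auto elim!: eventually_mono)
  then show "(\<integral>\<omega>. Q \<omega> * ((D n i \<omega> - q i \<omega>) * (D n j \<omega> - q j \<omega>)) \<partial>M) = (\<integral>\<omega>. Q \<omega> * r \<omega> \<partial>M)"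
    using expand[OF Q] by simp
qed

text \<open>A common frame for two laws of large numbers, with \<open>R n i h\<close> a centred
  summand linear in h: either h of the triple minus its mean, or D - q times h. Contraction in L1
  permits truncating h with a first moment only; the bounded part is handled by its variance, whose
  off-diagonal terms are controlled by \<open>\<rho>\<close>.\<close>

lemma lln_truncation:
  fixes R :: "nat \<Rightarrow> nat \<Rightarrow> (real \<times> real \<times> 'x \<Rightarrow> real) \<Rightarrow> 'a \<Rightarrow> real"
  assumes int: "\<And>n i h. i < n \<Longrightarrow> h \<in> borel_measurable borel \<Longrightarrow> integrable M (\<lambda>\<omega>. h (W 0 \<omega>)) \<Longrightarrow>
      integrable M (R n i h)"
    and L1: "\<And>n i h. i < n \<Longrightarrow> h \<in> borel_measurable borel \<Longrightarrow> integrable M (\<lambda>\<omega>. h (W 0 \<omega>)) \<Longrightarrow>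
      (\<integral>\<omega>. \<bar>R n i h \<omega>\<bar> \<partial>M) \<le> 2 * (\<integral>\<omega>. \<bar>h (W 0 \<omega>)\<bar> \<partial>M)"
    and diff: "\<And>n i h k \<omega>. i < n \<Longrightarrow> h \<in> borel_measurable borel \<Longrightarrow> k \<in> borel_measurable borel \<Longrightarrow>
      integrable M (\<lambda>\<omega>. h (W 0 \<omega>)) \<Longrightarrow> integrable M (\<lambda>\<omega>. k (W 0 \<omega>)) \<Longrightarrow>
      R n i (\<lambda>w. h w - k w) \<omega> = R n i h \<omega> - R n i k \<omega>"
    and bdd: "\<And>n i h B. i < n \<Longrightarrow> h \<in> borel_measurable borel \<Longrightarrow> (\<And>w. \<bar>h w\<bar> \<le> B) \<Longrightarrow>
      AE \<omega> in M. \<bar>R n i h \<omega>\<bar> \<le> 2 * B"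
    and cov: "\<And>n i j h B. i < n \<Longrightarrow> j < n \<Longrightarrow> i \<noteq> j \<Longrightarrow> h \<in> borel_measurable borel \<Longrightarrow>
      (\<And>w. \<bar>h w\<bar> \<le> B) \<Longrightarrow> (\<integral>\<omega>. R n i h \<omega> * R n j h \<omega> \<partial>M) \<le> B\<^sup>2 * \<rho> n"
    and \<rho>: "\<rho> \<longlonglongrightarrow> 0" "\<And>n. 0 \<le> \<rho> n"
    and h[measurable]: "h \<in> borel_measurable borel" and inth: "integrable M (\<lambda>\<omega>. h (W 0 \<omega>))"
  shows "(\<lambda>n. \<integral>\<omega>. \<bar>1 / real n * (\<Sum>i<n. R n i h \<omega>)\<bar> \<partial>M) \<longlonglongrightarrow> 0"
proof -
  define g where "g K w = (if \<bar>h w\<bar> \<le> real K then h w else 0)" for K w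
  have [measurable]: "g K \<in> borel_measurable borel" for K unfolding g_def by measurable
  have g_bd: "\<bar>g K w\<bar> \<le> real K" for K w by (simp add: g_def)
  have intg: "integrable M (\<lambda>\<omega>. g K (W 0 \<omega>))" for K
    by (rule integrable_const_bound[where B = "real K"]) (use g_bd in auto)
  have tail: "(\<lambda>K. \<integral>\<omega>. \<bar>h (W 0 \<omega>) - g K (W 0 \<omega>)\<bar> \<partial>M) \<longlonglongrightarrow> (\<integral>\<omega>. 0 \<partial>M)"
  proof (rule integral_dominated_convergence[where w = "\<lambda>\<omega>. \<bar>h (W 0 \<omega>)\<bar>"])
    show "AE \<omega> in M. (\<lambda>K. \<bar>h (W 0 \<omega>) - g K (W 0 \<omega>)\<bar>) \<longlonglongrightarrow> 0"
    proof (intro AE_I2 tendsto_eventually)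
      fix \<omega>
      show "\<forall>\<^sub>F K in sequentially. \<bar>h (W 0 \<omega>) - g K (W 0 \<omega>)\<bar> = 0"
        using eventually_ge_at_top[of "nat \<lceil>\<bar>h (W 0 \<omega>)\<bar>\<rceil>"]
        by eventually_elim (auto simp: g_def nat_le_iff ceiling_le_iff)
    qed
  qed (use inth in \<open>auto simp: g_def\<close>)
  \<comment> \<open>A truncation level whose L1 tail is at most \<delta>; dominated convergence
    shows that one exists for \<delta> > 0.\<close>
  define K where "K \<delta> = (SOME K. (\<integral>\<omega>. \<bar>h (W 0 \<omega>) - g K (W 0 \<omega>)\<bar> \<partial>M) \<le> \<delta>)" for \<delta> :: real
  have K: "(\<integral>\<omega>. \<bar>h (W 0 \<omega>) - g (K \<delta>) (W 0 \<omega>)\<bar> \<partial>M) \<le> \<delta>" if "\<delta> > 0" for \<delta>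
  proof -
    have "\<forall>\<^sub>F K in sequentially. (\<integral>\<omega>. \<bar>h (W 0 \<omega>) - g K (W 0 \<omega>)\<bar> \<partial>M) < \<delta>"
      using order_tendstoD(2)[OF tail, of \<delta>] that by simp
    then obtain k where "(\<integral>\<omega>. \<bar>h (W 0 \<omega>) - g k (W 0 \<omega>)\<bar> \<partial>M) < \<delta>"
      using eventually_happens by fastforce
    then show ?thesis unfolding K_def
      by (intro someI[of "\<lambda>K. (\<integral>\<omega>. \<bar>h (W 0 \<omega>) - g K (W 0 \<omega>)\<bar> \<partial>M) \<le> \<delta>" k]) (rule less_imp_le)
  qed
  define S where "S n k \<omega> = 1 / real n * (\<Sum>i<n. R n i k \<omega>)" for n k \<omega>
  have intS: "integrable M (S n k)" if "k \<in> borel_measurable borel" "integrable M (\<lambda>\<omega>. k (W 0 \<omega>))" for n k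
    unfolding S_def by (intro integrable_mult_right Bochner_Integration.integrable_sum int[OF _ that]) auto
  have L1S: "(\<integral>\<omega>. \<bar>S n k \<omega>\<bar> \<partial>M) \<le> 2 * (\<integral>\<omega>. \<bar>k (W 0 \<omega>)\<bar> \<partial>M)"
    if k: "k \<in> borel_measurable borel" "integrable M (\<lambda>\<omega>. k (W 0 \<omega>))" for n k
  proof -
    have "(\<integral>\<omega>. \<bar>S n k \<omega>\<bar> \<partial>M) \<le> (\<integral>\<omega>. 1 / real n * (\<Sum>i<n. \<bar>R n i k \<omega>\<bar>) \<partial>M)"
    proof (rule integral_mono)
      show "\<bar>S n k \<omega>\<bar> \<le> 1 / real n * (\<Sum>i<n. \<bar>R n i k \<omega>\<bar>)" for \<omega>
        unfolding S_def abs_mult by (intro mult_mono sum_abs) auto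
    next
      show "integrable M (\<lambda>\<omega>. \<bar>S n k \<omega>\<bar>)" by (intro integrable_abs intS[OF k])
      have "integrable M (\<lambda>\<omega>. \<Sum>i<n. \<bar>R n i k \<omega>\<bar>)"
        by (intro Bochner_Integration.integrable_sum integrable_abs int[OF _ k]) simp
      then show "integrable M (\<lambda>\<omega>. 1 / real n * (\<Sum>i<n. \<bar>R n i k \<omega>\<bar>))"
        by (rule integrable_mult_right)
    qed
    also have "\<dots> = 1 / real n * (\<Sum>i<n. \<integral>\<omega>. \<bar>R n i k \<omega>\<bar> \<partial>M)"
      by (subst integral_mult_right_zero, subst Bochner_Integration.integral_sum)
         (auto intro!: integrable_abs int[OF _ k])
    also have "\<dots> \<le> 1 / real n * (\<Sum>i<n. 2 * (\<integral>\<omega>. \<bar>k (W 0 \<omega>)\<bar> \<partial>M))"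
      by (intro mult_left_mono sum_mono L1 k) auto
    also have "\<dots> \<le> 2 * (\<integral>\<omega>. \<bar>k (W 0 \<omega>)\<bar> \<partial>M)"
      by (cases "n = 0") (auto intro: integral_nonneg_AE)
    finally show ?thesis .
  qed
  have L2S: "(\<integral>\<omega>. (S n k \<omega>)\<^sup>2 \<partial>M) \<le> 4 * B\<^sup>2 * (1 / real n) + B\<^sup>2 * \<rho> n \<and> integrable M (\<lambda>\<omega>. (S n k \<omega>)\<^sup>2)"
    if k: "k \<in> borel_measurable borel" "\<And>w. \<bar>k w\<bar> \<le> B" for n k B
  proof -
    note [measurable] = k(1)
    have ik: "integrable M (\<lambda>\<omega>. k (W 0 \<omega>))"
      by (rule integrable_const_bound[where B = B]) (use k in auto)
    have B: "B \<ge> 0" using k(2)[of undefined] by linarith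
    have iR: "integrable M (\<lambda>\<omega>. R n i k \<omega> * R n j k \<omega>)" if "i < n" "j < n" for i j
    proof (rule integrable_const_bound[where B = "2 * B * (2 * B)"])
      show "AE \<omega> in M. norm (R n i k \<omega> * R n j k \<omega>) \<le> 2 * B * (2 * B)"
        using bdd[OF that(1) k] bdd[OF that(2) k]
      proof eventually_elim
        case (elim \<omega>)
        then have "\<bar>R n i k \<omega>\<bar> * \<bar>R n j k \<omega>\<bar> \<le> 2 * B * (2 * B)" using B by (intro mult_mono) auto
        then show ?case by (simp add: abs_mult)
      qed
    next
      have "R n i k \<in> borel_measurable M" "R n j k \<in> borel_measurable M"
        by (rule borel_measurable_integrable[OF int[OF that(1) k(1) ik]],
            rule borel_measurable_integrable[OF int[OF that(2) k(1) ik]])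
      then show "(\<lambda>\<omega>. R n i k \<omega> * R n j k \<omega>) \<in> borel_measurable M" by (rule borel_measurable_times)
    qed
    have sq: "(S n k \<omega>)\<^sup>2 = (1 / real n)\<^sup>2 * (\<Sum>i<n. \<Sum>j<n. R n i k \<omega> * R n j k \<omega>)" for \<omega>
      unfolding S_def power_mult_distrib power2_eq_square[of "sum _ _"] sum_product ..
    have iS: "integrable M (\<lambda>\<omega>. (S n k \<omega>)\<^sup>2)" unfolding sq
      by (intro integrable_mult_right Bochner_Integration.integrable_sum iR) auto
    have "(\<integral>\<omega>. (S n k \<omega>)\<^sup>2 \<partial>M) = (1 / real n)\<^sup>2 * (\<Sum>i<n. \<Sum>j<n. \<integral>\<omega>. R n i k \<omega> * R n j k \<omega> \<partial>M)"
      unfolding sq integral_mult_right_zero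
      by (subst Bochner_Integration.integral_sum, intro Bochner_Integration.integrable_sum iR, simp, simp,
          intro arg_cong2[where f = "(*)"] refl sum.cong Bochner_Integration.integral_sum iR) auto
    \<comment> \<open>Only n of the n^2 terms are diagonal, so the crude bound 4 B^2 suffices for
      them after division by n^2; all others use the covariance bound.\<close>
    also have "(\<Sum>i<n. \<Sum>j<n. \<integral>\<omega>. R n i k \<omega> * R n j k \<omega> \<partial>M)
      \<le> (\<Sum>i<n. \<Sum>j<n. (if i = j then 4 * B\<^sup>2 else 0) + B\<^sup>2 * \<rho> n)"
    proof (intro sum_mono)
      fix i j assume ij: "i \<in> {..<n}" "j \<in> {..<n}"
      show "(\<integral>\<omega>. R n i k \<omega> * R n j k \<omega> \<partial>M) \<le> (if i = j then 4 * B\<^sup>2 else 0) + B\<^sup>2 * \<rho> n"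
      proof (cases "i = j")
        case True
        have "(\<integral>\<omega>. R n i k \<omega> * R n i k \<omega> \<partial>M) \<le> (\<integral>\<omega>. 2 * B * (2 * B) \<partial>M)"
        proof (rule integral_mono_AE[OF iR])
          have "AE \<omega> in M. \<bar>R n i k \<omega>\<bar> \<le> 2 * B" using ij by (intro bdd[OF _ k]) auto
          then show "AE \<omega> in M. R n i k \<omega> * R n i k \<omega> \<le> 2 * B * (2 * B)"
          proof eventually_elim
            case (elim \<omega>)
            have "\<bar>R n i k \<omega>\<bar> * \<bar>R n i k \<omega>\<bar> \<le> 2 * B * (2 * B)" using elim B by (intro mult_mono) auto
            then show ?case by simp
          qed
        qed (use ij in auto)
        then show ?thesis using True \<rho>(2)[of n] B by (simp add: prob_space power2_eq_square add_increasing2)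
      next
        case False
        then show ?thesis using cov[OF _ _ False k, of n] ij by auto
      qed
    qed
    also have "\<dots> = real n * (4 * B\<^sup>2) + (real n)\<^sup>2 * (B\<^sup>2 * \<rho> n)"
      by (simp add: sum.distrib power2_eq_square distrib_left mult.assoc)
    finally have "(\<integral>\<omega>. (S n k \<omega>)\<^sup>2 \<partial>M) \<le> (1 / real n)\<^sup>2 * (real n * (4 * B\<^sup>2) + (real n)\<^sup>2 * (B\<^sup>2 * \<rho> n))"
      by (simp add: mult_left_mono)
    also have "\<dots> \<le> 4 * B\<^sup>2 * (1 / real n) + B\<^sup>2 * \<rho> n"
      using mult_nonneg_nonneg[OF zero_le_power2[of B] \<rho>(2)[of n]]
      by (cases "n = 0") (auto simp: field_simps power2_eq_square)
    finally show ?thesis using iS by blast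
  qed
  show ?thesis
  \<comment> \<open>The 3 is made of 2 from the truncated tail, by the L1 bound with its factor 2,
    and 1 from Young's inequality |y| <= \<delta> + y^2 / \<delta> for the bounded part.\<close>
  proof (rule tendsto_zero_eps[where C = 3])
    show "(\<lambda>n. (4 * (real (K \<delta>))\<^sup>2 * (1 / real n) + (real (K \<delta>))\<^sup>2 * \<rho> n) / \<delta>) \<longlonglongrightarrow> 0" for \<delta> :: real
    proof -
      have "(\<lambda>n. (4 * (real (K \<delta>))\<^sup>2 * (1 / real n) + (real (K \<delta>))\<^sup>2 * \<rho> n) * (1 / \<delta>))
        \<longlonglongrightarrow> (4 * (real (K \<delta>))\<^sup>2 * 0 + (real (K \<delta>))\<^sup>2 * 0) * (1 / \<delta>)"
        by (intro tendsto_intros \<rho> lim_1_over_n)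
      then show ?thesis by simp
    qed
    fix n and \<delta> :: real assume \<delta>: "0 < \<delta>" "\<delta> < 1"
    let ?g = "g (K \<delta>)" and ?r = "\<lambda>w. h w - g (K \<delta>) w"
    have ir: "integrable M (\<lambda>\<omega>. ?r (W 0 \<omega>))" using inth intg by auto
    have gm: "?g \<in> borel_measurable borel" and rm: "?r \<in> borel_measurable borel" by measurable
    have iG: "integrable M (\<lambda>\<omega>. (S n ?g \<omega>)\<^sup>2)" using L2S[OF gm g_bd] by blast
    have split: "S n h \<omega> = S n ?r \<omega> + S n ?g \<omega>" for \<omega>
      unfolding S_def using diff[OF _ h gm inth intg] by (simp add: sum_subtractf right_diff_distrib)
    have pw: "\<bar>S n h \<omega>\<bar> \<le> \<bar>S n ?r \<omega>\<bar> + (\<delta> + (S n ?g \<omega>)\<^sup>2 / \<delta>)" for \<omega>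
    proof -
      let ?y = "\<bar>S n ?g \<omega>\<bar>"
      have "2 * sqrt \<delta> * (?y / sqrt \<delta>) \<le> (sqrt \<delta>)\<^sup>2 + (?y / sqrt \<delta>)\<^sup>2" by (rule sum_squares_bound)
      then have "2 * ?y \<le> \<delta> + ?y\<^sup>2 / \<delta>" using \<delta> by (simp add: power_divide)
      then have "?y \<le> \<delta> + (S n ?g \<omega>)\<^sup>2 / \<delta>" by simp
      then show ?thesis unfolding split[of \<omega>] by linarith
    qed
    have "(\<integral>\<omega>. \<bar>S n h \<omega>\<bar> \<partial>M) \<le> (\<integral>\<omega>. \<bar>S n ?r \<omega>\<bar> + (\<delta> + (S n ?g \<omega>)\<^sup>2 / \<delta>) \<partial>M)"
      by (intro integral_mono pw integrable_abs intS[OF h inth] Bochner_Integration.integrable_add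
          intS[OF rm ir] integrable_const integrable_divide iG)
    also have "\<dots> = (\<integral>\<omega>. \<bar>S n ?r \<omega>\<bar> \<partial>M) + (\<delta> + (\<integral>\<omega>. (S n ?g \<omega>)\<^sup>2 \<partial>M) / \<delta>)"
      using intS[OF rm ir, of n] iG by (simp add: prob_space)
    also have "\<dots> \<le> 2 * \<delta> + (\<delta> + (4 * (real (K \<delta>))\<^sup>2 * (1 / real n) + (real (K \<delta>))\<^sup>2 * \<rho> n) / \<delta>)"
      using L1S[OF rm ir, of n] K[OF \<delta>(1)] L2S[OF gm g_bd, of n] \<delta>
      by (intro add_mono divide_right_mono) auto
    finally show "(\<integral>\<omega>. \<bar>1 / real n * (\<Sum>i<n. R n i h \<omega>)\<bar> \<partial>M)
      \<le> \<delta> * 3 + (4 * (real (K \<delta>))\<^sup>2 * (1 / real n) + (real (K \<delta>))\<^sup>2 * \<rho> n) / \<delta>"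
      by (simp add: S_def)
  qed (auto intro: integral_nonneg_AE)
qed

text \<open>Different units are independent, so bounded centred functions of them are uncorrelated
  and the covariance bound is 0.\<close>

lemma lln_W:
  assumes h[measurable]: "h \<in> borel_measurable borel" and inth: "integrable M (\<lambda>\<omega>. h (W 0 \<omega>) :: real)"
  shows "(\<lambda>n. \<integral>\<omega>. \<bar>1 / real n * (\<Sum>i<n. h (W i \<omega>) - (\<integral>\<omega>. h (W 0 \<omega>) \<partial>M))\<bar> \<partial>M) \<longlonglongrightarrow> 0"
proof (rule lln_truncation[where R = "\<lambda>n i h \<omega>. h (W i \<omega>) - (\<integral>\<omega>. h (W 0 \<omega>) \<partial>M)" and \<rho> = "\<lambda>_. 0"])
  fix n i :: nat and h :: "real \<times> real \<times> 'x \<Rightarrow> real"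
  assume h[measurable]: "h \<in> borel_measurable borel" and ih: "integrable M (\<lambda>\<omega>. h (W 0 \<omega>))"
  note ih' = integrable_W[OF h ih]
  show "integrable M (\<lambda>\<omega>. h (W i \<omega>) - (\<integral>\<omega>. h (W 0 \<omega>) \<partial>M))" using ih' by auto
  have "(\<integral>\<omega>. \<bar>h (W i \<omega>) - (\<integral>\<omega>. h (W 0 \<omega>) \<partial>M)\<bar> \<partial>M)
    \<le> (\<integral>\<omega>. \<bar>h (W i \<omega>)\<bar> + \<bar>\<integral>\<omega>. h (W 0 \<omega>) \<partial>M\<bar> \<partial>M)"
    using ih' by (intro integral_mono) auto
  also have "\<dots> = (\<integral>\<omega>. \<bar>h (W i \<omega>)\<bar> \<partial>M) + \<bar>\<integral>\<omega>. h (W 0 \<omega>) \<partial>M\<bar>"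
    using ih' by (simp add: prob_space)
  also have "(\<integral>\<omega>. \<bar>h (W i \<omega>)\<bar> \<partial>M) = (\<integral>\<omega>. \<bar>h (W 0 \<omega>)\<bar> \<partial>M)"
    by (rule integral_W[of "\<lambda>w. \<bar>h w\<bar>"]) simp
  also have "\<bar>\<integral>\<omega>. h (W 0 \<omega>) \<partial>M\<bar> \<le> (\<integral>\<omega>. \<bar>h (W 0 \<omega>)\<bar> \<partial>M)" by (rule integral_abs_bound)
  finally show "(\<integral>\<omega>. \<bar>h (W i \<omega>) - (\<integral>\<omega>. h (W 0 \<omega>) \<partial>M)\<bar> \<partial>M) \<le> 2 * (\<integral>\<omega>. \<bar>h (W 0 \<omega>)\<bar> \<partial>M)" by simp
next
  fix n i :: nat and h :: "real \<times> real \<times> 'x \<Rightarrow> real" and B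
  assume [measurable]: "h \<in> borel_measurable borel" and B: "\<And>w. \<bar>h w\<bar> \<le> B"
  have ih: "integrable M (\<lambda>\<omega>. h (W 0 \<omega>))"
    by (rule integrable_const_bound[where B = B]) (use B in auto)
  have "\<bar>\<integral>\<omega>. h (W 0 \<omega>) \<partial>M\<bar> \<le> (\<integral>\<omega>. \<bar>h (W 0 \<omega>)\<bar> \<partial>M)" by (rule integral_abs_bound)
  also have "\<dots> \<le> (\<integral>\<omega>. B \<partial>M)"
    by (intro integral_mono integrable_abs ih B integrable_const)
  finally have "\<bar>\<integral>\<omega>. h (W 0 \<omega>) \<partial>M\<bar> \<le> B" by (simp add: prob_space)
  then have "\<bar>h (W i \<omega>) - (\<integral>\<omega>. h (W 0 \<omega>) \<partial>M)\<bar> \<le> 2 * B" for \<omega>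
    using B[of "W i \<omega>"] by linarith
  then show "AE \<omega> in M. \<bar>h (W i \<omega>) - (\<integral>\<omega>. h (W 0 \<omega>) \<partial>M)\<bar> \<le> 2 * B" by simp
next
  fix n i j :: nat and h :: "real \<times> real \<times> 'x \<Rightarrow> real" and B
  assume ij: "i \<noteq> j" and [measurable]: "h \<in> borel_measurable borel" and B: "\<And>w. \<bar>h w\<bar> \<le> B"
  let ?m = "\<integral>\<omega>. h (W 0 \<omega>) \<partial>M"
  have ih: "integrable M (\<lambda>\<omega>. h (W 0 \<omega>))"
    by (rule integrable_const_bound[where B = B]) (use B in auto)
  have "(\<integral>\<omega>. (\<Prod>k\<in>{i, j}. h (W k \<omega>) - ?m) \<partial>M) = (\<Prod>k\<in>{i, j}. \<integral>\<omega>. h (W 0 \<omega>) - ?m \<partial>M)"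
    by (rule prod_W(2)[where h = "\<lambda>_ w. h w - ?m"]) (use ih in auto)
  also have "\<dots> = 0" using ih ij by (simp add: prob_space)
  finally show "(\<integral>\<omega>. (h (W i \<omega>) - ?m) * (h (W j \<omega>) - ?m) \<partial>M) \<le> B\<^sup>2 * 0" using ij by simp
qed (use h inth in auto)

end

section \<open>Central limit theorem for two-armed sums\<close>

text \<open>For the cube method \<open>\<delta>\<close> is the supremum of the Poisson approximation for \<open>k = 2\<close>, for a coin toss it
  is \<open>0\<close>.\<close>

locale asymptotic_design = randomized_design +
  fixes \<delta> :: "nat \<Rightarrow> 'a \<Rightarrow> real"
  assumes \<delta>_measurable [measurable]: "\<And>n. \<delta> n \<in> borel_measurable M"
    and \<delta>_null: "null_in_prob M \<delta>"
    and pair_covariance: "\<And>n i j. i < n \<Longrightarrow> j < n \<Longrightarrow> i \<noteq> j \<Longrightarrow> AE \<omega> in M.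
      \<bar>real_cond_exp M (sigma_upto M n X) (\<lambda>\<omega>. (D n i \<omega> - q i \<omega>) * (D n j \<omega> - q j \<omega>)) \<omega>\<bar> \<le> \<delta> n \<omega>"
begin

lemma abs_D_minus_q: "i < n \<Longrightarrow> AE \<omega> in M. \<bar>D n i \<omega> - q i \<omega>\<bar> \<le> 1"
  using q_unit[of i] AE_space by eventually_elim (use D_binary[of i n] in fastforce)

text \<open>The conditional covariance of two assignments is bounded in modulus both by 1 and by
  \<delta>, hence by the truncated \<delta>, whose mean tends to 0. Products of bounded functions of
  the triples cost only the factor B^2.\<close>

lemma lln_D:
  assumes h[measurable]: "h \<in> borel_measurable borel" and inth: "integrable M (\<lambda>\<omega>. h (W 0 \<omega>) :: real)"
  shows "(\<lambda>n. \<integral>\<omega>. \<bar>1 / real n * (\<Sum>i<n. (D n i \<omega> - q i \<omega>) * h (W i \<omega>))\<bar> \<partial>M) \<longlonglongrightarrow> 0"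
proof (rule lln_truncation[where R = "\<lambda>n i h \<omega>. (D n i \<omega> - q i \<omega>) * h (W i \<omega>)"
      and \<rho> = "\<lambda>n. \<integral>\<omega>. min 1 \<bar>\<delta> n \<omega>\<bar> \<partial>M", OF _ _ _ _ _ \<delta>_null[unfolded null_in_prob_def] _ h inth])
  show "0 \<le> (\<integral>\<omega>. min 1 \<bar>\<delta> n \<omega>\<bar> \<partial>M)" for n by (rule integral_nonneg_AE) auto
next
  fix n i :: nat and h :: "real \<times> real \<times> 'b \<Rightarrow> real"
  assume i: "i < n" and h[measurable]: "h \<in> borel_measurable borel" and ih: "integrable M (\<lambda>\<omega>. h (W 0 \<omega>))"
  note [measurable] = D_measurable[OF i]
  note ih' = integrable_W[OF h ih]
  have bd: "AE \<omega> in M. \<bar>(D n i \<omega> - q i \<omega>) * h (W i \<omega>)\<bar> \<le> \<bar>h (W i \<omega>)\<bar>"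
    using abs_D_minus_q[OF i] by eventually_elim (auto simp: abs_mult intro!: mult_left_le_one_le)
  show int: "integrable M (\<lambda>\<omega>. (D n i \<omega> - q i \<omega>) * h (W i \<omega>))"
    by (rule Bochner_Integration.integrable_bound[OF ih']) (use bd in auto)
  have "(\<integral>\<omega>. \<bar>(D n i \<omega> - q i \<omega>) * h (W i \<omega>)\<bar> \<partial>M) \<le> (\<integral>\<omega>. \<bar>h (W i \<omega>)\<bar> \<partial>M)"
    by (intro integral_mono_AE integrable_abs int ih' bd)
  also have "\<dots> = (\<integral>\<omega>. \<bar>h (W 0 \<omega>)\<bar> \<partial>M)" by (rule integral_W[of "\<lambda>w. \<bar>h w\<bar>"]) simp
  also have "\<dots> \<le> 2 * (\<integral>\<omega>. \<bar>h (W 0 \<omega>)\<bar> \<partial>M)" by simp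
  finally show "(\<integral>\<omega>. \<bar>(D n i \<omega> - q i \<omega>) * h (W i \<omega>)\<bar> \<partial>M) \<le> 2 * (\<integral>\<omega>. \<bar>h (W 0 \<omega>)\<bar> \<partial>M)" .
next
  fix n i :: nat and h :: "real \<times> real \<times> 'b \<Rightarrow> real" and B
  assume i: "i < n" and B: "\<And>w. \<bar>h w\<bar> \<le> B"
  show "AE \<omega> in M. \<bar>(D n i \<omega> - q i \<omega>) * h (W i \<omega>)\<bar> \<le> 2 * B"
    using abs_D_minus_q[OF i]
  proof eventually_elim
    case (elim \<omega>)
    have "\<bar>(D n i \<omega> - q i \<omega>) * h (W i \<omega>)\<bar> \<le> 1 * B"
      unfolding abs_mult using elim B by (intro mult_mono) auto
    moreover have "0 \<le> B" using B[of "W i \<omega>"] by linarith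
    ultimately show ?case by linarith
  qed
next
  fix n i j :: nat and h :: "real \<times> real \<times> 'b \<Rightarrow> real" and B
  assume ij: "i < n" "j < n" "i \<noteq> j" and h[measurable]: "h \<in> borel_measurable borel" and B: "\<And>w. \<bar>h w\<bar> \<le> B"
  interpret FX: finite_measure_subalgebra M "sigma_upto M n X" by (rule finite_measure_subalgebra_X)
  let ?Q = "\<lambda>\<omega>. h (W i \<omega>) * h (W j \<omega>)"
  let ?c = "\<lambda>\<omega>. (D n i \<omega> - q i \<omega>) * (D n j \<omega> - q j \<omega>)"
  let ?r = "real_cond_exp M (sigma_upto M n X) ?c"
  note [measurable] = D_measurable[OF ij(1)] D_measurable[OF ij(2)]
  have QW: "?Q \<in> borel_measurable (sigma_upto M n W)"
    using h_W_sigma_upto[OF h ij(1)] h_W_sigma_upto[OF h ij(2)] by (rule borel_measurable_times)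
  have B0: "0 \<le> B" using B[of undefined] abs_ge_zero order_trans by blast
  have Qb: "\<bar>?Q \<omega>\<bar> \<le> B\<^sup>2" for \<omega>
    unfolding abs_mult power2_eq_square using B B0 by (intro mult_mono) auto
  have iQ: "integrable M ?Q"
    by (rule integrable_const_bound[where B = "B\<^sup>2"]) (use Qb in auto)
  have c1: "AE \<omega> in M. \<bar>?c \<omega>\<bar> \<le> 1"
    using abs_D_minus_q[OF ij(1)] abs_D_minus_q[OF ij(2)]
    by eventually_elim (auto simp: abs_mult intro!: mult_le_one)
  have ic: "integrable M ?c" by (rule integrable_const_bound[where B = 1]) (use c1 in auto)
  have r1: "AE \<omega> in M. \<bar>?r \<omega>\<bar> \<le> 1"
  proof -
    have "AE \<omega> in M. ?r \<omega> \<le> 1"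
      by (rule FX.real_cond_exp_le_c[OF ic]) (use c1 in \<open>auto elim!: eventually_mono\<close>)
    moreover have "AE \<omega> in M. - 1 \<le> ?r \<omega>"
      by (rule FX.real_cond_exp_ge_c[OF ic]) (use c1 in \<open>auto elim!: eventually_mono\<close>)
    ultimately show ?thesis by eventually_elim auto
  qed
  have "(\<integral>\<omega>. ((D n i \<omega> - q i \<omega>) * h (W i \<omega>)) * ((D n j \<omega> - q j \<omega>) * h (W j \<omega>)) \<partial>M)
    = (\<integral>\<omega>. ?Q \<omega> * ?c \<omega> \<partial>M)"
    by (rule Bochner_Integration.integral_cong) auto
  also have "\<dots> = (\<integral>\<omega>. ?Q \<omega> * ?r \<omega> \<partial>M)"
    by (rule integral_D_pair(1)[OF ij QW iQ])
  also have "\<dots> \<le> (\<integral>\<omega>. B\<^sup>2 * min 1 \<bar>\<delta> n \<omega>\<bar> \<partial>M)"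
  proof (rule integral_mono_AE)
    have le: "AE \<omega> in M. \<bar>?Q \<omega> * ?r \<omega>\<bar> \<le> B\<^sup>2 * min 1 \<bar>\<delta> n \<omega>\<bar>"
      using r1 pair_covariance[OF ij]
    proof eventually_elim
      case (elim \<omega>)
      show ?case unfolding abs_mult[of "?Q \<omega>"] using elim Qb by (intro mult_mono) auto
    qed
    then show "AE \<omega> in M. ?Q \<omega> * ?r \<omega> \<le> B\<^sup>2 * min 1 \<bar>\<delta> n \<omega>\<bar>" by (auto elim!: eventually_mono)
    show i2: "integrable M (\<lambda>\<omega>. B\<^sup>2 * min 1 \<bar>\<delta> n \<omega>\<bar>)"
      by (intro integrable_mult_right integrable_min_one) simp
    show "integrable M (\<lambda>\<omega>. ?Q \<omega> * ?r \<omega>)"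
      by (rule Bochner_Integration.integrable_bound[OF i2]) (use le in \<open>auto elim!: eventually_mono\<close>)
  qed
  finally show "(\<integral>\<omega>. ((D n i \<omega> - q i \<omega>) * h (W i \<omega>)) * ((D n j \<omega> - q j \<omega>) * h (W j \<omega>)) \<partial>M)
    \<le> B\<^sup>2 * (\<integral>\<omega>. min 1 \<bar>\<delta> n \<omega>\<bar> \<partial>M)" by simp
qed (simp add: right_diff_distrib)

definition arm :: "(real \<times> real \<times> 'b \<Rightarrow> real) \<Rightarrow> (real \<times> real \<times> 'b \<Rightarrow> real) \<Rightarrow> nat \<Rightarrow> nat \<Rightarrow> 'a \<Rightarrow> real" where
  "arm a b n i \<omega> = D n i \<omega> * a (W i \<omega>) + (1 - D n i \<omega>) * b (W i \<omega>)"

context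
  fixes a b :: "real \<times> real \<times> 'b \<Rightarrow> real"
  assumes a[measurable]: "a \<in> borel_measurable borel" and b[measurable]: "b \<in> borel_measurable borel"
    and a2: "integrable M (\<lambda>\<omega>. (a (W 0 \<omega>))\<^sup>2)" and b2: "integrable M (\<lambda>\<omega>. (b (W 0 \<omega>))\<^sup>2)"
begin

lemma arm_measurable: "i < n \<Longrightarrow> arm a b n i \<in> borel_measurable M"
  unfolding arm_def using D_measurable[of i n] by measurable

text \<open>As D is 0 or 1, the cross term with D (1 - D) vanishes and D and 1 - D equal their
  squares.\<close>

lemma arm_power2_eq:
  assumes "i < n" "\<omega> \<in> space M"
  shows "(arm a b n i \<omega>)\<^sup>2 = D n i \<omega> * (a (W i \<omega>))\<^sup>2 + (1 - D n i \<omega>) * (b (W i \<omega>))\<^sup>2"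
  using D_binary[OF assms] by (auto simp: arm_def)

lemma arm_power2_le:
  assumes "i < n" "\<omega> \<in> space M"
  shows "(arm a b n i \<omega>)\<^sup>2 \<le> (a (W i \<omega>))\<^sup>2 + (b (W i \<omega>))\<^sup>2"
  using D_binary[OF assms] by (auto simp: arm_def)

lemma arm_abs_le:
  assumes "i < n" "\<omega> \<in> space M"
  shows "\<bar>arm a b n i \<omega>\<bar> \<le> \<bar>a (W i \<omega>)\<bar> + \<bar>b (W i \<omega>)\<bar>"
  using D_binary[OF assms] by (auto simp: arm_def)

text \<open>Each factor is at most |a| + |b| at the triple of its unit, and these bounds are
  independent across units, so the product is integrable under every joint law of the
  assignments.\<close>

lemma arm_prod_integrable:
  assumes J: "J \<subseteq> {..<n}"
  shows "integrable M (\<lambda>\<omega>. \<Prod>i\<in>J. arm a b n i \<omega>)"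
proof (rule Bochner_Integration.integrable_bound)
  have fin: "finite J" using J finite_subset by auto
  have "integrable M (\<lambda>\<omega>. a (W 0 \<omega>))" by (rule integrable_square_imp[OF _ a2]) measurable
  moreover have "integrable M (\<lambda>\<omega>. b (W 0 \<omega>))" by (rule integrable_square_imp[OF _ b2]) measurable
  ultimately have int: "integrable M (\<lambda>\<omega>. \<bar>a (W 0 \<omega>)\<bar> + \<bar>b (W 0 \<omega>)\<bar>)" by simp
  show "integrable M (\<lambda>\<omega>. \<Prod>i\<in>J. \<bar>a (W i \<omega>)\<bar> + \<bar>b (W i \<omega>)\<bar>)"
    by (rule prod_W(1)[where h = "\<lambda>_ w. \<bar>a w\<bar> + \<bar>b w\<bar>", OF fin _ int]) simp
  show "(\<lambda>\<omega>. \<Prod>i\<in>J. arm a b n i \<omega>) \<in> borel_measurable M"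
    using J by (intro borel_measurable_prod arm_measurable) auto
  show "AE \<omega> in M. norm (\<Prod>i\<in>J. arm a b n i \<omega>) \<le> norm (\<Prod>i\<in>J. \<bar>a (W i \<omega>)\<bar> + \<bar>b (W i \<omega>)\<bar>)"
    unfolding prod_norm[symmetric] using J by (intro AE_I2 prod_mono) (auto intro!: arm_abs_le)
qed

text \<open>With D replaced by q, the squared arm is a function h of the triple; the error of the
  replacement is D - q times the difference k of the two squares. Each part has its own law of large
  numbers.\<close>

lemma weighted_lln:
  "null_in_prob M (\<lambda>n \<omega>. 1 / real n * (\<Sum>i<n. (arm a b n i \<omega>)\<^sup>2)
     - (\<integral>\<omega>. q 0 \<omega> * (a (W 0 \<omega>))\<^sup>2 + (1 - q 0 \<omega>) * (b (W 0 \<omega>))\<^sup>2 \<partial>M))"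
proof -
  define h where "h w = p (snd (snd w)) * (a w)\<^sup>2 + (1 - p (snd (snd w))) * (b w)\<^sup>2" for w
  define k where "k w = (a w)\<^sup>2 - (b w)\<^sup>2" for w
  have hm[measurable]: "h \<in> borel_measurable borel" "k \<in> borel_measurable borel"
    unfolding h_def k_def by measurable
  have hW: "h (W i \<omega>) = q i \<omega> * (a (W i \<omega>))\<^sup>2 + (1 - q i \<omega>) * (b (W i \<omega>))\<^sup>2" for i \<omega>
    by (simp add: h_def q_def)
  have ih: "integrable M (\<lambda>\<omega>. h (W 0 \<omega>))"
    using integrable_mult_q[OF a2, of 0] integrable_mult_q[OF b2, of 0] b2 unfolding hW
    by (simp add: left_diff_distrib mult.commute)
  have ik: "integrable M (\<lambda>\<omega>. k (W 0 \<omega>))" unfolding k_def using a2 b2 by auto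
  define v where "v = (\<integral>\<omega>. h (W 0 \<omega>) \<partial>M)"
  define R where "R n \<omega> = 1 / real n * (\<Sum>i<n. h (W i \<omega>) - v)" for n \<omega>
  define S where "S n \<omega> = 1 / real n * (\<Sum>i<n. (D n i \<omega> - q i \<omega>) * k (W i \<omega>))" for n \<omega>
  \<comment> \<open>At n = 0 the average is 0 by the convention 1 / 0 = 0, and the error is -v; this
    term keeps the decomposition exact for every n.\<close>
  define C where "C n \<omega> = (if n = 0 then - v else 0)" for n :: nat and \<omega> :: 'a
  have iR: "integrable M (R n)" for n
    unfolding R_def using integrable_W[OF hm(1) ih] by auto
  have iS: "integrable M (S n)" for n
    unfolding S_def
  proof (intro integrable_mult_right Bochner_Integration.integrable_sum)
    fix i assume "i \<in> {..<n}"
    then have i: "i < n" by simp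
    note [measurable] = D_measurable[OF i]
    show "integrable M (\<lambda>\<omega>. (D n i \<omega> - q i \<omega>) * k (W i \<omega>))"
      by (rule Bochner_Integration.integrable_bound[OF integrable_W[OF hm(2) ik, of i]])
         (measurable, use abs_D_minus_q[OF i] in eventually_elim, auto simp: abs_mult intro!: mult_left_le_one_le)
  qed
  have R: "null_in_prob M R"
    by (rule null_in_prob_L1[OF iR]) (use lln_W[OF hm(1) ih] in \<open>simp add: R_def v_def\<close>)
  have S: "null_in_prob M S"
    by (rule null_in_prob_L1[OF iS]) (use lln_D[OF hm(2) ik] in \<open>simp add: S_def\<close>)
  have C: "null_in_prob M C"
    unfolding null_in_prob_def
    by (rule tendsto_eventually, rule eventually_mono[OF eventually_gt_at_top[of 0]]) (simp add: C_def)
  have [measurable]: "R n \<in> borel_measurable M" "S n \<in> borel_measurable M" for n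
    using iR[of n] iS[of n] by auto
  have [measurable]: "C n \<in> borel_measurable M" for n unfolding C_def by simp
  have sm: "(\<lambda>\<omega>. \<Sum>i<n. (arm a b n i \<omega>)\<^sup>2) \<in> borel_measurable M" for n
    using arm_measurable by (intro borel_measurable_sum borel_measurable_power) auto
  have eq: "1 / real n * (\<Sum>i<n. (arm a b n i \<omega>)\<^sup>2) - v = R n \<omega> + (S n \<omega> + C n \<omega>)"
    if "\<omega> \<in> space M" for n \<omega>
  proof (cases "n = 0")
    case False
    have "(\<Sum>i<n. (arm a b n i \<omega>)\<^sup>2) = (\<Sum>i<n. h (W i \<omega>) + (D n i \<omega> - q i \<omega>) * k (W i \<omega>))"
      by (intro sum.cong refl, subst arm_power2_eq[OF _ that]) (auto simp: hW k_def algebra_simps)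
    then show ?thesis using False
      by (simp add: R_def S_def C_def sum.distrib sum_subtractf diff_divide_distrib add_divide_distrib)
  qed (simp add: R_def S_def C_def)
  have "null_in_prob M (\<lambda>n \<omega>. R n \<omega> + (S n \<omega> + C n \<omega>))"
    by (intro null_in_prob_add R S C) auto
  then have "null_in_prob M (\<lambda>n \<omega>. 1 / real n * (\<Sum>i<n. (arm a b n i \<omega>)\<^sup>2) - v)"
  proof (rule null_in_prob_mono[where K = 1, rotated 2])
    show "AE \<omega> in M. min 1 \<bar>1 / real n * (\<Sum>i<n. (arm a b n i \<omega>)\<^sup>2) - v\<bar>
      \<le> 1 * min 1 \<bar>R n \<omega> + (S n \<omega> + C n \<omega>)\<bar>" for n
      by (intro AE_I2) (simp only: eq mult_1 order_refl)
    show "(\<lambda>\<omega>. 1 / real n * (\<Sum>i<n. (arm a b n i \<omega>)\<^sup>2) - v) \<in> borel_measurable M" for n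
      using sm[of n] by measurable
  qed measurable
  then show ?thesis unfolding v_def hW .
qed

text \<open>Orthogonality leaves only the n diagonal terms. The resulting bound is uniform in n and
  later serves as tightness in the expansion of the Hajek estimator.\<close>

lemma arm_second_moment:
  assumes orth: "\<And>n i j. i < n \<Longrightarrow> j < n \<Longrightarrow> i \<noteq> j \<Longrightarrow> (\<integral>\<omega>. arm a b n i \<omega> * arm a b n j \<omega> \<partial>M) = 0"
  shows "integrable M (\<lambda>\<omega>. (1 / sqrt (real n) * (\<Sum>i<n. arm a b n i \<omega>))\<^sup>2)"
    and "(\<integral>\<omega>. (1 / sqrt (real n) * (\<Sum>i<n. arm a b n i \<omega>))\<^sup>2 \<partial>M) \<le> (\<integral>\<omega>. (a (W 0 \<omega>))\<^sup>2 + (b (W 0 \<omega>))\<^sup>2 \<partial>M)"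
proof -
  let ?s = "\<lambda>w. (a w)\<^sup>2 + (b w)\<^sup>2"
  have iss': "integrable M (\<lambda>\<omega>. ?s (W 0 \<omega>))" using a2 b2 by auto
  have iss: "integrable M (\<lambda>\<omega>. ?s (W i \<omega>))" for i by (rule integrable_W[OF _ iss']) measurable
  have i2: "integrable M (\<lambda>\<omega>. arm a b n i \<omega> * arm a b n i \<omega>)" if "i < n" for i
  proof (rule Bochner_Integration.integrable_bound[OF iss])
    show "AE \<omega> in M. norm (arm a b n i \<omega> * arm a b n i \<omega>) \<le> norm (?s (W i \<omega>))"
      using arm_power2_le[OF that] by (intro AE_I2) (auto simp: power2_eq_square)
    show "(\<lambda>\<omega>. arm a b n i \<omega> * arm a b n i \<omega>) \<in> borel_measurable M"
      using arm_measurable[OF that] by measurable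
  qed
  have ij: "integrable M (\<lambda>\<omega>. arm a b n i \<omega> * arm a b n j \<omega>)" if "i < n" "j < n" for i j
  proof (cases "i = j")
    case False
    then show ?thesis using arm_prod_integrable[of "{i, j}" n] that by simp
  qed (use i2 that in auto)
  have eq: "(1 / sqrt (real n) * (\<Sum>i<n. arm a b n i \<omega>))\<^sup>2
    = 1 / real n * (\<Sum>i<n. \<Sum>j<n. arm a b n i \<omega> * arm a b n j \<omega>)" for \<omega>
    unfolding power_mult_distrib power2_eq_square[of "sum _ _"] sum_product by (simp add: power_divide)
  have iin: "integrable M (\<lambda>\<omega>. \<Sum>i<n. \<Sum>j<n. arm a b n i \<omega> * arm a b n j \<omega>)"
    by (intro Bochner_Integration.integrable_sum ij) auto
  then show "integrable M (\<lambda>\<omega>. (1 / sqrt (real n) * (\<Sum>i<n. arm a b n i \<omega>))\<^sup>2)"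
    unfolding eq by (rule integrable_mult_right)
  have "(\<integral>\<omega>. (\<Sum>i<n. \<Sum>j<n. arm a b n i \<omega> * arm a b n j \<omega>) \<partial>M)
    = (\<Sum>i<n. \<Sum>j<n. (\<integral>\<omega>. arm a b n i \<omega> * arm a b n j \<omega> \<partial>M))"
  proof (subst Bochner_Integration.integral_sum)
    show "integrable M (\<lambda>\<omega>. \<Sum>j<n. arm a b n i \<omega> * arm a b n j \<omega>)" if "i \<in> {..<n}" for i
      using that by (intro Bochner_Integration.integrable_sum ij) auto
    show "(\<Sum>i<n. \<integral>\<omega>. (\<Sum>j<n. arm a b n i \<omega> * arm a b n j \<omega>) \<partial>M)
      = (\<Sum>i<n. \<Sum>j<n. \<integral>\<omega>. arm a b n i \<omega> * arm a b n j \<omega> \<partial>M)"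
      by (intro sum.cong refl Bochner_Integration.integral_sum ij) auto
  qed
  also have "\<dots> \<le> (\<Sum>i<n. \<Sum>j<n. if i = j then (\<integral>\<omega>. ?s (W 0 \<omega>) \<partial>M) else 0)"
  proof (intro sum_mono)
    fix i j assume ijn: "i \<in> {..<n}" "j \<in> {..<n}"
    show "(\<integral>\<omega>. arm a b n i \<omega> * arm a b n j \<omega> \<partial>M) \<le> (if i = j then (\<integral>\<omega>. ?s (W 0 \<omega>) \<partial>M) else 0)"
    proof (cases "i = j")
      case True
      have "(\<integral>\<omega>. arm a b n i \<omega> * arm a b n i \<omega> \<partial>M) \<le> (\<integral>\<omega>. ?s (W i \<omega>) \<partial>M)"
        using ijn arm_power2_le[of i n] by (intro integral_mono i2 iss) (auto simp: power2_eq_square)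
      also have "\<dots> = (\<integral>\<omega>. ?s (W 0 \<omega>) \<partial>M)" by (rule integral_W) measurable
      finally show ?thesis using True by simp
    qed (use orth ijn in auto)
  qed
  also have "\<dots> = real n * (\<integral>\<omega>. ?s (W 0 \<omega>) \<partial>M)" by simp
  finally have le: "(\<integral>\<omega>. (\<Sum>i<n. \<Sum>j<n. arm a b n i \<omega> * arm a b n j \<omega>) \<partial>M) \<le> real n * (\<integral>\<omega>. ?s (W 0 \<omega>) \<partial>M)" .
  have "0 \<le> (\<integral>\<omega>. ?s (W 0 \<omega>) \<partial>M)" by (rule integral_nonneg_AE) auto
  then show "(\<integral>\<omega>. (1 / sqrt (real n) * (\<Sum>i<n. arm a b n i \<omega>))\<^sup>2 \<partial>M) \<le> (\<integral>\<omega>. ?s (W 0 \<omega>) \<partial>M)"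
    unfolding eq integral_mult_right_zero using le by (cases "n = 0") (auto simp: field_simps)
qed

lemma arm_clt:
  assumes orth: "\<And>n J. J \<subseteq> {..<n} \<Longrightarrow> J \<noteq> {} \<Longrightarrow> (\<integral>\<omega>. (\<Prod>i\<in>J. arm a b n i \<omega>) \<partial>M) = 0"
  shows "converges_to_normal M (\<lambda>n \<omega>. 1 / sqrt (real n) * (\<Sum>i<n. arm a b n i \<omega>))
    (\<integral>\<omega>. q 0 \<omega> * (a (W 0 \<omega>))\<^sup>2 + (1 - q 0 \<omega>) * (b (W 0 \<omega>))\<^sup>2 \<partial>M)"
proof (rule converges_to_normalI)
  let ?v = "\<integral>\<omega>. q 0 \<omega> * (a (W 0 \<omega>))\<^sup>2 + (1 - q 0 \<omega>) * (b (W 0 \<omega>))\<^sup>2 \<partial>M"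
  let ?s = "\<lambda>w. (a w)\<^sup>2 + (b w)\<^sup>2"
  have iss': "integrable M (\<lambda>\<omega>. ?s (W 0 \<omega>))" using a2 b2 by auto
  have iss: "integrable M (\<lambda>\<omega>. ?s (W i \<omega>))" for i by (rule integrable_W[OF _ iss']) measurable
  show "(\<lambda>\<omega>. 1 / sqrt (real n) * (\<Sum>i<n. arm a b n i \<omega>)) \<in> borel_measurable M" for n
    using arm_measurable by (intro borel_measurable_times borel_measurable_sum) auto
  show v: "0 \<le> ?v"
  proof (rule integral_nonneg_AE)
    show "AE \<omega> in M. 0 \<le> q 0 \<omega> * (a (W 0 \<omega>))\<^sup>2 + (1 - q 0 \<omega>) * (b (W 0 \<omega>))\<^sup>2"
      using q_unit[of 0] by eventually_elim (auto intro!: add_nonneg_nonneg mult_nonneg_nonneg)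
  qed
  fix t :: real
  define x where "x n i \<omega> = t / sqrt (real n) * arm a b n i \<omega>" for n i \<omega>
  define \<kappa> where "\<kappa> = (\<integral>\<omega>. ?s (W 0 \<omega>) \<partial>M)"
  have \<kappa>: "\<kappa> \<ge> 0" unfolding \<kappa>_def by (rule integral_nonneg_AE) auto
  have xm: "x n i \<in> borel_measurable M" if "i < n" for n i
    unfolding x_def using arm_measurable[OF that] by auto
  have x2: "(x n i \<omega>)\<^sup>2 \<le> t\<^sup>2 / real n * ?s (W i \<omega>)" if "i < n" "\<omega> \<in> space M" for n i \<omega>
    unfolding x_def power_mult_distrib power_divide using arm_power2_le[OF that]
    by (auto intro!: mult_left_mono divide_right_mono)
  have "(\<lambda>n. CLINT \<omega>|M. iexp (\<Sum>i<n. x n i \<omega>)) \<longlonglongrightarrow> exp (- (t\<^sup>2 * ?v) / 2)"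
  proof (rule mcleish_clt[where C = "exp (t\<^sup>2 * \<kappa>)"])
    fix n
    have xJ: "complex_integrable M (\<lambda>\<omega>. \<Prod>i\<in>J. \<i> * x n i \<omega>)"
      "(CLINT \<omega>|M. \<Prod>i\<in>J. \<i> * x n i \<omega>) = (if J = {} then 1 else 0)" if "J \<subseteq> {..<n}" for J
    proof -
      have eq: "(\<Prod>i\<in>J. \<i> * x n i \<omega>) = (\<i> * of_real (t / sqrt (real n))) ^ card J * of_real (\<Prod>i\<in>J. arm a b n i \<omega>)" for \<omega>
      proof -
        have "(\<Prod>i\<in>J. \<i> * x n i \<omega>) = (\<Prod>i\<in>J. (\<i> * of_real (t / sqrt (real n))) * of_real (arm a b n i \<omega>))"
          by (simp add: x_def mult.assoc)
        then show ?thesis by (simp only: prod.distrib prod_constant of_real_prod power_mult_distrib)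
      qed
      show "complex_integrable M (\<lambda>\<omega>. \<Prod>i\<in>J. \<i> * x n i \<omega>)"
        unfolding eq using arm_prod_integrable[OF that]
        by (intro integrable_mult_right integrable_of_real)
      show "(CLINT \<omega>|M. \<Prod>i\<in>J. \<i> * x n i \<omega>) = (if J = {} then 1 else 0)"
      proof (cases "J = {}")
        case True then show ?thesis by (simp add: prob_space)
      next
        case False
        then show ?thesis unfolding eq integral_mult_right_zero integral_complex_of_real orth[OF that False] by simp
      qed
    qed
    \<comment> \<open>Expansion over subsets of units: each non-empty subset contributes a multiple
      of a mixed moment, which is 0, and the empty one contributes 1.\<close>
    have "(CLINT \<omega>|M. \<Prod>i<n. 1 + \<i> * x n i \<omega>) = (CLINT \<omega>|M. (\<Sum>J\<in>Pow {..<n}. \<Prod>i\<in>J. \<i> * x n i \<omega>))"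
      by (simp add: add.commute[of 1] prod_add)
    also have "\<dots> = (\<Sum>J\<in>Pow {..<n}. CLINT \<omega>|M. \<Prod>i\<in>J. \<i> * x n i \<omega>)"
      by (rule Bochner_Integration.integral_sum) (use xJ in auto)
    also have "\<dots> = (\<Sum>J\<in>Pow {..<n}. if J = {} then 1 else 0)"
      by (rule sum.cong) (use xJ in auto)
    finally show "(CLINT \<omega>|M. \<Prod>i<n. 1 + \<i> * x n i \<omega>) = 1" by simp
  next
    fix n
    let ?h = "\<lambda>w. 1 + t\<^sup>2 / real n * ?s w"
    have ih: "integrable M (\<lambda>\<omega>. ?h (W 0 \<omega>))" using iss' by auto
    note P = prod_W[of "{..<n}" "\<lambda>_. ?h", OF finite_lessThan _ ih]
    have iP: "integrable M (\<lambda>\<omega>. \<Prod>i<n. ?h (W i \<omega>))" by (rule P(1)) measurable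
    have xP: "(\<Prod>i<n. 1 + (x n i \<omega>)\<^sup>2) \<le> (\<Prod>i<n. ?h (W i \<omega>))" if "\<omega> \<in> space M" for \<omega>
      using x2[OF _ that] by (intro prod_mono) (auto intro: add_nonneg_nonneg)
    have xP0: "0 \<le> (\<Prod>i<n. 1 + (x n i \<omega>)\<^sup>2)" for \<omega> by (intro prod_nonneg) auto
    show iX: "integrable M (\<lambda>\<omega>. \<Prod>i<n. 1 + (x n i \<omega>)\<^sup>2)"
    proof (rule Bochner_Integration.integrable_bound[OF iP])
      show "(\<lambda>\<omega>. \<Prod>i<n. 1 + (x n i \<omega>)\<^sup>2) \<in> borel_measurable M"
        using xm by (intro borel_measurable_prod borel_measurable_add borel_measurable_power) auto
      show "AE \<omega> in M. norm (\<Prod>i<n. 1 + (x n i \<omega>)\<^sup>2) \<le> norm (\<Prod>i<n. ?h (W i \<omega>))"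
        unfolding real_norm_def using xP xP0 by (intro AE_I2) (smt (verit))
    qed
    have "(\<integral>\<omega>. (\<Prod>i<n. 1 + (x n i \<omega>)\<^sup>2) \<partial>M) \<le> (\<integral>\<omega>. (\<Prod>i<n. ?h (W i \<omega>)) \<partial>M)"
      by (intro integral_mono iX iP xP)
    \<comment> \<open>The dominating factors depend on i.i.d. triples only, so the bound becomes (1
      + t^2 \<kappa> / n)^n <= exp (t^2 \<kappa>), free of n.\<close>
    also have "\<dots> = (\<Prod>i<n. \<integral>\<omega>. ?h (W 0 \<omega>) \<partial>M)" by (rule P(2)) measurable
    also have "(\<integral>\<omega>. ?h (W 0 \<omega>) \<partial>M) = 1 + t\<^sup>2 / real n * \<kappa>"
      unfolding \<kappa>_def using iss' by (subst Bochner_Integration.integral_add) (auto simp: prob_space)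
    also have "(\<Prod>i<n. 1 + t\<^sup>2 / real n * \<kappa>) \<le> exp (t\<^sup>2 * \<kappa>)"
    proof (cases "n = 0")
      case False
      have "0 \<le> t\<^sup>2 * \<kappa>" using \<kappa> by simp
      then have "(1 + (t\<^sup>2 * \<kappa>) / real n) ^ n \<le> exp (t\<^sup>2 * \<kappa>)"
        using False by (intro exp_ge_one_plus_x_over_n_power_n) (auto intro: order_trans[of _ 0])
      then show ?thesis by simp
    qed (use \<kappa> in simp)
    finally show "(\<integral>\<omega>. (\<Prod>i<n. 1 + (x n i \<omega>)\<^sup>2) \<partial>M) \<le> exp (t\<^sup>2 * \<kappa>)" .
  next
    \<comment> \<open>\<open>y\<close> is n times the bound for a single unit. It is dominated by
      the integrable t^2 s and tends to 0 pointwise through its second argument, so dominated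
      convergence takes the place of a Lindeberg condition.\<close>
    define y where "y n w = min (t\<^sup>2 * ?s w) (\<bar>t\<bar> ^ 3 * (sqrt (?s w)) ^ 3 / sqrt (real n))" for n :: nat and w
    have ym[measurable]: "y n \<in> borel_measurable borel" for n unfolding y_def by measurable
    have y0: "0 \<le> y n w" for n w by (auto simp: y_def)
    have yle: "\<bar>y n w\<bar> \<le> t\<^sup>2 * ?s w" for n w using y0[of n w] by (auto simp: y_def)
    have iy: "integrable M (\<lambda>\<omega>. y n (W 0 \<omega>))" for n
      by (rule Bochner_Integration.integrable_bound[OF integrable_mult_right[OF iss', of "t\<^sup>2"]])
         (use yle in \<open>auto intro: order_trans\<close>)
    have pw: "min ((x n i \<omega>)\<^sup>2) (\<bar>x n i \<omega>\<bar> ^ 3) \<le> 1 / real n * y n (W i \<omega>)" if i: "i < n" "\<omega> \<in> space M" for n i \<omega>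
    proof -
      let ?z = "sqrt (?s (W i \<omega>))"
      have n: "real n > 0" using i by auto
      have z0: "0 \<le> ?s (W i \<omega>)" by simp
      have "\<bar>arm a b n i \<omega>\<bar> \<le> ?z" using arm_power2_le[OF i] by (simp add: real_le_rsqrt abs_le_square_iff)
      then have "\<bar>x n i \<omega>\<bar> \<le> \<bar>t\<bar> * ?z / sqrt (real n)"
        unfolding x_def abs_mult using n by (simp add: abs_divide mult_left_mono divide_right_mono)
      then have "\<bar>x n i \<omega>\<bar> ^ 3 \<le> (\<bar>t\<bar> * ?z / sqrt (real n)) ^ 3" by (intro power_mono) auto
      also have "\<dots> = 1 / real n * (\<bar>t\<bar> ^ 3 * ?z ^ 3 / sqrt (real n))"
      proof -
        have "sqrt (real n) ^ 3 = real n * sqrt (real n)" using n by (simp add: power3_eq_cube)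
        then show ?thesis by (simp only: power_mult_distrib power_divide) simp
      qed
      finally have 3: "\<bar>x n i \<omega>\<bar> ^ 3 \<le> 1 / real n * (\<bar>t\<bar> ^ 3 * ?z ^ 3 / sqrt (real n))" .
      have 2: "(x n i \<omega>)\<^sup>2 \<le> 1 / real n * (t\<^sup>2 * ?s (W i \<omega>))" using x2[OF i] by simp
      have "min (1 / real n * (t\<^sup>2 * ?s (W i \<omega>))) (1 / real n * (\<bar>t\<bar> ^ 3 * ?z ^ 3 / sqrt (real n)))
        = 1 / real n * y n (W i \<omega>)" unfolding y_def using n by (simp add: min_mult_distrib_left)
      then show ?thesis using min.mono[OF 2 3] by simp
    qed
    have m0: "0 \<le> min ((x n i \<omega>)\<^sup>2) (\<bar>x n i \<omega>\<bar> ^ 3)" for n i \<omega> by auto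
    have iS: "integrable M (\<lambda>\<omega>. min ((x n i \<omega>)\<^sup>2) (\<bar>x n i \<omega>\<bar> ^ 3))" if "i < n" for n i
    proof (rule Bochner_Integration.integrable_bound[OF integrable_mult_right[OF integrable_W[OF ym iy], of "1 / real n" n i]])
      show "(\<lambda>\<omega>. min ((x n i \<omega>)\<^sup>2) (\<bar>x n i \<omega>\<bar> ^ 3)) \<in> borel_measurable M" using xm[OF that] by measurable
      show "AE \<omega> in M. norm (min ((x n i \<omega>)\<^sup>2) (\<bar>x n i \<omega>\<bar> ^ 3)) \<le> norm (1 / real n * y n (W i \<omega>))"
        using pw[OF that] m0 by (intro AE_I2) (metis abs_of_nonneg order_trans real_norm_def)
    qed
    show iSS: "integrable M (\<lambda>\<omega>. \<Sum>i<n. min ((x n i \<omega>)\<^sup>2) (\<bar>x n i \<omega>\<bar> ^ 3))" for n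
      by (intro Bochner_Integration.integrable_sum iS) auto
    have lim: "(\<lambda>n. \<integral>\<omega>. y n (W 0 \<omega>) \<partial>M) \<longlonglongrightarrow> (\<integral>\<omega>. 0 \<partial>M)"
    proof (rule integral_dominated_convergence[where w = "\<lambda>\<omega>. t\<^sup>2 * ?s (W 0 \<omega>)"])
      show "AE \<omega> in M. (\<lambda>n. y n (W 0 \<omega>)) \<longlonglongrightarrow> 0"
      proof (rule AE_I2, rule tendsto_sandwich[OF _ _ tendsto_const])
        fix \<omega>
        show "\<forall>\<^sub>F n in sequentially. 0 \<le> y n (W 0 \<omega>)" using y0 by auto
        show "\<forall>\<^sub>F n in sequentially. y n (W 0 \<omega>) \<le> \<bar>t\<bar> ^ 3 * (sqrt (?s (W 0 \<omega>))) ^ 3 / sqrt (real n)"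
          by (auto simp: y_def)
        show "(\<lambda>n. \<bar>t\<bar> ^ 3 * (sqrt (?s (W 0 \<omega>))) ^ 3 / sqrt (real n)) \<longlonglongrightarrow> 0"
          by (rule real_tendsto_divide_at_top[OF tendsto_const])
             (rule filterlim_compose[OF sqrt_at_top filterlim_real_sequentially])
      qed
    qed (use iss' yle in auto)
    show "(\<lambda>n. \<integral>\<omega>. (\<Sum>i<n. min ((x n i \<omega>)\<^sup>2) (\<bar>x n i \<omega>\<bar> ^ 3)) \<partial>M) \<longlonglongrightarrow> 0"
    proof (rule tendsto_sandwich[OF _ _ tendsto_const])
      show "(\<lambda>n. \<integral>\<omega>. y n (W 0 \<omega>) \<partial>M) \<longlonglongrightarrow> 0" using lim by simp
      show "\<forall>\<^sub>F n in sequentially. 0 \<le> (\<integral>\<omega>. (\<Sum>i<n. min ((x n i \<omega>)\<^sup>2) (\<bar>x n i \<omega>\<bar> ^ 3)) \<partial>M)"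
        by (intro always_eventually allI integral_nonneg_AE AE_I2 sum_nonneg m0)
      have "(\<integral>\<omega>. (\<Sum>i<n. min ((x n i \<omega>)\<^sup>2) (\<bar>x n i \<omega>\<bar> ^ 3)) \<partial>M) \<le> (\<integral>\<omega>. y n (W 0 \<omega>) \<partial>M)" for n
      proof -
        have "(\<integral>\<omega>. (\<Sum>i<n. min ((x n i \<omega>)\<^sup>2) (\<bar>x n i \<omega>\<bar> ^ 3)) \<partial>M)
          \<le> (\<integral>\<omega>. (\<Sum>i<n. 1 / real n * y n (W i \<omega>)) \<partial>M)"
          by (intro integral_mono iSS Bochner_Integration.integrable_sum integrable_mult_right
              integrable_W[OF ym iy] sum_mono pw) auto
        also have "\<dots> = (\<Sum>i<n. \<integral>\<omega>. 1 / real n * y n (W i \<omega>) \<partial>M)"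
          by (intro Bochner_Integration.integral_sum integrable_mult_right integrable_W[OF ym iy])
        also have "\<dots> = (\<Sum>i<n. 1 / real n * (\<integral>\<omega>. y n (W 0 \<omega>) \<partial>M))"
          unfolding integral_mult_right_zero by (intro sum.cong refl arg_cong2[where f = "(*)"] integral_W ym)
        also have "\<dots> \<le> (\<integral>\<omega>. y n (W 0 \<omega>) \<partial>M)"
        proof -
          have "0 \<le> (\<integral>\<omega>. y n (W 0 \<omega>) \<partial>M)" by (rule integral_nonneg_AE) (simp add: y0)
          then show ?thesis by (cases "n = 0") auto
        qed
        finally show ?thesis .
      qed
      then show "\<forall>\<^sub>F n in sequentially. (\<integral>\<omega>. (\<Sum>i<n. min ((x n i \<omega>)\<^sup>2) (\<bar>x n i \<omega>\<bar> ^ 3)) \<partial>M)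
        \<le> (\<integral>\<omega>. y n (W 0 \<omega>) \<partial>M)" by auto
    qed
  next
    \<comment> \<open>The squares of x are those of the arms scaled by t^2 / n; in the truncated
      distance the factor t^2 is absorbed by 1 + t^2.\<close>
    have eq: "(\<Sum>i<n. (x n i \<omega>)\<^sup>2) - t\<^sup>2 * ?v = t\<^sup>2 * (1 / real n * (\<Sum>i<n. (arm a b n i \<omega>)\<^sup>2) - ?v)" for n \<omega>
      unfolding x_def power_mult_distrib power_divide sum_distrib_left[symmetric] by (simp add: algebra_simps)
    have mm: "(\<lambda>\<omega>. 1 / real n * (\<Sum>i<n. (arm a b n i \<omega>)\<^sup>2) - ?v) \<in> borel_measurable M" for n
      using arm_measurable by (intro borel_measurable_diff borel_measurable_times borel_measurable_sum borel_measurable_power) auto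
    have le: "min 1 \<bar>t\<^sup>2 * z\<bar> \<le> (1 + t\<^sup>2) * min 1 \<bar>z\<bar>" for z :: real
    proof (cases "\<bar>z\<bar> \<le> 1")
      case True
      then show ?thesis by (auto simp: abs_mult algebra_simps intro: min.coboundedI2)
    next
      case False
      then have "min 1 \<bar>z\<bar> = 1" by simp
      moreover have "min 1 \<bar>t\<^sup>2 * z\<bar> \<le> 1 + t\<^sup>2" by (rule min.coboundedI1) simp
      ultimately show ?thesis by simp
    qed
    show "null_in_prob M (\<lambda>n \<omega>. (\<Sum>i<n. (x n i \<omega>)\<^sup>2) - t\<^sup>2 * ?v)"
      unfolding eq
      by (rule null_in_prob_mono[OF mm _ weighted_lln, where K = "1 + t\<^sup>2"])
         (use mm le in \<open>auto intro!: borel_measurable_times\<close>)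
  qed (use xm v in auto)
  moreover have "(\<Sum>i<n. x n i \<omega>) = t * (1 / sqrt (real n) * (\<Sum>i<n. arm a b n i \<omega>))" for n \<omega>
    by (simp add: x_def sum_distrib_left)
  ultimately show "(\<lambda>n. CLINT \<omega>|M. iexp (t * (1 / sqrt (real n) * (\<Sum>i<n. arm a b n i \<omega>))))
    \<longlonglongrightarrow> complex_of_real (exp (- (t\<^sup>2 * ?v) / 2))" by simp
qed

end

end

section \<open>Mixed moments of two-armed terms\<close>

context asymptotic_design
begin

text \<open>Each arm is D (a - b) + b. Expanding over the set I of units that contribute their D
  leaves functions of the triples times products of D over I, and these products are replaced by
  their conditional expectations \<open>w I\<close>.\<close>

lemma integral_prod_arm:
  fixes a b :: "real \<times> real \<times> 'b \<Rightarrow> real"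
  assumes a[measurable]: "a \<in> borel_measurable borel" and b[measurable]: "b \<in> borel_measurable borel"
    and a2: "integrable M (\<lambda>\<omega>. (a (W 0 \<omega>))\<^sup>2)" and b2: "integrable M (\<lambda>\<omega>. (b (W 0 \<omega>))\<^sup>2)"
    and J: "J \<subseteq> {..<n}"
  defines "w I \<equiv> real_cond_exp M (sigma_upto M n X) (\<lambda>\<omega>. \<Prod>i\<in>I. D n i \<omega>)"
    and "Q I \<equiv> \<lambda>\<omega>. \<Prod>i\<in>J. if i \<in> I then a (W i \<omega>) - b (W i \<omega>) else b (W i \<omega>)"
  shows "(\<integral>\<omega>. (\<Prod>i\<in>J. arm a b n i \<omega>) \<partial>M) = (\<Sum>I\<in>Pow J. \<integral>\<omega>. Q I \<omega> * w I \<omega> \<partial>M)"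
    and "\<And>I. I \<subseteq> J \<Longrightarrow> integrable M (\<lambda>\<omega>. Q I \<omega> * w I \<omega>)"
proof -
  have fin: "finite J" using J finite_subset by auto
  have ia: "integrable M (\<lambda>\<omega>. a (W 0 \<omega>))" by (rule integrable_square_imp[OF _ a2]) measurable
  have ib: "integrable M (\<lambda>\<omega>. b (W 0 \<omega>))" by (rule integrable_square_imp[OF _ b2]) measurable
  define h where "h I i w = (if i \<in> I then a w - b w else b w)" for I and i :: nat and w
  have h[measurable]: "h I i \<in> borel_measurable borel" for I i unfolding h_def by measurable
  have Qh: "Q I \<omega> = (\<Prod>i\<in>J. h I i (W i \<omega>))" for I \<omega> unfolding Q_def h_def by (rule prod.cong) auto
  have ih: "integrable M (\<lambda>\<omega>. h I i (W 0 \<omega>))" for I i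
    unfolding h_def using ia ib by (cases "i \<in> I") auto
  have iQ: "integrable M (Q I)" for I
    unfolding Qh by (rule prod_W(1)[OF fin h ih])
  have mQ: "Q I \<in> borel_measurable (sigma_upto M n W)" for I
    unfolding Qh using J by (intro borel_measurable_prod h_W_sigma_upto h) auto
  show "integrable M (\<lambda>\<omega>. Q I \<omega> * w I \<omega>)" if "I \<subseteq> J" for I
    unfolding w_def by (rule integral_prod_D(4)[OF _ mQ iQ]) (use that J in auto)
  have "(\<Prod>i\<in>J. arm a b n i \<omega>) = (\<Sum>I\<in>Pow J. Q I \<omega> * (\<Prod>i\<in>I. D n i \<omega>))" for \<omega>
  proof -
    have "(\<Prod>i\<in>J. arm a b n i \<omega>) = (\<Prod>i\<in>J. D n i \<omega> * (a (W i \<omega>) - b (W i \<omega>)) + b (W i \<omega>))"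
      by (intro prod.cong refl) (simp add: arm_def algebra_simps)
    also have "\<dots> = (\<Sum>I\<in>Pow J. (\<Prod>i\<in>I. D n i \<omega> * (a (W i \<omega>) - b (W i \<omega>))) * (\<Prod>i\<in>J - I. b (W i \<omega>)))"
      by (rule prod_add[OF fin])
    also have "\<dots> = (\<Sum>I\<in>Pow J. Q I \<omega> * (\<Prod>i\<in>I. D n i \<omega>))"
    proof (rule sum.cong[OF refl])
      fix I assume "I \<in> Pow J"
      then have I: "I \<subseteq> J" by simp
      have "Q I \<omega> = (\<Prod>i\<in>J - I. h I i (W i \<omega>)) * (\<Prod>i\<in>I. h I i (W i \<omega>))"
        unfolding Qh by (rule prod.subset_diff[OF I fin])
      also have "(\<Prod>i\<in>J - I. h I i (W i \<omega>)) = (\<Prod>i\<in>J - I. b (W i \<omega>))"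
        by (rule prod.cong) (auto simp: h_def)
      also have "(\<Prod>i\<in>I. h I i (W i \<omega>)) = (\<Prod>i\<in>I. a (W i \<omega>) - b (W i \<omega>))"
        by (rule prod.cong) (auto simp: h_def)
      finally show "(\<Prod>i\<in>I. D n i \<omega> * (a (W i \<omega>) - b (W i \<omega>))) * (\<Prod>i\<in>J - I. b (W i \<omega>)) = Q I \<omega> * (\<Prod>i\<in>I. D n i \<omega>)"
        by (simp add: prod.distrib)
    qed
    finally show ?thesis .
  qed
  then have "(\<integral>\<omega>. (\<Prod>i\<in>J. arm a b n i \<omega>) \<partial>M) = (\<integral>\<omega>. (\<Sum>I\<in>Pow J. Q I \<omega> * (\<Prod>i\<in>I. D n i \<omega>)) \<partial>M)" by simp
  also have "\<dots> = (\<Sum>I\<in>Pow J. \<integral>\<omega>. Q I \<omega> * (\<Prod>i\<in>I. D n i \<omega>) \<partial>M)"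
    by (rule Bochner_Integration.integral_sum) (rule integral_prod_D(3)[OF _ mQ iQ], use J in auto)
  also have "\<dots> = (\<Sum>I\<in>Pow J. \<integral>\<omega>. Q I \<omega> * w I \<omega> \<partial>M)"
    unfolding w_def by (intro sum.cong refl integral_prod_D(1)[OF _ mQ iQ]) (use J in auto)
  finally show "(\<integral>\<omega>. (\<Prod>i\<in>J. arm a b n i \<omega>) \<partial>M) = (\<Sum>I\<in>Pow J. \<integral>\<omega>. Q I \<omega> * w I \<omega> \<partial>M)" .
qed

text \<open>When both arms have the same conditional mean given the covariates, the assignment drops out of
  the mixed moments, whatever the dependence between the assignments of different units.\<close>

lemma orthogonal_arm_residual:
  fixes a b :: "real \<times> real \<times> 'b \<Rightarrow> real"
  assumes a[measurable]: "a \<in> borel_measurable borel" and b[measurable]: "b \<in> borel_measurable borel"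
    and a2: "integrable M (\<lambda>\<omega>. (a (W 0 \<omega>))\<^sup>2)" and b2: "integrable M (\<lambda>\<omega>. (b (W 0 \<omega>))\<^sup>2)"
    and ab: "\<And>A. A \<in> sets borel \<Longrightarrow> (\<integral>\<omega>. indicator A (X 0 \<omega>) * (a (W 0 \<omega>) - b (W 0 \<omega>)) \<partial>M) = 0"
    and b0: "(\<integral>\<omega>. b (W 0 \<omega>) \<partial>M) = 0"
    and J: "J \<subseteq> {..<n}" "J \<noteq> {}"
  shows "(\<integral>\<omega>. (\<Prod>i\<in>J. arm a b n i \<omega>) \<partial>M) = 0"
proof -
  have fin: "finite J" using J finite_subset by auto
  have ia: "integrable M (\<lambda>\<omega>. a (W 0 \<omega>))" by (rule integrable_square_imp[OF _ a2]) measurable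
  have ib: "integrable M (\<lambda>\<omega>. b (W 0 \<omega>))" by (rule integrable_square_imp[OF _ b2]) measurable
  let ?w = "\<lambda>I. real_cond_exp M (sigma_upto M n X) (\<lambda>\<omega>. \<Prod>i\<in>I. D n i \<omega>)"
  let ?f = "\<lambda>I i w. if i \<in> I then a w - b w else b w"
  note P = integral_prod_arm[OF a b a2 b2 J(1)]
  \<comment> \<open>For empty I the term is a product of means of b. Otherwise some j in I carries
    the factor a - b, which has conditional mean zero given everything else.\<close>
  have zero: "(\<integral>\<omega>. (\<Prod>i\<in>J. ?f I i (W i \<omega>)) * ?w I \<omega> \<partial>M) = 0" if I: "I \<subseteq> J" for I
  proof (cases "I = {}")
    case True
    interpret FX: finite_measure_subalgebra M "sigma_upto M n X" by (rule finite_measure_subalgebra_X)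
    have w1: "AE \<omega> in M. ?w {} \<omega> = 1"
      using FX.real_cond_exp_F_meas[of "\<lambda>_. 1 :: real"] by simp
    have "(\<integral>\<omega>. (\<Prod>i\<in>J. ?f I i (W i \<omega>)) * ?w I \<omega> \<partial>M) = (\<integral>\<omega>. (\<Prod>i\<in>J. b (W i \<omega>)) \<partial>M)"
    proof (rule integral_cong_AE)
      show "AE \<omega> in M. (\<Prod>i\<in>J. ?f I i (W i \<omega>)) * ?w I \<omega> = (\<Prod>i\<in>J. b (W i \<omega>))"
        unfolding True using w1 by eventually_elim simp
    qed measurable
    also have "\<dots> = (\<Prod>i\<in>J. \<integral>\<omega>. b (W 0 \<omega>) \<partial>M)" by (rule prod_W(2)[OF fin b ib])
    also have "\<dots> = 0" using b0 J(2) fin by (simp add: card_gt_0_iff)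
    finally show ?thesis .
  next
    case False
    then obtain j where j: "j \<in> I" by auto
    then have jn: "j < n" "j \<in> J" using I J by auto
    \<comment> \<open>All remaining factors: those of other units are unaffected by masking j, and
      \<open>w I\<close> depends on the covariates only, which masking keeps. The actual dependence
      between assignments sits inside \<open>w I\<close> and never has to be known.\<close>
    let ?R = "\<lambda>\<omega>. (\<Prod>i\<in>J - {j}. ?f I i (W i \<omega>)) * ?w I \<omega>"
    have eq: "(\<Prod>i\<in>J. ?f I i (W i \<omega>)) * ?w I \<omega> = ?R \<omega> * (a (W j \<omega>) - b (W j \<omega>))" for \<omega>
      using j by (subst prod.remove[OF fin jn(2)]) simp
    have "(\<integral>\<omega>. ?R \<omega> * (a (W j \<omega>) - b (W j \<omega>)) \<partial>M) = 0"
    proof (rule integral_masked_zero[where a = "\<lambda>w. a w - b w", OF _ _ ab jn(1)])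
      show "integrable M (\<lambda>\<omega>. ?R \<omega> * (a (W j \<omega>) - b (W j \<omega>)))"
        using P(2)[OF I] unfolding eq .
      have X: "X i \<in> borel_measurable (sigma_upto M n (masked j))" if "i < n" for i
      proof -
        have "(\<lambda>\<omega>. snd (snd (masked j i \<omega>))) \<in> borel_measurable (sigma_upto M n (masked j))"
          by (rule measurable_compose[OF measurable_sigma_upto[OF that] measurable_covariate])
        also have "(\<lambda>\<omega>. snd (snd (masked j i \<omega>))) = X i" by (auto simp: masked_def X_def)
        finally show ?thesis .
      qed
      have w: "?w I \<in> borel_measurable (sigma_upto M n (masked j))"
        by (rule measurable_sigma_upto_subset[OF X]) auto
      have "(\<lambda>\<omega>. ?f I i (W i \<omega>)) \<in> borel_measurable (sigma_upto M n (masked j))" if "i \<in> J - {j}" for i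
      proof -
        have "(\<lambda>\<omega>. ?f I i (masked j i \<omega>)) \<in> borel_measurable (sigma_upto M n (masked j))"
          by (rule measurable_compose[OF measurable_sigma_upto]) (use that J in auto)
        moreover have "masked j i = W i" using that by (auto simp: masked_def)
        ultimately show ?thesis by (simp only:)
      qed
      then show "?R \<in> borel_measurable (sigma_upto M n (masked j))"
        by (intro borel_measurable_times borel_measurable_prod w)
    qed (use ia ib in auto)
    then show ?thesis unfolding eq .
  qed
  have zero': "(\<integral>\<omega>. (\<Prod>i\<in>J. if i \<in> I then a (W i \<omega>) - b (W i \<omega>) else b (W i \<omega>)) * ?w I \<omega> \<partial>M) = 0"
    if "I \<in> Pow J" for I
    using zero[of I] that by simp
  show ?thesis unfolding P(1) by (rule sum.neutral) (use zero' in blast)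
qed

text \<open>For independent assignments \<open>w I\<close> is the product of q over I, so each term
  splits into \<alpha> = E (q (a - b)) for units in I and \<gamma> = E b for the rest. Summing over
  I rebuilds a power of \<alpha> + \<gamma>, which is the vanishing mean of an arm.\<close>

lemma orthogonal_arm_independent:
  fixes a b :: "real \<times> real \<times> 'b \<Rightarrow> real"
  assumes a[measurable]: "a \<in> borel_measurable borel" and b[measurable]: "b \<in> borel_measurable borel"
    and a2: "integrable M (\<lambda>\<omega>. (a (W 0 \<omega>))\<^sup>2)" and b2: "integrable M (\<lambda>\<omega>. (b (W 0 \<omega>))\<^sup>2)"
    and ind: "\<And>n I. I \<subseteq> {..<n} \<Longrightarrow> AE \<omega> in M. real_cond_exp M (sigma_upto M n X) (\<lambda>\<omega>. \<Prod>i\<in>I. D n i \<omega>) \<omega> = (\<Prod>i\<in>I. q i \<omega>)"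
    and mean: "(\<integral>\<omega>. q 0 \<omega> * a (W 0 \<omega>) + (1 - q 0 \<omega>) * b (W 0 \<omega>) \<partial>M) = 0"
    and J: "J \<subseteq> {..<n}" "J \<noteq> {}"
  shows "(\<integral>\<omega>. (\<Prod>i\<in>J. arm a b n i \<omega>) \<partial>M) = 0"
proof -
  have fin: "finite J" using J finite_subset by auto
  have ia: "integrable M (\<lambda>\<omega>. a (W 0 \<omega>))" by (rule integrable_square_imp[OF _ a2]) measurable
  have ib: "integrable M (\<lambda>\<omega>. b (W 0 \<omega>))" by (rule integrable_square_imp[OF _ b2]) measurable
  let ?w = "\<lambda>I. real_cond_exp M (sigma_upto M n X) (\<lambda>\<omega>. \<Prod>i\<in>I. D n i \<omega>)"
  define g where "g I i w = (if i \<in> I then p (snd (snd w)) * (a w - b w) else b w)" for I and i :: nat and w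
  have g[measurable]: "g I i \<in> borel_measurable borel" for I i unfolding g_def by measurable
  have iab: "integrable M (\<lambda>\<omega>. p (snd (snd (W 0 \<omega>))) * (a (W 0 \<omega>) - b (W 0 \<omega>)))"
    using integrable_mult_q[of "\<lambda>\<omega>. a (W 0 \<omega>) - b (W 0 \<omega>)" 0] ia ib by (simp add: q_def mult.commute)
  have ig: "integrable M (\<lambda>\<omega>. g I i (W 0 \<omega>))" for I i
    unfolding g_def using ib iab by (cases "i \<in> I") auto
  define \<alpha> where "\<alpha> = (\<integral>\<omega>. p (snd (snd (W 0 \<omega>))) * (a (W 0 \<omega>) - b (W 0 \<omega>)) \<partial>M)"
  define \<gamma> where "\<gamma> = (\<integral>\<omega>. b (W 0 \<omega>) \<partial>M)"
  have "\<alpha> + \<gamma> = (\<integral>\<omega>. p (snd (snd (W 0 \<omega>))) * (a (W 0 \<omega>) - b (W 0 \<omega>)) + b (W 0 \<omega>) \<partial>M)"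
    unfolding \<alpha>_def \<gamma>_def using iab ib by simp
  also have "\<dots> = 0" unfolding mean[symmetric] by (rule Bochner_Integration.integral_cong) (auto simp: q_def algebra_simps)
  finally have sum0: "\<alpha> + \<gamma> = 0" .
  note P = integral_prod_arm[OF a b a2 b2 J(1)]
  have "(\<integral>\<omega>. (\<Prod>i\<in>J. arm a b n i \<omega>) \<partial>M) = (\<Sum>I\<in>Pow J. (\<Prod>i\<in>I. \<alpha>) * (\<Prod>i\<in>J - I. \<gamma>))"
    unfolding P(1)
  proof (rule sum.cong[OF refl])
    fix I assume "I \<in> Pow J"
    then have I: "I \<subseteq> J" "I \<subseteq> {..<n}" using J by auto
    have "(\<integral>\<omega>. (\<Prod>i\<in>J. if i \<in> I then a (W i \<omega>) - b (W i \<omega>) else b (W i \<omega>)) * ?w I \<omega> \<partial>M)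
      = (\<integral>\<omega>. (\<Prod>i\<in>J. g I i (W i \<omega>)) \<partial>M)"
    proof (rule integral_cong_AE)
      show "AE \<omega> in M. (\<Prod>i\<in>J. if i \<in> I then a (W i \<omega>) - b (W i \<omega>) else b (W i \<omega>)) * ?w I \<omega> = (\<Prod>i\<in>J. g I i (W i \<omega>))"
        using ind[OF I(2)]
      proof eventually_elim
        case (elim \<omega>)
        have "(\<Prod>i\<in>I. q i \<omega>) = (\<Prod>i\<in>J. if i \<in> I then q i \<omega> else 1)"
          using I(1) fin by (simp add: prod.If_cases Int_absorb1)
        then show ?case unfolding elim
          by (simp only: prod.distrib[symmetric]) (intro prod.cong refl, simp add: g_def q_def)
      qed
      show "(\<lambda>\<omega>. (\<Prod>i\<in>J. if i \<in> I then a (W i \<omega>) - b (W i \<omega>) else b (W i \<omega>)) * ?w I \<omega>) \<in> borel_measurable M"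
        by (rule borel_measurable_integrable[OF P(2)[OF I(1)]])
      show "(\<lambda>\<omega>. \<Prod>i\<in>J. g I i (W i \<omega>)) \<in> borel_measurable M"
        by (rule borel_measurable_integrable[OF prod_W(1)[OF fin g ig]])
    qed
    also have "\<dots> = (\<Prod>i\<in>J. \<integral>\<omega>. g I i (W 0 \<omega>) \<partial>M)" by (rule prod_W(2)[OF fin g ig])
    also have "\<dots> = (\<Prod>i\<in>J. if i \<in> I then \<alpha> else \<gamma>)"
      by (rule prod.cong) (auto simp: g_def \<alpha>_def \<gamma>_def)
    also have "\<dots> = (\<Prod>i\<in>I. \<alpha>) * (\<Prod>i\<in>J - I. \<gamma>)"
      using I(1) fin by (simp add: prod.If_cases Int_absorb1 Diff_eq)
    finally show "(\<integral>\<omega>. (\<Prod>i\<in>J. if i \<in> I then a (W i \<omega>) - b (W i \<omega>) else b (W i \<omega>)) * ?w I \<omega> \<partial>M)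
      = (\<Prod>i\<in>I. \<alpha>) * (\<Prod>i\<in>J - I. \<gamma>)" .
  qed
  also have "\<dots> = (\<Prod>i\<in>J. \<alpha> + \<gamma>)" by (rule prod_add[OF fin, symmetric])
  also have "\<dots> = 0" using sum0 J(2) fin by (simp add: card_gt_0_iff)
  finally show ?thesis .
qed

end

section \<open>Flight and landing phase of the cube method\<close>

text \<open>More vectors than the dimension are dependent. As this is a family and not a set, a
  repeated vector is treated apart, with coefficients 1 and -1 on two of its indices.\<close>

lemma exists_linear_relation:
  fixes v :: "'i \<Rightarrow> 'z::euclidean_space"
  assumes A: "finite A" "card A > DIM('z)"
  obtains u where "\<exists>i\<in>A. u i \<noteq> 0" "\<And>i. i \<notin> A \<Longrightarrow> u i = 0" "(\<Sum>i\<in>A. u i *\<^sub>R v i) = 0"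
proof (cases "inj_on v A")
  case True
  then have "dependent (v ` A)"
    using A by (intro dependent_biggerset) (simp add: card_image)
  then obtain f where f: "\<exists>x\<in>v ` A. f x \<noteq> 0" "(\<Sum>x\<in>v ` A. f x *\<^sub>R x) = 0"
    using A(1) by (auto simp: dependent_finite)
  have "(\<Sum>i\<in>A. (if i \<in> A then f (v i) else 0) *\<^sub>R v i) = (\<Sum>x\<in>v ` A. f x *\<^sub>R x)"
    using True by (simp add: sum.reindex)
  then show ?thesis using f by (intro that[of "\<lambda>i. if i \<in> A then f (v i) else 0"]) auto
next
  case False
  then obtain i j where ij: "i \<in> A" "j \<in> A" "i \<noteq> j" "v i = v j" by (auto simp: inj_on_def)
  define u where "u k = (if k = i then 1 else if k = j then - 1 else 0 :: real)" for k
  have "(\<Sum>k\<in>A. u k *\<^sub>R v k) = (\<Sum>k\<in>{i, j}. u k *\<^sub>R v k)"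
    using ij A(1) by (intro sum.mono_neutral_right) (auto simp: u_def)
  also have "\<dots> = 0" using ij by (simp add: u_def)
  finally show ?thesis using ij by (intro that[of u]) (auto simp: u_def)
qed

lemma cube_polytope_cong:
  assumes "\<And>i. i < n \<Longrightarrow> s i = s' i" "s \<in> cube_polytope n q Z"
  shows "s' \<in> cube_polytope n q Z"
proof -
  have "(\<Sum>i<n. (s' i / q i) *\<^sub>R Z i) = (\<Sum>i<n. (s i / q i) *\<^sub>R Z i)"
    by (intro sum.cong refl) (simp add: assms(1))
  then show ?thesis using assms by (auto simp: cube_polytope_def)
qed

lemma cube_vertex_cong:
  assumes "\<And>i. i < n \<Longrightarrow> s i = s' i" "cube_vertex n q Z s"
  shows "cube_vertex n q Z s'"
  using assms cube_polytope_cong[of n s s' q Z] by (auto simp: cube_vertex_def)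

lemma cube_polytope_move:
  fixes Z :: "nat \<Rightarrow> 'z::real_vector"
  assumes s: "s \<in> cube_polytope n q Z" and u: "(\<Sum>i<n. (u i / q i) *\<^sub>R Z i) = 0"
    and bd: "\<And>i. i < n \<Longrightarrow> 0 \<le> s i + r * u i \<and> s i + r * u i \<le> 1"
  shows "(\<lambda>i. s i + r * u i) \<in> cube_polytope n q Z"
proof -
  have "(\<Sum>i<n. ((s i + r * u i) / q i) *\<^sub>R Z i) = (\<Sum>i<n. (s i / q i) *\<^sub>R Z i) + r *\<^sub>R (\<Sum>i<n. (u i / q i) *\<^sub>R Z i)"
    by (simp add: add_divide_distrib scaleR_add_left sum.distrib scaleR_sum_right)
  then show ?thesis using s u bd by (auto simp: cube_polytope_def)
qed

text \<open>Fractional coordinates have slack on both sides and the others do not move; as there are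
  finitely many, one step size fits all.\<close>

lemma small_move_in_unit:
  fixes s u :: "nat \<Rightarrow> real"
  assumes "\<And>i. i < n \<Longrightarrow> 0 \<le> s i \<and> s i \<le> 1" "\<And>i. i < n \<Longrightarrow> s i \<in> {0, 1} \<Longrightarrow> u i = 0"
  obtains e where "e > 0" "\<And>i r. i < n \<Longrightarrow> \<bar>r\<bar> \<le> e \<Longrightarrow> 0 \<le> s i + r * u i \<and> s i + r * u i \<le> 1"
proof -
  have "\<exists>e>0. \<forall>i<n. \<forall>r. \<bar>r\<bar> \<le> e \<longrightarrow> 0 \<le> s i + r * u i \<and> s i + r * u i \<le> 1"
    using assms
  proof (induction n)
    case (Suc n)
    have "\<exists>e>0. \<forall>i<n. \<forall>r. \<bar>r\<bar> \<le> e \<longrightarrow> 0 \<le> s i + r * u i \<and> s i + r * u i \<le> 1"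
      by (rule Suc.IH) (simp_all add: Suc.prems)
    then obtain e where e: "e > 0" "\<And>i r. i < n \<Longrightarrow> \<bar>r\<bar> \<le> e \<Longrightarrow> 0 \<le> s i + r * u i \<and> s i + r * u i \<le> 1"
      by blast
    obtain e' where e': "e' > 0" "\<And>r. \<bar>r\<bar> \<le> e' \<Longrightarrow> 0 \<le> s n + r * u n \<and> s n + r * u n \<le> 1"
    proof (cases "u n = 0")
      case True
      then show ?thesis using Suc.prems(1)[of n] by (intro that[of 1]) auto
    next
      case False
      let ?m = "min (s n) (1 - s n)"
      have "s n \<noteq> 0" "s n \<noteq> 1" using Suc.prems(2)[of n] False by auto
      then have m: "0 < ?m" using Suc.prems(1)[of n] by (simp add: less_le)
      \<comment> \<open>Dividing the distance of \<open>s n\<close> to the nearer end of the unit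
        interval by the speed |u n| gives the admissible step.\<close>
      show ?thesis
      proof (rule that[of "?m / \<bar>u n\<bar>"])
        show "0 < ?m / \<bar>u n\<bar>" using m False by simp
        fix r assume "\<bar>r\<bar> \<le> ?m / \<bar>u n\<bar>"
        then have "\<bar>r * u n\<bar> \<le> ?m" using False by (simp add: field_simps abs_mult)
        then show "0 \<le> s n + r * u n \<and> s n + r * u n \<le> 1" by (auto simp: abs_le_iff)
      qed
    qed
    show ?case
      using e e' by (intro exI[of _ "min e e'"]) (auto simp: less_Suc_eq)
  qed (auto intro: exI[of _ 1])
  then show ?thesis using that by blast
qed

text \<open>With more fractional coordinates than balancing components, a non-zero direction
  supported on them keeps the balance. Small moves both ways stay in the polytope and have the point
  as midpoint, so it is not a vertex. Collinear components only make the bound larger than the true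
  rank.\<close>

lemma cube_vertex_fractional:
  fixes Z :: "nat \<Rightarrow> 'z::euclidean_space"
  assumes v: "cube_vertex n q Z s"
  shows "card {i. i < n \<and> s i \<notin> {0, 1}} \<le> DIM('z)"
proof (rule ccontr)
  let ?A = "{i. i < n \<and> s i \<notin> {0, 1}}"
  assume "\<not> card ?A \<le> DIM('z)"
  then obtain u where u: "\<exists>i\<in>?A. u i \<noteq> 0" "\<And>i. i \<notin> ?A \<Longrightarrow> u i = 0" "(\<Sum>i\<in>?A. u i *\<^sub>R ((1 / q i) *\<^sub>R Z i)) = 0"
    using exists_linear_relation[of ?A "\<lambda>i. (1 / q i) *\<^sub>R Z i"] by auto
  have s: "s \<in> cube_polytope n q Z" using v by (simp add: cube_vertex_def)
  have "(\<Sum>i<n. (u i / q i) *\<^sub>R Z i) = (\<Sum>i\<in>?A. u i *\<^sub>R ((1 / q i) *\<^sub>R Z i))"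
    using u(2) by (intro sum.mono_neutral_cong_right) auto
  then have bal: "(\<Sum>i<n. (u i / q i) *\<^sub>R Z i) = 0" using u(3) by simp
  have "0 \<le> s i \<and> s i \<le> 1" if "i < n" for i using s that by (auto simp: cube_polytope_def)
  moreover have "u i = 0" if "i < n" "s i \<in> {0, 1}" for i using u(2) that by auto
  ultimately obtain e where e: "e > 0" "\<And>i r. i < n \<Longrightarrow> \<bar>r\<bar> \<le> e \<Longrightarrow> 0 \<le> s i + r * u i \<and> s i + r * u i \<le> 1"
    using small_move_in_unit[of n s u] by blast
  have "(\<lambda>i. s i + e * u i) \<in> cube_polytope n q Z" "(\<lambda>i. s i + (- e) * u i) \<in> cube_polytope n q Z"
    by (rule cube_polytope_move[OF s bal e(2)]; use e(1) in simp)+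
  moreover have "(\<exists>i<n. s i + e * u i \<noteq> s i + (- e) * u i) \<and> (\<forall>i<n. s i = ((s i + e * u i) + (s i + (- e) * u i)) / 2)"
    using u(1) e(1) by auto
  ultimately have "\<exists>a\<in>cube_polytope n q Z. \<exists>b\<in>cube_polytope n q Z. (\<exists>i<n. a i \<noteq> b i) \<and> (\<forall>i<n. s i = (a i + b i) / 2)"
    by (intro bexI[of _ "\<lambda>i. s i + e * u i"] bexI[of _ "\<lambda>i. s i + (- e) * u i"])
  then show False using v unfolding cube_vertex_def by (elim conjE notE)
qed

text \<open>0 and 1 are extreme points of the unit interval, so a binary point is the midpoint of no
  two different points of the cube.\<close>

lemma cube_vertex_binary:
  assumes s: "s \<in> cube_polytope n q Z" and b: "\<And>i. i < n \<Longrightarrow> s i \<in> {0, 1}"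
  shows "cube_vertex n q Z s"
  unfolding cube_vertex_def
proof (intro conjI s notI)
  assume "\<exists>a\<in>cube_polytope n q Z. \<exists>b\<in>cube_polytope n q Z. (\<exists>i<n. a i \<noteq> b i) \<and> (\<forall>i<n. s i = (a i + b i) / 2)"
  then obtain a a' i where a: "a \<in> cube_polytope n q Z" "a' \<in> cube_polytope n q Z" "i < n" "a i \<noteq> a' i" "s i = (a i + a' i) / 2"
    by blast
  have "0 \<le> a i" "a i \<le> 1" "0 \<le> a' i" "a' i \<le> 1" using a by (auto simp: cube_polytope_def)
  then show False using b[OF a(3)] a(4,5) by auto
qed

text \<open>The step is maximal: if no further coordinate had become 0 or 1, every moving coordinate
  would still have slack and the move could be prolonged. Coordinates that are already 0 or 1 stay
  fixed, so the count of fractional ones drops.\<close>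

lemma flight_step_new_integer:
  fixes Z :: "nat \<Rightarrow> 'z::real_vector"
  assumes s: "s \<in> cube_polytope n q Z" and step: "flight_step n q Z s s'" and nv: "\<not> cube_vertex n q Z s"
  shows "s' \<in> cube_polytope n q Z"
    and "card {i. i < n \<and> s' i \<notin> {0, 1}} < card {i. i < n \<and> s i \<notin> {0, 1}}"
proof -
  obtain u r where u: "u \<in> flight_directions n q Z s" and r: "r > 0"
      "(\<lambda>i. s i + r * u i) \<in> cube_polytope n q Z"
      "\<And>r'. r' > r \<Longrightarrow> (\<lambda>i. s i + r' * u i) \<notin> cube_polytope n q Z"
      "\<And>i. i < n \<Longrightarrow> s' i = s i + r * u i"
    using step nv unfolding flight_step_def by auto
  have u': "(\<Sum>i<n. (u i / q i) *\<^sub>R Z i) = 0" "\<And>i. i < n \<Longrightarrow> s i \<in> {0, 1} \<Longrightarrow> u i = 0"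
    using u by (auto simp: flight_directions_def)
  show s': "s' \<in> cube_polytope n q Z"
    by (rule cube_polytope_cong[OF _ r(2)]) (simp add: r(4))
  have "\<exists>i<n. s i \<notin> {0, 1} \<and> s' i \<in> {0, 1}"
  proof (rule ccontr)
    assume neg: "\<not> (\<exists>i<n. s i \<notin> {0, 1} \<and> s' i \<in> {0, 1})"
    obtain e where e: "e > 0" "\<And>i r. i < n \<Longrightarrow> \<bar>r\<bar> \<le> e \<Longrightarrow> 0 \<le> s' i + r * u i \<and> s' i + r * u i \<le> 1"
    proof -
      have "0 \<le> s' i \<and> s' i \<le> 1" if "i < n" for i using s' that by (auto simp: cube_polytope_def)
      moreover have "u i = 0" if "i < n" "s' i \<in> {0, 1}" for i using neg that u'(2) by auto
      ultimately show ?thesis using small_move_in_unit[of n s' u] that by blast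
    qed
    have "(\<lambda>i. s i + (r + e) * u i) \<in> cube_polytope n q Z"
      using e(2)[of _ e] e(1) r(4) by (intro cube_polytope_move[OF s u'(1)]) (auto simp: algebra_simps)
    then show False using r(3)[of "r + e"] e(1) by auto
  qed
  then obtain k where k: "k < n" "s k \<notin> {0, 1}" "s' k \<in> {0, 1}" by blast
  have "{i. i < n \<and> s' i \<notin> {0, 1}} \<subset> {i. i < n \<and> s i \<notin> {0, 1}}"
  proof
    show "{i. i < n \<and> s' i \<notin> {0, 1}} \<subseteq> {i. i < n \<and> s i \<notin> {0, 1}}"
      using u'(2) r(4) by auto
    show "{i. i < n \<and> s' i \<notin> {0, 1}} \<noteq> {i. i < n \<and> s i \<notin> {0, 1}}" using k by blast
  qed
  then show "card {i. i < n \<and> s' i \<notin> {0, 1}} < card {i. i < n \<and> s i \<notin> {0, 1}}"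
    by (intro psubset_card_mono) auto
qed

text \<open>Invariant: the path is at a vertex, or the number of fractional coordinates plus the
  elapsed time is at most n. At time n the second alternative leaves a binary point, which is a
  vertex as well.\<close>

lemma flight_path_end:
  fixes Z :: "nat \<Rightarrow> 'z::real_vector"
  assumes q: "\<And>i. i < n \<Longrightarrow> 0 < q i \<and> q i \<le> 1" and s0: "\<And>i. i < n \<Longrightarrow> s 0 i = q i"
    and step: "\<And>t. flight_step n q Z (s t) (s (Suc t))"
  shows "cube_vertex n q Z (s n)"
proof -
  have "s t \<in> cube_polytope n q Z \<and>
      (cube_vertex n q Z (s t) \<or> card {i. i < n \<and> s t i \<notin> {0, 1}} + t \<le> n)" for t
  proof (induction t)
    case 0
    have "(\<Sum>i<n. (s 0 i / q i) *\<^sub>R Z i) = (\<Sum>i<n. Z i)"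
      by (intro sum.cong refl) (use s0 q in fastforce)
    then have "s 0 \<in> cube_polytope n q Z" using s0 q by (fastforce simp: cube_polytope_def)
    moreover have "card {i. i < n \<and> s 0 i \<notin> {0, 1}} \<le> card {..<n}" by (intro card_mono) auto
    ultimately show ?case by simp
  next
    case (Suc t)
    show ?case
    proof (cases "cube_vertex n q Z (s t)")
      case True
      then have "\<And>i. i < n \<Longrightarrow> s t i = s (Suc t) i" using step[of t] by (simp add: flight_step_def)
      then show ?thesis using cube_vertex_cong[OF _ True] by (auto simp: cube_vertex_def)
    next
      case False
      then show ?thesis using flight_step_new_integer[OF _ step[of t] False] Suc by auto
    qed
  qed
  from this[of n] show ?thesis
  proof (elim conjE disjE)
    assume s: "s n \<in> cube_polytope n q Z" and "card {i. i < n \<and> s n i \<notin> {0, 1}} + n \<le> n"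
    then have "{i. i < n \<and> s n i \<notin> {0, 1}} = {}" by simp
    then show ?thesis using cube_vertex_binary[OF s] by blast
  qed
qed

text \<open>The end of the flight phase lies in the polytope and is balanced exactly, so q may be
  replaced by it in the sum. Then only units decided in the landing phase remain; for them d differs
  from the end point by at most 1, and 1 / q is at most 1 / c.\<close>

lemma cube_balance_error:
  fixes Z :: "nat \<Rightarrow> 'z::euclidean_space"
  assumes q: "\<And>i. i < n \<Longrightarrow> c \<le> q i \<and> q i \<le> 1" and c: "c > 0" and s0: "\<And>i. i < n \<Longrightarrow> s 0 i = q i"
    and step: "\<And>t. flight_step n q Z (s t) (s (Suc t))"
    and d: "\<And>i. i < n \<Longrightarrow> d i \<in> {0, 1}" "\<And>i. i < n \<Longrightarrow> s n i \<in> {0, 1} \<Longrightarrow> d i = s n i"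
  obtains A where "A \<subseteq> {..<n}" "card A \<le> DIM('z)"
    "\<bar>\<Sum>i<n. (d i - q i) * (Z i \<bullet> \<beta> / q i)\<bar> \<le> (\<Sum>i\<in>A. \<bar>Z i \<bullet> \<beta>\<bar> / c)"
proof -
  let ?A = "{i. i < n \<and> s n i \<notin> {0, 1}}"
  have q0: "0 < q i" if "i < n" for i using q[OF that] c by linarith
  have v: "cube_vertex n q Z (s n)"
    by (rule flight_path_end[OF _ s0 step]) (use q c in fastforce)
  then have sn: "s n \<in> cube_polytope n q Z" by (simp add: cube_vertex_def)
  have "(\<Sum>i<n. (q i / q i) *\<^sub>R Z i) = (\<Sum>i<n. (s n i / q i) *\<^sub>R Z i)"
  proof -
    have "(\<Sum>i<n. (q i / q i) *\<^sub>R Z i) = (\<Sum>i<n. Z i)"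
      by (intro sum.cong refl) (use q0 in fastforce)
    then show ?thesis using sn by (simp add: cube_polytope_def)
  qed
  then have "(\<Sum>i<n. (q i / q i) *\<^sub>R Z i) \<bullet> \<beta> = (\<Sum>i<n. (s n i / q i) *\<^sub>R Z i) \<bullet> \<beta>" by simp
  then have eq: "(\<Sum>i<n. q i * (Z i \<bullet> \<beta> / q i)) = (\<Sum>i<n. s n i * (Z i \<bullet> \<beta> / q i))"
    by (simp only: inner_sum_left inner_scaleR_left times_divide_eq_left times_divide_eq_right)
  have "(\<Sum>i<n. (d i - q i) * (Z i \<bullet> \<beta> / q i)) = (\<Sum>i<n. (d i - s n i) * (Z i \<bullet> \<beta> / q i))"
    unfolding left_diff_distrib sum_subtractf eq ..
  also have "\<dots> = (\<Sum>i\<in>?A. (d i - s n i) * (Z i \<bullet> \<beta> / q i))"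
    using d(2) by (intro sum.mono_neutral_right) auto
  finally have "\<bar>\<Sum>i<n. (d i - q i) * (Z i \<bullet> \<beta> / q i)\<bar> \<le> (\<Sum>i\<in>?A. \<bar>(d i - s n i) * (Z i \<bullet> \<beta> / q i)\<bar>)"
    by (simp only: sum_abs)
  also have "\<dots> \<le> (\<Sum>i\<in>?A. \<bar>Z i \<bullet> \<beta>\<bar> / c)"
  proof (rule sum_mono)
    fix i assume "i \<in> ?A"
    then have i: "i < n" by simp
    have "0 \<le> s n i" "s n i \<le> 1" using sn i by (auto simp: cube_polytope_def)
    then have "\<bar>d i - s n i\<bar> \<le> 1" using d(1)[OF i] by auto
    moreover have "\<bar>Z i \<bullet> \<beta> / q i\<bar> \<le> \<bar>Z i \<bullet> \<beta>\<bar> / c"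
      unfolding abs_divide using q[OF i] c by (intro divide_left_mono) auto
    ultimately have "\<bar>(d i - s n i) * (Z i \<bullet> \<beta> / q i)\<bar> \<le> 1 * (\<bar>Z i \<bullet> \<beta>\<bar> / c)"
      unfolding abs_mult by (intro mult_mono) auto
    then show "\<bar>(d i - s n i) * (Z i \<bullet> \<beta> / q i)\<bar> \<le> \<bar>Z i \<bullet> \<beta>\<bar> / c" by simp
  qed
  finally show ?thesis using cube_vertex_fractional[OF v] by (intro that[of ?A]) auto
qed

section \<open>The Horvitz-Thompson estimator\<close>

context asymptotic_design
begin

definition square_integrable :: "(real \<times> real \<times> 'b \<Rightarrow> real) \<Rightarrow> bool" where
  "square_integrable f \<longleftrightarrow> f \<in> borel_measurable borel \<and> integrable M (\<lambda>\<omega>. (f (W 0 \<omega>))\<^sup>2)"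

lemma square_integrableD:
  assumes "square_integrable f"
  shows "f \<in> borel_measurable borel" "integrable M (\<lambda>\<omega>. (f (W 0 \<omega>))\<^sup>2)" "integrable M (\<lambda>\<omega>. f (W 0 \<omega>))"
proof -
  show *: "f \<in> borel_measurable borel" "integrable M (\<lambda>\<omega>. (f (W 0 \<omega>))\<^sup>2)"
    using assms by (auto simp: square_integrable_def)
  show "integrable M (\<lambda>\<omega>. f (W 0 \<omega>))"
    by (rule integrable_square_imp[OF _ *(2)])
       (rule measurable_compose[OF W_measurable *(1)])
qed

lemma square_integrable_bound:
  assumes f: "f \<in> borel_measurable borel" and g: "square_integrable g"
    and le: "AE \<omega> in M. \<bar>f (W 0 \<omega>)\<bar> \<le> K * \<bar>g (W 0 \<omega>)\<bar>"
  shows "square_integrable f"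
  unfolding square_integrable_def
proof (intro conjI f Bochner_Integration.integrable_bound[OF integrable_mult_right[OF square_integrableD(2)[OF g], of "K\<^sup>2"]])
  show "(\<lambda>\<omega>. (f (W 0 \<omega>))\<^sup>2) \<in> borel_measurable M"
    by (intro borel_measurable_power measurable_compose[OF W_measurable f])
  show "AE \<omega> in M. norm ((f (W 0 \<omega>))\<^sup>2) \<le> norm (K\<^sup>2 * (g (W 0 \<omega>))\<^sup>2)"
    using le
  proof eventually_elim
    case (elim \<omega>)
    from power_mono[OF elim, of 2] show ?case by (simp add: power_mult_distrib)
  qed
qed

lemma square_integrable_add:
  assumes f: "square_integrable f" and g: "square_integrable g"
  shows "square_integrable (\<lambda>w. f w + g w)"
  unfolding square_integrable_def
proof
  note fm = square_integrableD(1)[OF f] and gm = square_integrableD(1)[OF g]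
  show "(\<lambda>w. f w + g w) \<in> borel_measurable borel" using fm gm by simp
  show "integrable M (\<lambda>\<omega>. (f (W 0 \<omega>) + g (W 0 \<omega>))\<^sup>2)"
  proof (rule Bochner_Integration.integrable_bound)
    show "integrable M (\<lambda>\<omega>. 2 * (f (W 0 \<omega>))\<^sup>2 + 2 * (g (W 0 \<omega>))\<^sup>2)"
      using square_integrableD(2)[OF f] square_integrableD(2)[OF g] by simp
    show "(\<lambda>\<omega>. (f (W 0 \<omega>) + g (W 0 \<omega>))\<^sup>2) \<in> borel_measurable M"
      using measurable_compose[OF W_measurable fm] measurable_compose[OF W_measurable gm] by simp
    have "(x + y)\<^sup>2 \<le> 2 * x\<^sup>2 + 2 * y\<^sup>2" for x y :: real
      using sum_squares_bound[of x y] by (simp add: power2_sum)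
    then show "AE \<omega> in M. norm ((f (W 0 \<omega>) + g (W 0 \<omega>))\<^sup>2) \<le> norm (2 * (f (W 0 \<omega>))\<^sup>2 + 2 * (g (W 0 \<omega>))\<^sup>2)"
      by (auto simp: abs_of_nonneg add_nonneg_nonneg)
  qed
qed

lemma square_integrable_const: "square_integrable (\<lambda>_. k)"
  by (simp add: square_integrable_def)

lemma square_integrable_cmult: "square_integrable f \<Longrightarrow> square_integrable (\<lambda>w. k * f w)"
  by (rule square_integrable_bound[where K = "\<bar>k\<bar>"]) (auto dest: square_integrableD simp: abs_mult)

lemma square_integrable_diff:
  assumes "square_integrable f" "square_integrable g"
  shows "square_integrable (\<lambda>w. f w - g w)"
  using square_integrable_add[OF assms(1) square_integrable_cmult[OF assms(2), of "- 1"]] by simp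

abbreviation pr :: "real \<times> real \<times> 'b \<Rightarrow> real" where
  "pr w \<equiv> p (snd (snd w))"

lemma pr_bounds: "AE \<omega> in M. c \<le> pr (W i \<omega>) \<and> pr (W i \<omega>) \<le> 1 - c"
  using overlap[of i] by (simp add: q_def)

text \<open>By overlap the weights are at most 1 and their inverses at most 1 / c, almost
  everywhere.\<close>

lemma square_integrable_mult_pr:
  assumes f: "square_integrable f"
  shows "square_integrable (\<lambda>w. pr w * f w)" "square_integrable (\<lambda>w. (1 - pr w) * f w)"
    "square_integrable (\<lambda>w. f w / pr w)" "square_integrable (\<lambda>w. f w / (1 - pr w))"
proof -
  have bd: "\<bar>x * y\<bar> \<le> 1 * \<bar>y\<bar>" if "\<bar>x\<bar> \<le> 1" for x y :: real
    unfolding abs_mult using that by (intro mult_right_mono) auto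
  have bd2: "\<bar>y / x\<bar> \<le> 1 / c * \<bar>y\<bar>" if "c \<le> x" for x y :: real
    using c_pos that by (simp add: abs_divide divide_left_mono)
  note fm = square_integrableD(1)[OF f]
  note pm = measurable_p_covariate and pm' = borel_measurable_diff[OF borel_measurable_const measurable_p_covariate]
  show "square_integrable (\<lambda>w. pr w * f w)"
  proof (rule square_integrable_bound[OF borel_measurable_times[OF pm fm] f, where K = 1])
    show "AE \<omega> in M. \<bar>pr (W 0 \<omega>) * f (W 0 \<omega>)\<bar> \<le> 1 * \<bar>f (W 0 \<omega>)\<bar>"
      using pr_bounds[of 0] by eventually_elim (use c_pos in \<open>intro bd, auto\<close>)
  qed
  show "square_integrable (\<lambda>w. (1 - pr w) * f w)"
  proof (rule square_integrable_bound[OF borel_measurable_times[OF pm' fm] f, where K = 1])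
    show "AE \<omega> in M. \<bar>(1 - pr (W 0 \<omega>)) * f (W 0 \<omega>)\<bar> \<le> 1 * \<bar>f (W 0 \<omega>)\<bar>"
      using pr_bounds[of 0] by eventually_elim (use c_pos in \<open>intro bd, auto\<close>)
  qed
  show "square_integrable (\<lambda>w. f w / pr w)"
  proof (rule square_integrable_bound[OF borel_measurable_divide[OF fm pm] f, where K = "1 / c"])
    show "AE \<omega> in M. \<bar>f (W 0 \<omega>) / pr (W 0 \<omega>)\<bar> \<le> 1 / c * \<bar>f (W 0 \<omega>)\<bar>"
      using pr_bounds[of 0] by eventually_elim (intro bd2, auto)
  qed
  show "square_integrable (\<lambda>w. f w / (1 - pr w))"
  proof (rule square_integrable_bound[OF borel_measurable_divide[OF fm pm'] f, where K = "1 / c"])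
    show "AE \<omega> in M. \<bar>f (W 0 \<omega>) / (1 - pr (W 0 \<omega>))\<bar> \<le> 1 / c * \<bar>f (W 0 \<omega>)\<bar>"
      using pr_bounds[of 0] by eventually_elim (intro bd2, auto)
  qed
qed

text \<open>A convenient sufficient form of tightness: boundedness in L2 up to a sequence that
  vanishes in probability. The estimators need not themselves have uniformly bounded second moments,
  but their arm representations do.\<close>

definition tight_statistic :: "(nat \<Rightarrow> 'a \<Rightarrow> real) \<Rightarrow> bool" where
  "tight_statistic T \<longleftrightarrow> (\<forall>n. T n \<in> borel_measurable M) \<and> (\<exists>S C. (\<forall>n. S n \<in> borel_measurable M) \<and>
     (\<forall>n. integrable M (\<lambda>\<omega>. (S n \<omega>)\<^sup>2)) \<and> (\<forall>n. (\<integral>\<omega>. (S n \<omega>)\<^sup>2 \<partial>M) \<le> C) \<and>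
     null_in_prob M (\<lambda>n \<omega>. T n \<omega> - S n \<omega>))"

lemma tight_statistic_mult_null:
  assumes T: "tight_statistic T" and R: "\<And>n. R n \<in> borel_measurable M" "null_in_prob M R"
  shows "null_in_prob M (\<lambda>n \<omega>. T n \<omega> * R n \<omega>)"
proof -
  obtain S C where S: "\<And>n. S n \<in> borel_measurable M" "\<And>n. integrable M (\<lambda>\<omega>. (S n \<omega>)\<^sup>2)"
    "\<And>n. (\<integral>\<omega>. (S n \<omega>)\<^sup>2 \<partial>M) \<le> C" "null_in_prob M (\<lambda>n \<omega>. T n \<omega> - S n \<omega>)" and Tm: "\<And>n. T n \<in> borel_measurable M"
    using T unfolding tight_statistic_def by blast
  have "null_in_prob M (\<lambda>n \<omega>. S n \<omega> * R n \<omega>)"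
    by (rule null_in_prob_mult_L2[OF R(1) S(1) R(2) S(2,3)])
  moreover have "null_in_prob M (\<lambda>n \<omega>. (T n \<omega> - S n \<omega>) * R n \<omega>)"
    using Tm S(1) R(1) by (intro null_in_prob_mult S(4) R(2)) auto
  ultimately have "null_in_prob M (\<lambda>n \<omega>. S n \<omega> * R n \<omega> + (T n \<omega> - S n \<omega>) * R n \<omega>)"
    using Tm S(1) R(1) by (intro null_in_prob_add) auto
  then show ?thesis by (simp add: algebra_simps)
qed

text \<open>Where no \<open>q i\<close> is \<open>0\<close> or \<open>1\<close> these are \<open>sqrt n\<close> times the errors of the Horvitz-Thompson estimator.\<close>

definition sample_error :: "(real \<times> real \<times> 'b \<Rightarrow> real) \<Rightarrow> (real \<times> real \<times> 'b \<Rightarrow> real) \<Rightarrow> nat \<Rightarrow> 'a \<Rightarrow> real" where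
  "sample_error y1 y0 n \<omega> = 1 / sqrt (real n) *
     (\<Sum>i<n. (D n i \<omega> - q i \<omega>) * (y1 (W i \<omega>) / q i \<omega> + y0 (W i \<omega>) / (1 - q i \<omega>)))"

definition population_error :: "(real \<times> real \<times> 'b \<Rightarrow> real) \<Rightarrow> (real \<times> real \<times> 'b \<Rightarrow> real) \<Rightarrow> nat \<Rightarrow> 'a \<Rightarrow> real" where
  "population_error y1 y0 n \<omega> = 1 / sqrt (real n) *
     (\<Sum>i<n. D n i \<omega> * y1 (W i \<omega>) / q i \<omega> - (1 - D n i \<omega>) * y0 (W i \<omega>) / (1 - q i \<omega>)
        - (\<integral>\<omega>. y1 (W 0 \<omega>) - y0 (W 0 \<omega>) \<partial>M))"

lemma error_measurable:
  assumes [measurable]: "y1 \<in> borel_measurable borel" "y0 \<in> borel_measurable borel"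
  shows "sample_error y1 y0 n \<in> borel_measurable M" "population_error y1 y0 n \<in> borel_measurable M"
proof -
  have *: "(\<lambda>\<omega>. (D n i \<omega> - q i \<omega>) * (y1 (W i \<omega>) / q i \<omega> + y0 (W i \<omega>) / (1 - q i \<omega>))) \<in> borel_measurable M"
    "(\<lambda>\<omega>. D n i \<omega> * y1 (W i \<omega>) / q i \<omega> - (1 - D n i \<omega>) * y0 (W i \<omega>) / (1 - q i \<omega>)
        - (\<integral>\<omega>. y1 (W 0 \<omega>) - y0 (W 0 \<omega>) \<partial>M)) \<in> borel_measurable M" if "i < n" for i
  proof -
    note [measurable] = D_measurable[OF that]
    show "(\<lambda>\<omega>. (D n i \<omega> - q i \<omega>) * (y1 (W i \<omega>) / q i \<omega> + y0 (W i \<omega>) / (1 - q i \<omega>))) \<in> borel_measurable M"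
      by measurable
    show "(\<lambda>\<omega>. D n i \<omega> * y1 (W i \<omega>) / q i \<omega> - (1 - D n i \<omega>) * y0 (W i \<omega>) / (1 - q i \<omega>)
        - (\<integral>\<omega>. y1 (W 0 \<omega>) - y0 (W 0 \<omega>) \<partial>M)) \<in> borel_measurable M" by measurable
  qed
  show "sample_error y1 y0 n \<in> borel_measurable M" unfolding sample_error_def
    by (intro borel_measurable_times borel_measurable_const borel_measurable_sum *) auto
  show "population_error y1 y0 n \<in> borel_measurable M" unfolding population_error_def
    by (intro borel_measurable_times borel_measurable_const borel_measurable_sum *) auto
qed

text \<open>A representation by orthogonal arms up to a null sequence yields both properties wanted
  of an error statistic, its limit law and its tightness.\<close>

lemma converges_from_arms:
  assumes a: "square_integrable a" and b: "square_integrable b"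
    and orth: "\<And>n J. J \<subseteq> {..<n} \<Longrightarrow> J \<noteq> {} \<Longrightarrow> (\<integral>\<omega>. (\<Prod>i\<in>J. arm a b n i \<omega>) \<partial>M) = 0"
    and T: "\<And>n. T n \<in> borel_measurable M"
    and null: "null_in_prob M (\<lambda>n \<omega>. T n \<omega> - 1 / sqrt (real n) * (\<Sum>i<n. arm a b n i \<omega>))"
  shows "converges_to_normal M T (\<integral>\<omega>. q 0 \<omega> * (a (W 0 \<omega>))\<^sup>2 + (1 - q 0 \<omega>) * (b (W 0 \<omega>))\<^sup>2 \<partial>M)"
    and "tight_statistic T"
proof -
  note a' = square_integrableD[OF a] and b' = square_integrableD[OF b]
  note ab = a'(1) b'(1) a'(2) b'(2)
  have Sm: "(\<lambda>\<omega>. 1 / sqrt (real n) * (\<Sum>i<n. arm a b n i \<omega>)) \<in> borel_measurable M" for n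
    using arm_measurable[OF ab] by (intro borel_measurable_times borel_measurable_sum) auto
  have v: "0 \<le> (\<integral>\<omega>. q 0 \<omega> * (a (W 0 \<omega>))\<^sup>2 + (1 - q 0 \<omega>) * (b (W 0 \<omega>))\<^sup>2 \<partial>M)"
  proof (rule integral_nonneg_AE)
    show "AE \<omega> in M. 0 \<le> q 0 \<omega> * (a (W 0 \<omega>))\<^sup>2 + (1 - q 0 \<omega>) * (b (W 0 \<omega>))\<^sup>2"
      using q_unit[of 0] by eventually_elim (auto intro!: add_nonneg_nonneg mult_nonneg_nonneg)
  qed
  show "converges_to_normal M T (\<integral>\<omega>. q 0 \<omega> * (a (W 0 \<omega>))\<^sup>2 + (1 - q 0 \<omega>) * (b (W 0 \<omega>))\<^sup>2 \<partial>M)"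
    by (rule converges_to_normal_cong[OF arm_clt[OF ab orth] v Sm T null])
  have pair: "(\<integral>\<omega>. arm a b n i \<omega> * arm a b n j \<omega> \<partial>M) = 0" if "i < n" "j < n" "i \<noteq> j" for n i j
    using orth[of "{i, j}" n] that by simp
  show "tight_statistic T"
    unfolding tight_statistic_def
    by (intro conjI allI T exI[of _ "\<lambda>n \<omega>. 1 / sqrt (real n) * (\<Sum>i<n. arm a b n i \<omega>)"]
        exI[of _ "\<integral>\<omega>. (a (W 0 \<omega>))\<^sup>2 + (b (W 0 \<omega>))\<^sup>2 \<partial>M"] Sm null arm_second_moment[OF ab pair])
qed

text \<open>Without balancing the linear parts stay in the arms. The sample error is a sum of (D -
  q) h, so its arms are (1 - q) h and - q h; the population error has the weighted outcomes less the
  mean effect m. In both cases an arm has mean zero once averaged over the assignment.\<close>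

lemma coin_toss_errors:
  assumes ind: "\<And>n I. I \<subseteq> {..<n} \<Longrightarrow> AE \<omega> in M. real_cond_exp M (sigma_upto M n X) (\<lambda>\<omega>. \<Prod>i\<in>I. D n i \<omega>) \<omega> = (\<Prod>i\<in>I. q i \<omega>)"
    and y1: "square_integrable y1" and y0: "square_integrable y0"
  defines "h \<equiv> \<lambda>w. y1 w / pr w + y0 w / (1 - pr w)"
    and "m \<equiv> \<integral>\<omega>. y1 (W 0 \<omega>) - y0 (W 0 \<omega>) \<partial>M"
  shows "converges_to_normal M (sample_error y1 y0)
      (\<integral>\<omega>. q 0 \<omega> * ((1 - q 0 \<omega>) * h (W 0 \<omega>))\<^sup>2 + (1 - q 0 \<omega>) * (q 0 \<omega> * h (W 0 \<omega>))\<^sup>2 \<partial>M)"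
    and "converges_to_normal M (population_error y1 y0)
      (\<integral>\<omega>. q 0 \<omega> * (y1 (W 0 \<omega>) / q 0 \<omega> - m)\<^sup>2 + (1 - q 0 \<omega>) * (y0 (W 0 \<omega>) / (1 - q 0 \<omega>) + m)\<^sup>2 \<partial>M)"
    and "tight_statistic (population_error y1 y0)"
proof -
  note ym = square_integrableD(1)[OF y1] square_integrableD(1)[OF y0]
  have h: "square_integrable h"
    unfolding h_def by (intro square_integrable_add square_integrable_mult_pr y1 y0)
  define a where "a w = (1 - pr w) * h w" for w
  define b where "b w = - 1 * (pr w * h w)" for w
  have a: "square_integrable a" unfolding a_def by (rule square_integrable_mult_pr(2)[OF h])
  have b: "square_integrable b" unfolding b_def
    by (rule square_integrable_cmult[OF square_integrable_mult_pr(1)[OF h]])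
  note ab = square_integrableD(1)[OF a] square_integrableD(1)[OF b] square_integrableD(2)[OF a] square_integrableD(2)[OF b]
  have mean: "(\<integral>\<omega>. q 0 \<omega> * a (W 0 \<omega>) + (1 - q 0 \<omega>) * b (W 0 \<omega>) \<partial>M) = 0"
    by (simp add: a_def b_def q_def algebra_simps)
  have eq: "sample_error y1 y0 n \<omega> - 1 / sqrt (real n) * (\<Sum>i<n. arm a b n i \<omega>) = 0" for n \<omega>
  proof -
    have "(\<Sum>i<n. (D n i \<omega> - q i \<omega>) * (y1 (W i \<omega>) / q i \<omega> + y0 (W i \<omega>) / (1 - q i \<omega>))) = (\<Sum>i<n. arm a b n i \<omega>)"
    proof (intro sum.cong refl)
      fix i
      have "arm a b n i \<omega> = (D n i \<omega> - q i \<omega>) * h (W i \<omega>)"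
        by (simp add: arm_def a_def b_def q_def algebra_simps)
      then show "(D n i \<omega> - q i \<omega>) * (y1 (W i \<omega>) / q i \<omega> + y0 (W i \<omega>) / (1 - q i \<omega>)) = arm a b n i \<omega>"
        by (simp add: h_def q_def)
    qed
    then show ?thesis by (simp add: sample_error_def)
  qed
  have null: "null_in_prob M (\<lambda>n \<omega>. sample_error y1 y0 n \<omega> - 1 / sqrt (real n) * (\<Sum>i<n. arm a b n i \<omega>))"
    unfolding eq by (simp add: null_in_prob_def)
  show "converges_to_normal M (sample_error y1 y0)
      (\<integral>\<omega>. q 0 \<omega> * ((1 - q 0 \<omega>) * h (W 0 \<omega>))\<^sup>2 + (1 - q 0 \<omega>) * (q 0 \<omega> * h (W 0 \<omega>))\<^sup>2 \<partial>M)"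
    using converges_from_arms(1)[OF a b orthogonal_arm_independent[OF ab ind mean] error_measurable(1)[OF ym] null]
    by (simp add: a_def b_def q_def)
next
  note ym = square_integrableD(1)[OF y1] square_integrableD(1)[OF y0]
  define a where "a w = y1 w / pr w - m" for w
  define b where "b w = - 1 * (y0 w / (1 - pr w)) - m" for w
  have a: "square_integrable a" unfolding a_def
    by (intro square_integrable_diff square_integrable_const square_integrable_mult_pr y1)
  have b: "square_integrable b" unfolding b_def
    by (intro square_integrable_diff square_integrable_const square_integrable_cmult square_integrable_mult_pr y0)
  note ab = square_integrableD(1)[OF a] square_integrableD(1)[OF b] square_integrableD(2)[OF a] square_integrableD(2)[OF b]
  have [measurable]: "y1 \<in> borel_measurable borel" "y0 \<in> borel_measurable borel" by (fact ym)+
  have "(\<integral>\<omega>. q 0 \<omega> * a (W 0 \<omega>) + (1 - q 0 \<omega>) * b (W 0 \<omega>) \<partial>M) = (\<integral>\<omega>. y1 (W 0 \<omega>) - y0 (W 0 \<omega>) - m \<partial>M)"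
  proof (rule integral_cong_AE)
    show "AE \<omega> in M. q 0 \<omega> * a (W 0 \<omega>) + (1 - q 0 \<omega>) * b (W 0 \<omega>) = y1 (W 0 \<omega>) - y0 (W 0 \<omega>) - m"
      using pr_bounds[of 0]
    proof eventually_elim
      case (elim \<omega>)
      then have "pr (W 0 \<omega>) \<noteq> 0" "1 - pr (W 0 \<omega>) \<noteq> 0" using c_pos by auto
      then show ?case by (simp add: a_def b_def q_def right_diff_distrib) (simp add: algebra_simps)
    qed
  qed (auto simp: a_def b_def)
  also have "\<dots> = 0"
    unfolding m_def using square_integrableD(3)[OF y1] square_integrableD(3)[OF y0] by (simp add: prob_space)
  finally have mean: "(\<integral>\<omega>. q 0 \<omega> * a (W 0 \<omega>) + (1 - q 0 \<omega>) * b (W 0 \<omega>) \<partial>M) = 0" .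
  have eq: "population_error y1 y0 n \<omega> - 1 / sqrt (real n) * (\<Sum>i<n. arm a b n i \<omega>) = 0" for n \<omega>
  proof -
    have "(\<Sum>i<n. D n i \<omega> * y1 (W i \<omega>) / q i \<omega> - (1 - D n i \<omega>) * y0 (W i \<omega>) / (1 - q i \<omega>) - m) = (\<Sum>i<n. arm a b n i \<omega>)"
      by (intro sum.cong refl) (simp add: arm_def a_def b_def q_def algebra_simps add_divide_distrib[symmetric] diff_divide_distrib[symmetric])
    then show ?thesis by (simp add: population_error_def m_def)
  qed
  have null: "null_in_prob M (\<lambda>n \<omega>. population_error y1 y0 n \<omega> - 1 / sqrt (real n) * (\<Sum>i<n. arm a b n i \<omega>))"
    unfolding eq by (simp add: null_in_prob_def)
  note conv = converges_from_arms[OF a b orthogonal_arm_independent[OF ab ind mean] error_measurable(2)[OF ym] null]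
  have "(- y0 (W 0 \<omega>) / (1 - q 0 \<omega>) - m)\<^sup>2 = (y0 (W 0 \<omega>) / (1 - q 0 \<omega>) + m)\<^sup>2" for \<omega>
    by (simp add: power2_eq_square algebra_simps)
  then show "converges_to_normal M (population_error y1 y0)
      (\<integral>\<omega>. q 0 \<omega> * (y1 (W 0 \<omega>) / q 0 \<omega> - m)\<^sup>2 + (1 - q 0 \<omega>) * (y0 (W 0 \<omega>) / (1 - q 0 \<omega>) + m)\<^sup>2 \<partial>M)"
    using conv(1) by (simp add: a_def b_def q_def)
  show "tight_statistic (population_error y1 y0)" by (rule conv(2))
qed

text \<open>At most a bounded number of units is assigned in the landing phase, and the balancing variables
  are square integrable, so their sum over these units is of smaller order than \<open>sqrt n\<close>.\<close>

lemma null_in_prob_few_units: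
  assumes f: "square_integrable f" and R[measurable]: "\<And>n. R n \<in> borel_measurable M"
    and le: "\<And>n. AE \<omega> in M. \<exists>A. A \<subseteq> {..<n} \<and> card A \<le> d \<and> \<bar>R n \<omega>\<bar> \<le> 1 / sqrt (real n) * (\<Sum>i\<in>A. \<bar>f (W i \<omega>)\<bar>)"
  shows "null_in_prob M R"
  unfolding null_in_prob_def
proof (rule tendsto_zero_eps[where C = "real d"])
  note [measurable] = square_integrableD(1)[OF f]
  \<comment> \<open>The part of f^2 above the threshold \<delta> sqrt n. Its mean tends to 0 by
    dominated convergence, as f is square integrable.\<close>
  define g where "g n \<delta> w = (if \<bar>f w\<bar> > \<delta> * sqrt (real n) then (f w)\<^sup>2 else 0)" for n :: nat and \<delta> w
  have gm[measurable]: "g n \<delta> \<in> borel_measurable borel" for n \<delta> unfolding g_def by measurable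
  have ig: "integrable M (\<lambda>\<omega>. g n \<delta> (W 0 \<omega>))" for n \<delta>
    by (rule Bochner_Integration.integrable_bound[OF square_integrableD(2)[OF f]]) (auto simp: g_def)
  have g0: "0 \<le> g n \<delta> w" for n \<delta> w by (simp add: g_def)
  show "0 \<le> (\<integral>\<omega>. min 1 \<bar>R n \<omega>\<bar> \<partial>M)" for n by (rule integral_nonneg_AE) auto
  show "(\<lambda>n. 1 / \<delta> * (\<integral>\<omega>. g n \<delta> (W 0 \<omega>) \<partial>M)) \<longlonglongrightarrow> 0" if \<delta>: "\<delta> > 0" for \<delta>
  proof -
    have "(\<lambda>n. \<integral>\<omega>. g n \<delta> (W 0 \<omega>) \<partial>M) \<longlonglongrightarrow> (\<integral>\<omega>. 0 \<partial>M)"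
    proof (rule integral_dominated_convergence[OF _ _ square_integrableD(2)[OF f]])
      show "AE \<omega> in M. (\<lambda>n. g n \<delta> (W 0 \<omega>)) \<longlonglongrightarrow> 0"
      proof (rule AE_I2, rule tendsto_eventually)
        fix \<omega>
        have "filterlim (\<lambda>n. sqrt (real n)) at_top sequentially"
          by (rule filterlim_compose[OF sqrt_at_top filterlim_real_sequentially])
        then have "\<forall>\<^sub>F n in sequentially. \<bar>f (W 0 \<omega>)\<bar> / \<delta> \<le> sqrt (real n)"
          by (auto simp: filterlim_at_top)
        then show "\<forall>\<^sub>F n in sequentially. g n \<delta> (W 0 \<omega>) = 0"
          by eventually_elim (use \<delta> in \<open>auto simp: g_def field_simps\<close>)
      qed
    qed (auto simp: g_def)
    from tendsto_mult_left[OF this, of "1 / \<delta>"] show ?thesis by simp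
  qed
  fix n and \<delta> :: real assume \<delta>: "0 < \<delta>" "\<delta> < 1"
  have ii: "integrable M (\<lambda>\<omega>. \<Sum>i<n. 1 / (\<delta> * real n) * g n \<delta> (W i \<omega>))"
    by (intro Bochner_Integration.integrable_sum integrable_mult_right integrable_W[OF gm ig])
  have "(\<integral>\<omega>. min 1 \<bar>R n \<omega>\<bar> \<partial>M) \<le> (\<integral>\<omega>. \<delta> * real d + (\<Sum>i<n. 1 / (\<delta> * real n) * g n \<delta> (W i \<omega>)) \<partial>M)"
  proof (rule integral_mono_AE)
    show "integrable M (\<lambda>\<omega>. min 1 \<bar>R n \<omega>\<bar>)" by (rule integrable_min_one) measurable
    show "integrable M (\<lambda>\<omega>. \<delta> * real d + (\<Sum>i<n. 1 / (\<delta> * real n) * g n \<delta> (W i \<omega>)))"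
      using ii by simp
    show "AE \<omega> in M. min 1 \<bar>R n \<omega>\<bar> \<le> \<delta> * real d + (\<Sum>i<n. 1 / (\<delta> * real n) * g n \<delta> (W i \<omega>))"
      using le[of n]
    proof eventually_elim
      case (elim \<omega>)
      then obtain A where A: "A \<subseteq> {..<n}" "card A \<le> d" "\<bar>R n \<omega>\<bar> \<le> 1 / sqrt (real n) * (\<Sum>i\<in>A. \<bar>f (W i \<omega>)\<bar>)" by blast
      have fin: "finite A" using A(1) finite_subset by auto
      \<comment> \<open>Below the threshold a term is at most \<delta>, above it at most f^2 /
        (\<delta> n). Over A the first parts add up to at most d \<delta>; the second parts may be
        summed over all n units, so the random choice of A disappears from the bound.\<close>
      have t: "1 / sqrt (real n) * \<bar>f w\<bar> \<le> \<delta> + 1 / (\<delta> * real n) * g n \<delta> w" if "n > 0" for w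
      proof (cases "\<bar>f w\<bar> > \<delta> * sqrt (real n)")
        case True
        have "1 / sqrt (real n) * \<bar>f w\<bar> = (\<delta> * sqrt (real n)) * \<bar>f w\<bar> / (\<delta> * real n)"
          using that \<delta> by (simp add: field_simps)
        also have "\<dots> \<le> \<bar>f w\<bar> * \<bar>f w\<bar> / (\<delta> * real n)"
          using True that \<delta> by (intro divide_right_mono mult_right_mono) auto
        also have "\<dots> = 1 / (\<delta> * real n) * g n \<delta> w" using True by (simp add: g_def power2_eq_square)
        finally show ?thesis using \<delta> by linarith
      next
        case False
        then have "1 / sqrt (real n) * \<bar>f w\<bar> \<le> \<delta>" using that by (simp add: field_simps)
        then show ?thesis using False by (simp add: g_def)
      qed
      have "min 1 \<bar>R n \<omega>\<bar> \<le> (\<Sum>i\<in>A. 1 / sqrt (real n) * \<bar>f (W i \<omega>)\<bar>)"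
        using A(3) by (simp add: sum_distrib_left)
      also have "\<dots> \<le> (\<Sum>i\<in>A. \<delta> + 1 / (\<delta> * real n) * g n \<delta> (W i \<omega>))"
        using A(1) by (intro sum_mono t) auto
      also have "\<dots> = real (card A) * \<delta> + (\<Sum>i\<in>A. 1 / (\<delta> * real n) * g n \<delta> (W i \<omega>))"
        by (simp add: sum.distrib)
      also have "\<dots> \<le> \<delta> * real d + (\<Sum>i<n. 1 / (\<delta> * real n) * g n \<delta> (W i \<omega>))"
      proof (rule add_mono)
        show "real (card A) * \<delta> \<le> \<delta> * real d" using A(2) \<delta> by (simp add: mult.commute)
        show "(\<Sum>i\<in>A. 1 / (\<delta> * real n) * g n \<delta> (W i \<omega>)) \<le> (\<Sum>i<n. 1 / (\<delta> * real n) * g n \<delta> (W i \<omega>))"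
          using A(1) \<delta> g0 by (intro sum_mono2) auto
      qed
      finally show ?case .
    qed
  qed
  also have "\<dots> = \<delta> * real d + (\<Sum>i<n. 1 / (\<delta> * real n) * (\<integral>\<omega>. g n \<delta> (W i \<omega>) \<partial>M))"
    using ii integrable_W[OF gm ig]
    by (subst Bochner_Integration.integral_add) (auto simp: prob_space Bochner_Integration.integral_sum)
  also have "(\<Sum>i<n. 1 / (\<delta> * real n) * (\<integral>\<omega>. g n \<delta> (W i \<omega>) \<partial>M)) = (\<Sum>i<n. 1 / (\<delta> * real n) * (\<integral>\<omega>. g n \<delta> (W 0 \<omega>) \<partial>M))"
    by (intro sum.cong refl arg_cong2[where f = "(*)"] integral_W gm)
  also have "\<delta> * real d + \<dots> \<le> \<delta> * real d + 1 / \<delta> * (\<integral>\<omega>. g n \<delta> (W 0 \<omega>) \<partial>M)"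
  proof -
    have "0 \<le> (\<integral>\<omega>. g n \<delta> (W 0 \<omega>) \<partial>M)" by (rule integral_nonneg_AE) (simp add: g0)
    then show ?thesis using \<delta> by (cases "n = 0") auto
  qed
  finally show "(\<integral>\<omega>. min 1 \<bar>R n \<omega>\<bar> \<partial>M) \<le> \<delta> * real d + 1 / \<delta> * (\<integral>\<omega>. g n \<delta> (W 0 \<omega>) \<partial>M)" .
qed auto

end

section \<open>Linear predictors, residuals and the variance formulas\<close>

context asymptotic_design
begin

definition fit1 :: "real \<times> real \<times> real \<times> 'b \<Rightarrow> real \<times> real \<times> 'b \<Rightarrow> real" where
  "fit1 \<beta> w = balance1 (pr w) (snd (snd w)) \<bullet> \<beta>"

definition fit0 :: "real \<times> real \<times> real \<times> 'b \<Rightarrow> real \<times> real \<times> 'b \<Rightarrow> real" where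
  "fit0 \<beta> w = balance0 (pr w) (snd (snd w)) \<bullet> \<beta>"

text \<open>This proportionality turns fit1 \<beta>1 / q + fit0 \<beta>0 / (1 - q) into fit1
  (\<beta>1 + \<beta>0) / q, the reason why the sum of the coefficients is all that balancing has to
  control.\<close>

lemma fit0_eq: "fit0 \<beta> w = (1 - pr w) * (fit1 \<beta> w / pr w)"
  by (simp add: fit0_def fit1_def balance0_def)

lemma fit1_add: "fit1 (\<beta> + \<gamma>) w = fit1 \<beta> w + fit1 \<gamma> w"
  by (simp add: fit1_def inner_add_right)

definition covariate_function :: "(real \<times> real \<times> 'b \<Rightarrow> real) \<Rightarrow> bool" where
  "covariate_function f \<longleftrightarrow> square_integrable f \<and> (\<exists>K\<in>borel_measurable borel. f = (\<lambda>w. K (snd (snd w))))"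

lemma covariate_function_const: "covariate_function (\<lambda>_. k)"
  unfolding covariate_function_def using square_integrable_const by (auto intro!: bexI[of _ "\<lambda>_. k"])

lemma covariate_function_add:
  assumes "covariate_function f" "covariate_function g"
  shows "covariate_function (\<lambda>w. f w + g w)"
proof -
  obtain K L where "K \<in> borel_measurable borel" "f = (\<lambda>w. K (snd (snd w)))" "L \<in> borel_measurable borel" "g = (\<lambda>w. L (snd (snd w)))"
    using assms by (auto simp: covariate_function_def)
  then show ?thesis using assms square_integrable_add[of f g]
    by (auto simp: covariate_function_def intro!: bexI[of _ "\<lambda>x. K x + L x"])
qed

lemma covariate_function_cmult:
  assumes "covariate_function f"
  shows "covariate_function (\<lambda>w. k * f w)"
proof -
  obtain K where "K \<in> borel_measurable borel" "f = (\<lambda>w. K (snd (snd w)))"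
    using assms by (auto simp: covariate_function_def)
  then show ?thesis using assms square_integrable_cmult[of f k]
    by (auto simp: covariate_function_def intro!: bexI[of _ "\<lambda>x. k * K x"])
qed

lemma covariate_function_diff:
  assumes "covariate_function f" "covariate_function g"
  shows "covariate_function (\<lambda>w. f w - g w)"
  using covariate_function_add[OF assms(1) covariate_function_cmult[OF assms(2), of "- 1"]] by simp

lemma covariate_function_mult_pr:
  assumes f: "covariate_function f"
  shows "covariate_function (\<lambda>w. pr w * f w)" "covariate_function (\<lambda>w. (1 - pr w) * f w)"
    "covariate_function (\<lambda>w. f w / pr w)" "covariate_function (\<lambda>w. f w / (1 - pr w))"
proof -
  obtain K where K: "K \<in> borel_measurable borel" "f = (\<lambda>w. K (snd (snd w)))"
    using f by (auto simp: covariate_function_def)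
  note [measurable] = K(1)
  have si: "square_integrable f" using f by (simp add: covariate_function_def)
  note S = square_integrable_mult_pr[OF si]
  have m: "(\<lambda>x. p x * K x) \<in> borel_measurable borel" "(\<lambda>x. (1 - p x) * K x) \<in> borel_measurable borel"
    "(\<lambda>x. K x / p x) \<in> borel_measurable borel" "(\<lambda>x. K x / (1 - p x)) \<in> borel_measurable borel"
    by measurable
  show "covariate_function (\<lambda>w. pr w * f w)"
    unfolding covariate_function_def using S(1) m(1) unfolding K(2) by (intro conjI bexI[of _ "\<lambda>x. p x * K x"]) auto
  show "covariate_function (\<lambda>w. (1 - pr w) * f w)"
    unfolding covariate_function_def using S(2) m(2) unfolding K(2) by (intro conjI bexI[of _ "\<lambda>x. (1 - p x) * K x"]) auto
  show "covariate_function (\<lambda>w. f w / pr w)"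
    unfolding covariate_function_def using S(3) m(3) unfolding K(2) by (intro conjI bexI[of _ "\<lambda>x. K x / p x"]) auto
  show "covariate_function (\<lambda>w. f w / (1 - pr w))"
    unfolding covariate_function_def using S(4) m(4) unfolding K(2) by (intro conjI bexI[of _ "\<lambda>x. K x / (1 - p x)"]) auto
qed

text \<open>Conditional mean zero given the covariate, stated as orthogonality to every function of
  it with an integrable product, so that later computations need no conditional
  expectations.\<close>

definition residual :: "(real \<times> real \<times> 'b \<Rightarrow> real) \<Rightarrow> bool" where
  "residual e \<longleftrightarrow> square_integrable e \<and> (\<forall>K\<in>borel_measurable borel.
     integrable M (\<lambda>\<omega>. K (X 0 \<omega>) * e (W 0 \<omega>)) \<longrightarrow> (\<integral>\<omega>. K (X 0 \<omega>) * e (W 0 \<omega>) \<partial>M) = 0)"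

lemma integrable_mult_square_integrable:
  assumes f: "square_integrable f" and g: "square_integrable g"
  shows "integrable M (\<lambda>\<omega>. f (W 0 \<omega>) * g (W 0 \<omega>))"
proof (rule Bochner_Integration.integrable_bound)
  show "integrable M (\<lambda>\<omega>. (f (W 0 \<omega>))\<^sup>2 + (g (W 0 \<omega>))\<^sup>2)"
    using square_integrableD(2)[OF f] square_integrableD(2)[OF g] by simp
  show "(\<lambda>\<omega>. f (W 0 \<omega>) * g (W 0 \<omega>)) \<in> borel_measurable M"
    using measurable_compose[OF W_measurable square_integrableD(1)[OF f]]
      measurable_compose[OF W_measurable square_integrableD(1)[OF g]] by simp
  have "\<bar>x * y\<bar> \<le> x\<^sup>2 + y\<^sup>2" for x y :: real
  proof -
    have "2 * (\<bar>x\<bar> * \<bar>y\<bar>) \<le> x\<^sup>2 + y\<^sup>2" using sum_squares_bound[of "\<bar>x\<bar>" "\<bar>y\<bar>"] by simp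
    moreover have "0 \<le> \<bar>x\<bar> * \<bar>y\<bar>" by simp
    ultimately show ?thesis unfolding abs_mult by linarith
  qed
  then show "AE \<omega> in M. norm (f (W 0 \<omega>) * g (W 0 \<omega>)) \<le> norm ((f (W 0 \<omega>))\<^sup>2 + (g (W 0 \<omega>))\<^sup>2)"
    by (auto simp: abs_of_nonneg)
qed

lemma residual_orthogonal:
  assumes e: "residual e" and f: "covariate_function f"
  shows "(\<integral>\<omega>. f (W 0 \<omega>) * e (W 0 \<omega>) \<partial>M) = 0"
proof -
  obtain K where K: "K \<in> borel_measurable borel" "f = (\<lambda>w. K (snd (snd w)))" and f2: "square_integrable f"
    using f by (auto simp: covariate_function_def)
  have e2: "square_integrable e" using e by (simp add: residual_def)
  have eq: "f (W 0 \<omega>) = K (X 0 \<omega>)" for \<omega> by (simp add: K(2) X_def)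
  show ?thesis
    using e K(1) integrable_mult_square_integrable[OF f2 e2] unfolding residual_def eq by blast
qed

lemma residual_cong:
  assumes e: "residual e" and f: "f \<in> borel_measurable borel" and eq: "AE \<omega> in M. f (W 0 \<omega>) = e (W 0 \<omega>)"
  shows "residual f"
  unfolding residual_def
proof (intro conjI ballI impI)
  have e2: "square_integrable e" using e by (simp add: residual_def)
  note em = square_integrableD(1)[OF e2]
  note [measurable] = measurable_compose[OF W_measurable em] measurable_compose[OF W_measurable f]
  show "square_integrable f"
    by (rule square_integrable_bound[OF f e2, where K = 1]) (use eq in \<open>auto elim!: eventually_mono\<close>)
  fix K :: "'b \<Rightarrow> real" assume K[measurable]: "K \<in> borel_measurable borel" and int: "integrable M (\<lambda>\<omega>. K (X 0 \<omega>) * f (W 0 \<omega>))"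
  have eq': "AE \<omega> in M. K (X 0 \<omega>) * f (W 0 \<omega>) = K (X 0 \<omega>) * e (W 0 \<omega>)" using eq by (auto elim!: eventually_mono)
  have "integrable M (\<lambda>\<omega>. K (X 0 \<omega>) * e (W 0 \<omega>))"
    by (rule integrable_cong_AE_imp[OF int]) (use eq' in \<open>auto elim!: eventually_mono\<close>)
  then have "(\<integral>\<omega>. K (X 0 \<omega>) * e (W 0 \<omega>) \<partial>M) = 0" using e K by (simp add: residual_def)
  moreover have "(\<integral>\<omega>. K (X 0 \<omega>) * f (W 0 \<omega>) \<partial>M) = (\<integral>\<omega>. K (X 0 \<omega>) * e (W 0 \<omega>) \<partial>M)"
    by (rule integral_cong_AE) (use eq' in auto)
  ultimately show "(\<integral>\<omega>. K (X 0 \<omega>) * f (W 0 \<omega>) \<partial>M) = 0" by simp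
qed

lemma residual_zero: "residual (\<lambda>_. 0)"
  by (simp add: residual_def square_integrable_const)

lemma covariate_function_fit:
  assumes X2: "integrable M (\<lambda>\<omega>. (norm (X 0 \<omega>))\<^sup>2)"
  shows "covariate_function (fit1 \<beta>)" "covariate_function (fit0 \<beta>)"
proof -
  obtain b1 b2 b3 b4 where \<beta>: "\<beta> = (b1, b2, b3, b4)" by (cases \<beta>)
  have xm: "(\<lambda>x :: 'b. x \<bullet> b4) \<in> borel_measurable borel" by measurable
  have "square_integrable (\<lambda>w. snd (snd w) \<bullet> b4)"
    unfolding square_integrable_def
  proof
    show m: "(\<lambda>w :: real \<times> real \<times> 'b. snd (snd w) \<bullet> b4) \<in> borel_measurable borel"
      by (rule measurable_compose[OF measurable_covariate xm])
    show "integrable M (\<lambda>\<omega>. (snd (snd (W 0 \<omega>)) \<bullet> b4)\<^sup>2)"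
    proof (rule Bochner_Integration.integrable_bound[OF integrable_mult_right[OF X2, of "(norm b4)\<^sup>2"]])
      show "(\<lambda>\<omega>. (snd (snd (W 0 \<omega>)) \<bullet> b4)\<^sup>2) \<in> borel_measurable M"
        by (intro borel_measurable_power measurable_compose[OF W_measurable m])
      have "(x \<bullet> b4)\<^sup>2 \<le> (norm b4)\<^sup>2 * (norm x)\<^sup>2" for x
        using power_mono[OF Cauchy_Schwarz_ineq2[of x b4], of 2] by (simp add: power_mult_distrib mult.commute)
      then show "AE \<omega> in M. norm ((snd (snd (W 0 \<omega>)) \<bullet> b4)\<^sup>2) \<le> norm ((norm b4)\<^sup>2 * (norm (X 0 \<omega>))\<^sup>2)"
        by (auto simp: X_def)
    qed
  qed
  then have x: "covariate_function (\<lambda>w. snd (snd w) \<bullet> b4)"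
    unfolding covariate_function_def using xm by (intro conjI bexI[of _ "\<lambda>x. x \<bullet> b4"]) auto
  have "fit1 \<beta> = (\<lambda>w. b1 + (pr w * b2) / (1 - pr w) + pr w * b3 + (snd (snd w) \<bullet> b4) / (1 - pr w))"
    by (auto simp: fit1_def balance1_def \<beta> inner_Pair algebra_simps)
  then show 1: "covariate_function (fit1 \<beta>)"
    by (simp only:) (intro covariate_function_add covariate_function_mult_pr covariate_function_const x)
  show "covariate_function (fit0 \<beta>)"
    unfolding fit0_eq[abs_def] by (intro covariate_function_mult_pr 1)
qed

lemma covariate_functionD: "covariate_function f \<Longrightarrow> square_integrable f"
  by (simp add: covariate_function_def)

lemma integrable_weighted_squares:
  assumes "square_integrable f"
  shows "integrable M (\<lambda>\<omega>. (f (W 0 \<omega>))\<^sup>2 / q 0 \<omega>)" "integrable M (\<lambda>\<omega>. (f (W 0 \<omega>))\<^sup>2 / (1 - q 0 \<omega>))"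
  using integrable_mult_square_integrable[OF square_integrable_mult_pr(3)[OF assms] assms]
    integrable_mult_square_integrable[OF square_integrable_mult_pr(4)[OF assms] assms]
  by (simp_all add: q_def power2_eq_square)

lemma pr_nonzero: "AE \<omega> in M. pr (W i \<omega>) \<noteq> 0 \<and> 1 - pr (W i \<omega>) \<noteq> 0"
  using pr_bounds[of i] by eventually_elim (use c_pos in auto)

definition linear_outcomes where
  "linear_outcomes y1 y0 \<beta>1 \<beta>0 \<longleftrightarrow> square_integrable y1 \<and> square_integrable y0 \<and>
     residual (\<lambda>w. y1 w - fit1 \<beta>1 w) \<and> residual (\<lambda>w. y0 w - fit0 \<beta>0 w)"

definition residual_variance where
  "residual_variance y1 y0 \<beta>1 \<beta>0 = (\<integral>\<omega>. q 0 \<omega> * (1 - q 0 \<omega>) *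
     ((y1 (W 0 \<omega>) - fit1 \<beta>1 (W 0 \<omega>)) / q 0 \<omega> + (y0 (W 0 \<omega>) - fit0 \<beta>0 (W 0 \<omega>)) / (1 - q 0 \<omega>))\<^sup>2 \<partial>M)"

definition population_variance where
  "population_variance y1 y0 \<beta>1 \<beta>0 = variance (\<lambda>\<omega>. fit1 \<beta>1 (W 0 \<omega>) - fit0 \<beta>0 (W 0 \<omega>))
     + (\<integral>\<omega>. (y1 (W 0 \<omega>) - fit1 \<beta>1 (W 0 \<omega>))\<^sup>2 / q 0 \<omega> \<partial>M)
     + (\<integral>\<omega>. (y0 (W 0 \<omega>) - fit0 \<beta>0 (W 0 \<omega>))\<^sup>2 / (1 - q 0 \<omega>) \<partial>M)"

text \<open>\<open>\<Sigma>\<close> is the design's additional variance as a function of the two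
  coefficient vectors. Quantifying over all linear outcomes lets the Hajek estimator reuse the
  limits for centred outcomes and for one arm with the other set to zero.\<close>

definition design_limits where
  "design_limits \<Sigma> \<longleftrightarrow> (\<forall>y1 y0 \<beta>1 \<beta>0. linear_outcomes y1 y0 \<beta>1 \<beta>0 \<longrightarrow>
     converges_to_normal M (sample_error y1 y0) (residual_variance y1 y0 \<beta>1 \<beta>0 + \<Sigma> \<beta>1 \<beta>0) \<and>
     converges_to_normal M (population_error y1 y0) (population_variance y1 y0 \<beta>1 \<beta>0 + \<Sigma> \<beta>1 \<beta>0) \<and>
     tight_statistic (population_error y1 y0))"

context
  fixes y1 y0 \<beta>1 \<beta>0
  assumes X2: "integrable M (\<lambda>\<omega>. (norm (X 0 \<omega>))\<^sup>2)" and lin: "linear_outcomes y1 y0 \<beta>1 \<beta>0"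
begin

private abbreviation (input) "e1 w \<equiv> y1 w - fit1 \<beta>1 w"
private abbreviation (input) "e0 w \<equiv> y0 w - fit0 \<beta>0 w"
private abbreviation (input) "m \<equiv> (\<integral>\<omega>. y1 (W 0 \<omega>) - y0 (W 0 \<omega>) \<partial>M)"
private abbreviation (input) "g w \<equiv> fit1 \<beta>1 w - fit0 \<beta>0 w"

lemma linear_outcomes_facts:
  shows "square_integrable y1" "square_integrable y0" "residual e1" "residual e0"
    "square_integrable e1" "square_integrable e0" "covariate_function g"
    "covariate_function (fit1 \<beta>1)" "covariate_function (fit0 \<beta>0)"
proof -
  show "square_integrable y1" "square_integrable y0" "residual e1" "residual e0"
    using lin unfolding linear_outcomes_def by blast+
  then show "square_integrable e1" "square_integrable e0" unfolding residual_def by blast+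
  show f: "covariate_function (fit1 \<beta>1)" "covariate_function (fit0 \<beta>0)"
    by (rule covariate_function_fit[OF X2])+
  show "covariate_function g" by (rule covariate_function_diff[OF f])
qed

lemma mean_fit: "(\<integral>\<omega>. g (W 0 \<omega>) \<partial>M) = m"
proof -
  note F = linear_outcomes_facts
  have z: "(\<integral>\<omega>. e1 (W 0 \<omega>) \<partial>M) = 0" "(\<integral>\<omega>. e0 (W 0 \<omega>) \<partial>M) = 0"
    using residual_orthogonal[OF F(3) covariate_function_const[of 1]]
      residual_orthogonal[OF F(4) covariate_function_const[of 1]] by simp_all
  note i = square_integrableD(3)[OF F(5)] square_integrableD(3)[OF F(6)]
    square_integrableD(3)[OF covariate_functionD[OF F(7)]]
  have "m = (\<integral>\<omega>. g (W 0 \<omega>) + (e1 (W 0 \<omega>) - e0 (W 0 \<omega>)) \<partial>M)"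
    by (rule Bochner_Integration.integral_cong) auto
  also have "\<dots> = (\<integral>\<omega>. g (W 0 \<omega>) \<partial>M) + ((\<integral>\<omega>. e1 (W 0 \<omega>) \<partial>M) - (\<integral>\<omega>. e0 (W 0 \<omega>) \<partial>M))"
    by (subst Bochner_Integration.integral_add[OF i(3) Bochner_Integration.integrable_diff[OF i(1,2)]],
        subst Bochner_Integration.integral_diff[OF i(1,2)]) (rule refl)
  finally show ?thesis using z by simp
qed

text \<open>The cross terms between linear parts and residuals in the variance computations are
  brought to this shape.\<close>

lemma residual_cross:
  assumes "covariate_function f" "covariate_function k"
  shows "(\<integral>\<omega>. f (W 0 \<omega>) * e1 (W 0 \<omega>) + k (W 0 \<omega>) * e0 (W 0 \<omega>) \<partial>M) = 0"
    and "integrable M (\<lambda>\<omega>. f (W 0 \<omega>) * e1 (W 0 \<omega>) + k (W 0 \<omega>) * e0 (W 0 \<omega>))"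
proof -
  note F = linear_outcomes_facts
  note i = integrable_mult_square_integrable[OF covariate_functionD[OF assms(1)] F(5)]
    integrable_mult_square_integrable[OF covariate_functionD[OF assms(2)] F(6)]
  show "integrable M (\<lambda>\<omega>. f (W 0 \<omega>) * e1 (W 0 \<omega>) + k (W 0 \<omega>) * e0 (W 0 \<omega>))"
    by (rule Bochner_Integration.integrable_add[OF i])
  show "(\<integral>\<omega>. f (W 0 \<omega>) * e1 (W 0 \<omega>) + k (W 0 \<omega>) * e0 (W 0 \<omega>) \<partial>M) = 0"
    unfolding Bochner_Integration.integral_add[OF i]
    using residual_orthogonal[OF F(3) assms(1)] residual_orthogonal[OF F(4) assms(2)] by simp
qed

text \<open>The second moments of the coin-toss arms are split into a residual part, a part from the
  linear predictors and cross terms with mean zero. The linear part of the sample error is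
  \<open>\<Sigma>\<close>; that of the population error is \<open>\<Sigma>\<close> plus the variance
  of the predicted effect.\<close>

lemma coin_toss_limits:
  assumes ind: "\<And>n I. I \<subseteq> {..<n} \<Longrightarrow> AE \<omega> in M. real_cond_exp M (sigma_upto M n X) (\<lambda>\<omega>. \<Prod>i\<in>I. D n i \<omega>) \<omega> = (\<Prod>i\<in>I. q i \<omega>)"
  defines "\<Sigma> \<equiv> coin_toss_variance M (q 0) (\<lambda>\<omega>. balance0 (q 0 \<omega>) (X 0 \<omega>)) \<beta>1 \<beta>0"
  shows "converges_to_normal M (sample_error y1 y0) (residual_variance y1 y0 \<beta>1 \<beta>0 + \<Sigma>)"
    and "converges_to_normal M (population_error y1 y0) (population_variance y1 y0 \<beta>1 \<beta>0 + \<Sigma>)"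
    and "tight_statistic (population_error y1 y0)"
proof -
  note F = linear_outcomes_facts
  note C = coin_toss_errors[OF ind F(1,2)]
  show "tight_statistic (population_error y1 y0)" by (rule C(3))
  let ?b = "\<beta>1 + \<beta>0"
  have fit: "covariate_function (fit1 ?b)" by (rule covariate_function_fit[OF X2])
  \<comment> \<open>Rewritten with Z_0 = (1 - q) / q Z_1, since the variance computations produce
    the square of fit1 (\<beta>1 + \<beta>0).\<close>
  have \<Sigma>: "\<Sigma> = (\<integral>\<omega>. (1 - q 0 \<omega>) * ((fit1 ?b (W 0 \<omega>))\<^sup>2 / q 0 \<omega>) \<partial>M)"
    unfolding \<Sigma>_def coin_toss_variance_def
  proof (rule integral_cong_AE)
    have [measurable]: "(\<lambda>\<omega>. balance0 (q 0 \<omega>) (X 0 \<omega>) \<bullet> ?b) \<in> borel_measurable M"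
      using measurable_compose[OF W_measurable square_integrableD(1)[OF covariate_functionD[OF covariate_function_fit(2)[OF X2, of ?b]]], of 0]
      by (simp add: fit0_def[abs_def] q_def X_def)
    show "(\<lambda>\<omega>. q 0 \<omega> / (1 - q 0 \<omega>) * (balance0 (q 0 \<omega>) (X 0 \<omega>) \<bullet> ?b)\<^sup>2) \<in> borel_measurable M" by measurable
    have [measurable]: "(\<lambda>\<omega>. fit1 ?b (W 0 \<omega>)) \<in> borel_measurable M"
      by (rule measurable_compose[OF W_measurable square_integrableD(1)[OF covariate_functionD[OF fit]]])
    show "(\<lambda>\<omega>. (1 - q 0 \<omega>) * ((fit1 ?b (W 0 \<omega>))\<^sup>2 / q 0 \<omega>)) \<in> borel_measurable M" by measurable
    show "AE \<omega> in M. q 0 \<omega> / (1 - q 0 \<omega>) * (balance0 (q 0 \<omega>) (X 0 \<omega>) \<bullet> ?b)\<^sup>2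
        = (1 - q 0 \<omega>) * ((fit1 ?b (W 0 \<omega>))\<^sup>2 / q 0 \<omega>)"
      using pr_nonzero[of 0]
    proof eventually_elim
      case (elim \<omega>)
      have "balance0 (q 0 \<omega>) (X 0 \<omega>) \<bullet> ?b = (1 - q 0 \<omega>) * (fit1 ?b (W 0 \<omega>) / q 0 \<omega>)"
        using fit0_eq[of ?b "W 0 \<omega>"] by (simp add: fit0_def q_def X_def)
      moreover have "r / (1 - r) * ((1 - r) * (z / r))\<^sup>2 = (1 - r) * (z\<^sup>2 / r)" if "r \<noteq> 0" "1 - r \<noteq> 0" for r z :: real
        using that by (simp add: power2_eq_square)
      ultimately show ?case using elim by (simp only: q_def simp_thms)
    qed
  qed
  have ifit: "integrable M (\<lambda>\<omega>. (1 - q 0 \<omega>) * ((fit1 ?b (W 0 \<omega>))\<^sup>2 / q 0 \<omega>))"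
    using integrable_mult_square_integrable[OF square_integrable_mult_pr(2)[OF square_integrable_mult_pr(3)[OF covariate_functionD[OF fit]]] covariate_functionD[OF fit]]
    by (simp add: q_def power2_eq_square mult.assoc)
  define h where "h w = y1 w / pr w + y0 w / (1 - pr w)" for w
  define k where "k w = e1 w / pr w + e0 w / (1 - pr w)" for w
  have k: "square_integrable k" unfolding k_def by (intro square_integrable_add square_integrable_mult_pr F)
  have ik: "integrable M (\<lambda>\<omega>. q 0 \<omega> * (1 - q 0 \<omega>) * (k (W 0 \<omega>))\<^sup>2)"
    using integrable_mult_square_integrable[OF square_integrable_mult_pr(1)[OF square_integrable_mult_pr(2)[OF k]] k]
    by (simp add: q_def power2_eq_square mult.assoc)
  \<comment> \<open>With z = fit1 (\<beta>1 + \<beta>0), the weighted outcome is h = k + z / q, and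
    the square of h yields the cross term 2 (1 - q) z k. \<open>f1\<close> and \<open>f0\<close> are
    its coefficients at the two residuals.\<close>
  define f1 where "f1 w = (1 - pr w) * (2 * fit1 ?b w / pr w)" for w
  define f0 where "f0 w = (1 - pr w) * (2 * fit1 ?b w / (1 - pr w))" for w
  have "covariate_function (\<lambda>w. 2 * fit1 ?b w)" by (rule covariate_function_cmult[OF fit])
  then have f: "covariate_function f1" "covariate_function f0"
    unfolding f1_def f0_def by (intro covariate_function_mult_pr; assumption)+
  note cross = residual_cross[OF f]
  have v: "(\<integral>\<omega>. q 0 \<omega> * ((1 - q 0 \<omega>) * h (W 0 \<omega>))\<^sup>2 + (1 - q 0 \<omega>) * (q 0 \<omega> * h (W 0 \<omega>))\<^sup>2 \<partial>M)
    = residual_variance y1 y0 \<beta>1 \<beta>0 + \<Sigma>"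
  proof -
    have "(\<integral>\<omega>. q 0 \<omega> * ((1 - q 0 \<omega>) * h (W 0 \<omega>))\<^sup>2 + (1 - q 0 \<omega>) * (q 0 \<omega> * h (W 0 \<omega>))\<^sup>2 \<partial>M)
      = (\<integral>\<omega>. q 0 \<omega> * (1 - q 0 \<omega>) * (k (W 0 \<omega>))\<^sup>2 + (1 - q 0 \<omega>) * ((fit1 ?b (W 0 \<omega>))\<^sup>2 / q 0 \<omega>)
          + (f1 (W 0 \<omega>) * e1 (W 0 \<omega>) + f0 (W 0 \<omega>) * e0 (W 0 \<omega>)) \<partial>M)"
    proof (rule integral_cong_AE)
      have [measurable]: "y1 \<in> borel_measurable borel" "y0 \<in> borel_measurable borel"
        using square_integrableD(1) F by auto
      have "square_integrable h" unfolding h_def by (intro square_integrable_add square_integrable_mult_pr F)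
      note hm = measurable_compose[OF W_measurable square_integrableD(1)[OF this]]
      show "(\<lambda>\<omega>. q 0 \<omega> * ((1 - q 0 \<omega>) * h (W 0 \<omega>))\<^sup>2 + (1 - q 0 \<omega>) * (q 0 \<omega> * h (W 0 \<omega>))\<^sup>2) \<in> borel_measurable M"
        using hm by measurable
      show "(\<lambda>\<omega>. q 0 \<omega> * (1 - q 0 \<omega>) * (k (W 0 \<omega>))\<^sup>2 + (1 - q 0 \<omega>) * ((fit1 ?b (W 0 \<omega>))\<^sup>2 / q 0 \<omega>)
          + (f1 (W 0 \<omega>) * e1 (W 0 \<omega>) + f0 (W 0 \<omega>) * e0 (W 0 \<omega>))) \<in> borel_measurable M"
        by (rule borel_measurable_integrable) (intro Bochner_Integration.integrable_add ik ifit cross(2))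
      show "AE \<omega> in M. q 0 \<omega> * ((1 - q 0 \<omega>) * h (W 0 \<omega>))\<^sup>2 + (1 - q 0 \<omega>) * (q 0 \<omega> * h (W 0 \<omega>))\<^sup>2
        = q 0 \<omega> * (1 - q 0 \<omega>) * (k (W 0 \<omega>))\<^sup>2 + (1 - q 0 \<omega>) * ((fit1 ?b (W 0 \<omega>))\<^sup>2 / q 0 \<omega>)
          + (f1 (W 0 \<omega>) * e1 (W 0 \<omega>) + f0 (W 0 \<omega>) * e0 (W 0 \<omega>))"
        using pr_nonzero[of 0]
      proof eventually_elim
        case (elim \<omega>)
        define r where "r = pr (W 0 \<omega>)"
        define z where "z = fit1 ?b (W 0 \<omega>)"
        have r: "r \<noteq> 0" "1 - r \<noteq> 0" using elim by (auto simp: r_def)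
        have hk: "h (W 0 \<omega>) = k (W 0 \<omega>) + z / r"
          using elim by (simp add: h_def k_def z_def r_def fit1_add fit0_eq diff_divide_distrib add_divide_distrib)
        have fe: "f1 (W 0 \<omega>) * e1 (W 0 \<omega>) + f0 (W 0 \<omega>) * e0 (W 0 \<omega>) = 2 * (1 - r) * z * k (W 0 \<omega>)"
        proof -
          have "t * (2 * z / r) * a + t * (2 * z / s) * b = 2 * t * z * (a / r + b / s)" for s t a b :: real
            by (simp add: distrib_left mult_ac)
          then show ?thesis by (simp only: f1_def f0_def k_def z_def r_def)
        qed
        have "r * ((1 - r) * (K + z / r))\<^sup>2 + (1 - r) * (r * (K + z / r))\<^sup>2
          = r * (1 - r) * K\<^sup>2 + (1 - r) * (z\<^sup>2 / r) + 2 * (1 - r) * z * K" for K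
        proof -
          have "r * ((1 - r) * (K + z / r))\<^sup>2 + (1 - r) * (r * (K + z / r))\<^sup>2 = r * (1 - r) * (K + z / r)\<^sup>2"
          proof -
            have "r * ((1 - r) * Y)\<^sup>2 + (1 - r) * (r * Y)\<^sup>2 = r * (1 - r) * Y\<^sup>2" for Y
              by (simp add: power2_eq_square algebra_simps)
            then show ?thesis .
          qed
          also have "\<dots> = r * (1 - r) * K\<^sup>2 + (1 - r) * (z\<^sup>2 / r) + 2 * (1 - r) * z * K"
          proof -
            have "z = r * (z / r)" "z\<^sup>2 / r = r * (z / r)\<^sup>2" using r by (auto simp: power2_eq_square)
            moreover have "r * (1 - r) * (K + Z)\<^sup>2 = r * (1 - r) * K\<^sup>2 + (1 - r) * (r * Z\<^sup>2) + 2 * (1 - r) * (r * Z) * K" for Z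
              by (simp add: power2_eq_square algebra_simps)
            ultimately show ?thesis by metis
          qed
          finally show ?thesis .
        qed
        then show ?case unfolding hk fe by (simp add: q_def r_def z_def)
      qed
    qed
    also have "\<dots> = (\<integral>\<omega>. q 0 \<omega> * (1 - q 0 \<omega>) * (k (W 0 \<omega>))\<^sup>2 \<partial>M) + \<Sigma>"
      unfolding \<Sigma> using ik ifit cross by simp
    finally show ?thesis by (simp add: residual_variance_def k_def q_def)
  qed
  show "converges_to_normal M (sample_error y1 y0) (residual_variance y1 y0 \<beta>1 \<beta>0 + \<Sigma>)"
    using C(1) v unfolding h_def by simp
  \<comment> \<open>Coefficients of the residuals in the cross term when the two squared arms of the
    population error are expanded around their linear parts.\<close>
  define u1 where "u1 w = 2 * (fit1 \<beta>1 w / pr w - m)" for w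
  define u0 where "u0 w = 2 * (fit0 \<beta>0 w / (1 - pr w) + m)" for w
  have u: "covariate_function u1" "covariate_function u0"
    unfolding u1_def u0_def
    by (intro covariate_function_cmult covariate_function_diff covariate_function_add covariate_function_const
        covariate_function_mult_pr F)+
  note cross' = residual_cross[OF u]
  note is1 = integrable_weighted_squares(1)[OF F(5)] and is0 = integrable_weighted_squares(2)[OF F(6)]
  have ig: "integrable M (\<lambda>\<omega>. (g (W 0 \<omega>) - m)\<^sup>2)"
    by (rule square_integrableD(2)[of "\<lambda>w. g w - m"])
       (intro square_integrable_diff square_integrable_const covariate_functionD F)
  have "(\<integral>\<omega>. q 0 \<omega> * (y1 (W 0 \<omega>) / q 0 \<omega> - m)\<^sup>2 + (1 - q 0 \<omega>) * (y0 (W 0 \<omega>) / (1 - q 0 \<omega>) + m)\<^sup>2 \<partial>M)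
    = (\<integral>\<omega>. (g (W 0 \<omega>) - m)\<^sup>2 + (e1 (W 0 \<omega>))\<^sup>2 / q 0 \<omega> + (e0 (W 0 \<omega>))\<^sup>2 / (1 - q 0 \<omega>)
        + (1 - q 0 \<omega>) * ((fit1 ?b (W 0 \<omega>))\<^sup>2 / q 0 \<omega>)
        + (u1 (W 0 \<omega>) * e1 (W 0 \<omega>) + u0 (W 0 \<omega>) * e0 (W 0 \<omega>)) \<partial>M)"
  proof (rule integral_cong_AE)
    have [measurable]: "(\<lambda>\<omega>. y1 (W 0 \<omega>)) \<in> borel_measurable M" "(\<lambda>\<omega>. y0 (W 0 \<omega>)) \<in> borel_measurable M"
      by (rule measurable_compose[OF W_measurable square_integrableD(1)], rule F)+
    show "(\<lambda>\<omega>. q 0 \<omega> * (y1 (W 0 \<omega>) / q 0 \<omega> - m)\<^sup>2 + (1 - q 0 \<omega>) * (y0 (W 0 \<omega>) / (1 - q 0 \<omega>) + m)\<^sup>2) \<in> borel_measurable M"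
      by measurable
    show "(\<lambda>\<omega>. (g (W 0 \<omega>) - m)\<^sup>2 + (e1 (W 0 \<omega>))\<^sup>2 / q 0 \<omega> + (e0 (W 0 \<omega>))\<^sup>2 / (1 - q 0 \<omega>)
        + (1 - q 0 \<omega>) * ((fit1 ?b (W 0 \<omega>))\<^sup>2 / q 0 \<omega>)
        + (u1 (W 0 \<omega>) * e1 (W 0 \<omega>) + u0 (W 0 \<omega>) * e0 (W 0 \<omega>))) \<in> borel_measurable M"
      by (rule borel_measurable_integrable) (intro Bochner_Integration.integrable_add ig is1 is0 ifit cross'(2))
    show "AE \<omega> in M. q 0 \<omega> * (y1 (W 0 \<omega>) / q 0 \<omega> - m)\<^sup>2 + (1 - q 0 \<omega>) * (y0 (W 0 \<omega>) / (1 - q 0 \<omega>) + m)\<^sup>2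
      = (g (W 0 \<omega>) - m)\<^sup>2 + (e1 (W 0 \<omega>))\<^sup>2 / q 0 \<omega> + (e0 (W 0 \<omega>))\<^sup>2 / (1 - q 0 \<omega>)
        + (1 - q 0 \<omega>) * ((fit1 ?b (W 0 \<omega>))\<^sup>2 / q 0 \<omega>)
        + (u1 (W 0 \<omega>) * e1 (W 0 \<omega>) + u0 (W 0 \<omega>) * e0 (W 0 \<omega>))"
      using pr_nonzero[of 0]
    proof eventually_elim
      case (elim \<omega>)
      define r s where "r = pr (W 0 \<omega>)" and "s = 1 - pr (W 0 \<omega>)"
      define z1 z0 E1 E0 where "z1 = fit1 \<beta>1 (W 0 \<omega>) / r" and "z0 = fit1 \<beta>0 (W 0 \<omega>) / r"
        and "E1 = e1 (W 0 \<omega>) / r" and "E0 = e0 (W 0 \<omega>) / s"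
      have r: "r \<noteq> 0" "s \<noteq> 0" "r + s = 1" using elim by (auto simp: r_def s_def)
      have y: "y1 (W 0 \<omega>) / r = z1 + E1" "y0 (W 0 \<omega>) / s = z0 + E0"
        "fit1 \<beta>1 (W 0 \<omega>) = r * z1"
        "fit0 \<beta>0 (W 0 \<omega>) = s * z0" "fit1 ?b (W 0 \<omega>) = r * (z1 + z0)"
        "u1 (W 0 \<omega>) = 2 * (z1 - m)" "u0 (W 0 \<omega>) = 2 * (z0 + m)"
        using r elim by (auto simp: z1_def z0_def E1_def E0_def fit1_add fit0_eq r_def s_def u1_def u0_def
            diff_divide_distrib add_divide_distrib distrib_left)
      have e: "e1 (W 0 \<omega>) = r * E1" "e0 (W 0 \<omega>) = s * E0"
        using r(1,2) by (auto simp: E1_def E0_def)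
      \<comment> \<open>Apart from the residuals this is the second moment of a variable equal to z1
        - t with probability r and to -(z0 + t) with probability s. Its mean is r z1 - s z0 - t and
        its variance r s (z1 + z0)^2; the latter integrates to \<open>\<Sigma>\<close>.\<close>
      have "r * (z1 + E1 - t)\<^sup>2 + s * (z0 + E0 + t)\<^sup>2 = (r * z1 - s * z0 - t)\<^sup>2 + r * E1\<^sup>2 + s * E0\<^sup>2 + s * (r * (z1 + z0)\<^sup>2)
          + (2 * (z1 - t) * (r * E1) + 2 * (z0 + t) * (s * E0))" for t
      proof -
        have s: "s = 1 - r" using r by simp
        show ?thesis unfolding s by (simp add: power2_eq_square algebra_simps)
      qed
      then have "r * (y1 (W 0 \<omega>) / r - m)\<^sup>2 + s * (y0 (W 0 \<omega>) / s + m)\<^sup>2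
        = (g (W 0 \<omega>) - m)\<^sup>2 + (e1 (W 0 \<omega>))\<^sup>2 / r + (e0 (W 0 \<omega>))\<^sup>2 / s + s * ((fit1 ?b (W 0 \<omega>))\<^sup>2 / r)
          + (u1 (W 0 \<omega>) * e1 (W 0 \<omega>) + u0 (W 0 \<omega>) * e0 (W 0 \<omega>))"
        unfolding e unfolding y using r(1,2) by (simp add: power2_eq_square)
      then show ?case by (simp add: r_def s_def q_def)
    qed
  qed
  also have "\<dots> = (\<integral>\<omega>. (g (W 0 \<omega>) - m)\<^sup>2 \<partial>M) + (\<integral>\<omega>. (e1 (W 0 \<omega>))\<^sup>2 / q 0 \<omega> \<partial>M)
      + (\<integral>\<omega>. (e0 (W 0 \<omega>))\<^sup>2 / (1 - q 0 \<omega>) \<partial>M) + \<Sigma>"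
    unfolding \<Sigma> using ig is1 is0 ifit cross' by simp
  also have "\<dots> = population_variance y1 y0 \<beta>1 \<beta>0 + \<Sigma>"
    unfolding population_variance_def mean_fit by simp
  finally show "converges_to_normal M (population_error y1 y0) (population_variance y1 y0 \<beta>1 \<beta>0 + \<Sigma>)"
    using C(2) by simp
qed

section \<open>The balance error and the limits under the cube method\<close>

definition balance_error :: "nat \<Rightarrow> 'a \<Rightarrow> real" where
  "balance_error n \<omega> = 1 / sqrt (real n) * (\<Sum>i<n. (D n i \<omega> - q i \<omega>) * (fit1 (\<beta>1 + \<beta>0) (W i \<omega>) / q i \<omega>))"

lemma balance_error_measurable: "balance_error n \<in> borel_measurable M"
proof -
  note fm = square_integrableD(1)[OF covariate_functionD[OF covariate_function_fit(1)[OF X2, of "\<beta>1 + \<beta>0"]]]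
  have "(\<lambda>\<omega>. (D n i \<omega> - q i \<omega>) * (fit1 (\<beta>1 + \<beta>0) (W i \<omega>) / q i \<omega>)) \<in> borel_measurable M" if "i < n" for i
    using D_measurable[OF that] measurable_compose[OF W_measurable fm] by measurable
  then have "(\<lambda>\<omega>. \<Sum>i<n. (D n i \<omega> - q i \<omega>) * (fit1 (\<beta>1 + \<beta>0) (W i \<omega>) / q i \<omega>)) \<in> borel_measurable M"
    by (rule borel_measurable_sum) simp
  then show ?thesis unfolding balance_error_def by (rule borel_measurable_times[OF borel_measurable_const])
qed

text \<open>The linear part left over in both errors is the balance error in the direction \<beta>1
  + \<beta>0, so it is carried by at most as many units as there are balancing components, namely
  three more than covariates.\<close>

lemma cube_balance_error_null:
  assumes cube: "\<And>n. cube_method M n X q (\<lambda>i \<omega>. balance1 (q i \<omega>) (X i \<omega>)) (D n)"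
  shows "null_in_prob M balance_error"
proof (rule null_in_prob_few_units[where d = "DIM(real \<times> real \<times> real \<times> 'b)" and f = "\<lambda>w. 1 / c * fit1 (\<beta>1 + \<beta>0) w"])
  show "square_integrable (\<lambda>w. 1 / c * fit1 (\<beta>1 + \<beta>0) w)"
    by (intro square_integrable_cmult covariate_functionD covariate_function_fit X2)
  show "balance_error n \<in> borel_measurable M" for n by (rule balance_error_measurable)
  fix n
  obtain s :: "nat \<Rightarrow> nat \<Rightarrow> 'a \<Rightarrow> real" where s: "AE \<omega> in M. \<forall>i<n. s 0 i \<omega> = q i \<omega>"
    "AE \<omega> in M. \<forall>t. flight_step n (\<lambda>i. q i \<omega>) (\<lambda>i. balance1 (q i \<omega>) (X i \<omega>)) (\<lambda>i. s t i \<omega>) (\<lambda>i. s (Suc t) i \<omega>)"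
    "AE \<omega> in M. \<forall>i<n. s n i \<omega> \<in> {0, 1} \<longrightarrow> D n i \<omega> = s n i \<omega>"
    using cube[of n] unfolding cube_method_def by blast
  have "AE \<omega> in M. \<forall>i. c \<le> pr (W i \<omega>) \<and> pr (W i \<omega>) \<le> 1 - c"
    using pr_bounds by (simp add: AE_all_countable)
  then show "AE \<omega> in M. \<exists>A. A \<subseteq> {..<n} \<and> card A \<le> DIM(real \<times> real \<times> real \<times> 'b) \<and>
      \<bar>balance_error n \<omega>\<bar> \<le> 1 / sqrt (real n) * (\<Sum>i\<in>A. \<bar>1 / c * fit1 (\<beta>1 + \<beta>0) (W i \<omega>)\<bar>)"
    using s AE_space
  proof eventually_elim
    case (elim \<omega>)
    have fit: "balance1 (q i \<omega>) (X i \<omega>) \<bullet> (\<beta>1 + \<beta>0) = fit1 (\<beta>1 + \<beta>0) (W i \<omega>)" for i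
      by (simp add: fit1_def q_def X_def)
    obtain A where A: "A \<subseteq> {..<n}" "card A \<le> DIM(real \<times> real \<times> real \<times> 'b)"
      "\<bar>\<Sum>i<n. (D n i \<omega> - q i \<omega>) * (balance1 (q i \<omega>) (X i \<omega>) \<bullet> (\<beta>1 + \<beta>0) / q i \<omega>)\<bar>
        \<le> (\<Sum>i\<in>A. \<bar>balance1 (q i \<omega>) (X i \<omega>) \<bullet> (\<beta>1 + \<beta>0)\<bar> / c)"
    proof (rule cube_balance_error[where n = n and c = c and q = "\<lambda>i. q i \<omega>" and s = "\<lambda>t i. s t i \<omega>"
          and d = "\<lambda>i. D n i \<omega>" and Z = "\<lambda>i. balance1 (q i \<omega>) (X i \<omega>)" and \<beta> = "\<beta>1 + \<beta>0"])
      show "c \<le> q i \<omega> \<and> q i \<omega> \<le> 1" for i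
        using elim(1)[rule_format, of i] c_pos by (auto simp: q_def)
      show "D n i \<omega> \<in> {0, 1}" if "i < n" for i by (rule D_binary[OF that elim(5)])
    qed (use elim c_pos in auto)
    have "\<bar>balance_error n \<omega>\<bar> \<le> 1 / sqrt (real n) * (\<Sum>i\<in>A. \<bar>fit1 (\<beta>1 + \<beta>0) (W i \<omega>)\<bar> / c)"
      using A(3) unfolding balance_error_def fit abs_mult by (intro mult_mono) auto
    also have "(\<Sum>i\<in>A. \<bar>fit1 (\<beta>1 + \<beta>0) (W i \<omega>)\<bar> / c) = (\<Sum>i\<in>A. \<bar>1 / c * fit1 (\<beta>1 + \<beta>0) (W i \<omega>)\<bar>)"
      using c_pos by (intro sum.cong refl) (simp add: abs_mult)
    finally show ?case using A(1,2) by blast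
  qed
qed

text \<open>Once the balance error is removed, the linear predictors no longer interact with the
  assignment: they disappear from the sample error and enter the population error as a function of
  the covariate, the same in both arms.\<close>

lemma cube_limits:
  assumes cube: "\<And>n. cube_method M n X q (\<lambda>i \<omega>. balance1 (q i \<omega>) (X i \<omega>)) (D n)"
  shows "converges_to_normal M (sample_error y1 y0) (residual_variance y1 y0 \<beta>1 \<beta>0)"
    and "converges_to_normal M (population_error y1 y0) (population_variance y1 y0 \<beta>1 \<beta>0)"
    and "tight_statistic (population_error y1 y0)"
proof -
  note F = linear_outcomes_facts
  note null = cube_balance_error_null[OF cube]
  note em = error_measurable[OF square_integrableD(1)[OF F(1)] square_integrableD(1)[OF F(2)]]
  let ?b = "\<beta>1 + \<beta>0"
  have nz: "AE \<omega> in M. \<forall>i. pr (W i \<omega>) \<noteq> 0 \<and> 1 - pr (W i \<omega>) \<noteq> 0"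
    using pr_nonzero by (simp add: AE_all_countable)
  define k where "k w = e1 w / pr w + e0 w / (1 - pr w)" for w
  have k: "square_integrable k" unfolding k_def by (intro square_integrable_add square_integrable_mult_pr F)
  \<comment> \<open>k is the difference of the two arms in both representations below; that it has
    conditional mean zero given the covariate is what makes the assignment drop out of mixed
    moments.\<close>
  have k0: "(\<integral>\<omega>. indicator A (X 0 \<omega>) * k (W 0 \<omega>) \<partial>M) = 0" if A: "A \<in> sets borel" for A
  proof -
    have f: "covariate_function (\<lambda>w. indicator A (snd (snd w)))"
      unfolding covariate_function_def
    proof
      have "(\<lambda>w :: real \<times> real \<times> 'b. indicator A (snd (snd w)) :: real) \<in> borel_measurable borel"
        by (rule measurable_compose[OF measurable_covariate borel_measurable_indicator[OF A]])
      then show "square_integrable (\<lambda>w. indicator A (snd (snd w)))"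
        by (rule square_integrable_bound[OF _ square_integrable_const[of 1], where K = 1]) auto
      show "\<exists>K\<in>borel_measurable borel. (\<lambda>w :: real \<times> real \<times> 'b. indicator A (snd (snd w)) :: real) = (\<lambda>w. K (snd (snd w)))"
        using borel_measurable_indicator[OF A] by (intro bexI[of _ "indicator A"]) auto
    qed
    have "(\<integral>\<omega>. indicator A (X 0 \<omega>) * k (W 0 \<omega>) \<partial>M) = (\<integral>\<omega>. indicator A (snd (snd (W 0 \<omega>))) / pr (W 0 \<omega>) * e1 (W 0 \<omega>)
       + indicator A (snd (snd (W 0 \<omega>))) / (1 - pr (W 0 \<omega>)) * e0 (W 0 \<omega>) \<partial>M)"
      by (rule Bochner_Integration.integral_cong) (auto simp: k_def X_def distrib_left)
    also have "\<dots> = 0"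
      by (rule residual_cross(1)[OF covariate_function_mult_pr(3)[OF f] covariate_function_mult_pr(4)[OF f]])
    finally show ?thesis .
  qed
  show "converges_to_normal M (sample_error y1 y0) (residual_variance y1 y0 \<beta>1 \<beta>0)"
  proof -
    \<comment> \<open>With these arms a unit contributes (D - q) k, the sample error with outcomes
      replaced by residuals.\<close>
    define a where "a w = (1 - pr w) * k w" for w
    define b where "b w = - 1 * (pr w * k w)" for w
    have a: "square_integrable a" unfolding a_def by (rule square_integrable_mult_pr(2)[OF k])
    have b: "square_integrable b" unfolding b_def by (rule square_integrable_cmult[OF square_integrable_mult_pr(1)[OF k]])
    note ab = square_integrableD(1)[OF a] square_integrableD(1)[OF b] square_integrableD(2)[OF a] square_integrableD(2)[OF b]
    have diff: "a (W 0 \<omega>) - b (W 0 \<omega>) = k (W 0 \<omega>)" for \<omega> by (simp add: a_def b_def algebra_simps)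
    have one: "covariate_function (\<lambda>_. - 1)" by (rule covariate_function_const)
    have "(\<integral>\<omega>. b (W 0 \<omega>) \<partial>M) = (\<integral>\<omega>. pr (W 0 \<omega>) * (- 1 / pr (W 0 \<omega>)) * e1 (W 0 \<omega>)
       + pr (W 0 \<omega>) * (- 1 / (1 - pr (W 0 \<omega>))) * e0 (W 0 \<omega>) \<partial>M)"
      by (rule Bochner_Integration.integral_cong) (auto simp: b_def k_def distrib_left)
    also have "\<dots> = 0"
      by (rule residual_cross(1)) (intro covariate_function_mult_pr one)+
    finally have b0: "(\<integral>\<omega>. b (W 0 \<omega>) \<partial>M) = 0" .
    have orth: "(\<integral>\<omega>. (\<Prod>i\<in>J. arm a b n i \<omega>) \<partial>M) = 0" if "J \<subseteq> {..<n}" "J \<noteq> {}" for n J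
      by (rule orthogonal_arm_residual[OF ab _ b0 that]) (simp only: diff k0)
    have eq: "AE \<omega> in M. sample_error y1 y0 n \<omega> - 1 / sqrt (real n) * (\<Sum>i<n. arm a b n i \<omega>) = balance_error n \<omega>" for n
      using nz
    proof eventually_elim
      case (elim \<omega>)
      have "(D n i \<omega> - q i \<omega>) * (y1 (W i \<omega>) / q i \<omega> + y0 (W i \<omega>) / (1 - q i \<omega>))
        = arm a b n i \<omega> + (D n i \<omega> - q i \<omega>) * (fit1 ?b (W i \<omega>) / q i \<omega>)" for i
      proof -
        have r: "pr (W i \<omega>) \<noteq> 0" "1 - pr (W i \<omega>) \<noteq> 0" using elim by auto
        have 1: "arm a b n i \<omega> = (D n i \<omega> - q i \<omega>) * k (W i \<omega>)"
          by (simp add: arm_def a_def b_def q_def algebra_simps)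
        have 2: "y1 (W i \<omega>) / q i \<omega> + y0 (W i \<omega>) / (1 - q i \<omega>) = k (W i \<omega>) + fit1 ?b (W i \<omega>) / q i \<omega>"
          using r by (simp add: k_def q_def fit1_add fit0_eq diff_divide_distrib add_divide_distrib)
        show ?thesis unfolding 1 2 by (simp add: distrib_left)
      qed
      then show ?case by (simp add: sample_error_def balance_error_def sum.distrib add_divide_distrib)
    qed
    have Tm: "(\<lambda>\<omega>. sample_error y1 y0 n \<omega> - 1 / sqrt (real n) * (\<Sum>i<n. arm a b n i \<omega>)) \<in> borel_measurable M" for n
      using arm_measurable[OF ab]
      by (intro borel_measurable_diff em(1) borel_measurable_times borel_measurable_const borel_measurable_sum) auto
    have nl: "null_in_prob M (\<lambda>n \<omega>. sample_error y1 y0 n \<omega> - 1 / sqrt (real n) * (\<Sum>i<n. arm a b n i \<omega>))"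
    proof (rule null_in_prob_mono[OF balance_error_measurable Tm null, where K = 1])
      show "AE \<omega> in M. min 1 \<bar>sample_error y1 y0 n \<omega> - 1 / sqrt (real n) * (\<Sum>i<n. arm a b n i \<omega>)\<bar>
        \<le> 1 * min 1 \<bar>balance_error n \<omega>\<bar>" for n
        using eq[of n] by eventually_elim (simp only: mult_1 order_refl)
    qed
    note conv = converges_from_arms(1)[OF a b orth em(1) nl]
    have "(\<integral>\<omega>. q 0 \<omega> * (a (W 0 \<omega>))\<^sup>2 + (1 - q 0 \<omega>) * (b (W 0 \<omega>))\<^sup>2 \<partial>M) = residual_variance y1 y0 \<beta>1 \<beta>0"
      unfolding residual_variance_def
      by (rule Bochner_Integration.integral_cong)
         (auto simp: a_def b_def q_def k_def[symmetric] power_mult_distrib power2_eq_square, simp add: algebra_simps)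
    then show ?thesis using conv by simp
  qed
  \<comment> \<open>Weighted residuals plus the centred predicted effect g - m, which is the common
    conditional mean of the two arms and produces the variance term of the population limit.\<close>
  define a where "a w = e1 w / pr w + (g w - m)" for w
  define b where "b w = - 1 * (e0 w / (1 - pr w)) + (g w - m)" for w
  have gm: "covariate_function (\<lambda>w. g w - m)" by (intro covariate_function_diff covariate_function_const F)
  have a: "square_integrable a" unfolding a_def
    by (intro square_integrable_add square_integrable_mult_pr covariate_functionD[OF gm] F)
  have b: "square_integrable b" unfolding b_def
    by (intro square_integrable_add square_integrable_cmult square_integrable_mult_pr covariate_functionD[OF gm] F)
  note ab = square_integrableD(1)[OF a] square_integrableD(1)[OF b] square_integrableD(2)[OF a] square_integrableD(2)[OF b]
  have diff: "a (W 0 \<omega>) - b (W 0 \<omega>) = k (W 0 \<omega>)" for \<omega> 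
  proof -
    have "x + z - (- 1 * y + z) = x + y" for x y z :: real by simp
    then show ?thesis by (simp only: a_def b_def k_def)
  qed
  have b0: "(\<integral>\<omega>. b (W 0 \<omega>) \<partial>M) = 0"
  proof -
    have zero: "covariate_function (\<lambda>_. 0)" and one: "covariate_function (\<lambda>_. - 1)" by (rule covariate_function_const)+
    note cr = residual_cross[OF zero covariate_function_mult_pr(4)[OF one]]
    have ig: "integrable M (\<lambda>\<omega>. g (W 0 \<omega>))" by (rule square_integrableD(3)[OF covariate_functionD[OF F(7)]])
    have eq: "- 1 * (x / s) + z = (0 * y + - 1 / s * x) + z" for x y z s :: real by simp
    have "(\<integral>\<omega>. b (W 0 \<omega>) \<partial>M) = (\<integral>\<omega>. (0 * e1 (W 0 \<omega>) + - 1 / (1 - pr (W 0 \<omega>)) * e0 (W 0 \<omega>)) + (g (W 0 \<omega>) - m) \<partial>M)"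
      by (simp only: b_def eq[symmetric])
    also have "\<dots> = 0 + ((\<integral>\<omega>. g (W 0 \<omega>) \<partial>M) - m)"
      unfolding Bochner_Integration.integral_add[OF cr(2) Bochner_Integration.integrable_diff[OF ig integrable_const]] cr(1)
        Bochner_Integration.integral_diff[OF ig integrable_const] by (simp add: prob_space)
    finally show ?thesis using mean_fit by simp
  qed
  have orth: "(\<integral>\<omega>. (\<Prod>i\<in>J. arm a b n i \<omega>) \<partial>M) = 0" if "J \<subseteq> {..<n}" "J \<noteq> {}" for n J
    by (rule orthogonal_arm_residual[OF ab _ b0 that]) (simp only: diff k0)
  have eq: "AE \<omega> in M. population_error y1 y0 n \<omega> - 1 / sqrt (real n) * (\<Sum>i<n. arm a b n i \<omega>) = balance_error n \<omega>" for n
    using nz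
  proof eventually_elim
    case (elim \<omega>)
    have "D n i \<omega> * y1 (W i \<omega>) / q i \<omega> - (1 - D n i \<omega>) * y0 (W i \<omega>) / (1 - q i \<omega>) - m
      = arm a b n i \<omega> + (D n i \<omega> - q i \<omega>) * (fit1 ?b (W i \<omega>) / q i \<omega>)" for i
    proof -
      define r s where "r = pr (W i \<omega>)" and "s = 1 - pr (W i \<omega>)"
      define z1 z0 E1 E0 where "z1 = fit1 \<beta>1 (W i \<omega>) / r" and "z0 = fit1 \<beta>0 (W i \<omega>) / r"
        and "E1 = e1 (W i \<omega>) / r" and "E0 = e0 (W i \<omega>) / s"
      have r: "r \<noteq> 0" "s \<noteq> 0" "s = 1 - r" using elim by (auto simp: r_def s_def)
      have y: "y1 (W i \<omega>) / r = z1 + E1" "y0 (W i \<omega>) / s = z0 + E0"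
        "fit1 \<beta>1 (W i \<omega>) = r * z1" "fit0 \<beta>0 (W i \<omega>) = s * z0" "fit1 ?b (W i \<omega>) / r = z1 + z0"
        using r(1,2) by (auto simp: z1_def z0_def E1_def E0_def fit1_add fit0_eq r_def s_def
            diff_divide_distrib add_divide_distrib)
      \<comment> \<open>The linear part D z1 - (1 - D) z0 equals its average r z1 - s z0 over the
        assignment plus (D - r) (z1 + z0); the average is g, and the remainder goes into the balance
        error.\<close>
      have "D n i \<omega> * (y1 (W i \<omega>) / r) - (1 - D n i \<omega>) * (y0 (W i \<omega>) / s) - m
        = D n i \<omega> * (E1 + (r * z1 - s * z0 - m)) + (1 - D n i \<omega>) * (- 1 * E0 + (r * z1 - s * z0 - m))
          + (D n i \<omega> - r) * (z1 + z0)"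
        unfolding y unfolding r(3) by (simp add: algebra_simps)
      also have "\<dots> = arm a b n i \<omega> + (D n i \<omega> - r) * (fit1 ?b (W i \<omega>) / r)"
        unfolding arm_def a_def b_def y(5) by (simp only: y(3,4) E1_def E0_def r_def s_def)
      finally show ?thesis by (simp add: r_def s_def q_def)
    qed
    then show ?case by (simp add: population_error_def balance_error_def sum.distrib add_divide_distrib)
  qed
  have Tm: "(\<lambda>\<omega>. population_error y1 y0 n \<omega> - 1 / sqrt (real n) * (\<Sum>i<n. arm a b n i \<omega>)) \<in> borel_measurable M" for n
    using arm_measurable[OF ab]
    by (intro borel_measurable_diff em(2) borel_measurable_times borel_measurable_const borel_measurable_sum) auto
  have nl: "null_in_prob M (\<lambda>n \<omega>. population_error y1 y0 n \<omega> - 1 / sqrt (real n) * (\<Sum>i<n. arm a b n i \<omega>))"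
  proof (rule null_in_prob_mono[OF balance_error_measurable Tm null, where K = 1])
    show "AE \<omega> in M. min 1 \<bar>population_error y1 y0 n \<omega> - 1 / sqrt (real n) * (\<Sum>i<n. arm a b n i \<omega>)\<bar>
      \<le> 1 * min 1 \<bar>balance_error n \<omega>\<bar>" for n
      using eq[of n] by eventually_elim (simp only: mult_1 order_refl)
  qed
  note conv = converges_from_arms[OF a b orth em(2) nl]
  show "tight_statistic (population_error y1 y0)" by (rule conv(2))
  \<comment> \<open>Coefficients of the residuals in the cross terms; their signs are those with
    which the residuals enter the two arms.\<close>
  define u1 where "u1 w = 2 * (g w - m)" for w
  define u0 where "u0 w = - 2 * (g w - m)" for w
  have u: "covariate_function u1" "covariate_function u0"
    unfolding u1_def u0_def by (intro covariate_function_cmult gm)+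
  note cross = residual_cross[OF u]
  note is1 = integrable_weighted_squares(1)[OF F(5)] and is0 = integrable_weighted_squares(2)[OF F(6)]
  have ig: "integrable M (\<lambda>\<omega>. (g (W 0 \<omega>) - m)\<^sup>2)"
    by (rule square_integrableD(2)[OF covariate_functionD[OF gm]])
  have "(\<integral>\<omega>. q 0 \<omega> * (a (W 0 \<omega>))\<^sup>2 + (1 - q 0 \<omega>) * (b (W 0 \<omega>))\<^sup>2 \<partial>M)
    = (\<integral>\<omega>. (g (W 0 \<omega>) - m)\<^sup>2 + (e1 (W 0 \<omega>))\<^sup>2 / q 0 \<omega> + (e0 (W 0 \<omega>))\<^sup>2 / (1 - q 0 \<omega>)
        + (u1 (W 0 \<omega>) * e1 (W 0 \<omega>) + u0 (W 0 \<omega>) * e0 (W 0 \<omega>)) \<partial>M)"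
  proof (rule integral_cong_AE)
    have [measurable]: "(\<lambda>\<omega>. a (W 0 \<omega>)) \<in> borel_measurable M" "(\<lambda>\<omega>. b (W 0 \<omega>)) \<in> borel_measurable M"
      by (rule measurable_compose[OF W_measurable ab(1)], rule measurable_compose[OF W_measurable ab(2)])
    show "(\<lambda>\<omega>. q 0 \<omega> * (a (W 0 \<omega>))\<^sup>2 + (1 - q 0 \<omega>) * (b (W 0 \<omega>))\<^sup>2) \<in> borel_measurable M" by measurable
    show "(\<lambda>\<omega>. (g (W 0 \<omega>) - m)\<^sup>2 + (e1 (W 0 \<omega>))\<^sup>2 / q 0 \<omega> + (e0 (W 0 \<omega>))\<^sup>2 / (1 - q 0 \<omega>)
        + (u1 (W 0 \<omega>) * e1 (W 0 \<omega>) + u0 (W 0 \<omega>) * e0 (W 0 \<omega>))) \<in> borel_measurable M"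
      by (rule borel_measurable_integrable) (intro Bochner_Integration.integrable_add ig is1 is0 cross(2))
    show "AE \<omega> in M. q 0 \<omega> * (a (W 0 \<omega>))\<^sup>2 + (1 - q 0 \<omega>) * (b (W 0 \<omega>))\<^sup>2
      = (g (W 0 \<omega>) - m)\<^sup>2 + (e1 (W 0 \<omega>))\<^sup>2 / q 0 \<omega> + (e0 (W 0 \<omega>))\<^sup>2 / (1 - q 0 \<omega>)
        + (u1 (W 0 \<omega>) * e1 (W 0 \<omega>) + u0 (W 0 \<omega>) * e0 (W 0 \<omega>))"
      using nz
    proof eventually_elim
      case (elim \<omega>)
      define r s where "r = pr (W 0 \<omega>)" and "s = 1 - pr (W 0 \<omega>)"
      define E1 E0 G where "E1 = e1 (W 0 \<omega>) / r" and "E0 = e0 (W 0 \<omega>) / s" and "G = g (W 0 \<omega>) - m"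
      have r: "r \<noteq> 0" "s \<noteq> 0" "s = 1 - r" using elim by (auto simp: r_def s_def)
      have e: "e1 (W 0 \<omega>) = r * E1" "e0 (W 0 \<omega>) = s * E0" using r(1,2) by (auto simp: E1_def E0_def)
      have "r * (E1 + G)\<^sup>2 + s * (- 1 * E0 + G)\<^sup>2 = G\<^sup>2 + (r * E1)\<^sup>2 / r + (s * E0)\<^sup>2 / s + (2 * G * (r * E1) + - 2 * G * (s * E0))"
      proof -
        have "(r * E1)\<^sup>2 / r = r * E1\<^sup>2" "(s * E0)\<^sup>2 / s = s * E0\<^sup>2" using r(1,2) by (auto simp: power2_eq_square)
        then show ?thesis unfolding r(3) by (simp add: power2_eq_square algebra_simps)
      qed
      moreover have "a (W 0 \<omega>) = E1 + G" "b (W 0 \<omega>) = - 1 * E0 + G"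
        by (simp_all add: a_def b_def E1_def E0_def G_def r_def s_def)
      moreover have "u1 (W 0 \<omega>) = 2 * G" "u0 (W 0 \<omega>) = - 2 * G" by (simp_all add: u1_def u0_def G_def)
      ultimately show ?case unfolding e by (simp only: G_def r_def s_def q_def)
    qed
  qed
  also have "\<dots> = population_variance y1 y0 \<beta>1 \<beta>0"
    unfolding population_variance_def mean_fit using ig is1 is0 cross by simp
  finally show "converges_to_normal M (population_error y1 y0) (population_variance y1 y0 \<beta>1 \<beta>0)"
    using conv(1) by simp
qed

end

end

section \<open>The Hajek estimator\<close>

context randomized_design
begin

text \<open>Conditional independence applied to the events D = 1 for units in I and to the whole
  line for the others turns the conditional mean of a product of assignments into the product of
  their conditional means.\<close>

lemma coin_toss_prod:
  assumes coin: "coin_toss M n X q (D n)" and I: "I \<subseteq> {..<n}"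
  shows "AE \<omega> in M. real_cond_exp M (sigma_upto M n X) (\<lambda>\<omega>. \<Prod>i\<in>I. D n i \<omega>) \<omega> = (\<Prod>i\<in>I. q i \<omega>)"
proof -
  interpret FX: finite_measure_subalgebra M "sigma_upto M n X" by (rule finite_measure_subalgebra_X)
  define A where "A i = (if i \<in> I then {1} else UNIV :: real set)" for i :: nat
  let ?E = "real_cond_exp M (sigma_upto M n X)"
  let ?i = "\<lambda>i \<omega>. indicator (A i) (D n i \<omega>) :: real"
  have Am: "A i \<in> sets borel" for i by (simp add: A_def)
  have im: "?i i \<in> borel_measurable M" if "i < n" for i
    by (rule measurable_compose[OF D_measurable[OF that] borel_measurable_indicator[OF Am]])
  have i_eq: "?i i \<omega> = (if i \<in> I then D n i \<omega> else 1)" if "i < n" "\<omega> \<in> space M" for i \<omega>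
    using D_binary[OF that] by (auto simp: A_def)
  have "AE \<omega> in M. ?E (\<lambda>\<omega>. \<Prod>i<n. ?i i \<omega>) \<omega> = (\<Prod>i<n. ?E (?i i) \<omega>)"
    using coin Am unfolding coin_toss_def cond_indep_family_def by blast
  moreover have "AE \<omega> in M. \<forall>i\<in>{..<n}. ?E (?i i) \<omega> = (if i \<in> I then q i \<omega> else 1)"
  proof (rule AE_finite_allI)
    fix i assume "i \<in> {..<n}"
    then have i: "i < n" by simp
    show "AE \<omega> in M. ?E (?i i) \<omega> = (if i \<in> I then q i \<omega> else 1)"
    proof (cases "i \<in> I")
      case True
      have "AE \<omega> in M. ?E (?i i) \<omega> = ?E (D n i) \<omega>"
        by (rule FX.real_cond_exp_cong) (use i_eq[OF i] True D_measurable[OF i] im[OF i] in auto)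
      then show ?thesis using propensity[OF i] by eventually_elim (simp add: True)
    next
      case False
      have "AE \<omega> in M. ?E (?i i) \<omega> = ?E (\<lambda>_. 1) \<omega>"
        by (rule FX.real_cond_exp_cong) (use i_eq[OF i] False im[OF i] in auto)
      moreover have "AE \<omega> in M. ?E (\<lambda>_. 1) \<omega> = 1" by (rule FX.real_cond_exp_F_meas) auto
      ultimately show ?thesis by eventually_elim (simp add: False)
    qed
  qed simp
  moreover have "AE \<omega> in M. ?E (\<lambda>\<omega>. \<Prod>i\<in>I. D n i \<omega>) \<omega> = ?E (\<lambda>\<omega>. \<Prod>i<n. ?i i \<omega>) \<omega>"
  proof (rule FX.real_cond_exp_cong)
    have "(\<Prod>i\<in>I. D n i \<omega>) = (\<Prod>i<n. ?i i \<omega>)" if "\<omega> \<in> space M" for \<omega>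
    proof -
      have "(\<Prod>i<n. ?i i \<omega>) = (\<Prod>i<n. if i \<in> I then D n i \<omega> else 1)"
        by (rule prod.cong) (use i_eq that in auto)
      also have "\<dots> = (\<Prod>i\<in>I. D n i \<omega>)" using I by (simp add: prod.If_cases Int_absorb1)
      finally show ?thesis by simp
    qed
    then show "AE \<omega> in M. (\<Prod>i\<in>I. D n i \<omega>) = (\<Prod>i<n. ?i i \<omega>)" by (rule AE_I2)
    show "(\<lambda>\<omega>. \<Prod>i\<in>I. D n i \<omega>) \<in> borel_measurable M" by (rule prod_D_measurable[OF I])
    show "(\<lambda>\<omega>. \<Prod>i<n. ?i i \<omega>) \<in> borel_measurable M" using im by (intro borel_measurable_prod) auto
  qed
  ultimately show ?thesis
  proof eventually_elim
    case (elim \<omega>)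
    have "(\<Prod>i<n. ?E (?i i) \<omega>) = (\<Prod>i<n. if i \<in> I then q i \<omega> else 1)"
      by (rule prod.cong) (use elim in auto)
    also have "\<dots> = (\<Prod>i\<in>I. q i \<omega>)" using I by (simp add: prod.If_cases Int_absorb1)
    finally show ?case using elim by simp
  qed
qed

end

lemma sqrt_mult_mean: "sqrt (real n) * (1 / real n * s) = 1 / sqrt (real n) * s"
proof (cases "n = 0")
  case False
  then have "sqrt (real n) * (1 / real n) = 1 / sqrt (real n)"
    by (simp add: real_div_sqrt field_simps)
  then show ?thesis by (metis mult.assoc)
qed simp

section \<open>Centring the outcomes and expanding the Hajek ratios\<close>

context asymptotic_design
begin

lemma linear_outcomes_nonneg:
  assumes X2: "integrable M (\<lambda>\<omega>. (norm (X 0 \<omega>))\<^sup>2)" and lin: "linear_outcomes y1 y0 \<beta>1 \<beta>0"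
  shows "0 \<le> residual_variance y1 y0 \<beta>1 \<beta>0" "0 \<le> population_variance y1 y0 \<beta>1 \<beta>0"
proof -
  show "0 \<le> residual_variance y1 y0 \<beta>1 \<beta>0"
    unfolding residual_variance_def
    by (rule integral_nonneg_AE) (use q_unit[of 0] in \<open>eventually_elim, auto\<close>)
  have "0 \<le> (\<integral>\<omega>. (y1 (W 0 \<omega>) - fit1 \<beta>1 (W 0 \<omega>))\<^sup>2 / q 0 \<omega> \<partial>M)"
    by (rule integral_nonneg_AE) (use q_unit[of 0] in \<open>eventually_elim, auto\<close>)
  moreover have "0 \<le> (\<integral>\<omega>. (y0 (W 0 \<omega>) - fit0 \<beta>0 (W 0 \<omega>))\<^sup>2 / (1 - q 0 \<omega>) \<partial>M)"
    by (rule integral_nonneg_AE) (use q_unit[of 0] in \<open>eventually_elim, auto\<close>)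
  moreover have "0 \<le> variance (\<lambda>\<omega>. fit1 \<beta>1 (W 0 \<omega>) - fit0 \<beta>0 (W 0 \<omega>))"
    by (rule integral_nonneg_AE) auto
  ultimately show "0 \<le> population_variance y1 y0 \<beta>1 \<beta>0" unfolding population_variance_def by linarith
qed

text \<open>Residuals after centring agree with the original ones only where \<open>q\<close> is neither \<open>0\<close> nor \<open>1\<close>.\<close>

lemma fit0_centred: "AE \<omega> in M. fit0 (\<beta> - (0, k, 0, 0)) (W i \<omega>) = fit0 \<beta> (W i \<omega>) - k"
  using pr_bounds[of i]
proof eventually_elim
  case (elim \<omega>)
  then have r: "pr (W i \<omega>) \<noteq> 0" "1 - pr (W i \<omega>) \<noteq> 0" using c_pos by auto
  have "fit0 (0, k, 0, 0) (W i \<omega>) = k" using r by (simp add: fit0_def balance0_def balance1_def inner_Pair)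
  then show ?case by (simp add: fit0_def inner_diff_right)
qed

lemma fit1_centred: "fit1 (\<beta> - (k, 0, 0, 0)) w = fit1 \<beta> w - k"
  by (simp add: fit1_def balance1_def inner_Pair inner_diff_right)

text \<open>The component of each balancing vector that is constantly 1 absorbs a shift of the
  outcomes, so residuals persist, and both variances depend on residuals and on predictions up to
  constants only. The versions with a zero arm serve the two Hajek ratios separately.\<close>

lemma linear_outcomes_centred:
  assumes X2: "integrable M (\<lambda>\<omega>. (norm (X 0 \<omega>))\<^sup>2)" and lin: "linear_outcomes y1 y0 \<beta>1 \<beta>0"
  defines "b1 k \<equiv> \<beta>1 - (k, 0, 0, 0)" and "b0 k \<equiv> \<beta>0 - (0, k, 0, 0)"
  shows "linear_outcomes (\<lambda>w. y1 w - k1) (\<lambda>w. y0 w - k0) (b1 k1) (b0 k0)"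
    and "linear_outcomes (\<lambda>w. y1 w - k1) (\<lambda>_. 0) (b1 k1) 0"
    and "linear_outcomes (\<lambda>_. 0) (\<lambda>w. y0 w - k0) 0 (b0 k0)"
    and "residual_variance (\<lambda>w. y1 w - k1) (\<lambda>w. y0 w - k0) (b1 k1) (b0 k0) = residual_variance y1 y0 \<beta>1 \<beta>0"
    and "population_variance (\<lambda>w. y1 w - k1) (\<lambda>w. y0 w - k0) (b1 k1) (b0 k0) = population_variance y1 y0 \<beta>1 \<beta>0"
proof -
  note F = linear_outcomes_facts[OF X2 lin]
  note fit = covariate_function_fit[OF X2]
  have s1: "square_integrable (\<lambda>w. y1 w - k1)" and s0: "square_integrable (\<lambda>w. y0 w - k0)"
    by (intro square_integrable_diff square_integrable_const F)+
  have eq1: "y1 w - k1 - fit1 (b1 k1) w = y1 w - fit1 \<beta>1 w" for w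
    by (simp add: b1_def fit1_centred)
  have eq0: "AE \<omega> in M. y0 (W 0 \<omega>) - k0 - fit0 (b0 k0) (W 0 \<omega>) = y0 (W 0 \<omega>) - fit0 \<beta>0 (W 0 \<omega>)"
    using fit0_centred[of \<beta>0 k0 0] by eventually_elim (simp add: b0_def)
  have s: "square_integrable (\<lambda>w. y0 w - k0 - fit0 (b0 k0) w)"
    by (intro square_integrable_diff s0 covariate_functionD fit)
  have r1: "residual (\<lambda>w. y1 w - k1 - fit1 (b1 k1) w)" unfolding eq1 by (rule F(3))
  have r0: "residual (\<lambda>w. y0 w - k0 - fit0 (b0 k0) w)"
    by (rule residual_cong[OF F(4) square_integrableD(1)[OF s] eq0])
  have z: "fit1 0 = (\<lambda>_. 0)" "fit0 0 = (\<lambda>_. 0)" by (auto simp: fit1_def fit0_def)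
  show "linear_outcomes (\<lambda>w. y1 w - k1) (\<lambda>w. y0 w - k0) (b1 k1) (b0 k0)"
    unfolding linear_outcomes_def using s1 s0 r1 r0 by blast
  show "linear_outcomes (\<lambda>w. y1 w - k1) (\<lambda>_. 0) (b1 k1) 0"
    unfolding linear_outcomes_def z using s1 r1 residual_zero square_integrable_const[of 0] by simp
  show "linear_outcomes (\<lambda>_. 0) (\<lambda>w. y0 w - k0) 0 (b0 k0)"
    unfolding linear_outcomes_def z using s0 r0 residual_zero square_integrable_const[of 0] by simp
  have m: "(\<lambda>\<omega>. f (W 0 \<omega>)) \<in> borel_measurable M" if "square_integrable f" for f
    by (rule measurable_compose[OF W_measurable square_integrableD(1)[OF that]])
  note [measurable] = m[OF covariate_functionD[OF fit(1)]] m[OF covariate_functionD[OF fit(2)]] m[OF F(1)] m[OF F(2)]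
  show "residual_variance (\<lambda>w. y1 w - k1) (\<lambda>w. y0 w - k0) (b1 k1) (b0 k0) = residual_variance y1 y0 \<beta>1 \<beta>0"
    unfolding residual_variance_def eq1
  proof (rule integral_cong_AE)
    show "AE \<omega> in M. q 0 \<omega> * (1 - q 0 \<omega>) * ((y1 (W 0 \<omega>) - fit1 \<beta>1 (W 0 \<omega>)) / q 0 \<omega>
          + (y0 (W 0 \<omega>) - k0 - fit0 (b0 k0) (W 0 \<omega>)) / (1 - q 0 \<omega>))\<^sup>2
      = q 0 \<omega> * (1 - q 0 \<omega>) * ((y1 (W 0 \<omega>) - fit1 \<beta>1 (W 0 \<omega>)) / q 0 \<omega>
          + (y0 (W 0 \<omega>) - fit0 \<beta>0 (W 0 \<omega>)) / (1 - q 0 \<omega>))\<^sup>2"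
      using eq0 by eventually_elim (simp only:)
  qed measurable
  have "(\<integral>\<omega>. (y0 (W 0 \<omega>) - k0 - fit0 (b0 k0) (W 0 \<omega>))\<^sup>2 / (1 - q 0 \<omega>) \<partial>M)
    = (\<integral>\<omega>. (y0 (W 0 \<omega>) - fit0 \<beta>0 (W 0 \<omega>))\<^sup>2 / (1 - q 0 \<omega>) \<partial>M)"
  proof (rule integral_cong_AE)
    show "AE \<omega> in M. (y0 (W 0 \<omega>) - k0 - fit0 (b0 k0) (W 0 \<omega>))\<^sup>2 / (1 - q 0 \<omega>)
      = (y0 (W 0 \<omega>) - fit0 \<beta>0 (W 0 \<omega>))\<^sup>2 / (1 - q 0 \<omega>)"
      using eq0 by eventually_elim (simp only:)
  qed measurable
  moreover have "variance (\<lambda>\<omega>. fit1 (b1 k1) (W 0 \<omega>) - fit0 (b0 k0) (W 0 \<omega>)) = variance (\<lambda>\<omega>. fit1 \<beta>1 (W 0 \<omega>) - fit0 \<beta>0 (W 0 \<omega>))"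
  proof -
    let ?g = "\<lambda>\<omega>. fit1 \<beta>1 (W 0 \<omega>) - fit0 \<beta>0 (W 0 \<omega>)"
    have ae: "AE \<omega> in M. fit1 (b1 k1) (W 0 \<omega>) - fit0 (b0 k0) (W 0 \<omega>) = ?g \<omega> - (k1 - k0)"
      using fit0_centred[of \<beta>0 k0 0] by eventually_elim (simp add: b0_def b1_def fit1_centred)
    have ig: "integrable M ?g" by (rule square_integrableD(3)[OF covariate_functionD[OF F(7)]])
    have "expectation (\<lambda>\<omega>. fit1 (b1 k1) (W 0 \<omega>) - fit0 (b0 k0) (W 0 \<omega>)) = expectation (\<lambda>\<omega>. ?g \<omega> - (k1 - k0))"
      by (rule integral_cong_AE[OF _ _ ae]) measurable
    also have "\<dots> = expectation ?g - (k1 - k0)"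
      unfolding Bochner_Integration.integral_diff[OF ig integrable_const] by (simp add: prob_space)
    finally have e: "expectation (\<lambda>\<omega>. fit1 (b1 k1) (W 0 \<omega>) - fit0 (b0 k0) (W 0 \<omega>)) = expectation ?g - (k1 - k0)" .
    show ?thesis unfolding e
    proof (rule integral_cong_AE)
      show "AE \<omega> in M. (fit1 (b1 k1) (W 0 \<omega>) - fit0 (b0 k0) (W 0 \<omega>) - (expectation ?g - (k1 - k0)))\<^sup>2
        = (?g \<omega> - expectation ?g)\<^sup>2"
        using ae
      proof eventually_elim
        case (elim \<omega>)
        have "a - t - (e - t) = a - e" for a t e :: real by simp
        then show ?case unfolding elim by metis
      qed
    qed measurable
  qed
  ultimately show "population_variance (\<lambda>w. y1 w - k1) (\<lambda>w. y0 w - k0) (b1 k1) (b0 k0) = population_variance y1 y0 \<beta>1 \<beta>0"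
    unfolding population_variance_def eq1 by simp
qed

text \<open>A ratio of weighted sums equals the centring constant k plus the ratio for centred
  outcomes; n B is the weight total, S the centred weighted sum.\<close>

lemma hajek_ratio:
  fixes S1 B1 S0 B0 :: real
  assumes n: "n > 0" and B: "B1 \<noteq> 0" "B0 \<noteq> 0"
  shows "sqrt (real n) * ((S1 + k1 * (real n * B1)) / (real n * B1) - (S0 + k0 * (real n * B0)) / (real n * B0) - (k1 - k0))
    = 1 / sqrt (real n) * S1 * (1 / B1) - 1 / sqrt (real n) * S0 * (1 / B0)"
proof -
  have "(S + k * (real n * B)) / (real n * B) = 1 / real n * (S / B) + k" if "B \<noteq> 0" for S B k
    using n that by (simp add: field_simps)
  then have "sqrt (real n) * ((S1 + k1 * (real n * B1)) / (real n * B1) - (S0 + k0 * (real n * B0)) / (real n * B0) - (k1 - k0))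
    = sqrt (real n) * (1 / real n * (S1 / B1)) - sqrt (real n) * (1 / real n * (S0 / B0))"
    using B by (simp add: right_diff_distrib)
  then show ?thesis unfolding sqrt_mult_mean by simp
qed

text \<open>The Horvitz-Thompson errors coincide almost everywhere with the error statistics above.
  A Hajek error is the error for centred outcomes plus, for each arm, a tight statistic times 1 / B
  - 1, which vanishes in probability; hence it has the limit of the centred problem.\<close>

lemma estimator_limits:
  assumes X2: "integrable M (\<lambda>\<omega>. (norm (X 0 \<omega>))\<^sup>2)" and lin: "linear_outcomes y1 y0 \<beta>1 \<beta>0"
    and lim: "design_limits \<Sigma>" and \<Sigma>: "\<And>b1 b0. 0 \<le> \<Sigma> b1 b0"
  defines "obs n \<omega> \<equiv> observed (\<lambda>i. y0 (W i \<omega>)) (\<lambda>i. y1 (W i \<omega>)) (\<lambda>i. D n i \<omega>)"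
  defines "HT n \<omega> \<equiv> horvitz_thompson n (\<lambda>i. q i \<omega>) (obs n \<omega>) (\<lambda>i. D n i \<omega>)"
    and "HJ n \<omega> \<equiv> hajek n (\<lambda>i. q i \<omega>) (obs n \<omega>) (\<lambda>i. D n i \<omega>)"
    and "\<theta>0 n \<omega> \<equiv> (1 / real n) * (\<Sum>i<n. y1 (W i \<omega>) - y0 (W i \<omega>))"
    and "m1 \<equiv> \<integral>\<omega>. y1 (W 0 \<omega>) \<partial>M" and "m0 \<equiv> \<integral>\<omega>. y0 (W 0 \<omega>) \<partial>M"
  defines "\<theta>s \<equiv> \<integral>\<omega>. y1 (W 0 \<omega>) - y0 (W 0 \<omega>) \<partial>M"
    and "\<Sigma>H \<equiv> \<Sigma> (\<beta>1 - (m1, 0, 0, 0)) (\<beta>0 - (0, m0, 0, 0))"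
  shows "converges_to_normal M (\<lambda>n \<omega>. sqrt (real n) * (HT n \<omega> - \<theta>0 n \<omega>)) (residual_variance y1 y0 \<beta>1 \<beta>0 + \<Sigma> \<beta>1 \<beta>0)"
    and "converges_to_normal M (\<lambda>n \<omega>. sqrt (real n) * (HT n \<omega> - \<theta>s)) (population_variance y1 y0 \<beta>1 \<beta>0 + \<Sigma> \<beta>1 \<beta>0)"
    and "converges_to_normal M (\<lambda>n \<omega>. sqrt (real n) * (HJ n \<omega> - \<theta>0 n \<omega>)) (residual_variance y1 y0 \<beta>1 \<beta>0 + \<Sigma>H)"
    and "converges_to_normal M (\<lambda>n \<omega>. sqrt (real n) * (HJ n \<omega> - \<theta>s)) (population_variance y1 y0 \<beta>1 \<beta>0 + \<Sigma>H)"
proof -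
  note F = linear_outcomes_facts[OF X2 lin]
  note v = linear_outcomes_nonneg[OF X2 lin]
  have i10: "integrable M (\<lambda>\<omega>. y1 (W 0 \<omega>))" "integrable M (\<lambda>\<omega>. y0 (W 0 \<omega>))"
    by (rule square_integrableD(3)[OF F(1)], rule square_integrableD(3)[OF F(2)])
  have \<theta>s: "\<theta>s = m1 - m0" unfolding \<theta>s_def m1_def m0_def by (rule Bochner_Integration.integral_diff[OF i10])
  let ?u1 = "\<lambda>w. y1 w - m1" and ?u0 = "\<lambda>w. y0 w - m0" and ?z = "\<lambda>w :: real \<times> real \<times> 'b. 0 :: real"
  note cen = linear_outcomes_centred(1)[OF X2 lin, where ?k1.0 = m1 and ?k0.0 = m0]
    linear_outcomes_centred(2)[OF X2 lin, where ?k1.0 = m1] linear_outcomes_centred(3)[OF X2 lin, where ?k0.0 = m0]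
    linear_outcomes_centred(4,5)[OF X2 lin, where ?k1.0 = m1 and ?k0.0 = m0]
  have u: "square_integrable ?u1" "square_integrable ?u0" "square_integrable ?z"
    by (intro square_integrable_diff square_integrable_const F)+
  have mean0: "(\<integral>\<omega>. ?u1 (W 0 \<omega>) - ?u0 (W 0 \<omega>) \<partial>M) = 0" "(\<integral>\<omega>. ?u1 (W 0 \<omega>) - ?z (W 0 \<omega>) \<partial>M) = 0"
    "(\<integral>\<omega>. ?z (W 0 \<omega>) - ?u0 (W 0 \<omega>) \<partial>M) = 0"
    using i10 by (simp_all add: m1_def m0_def prob_space)
  have ym: "(\<lambda>\<omega>. y1 (W i \<omega>)) \<in> borel_measurable M" "(\<lambda>\<omega>. y0 (W i \<omega>)) \<in> borel_measurable M" for i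
    by (rule measurable_compose[OF W_measurable square_integrableD(1)[OF F(1)]],
        rule measurable_compose[OF W_measurable square_integrableD(1)[OF F(2)]])
  have nz: "AE \<omega> in M. \<forall>i. q i \<omega> \<noteq> 0 \<and> 1 - q i \<omega> \<noteq> 0"
    using pr_nonzero by (simp add: AE_all_countable q_def)
  have obs_m: "(\<lambda>\<omega>. obs n \<omega> i) \<in> borel_measurable M" if "i < n" for n i
    unfolding obs_def observed_def using ym[of i] D_measurable[OF that] by measurable
  have sums_m: "(\<lambda>\<omega>. \<Sum>i<n. obs n \<omega> i * D n i \<omega> / q i \<omega>) \<in> borel_measurable M"
    "(\<lambda>\<omega>. \<Sum>i<n. D n i \<omega> / q i \<omega>) \<in> borel_measurable M"
    "(\<lambda>\<omega>. \<Sum>i<n. obs n \<omega> i * (1 - D n i \<omega>) / (1 - q i \<omega>)) \<in> borel_measurable M"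
    "(\<lambda>\<omega>. \<Sum>i<n. (1 - D n i \<omega>) / (1 - q i \<omega>)) \<in> borel_measurable M"
    "(\<lambda>\<omega>. \<Sum>i<n. obs n \<omega> i * D n i \<omega> / q i \<omega> - obs n \<omega> i * (1 - D n i \<omega>) / (1 - q i \<omega>)) \<in> borel_measurable M" for n
    using obs_m D_measurable
    by (auto intro!: borel_measurable_sum borel_measurable_divide borel_measurable_times borel_measurable_diff)
  have HTm: "HT n \<in> borel_measurable M" for n
    unfolding HT_def horvitz_thompson_def using sums_m(5)[of n] by (intro borel_measurable_times) auto
  have HJm: "HJ n \<in> borel_measurable M" for n
    unfolding HJ_def hajek_def using sums_m[of n] by (intro borel_measurable_diff borel_measurable_divide) auto
  have \<theta>m: "\<theta>0 n \<in> borel_measurable M" for n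
    unfolding \<theta>0_def using ym by (intro borel_measurable_times borel_measurable_sum borel_measurable_diff) auto
  have err_m: "(\<lambda>\<omega>. sqrt (real n) * (HT n \<omega> - \<theta>0 n \<omega>)) \<in> borel_measurable M"
    "(\<lambda>\<omega>. sqrt (real n) * (HT n \<omega> - \<theta>s)) \<in> borel_measurable M"
    "(\<lambda>\<omega>. sqrt (real n) * (HJ n \<omega> - \<theta>0 n \<omega>)) \<in> borel_measurable M"
    "(\<lambda>\<omega>. sqrt (real n) * (HJ n \<omega> - \<theta>s)) \<in> borel_measurable M" for n
    using HTm[of n] HJm[of n] \<theta>m[of n] by measurable
  have obs: "obs n \<omega> i * D n i \<omega> = D n i \<omega> * y1 (W i \<omega>)"
    "obs n \<omega> i * (1 - D n i \<omega>) = (1 - D n i \<omega>) * y0 (W i \<omega>)" if "i < n" "\<omega> \<in> space M" for n i \<omega>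
    using D_binary[OF that] by (auto simp: obs_def observed_def)
  \<comment> \<open>The term (d - r) (x / r + y / s) with s = 1 - r is the Horvitz-Thompson summand
    of a unit minus its own effect x - y.\<close>
  have se: "sample_error t1 t0 n \<omega> = 1 / sqrt (real n) *
      (\<Sum>i<n. D n i \<omega> * t1 (W i \<omega>) / q i \<omega> - (1 - D n i \<omega>) * t0 (W i \<omega>) / (1 - q i \<omega>) - (t1 (W i \<omega>) - t0 (W i \<omega>)))"
    if "\<forall>i. q i \<omega> \<noteq> 0 \<and> 1 - q i \<omega> \<noteq> 0" for t1 t0 n \<omega>
  proof -
    have "(d - r) * (x / r + y / s) = d * x / r - (1 - d) * y / s - (x - y)" if "r \<noteq> 0" "s \<noteq> 0" "s = 1 - r" for d r s x y :: real
    proof -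
      have "(d - r) * (u + w) = d * u - r * u + (s - (1 - d)) * w" for u w
        unfolding that(3) by (simp add: algebra_simps)
      then have "(d - r) * (x / r + y / s) = d * (x / r) - r * (x / r) + (s - (1 - d)) * (y / s)" .
      also have "\<dots> = d * x / r - (1 - d) * y / s - (x - y)"
        using that(1,2) by (simp add: left_diff_distrib diff_divide_distrib)
      finally show ?thesis .
    qed
    then show ?thesis unfolding sample_error_def using that by simp
  qed
  have HT_se: "AE \<omega> in M. sqrt (real n) * (HT n \<omega> - \<theta>0 n \<omega>) - sample_error y1 y0 n \<omega> = 0" for n
    using nz AE_space
  proof eventually_elim
    case (elim \<omega>)
    have "HT n \<omega> - \<theta>0 n \<omega> = 1 / real n * (\<Sum>i<n. D n i \<omega> * y1 (W i \<omega>) / q i \<omega> - (1 - D n i \<omega>) * y0 (W i \<omega>) / (1 - q i \<omega>) - (y1 (W i \<omega>) - y0 (W i \<omega>)))"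
      unfolding HT_def horvitz_thompson_def \<theta>0_def right_diff_distrib[symmetric] sum_subtractf[symmetric]
      by (intro arg_cong2[where f = "(*)"] refl sum.cong) (simp only: obs[OF _ elim(2)] lessThan_iff)
    then show ?case unfolding se[OF elim(1)] by (simp only: sqrt_mult_mean diff_self)
  qed
  have HT_pe: "AE \<omega> in M. sqrt (real n) * (HT n \<omega> - \<theta>s) - population_error y1 y0 n \<omega> = 0" for n
    using AE_space
  proof eventually_elim
    case (elim \<omega>)
    show ?case
    proof (cases "n = 0")
      case False
      have "HT n \<omega> - \<theta>s = 1 / real n * (\<Sum>i<n. obs n \<omega> i * D n i \<omega> / q i \<omega> - obs n \<omega> i * (1 - D n i \<omega>) / (1 - q i \<omega>) - \<theta>s)"
        unfolding HT_def horvitz_thompson_def using False by (simp add: sum_subtractf diff_divide_distrib)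
      also have "\<dots> = 1 / real n * (\<Sum>i<n. D n i \<omega> * y1 (W i \<omega>) / q i \<omega> - (1 - D n i \<omega>) * y0 (W i \<omega>) / (1 - q i \<omega>) - \<theta>s)"
        by (intro arg_cong2[where f = "(*)"] refl sum.cong) (simp only: obs[OF _ elim] lessThan_iff)
      finally show ?thesis unfolding population_error_def \<theta>s_def[symmetric] by (simp only: sqrt_mult_mean diff_self)
    qed (simp add: population_error_def)
  qed
  have zero_null: "null_in_prob M (\<lambda>n \<omega>. 0)" by (simp add: null_in_prob_def)
  note em = error_measurable[OF square_integrableD(1)[OF F(1)] square_integrableD(1)[OF F(2)]]
  note L = lim[unfolded design_limits_def, rule_format, OF lin]
  show "converges_to_normal M (\<lambda>n \<omega>. sqrt (real n) * (HT n \<omega> - \<theta>0 n \<omega>)) (residual_variance y1 y0 \<beta>1 \<beta>0 + \<Sigma> \<beta>1 \<beta>0)"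
  proof (rule converges_to_normal_cong)
    show "converges_to_normal M (sample_error y1 y0) (residual_variance y1 y0 \<beta>1 \<beta>0 + \<Sigma> \<beta>1 \<beta>0)" using L by blast
    show "null_in_prob M (\<lambda>n \<omega>. sqrt (real n) * (HT n \<omega> - \<theta>0 n \<omega>) - sample_error y1 y0 n \<omega>)"
      by (rule null_in_prob_cong_AE[OF _ _ zero_null HT_se]) (use err_m(1) em(1) in auto)
  qed (use v \<Sigma> err_m em in auto)
  show "converges_to_normal M (\<lambda>n \<omega>. sqrt (real n) * (HT n \<omega> - \<theta>s)) (population_variance y1 y0 \<beta>1 \<beta>0 + \<Sigma> \<beta>1 \<beta>0)"
  proof (rule converges_to_normal_cong)
    show "converges_to_normal M (population_error y1 y0) (population_variance y1 y0 \<beta>1 \<beta>0 + \<Sigma> \<beta>1 \<beta>0)" using L by blast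
    show "null_in_prob M (\<lambda>n \<omega>. sqrt (real n) * (HT n \<omega> - \<theta>s) - population_error y1 y0 n \<omega>)"
      by (rule null_in_prob_cong_AE[OF _ _ zero_null HT_pe]) (use err_m(2) em(2) in auto)
  qed (use v \<Sigma> err_m em in auto)
  \<comment> \<open>Weight means of the two arms, written as 1 plus an average of D - q times a
    square integrable weight so that the law of large numbers applies. They equal 1 for n =
    0.\<close>
  define B1 where "B1 n \<omega> = 1 + 1 / real n * (\<Sum>i<n. (D n i \<omega> - q i \<omega>) * (1 / q i \<omega>))" for n \<omega>
  define B0 where "B0 n \<omega> = 1 + 1 / real n * (\<Sum>i<n. (D n i \<omega> - q i \<omega>) * (- 1 / (1 - q i \<omega>)))" for n \<omega>
  have lln: "null_in_prob M (\<lambda>n \<omega>. 1 / real n * (\<Sum>i<n. (D n i \<omega> - q i \<omega>) * h (W i \<omega>)))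
      \<and> (\<forall>n. (\<lambda>\<omega>. 1 / real n * (\<Sum>i<n. (D n i \<omega> - q i \<omega>) * h (W i \<omega>))) \<in> borel_measurable M)"
    if h: "square_integrable h" for h
  proof
    note hm = square_integrableD(1)[OF h] and hi = square_integrableD(3)[OF h]
    have int: "integrable M (\<lambda>\<omega>. 1 / real n * (\<Sum>i<n. (D n i \<omega> - q i \<omega>) * h (W i \<omega>)))" for n
    proof (intro integrable_mult_right Bochner_Integration.integrable_sum)
      fix i assume "i \<in> {..<n}"
      then have i: "i < n" by simp
      note [measurable] = D_measurable[OF i] measurable_compose[OF W_measurable hm]
      show "integrable M (\<lambda>\<omega>. (D n i \<omega> - q i \<omega>) * h (W i \<omega>))"
        by (rule Bochner_Integration.integrable_bound[OF integrable_W[OF hm hi, of i]])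
           (measurable, use abs_D_minus_q[OF i] in eventually_elim, auto simp: abs_mult intro!: mult_left_le_one_le)
    qed
    show "null_in_prob M (\<lambda>n \<omega>. 1 / real n * (\<Sum>i<n. (D n i \<omega> - q i \<omega>) * h (W i \<omega>)))"
      by (rule null_in_prob_L1[OF int lln_D[OF hm hi]])
    show "\<forall>n. (\<lambda>\<omega>. 1 / real n * (\<Sum>i<n. (D n i \<omega> - q i \<omega>) * h (W i \<omega>))) \<in> borel_measurable M"
      using int by auto
  qed
  have h1: "square_integrable (\<lambda>w. 1 / pr w)" and h0: "square_integrable (\<lambda>w. - 1 / (1 - pr w))"
    by (intro square_integrable_mult_pr square_integrable_const)+
  have Bn: "null_in_prob M (\<lambda>n \<omega>. B1 n \<omega> - 1)" "null_in_prob M (\<lambda>n \<omega>. B0 n \<omega> - 1)"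
    using lln[OF h1] lln[OF h0] by (auto simp: B1_def B0_def q_def)
  have Bm: "B1 n \<in> borel_measurable M" "B0 n \<in> borel_measurable M" for n
  proof -
    have "(\<lambda>\<omega>. 1 + 1 / real n * (\<Sum>i<n. (D n i \<omega> - q i \<omega>) * (1 / pr (W i \<omega>)))) \<in> borel_measurable M"
      by (intro borel_measurable_add borel_measurable_const spec[OF conjunct2[OF lln[OF h1]]])
    then show "B1 n \<in> borel_measurable M" unfolding B1_def q_def .
    have "(\<lambda>\<omega>. 1 + 1 / real n * (\<Sum>i<n. (D n i \<omega> - q i \<omega>) * (- 1 / (1 - pr (W i \<omega>))))) \<in> borel_measurable M"
      by (intro borel_measurable_add borel_measurable_const spec[OF conjunct2[OF lln[OF h0]]])
    then show "B0 n \<in> borel_measurable M" unfolding B0_def q_def .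
  qed
  have Bi: "null_in_prob M (\<lambda>n \<omega>. 1 / B1 n \<omega> - 1)" "null_in_prob M (\<lambda>n \<omega>. 1 / B0 n \<omega> - 1)"
    by (rule null_in_prob_inverse[OF Bm(1) Bn(1)], rule null_in_prob_inverse[OF Bm(2) Bn(2)])
  let ?err = "population_error ?u1 ?u0" and ?P1 = "population_error ?u1 ?z" and ?P0 = "population_error ?z ?u0"
  have Pm: "?err n \<in> borel_measurable M" "?P1 n \<in> borel_measurable M" "?P0 n \<in> borel_measurable M"
    "sample_error ?u1 ?u0 n \<in> borel_measurable M" for n
    by (rule error_measurable; rule square_integrableD(1); rule u)+
  have tight: "tight_statistic ?P1" "tight_statistic ?P0"
    using lim[unfolded design_limits_def, rule_format, OF cen(2)] lim[unfolded design_limits_def, rule_format, OF cen(3)] by auto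
  \<comment> \<open>Tightness is needed for each arm by itself here, since the two arms are divided
    by different weight means.\<close>
  have lin_null: "null_in_prob M (\<lambda>n \<omega>. ?P1 n \<omega> * (1 / B1 n \<omega> - 1) + ?P0 n \<omega> * (1 / B0 n \<omega> - 1))"
    using Pm Bm by (intro null_in_prob_add tight_statistic_mult_null tight Bi) auto
  have P_split: "?err n \<omega> = ?P1 n \<omega> + ?P0 n \<omega>" for n \<omega>
  proof -
    have p: "?P1 n \<omega> = 1 / sqrt (real n) * (\<Sum>i<n. D n i \<omega> * ?u1 (W i \<omega>) / q i \<omega>)"
      "?P0 n \<omega> = 1 / sqrt (real n) * (\<Sum>i<n. - ((1 - D n i \<omega>) * ?u0 (W i \<omega>) / (1 - q i \<omega>)))"
      unfolding population_error_def mean0 by simp_all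
    have "?err n \<omega> = 1 / sqrt (real n) * (\<Sum>i<n. D n i \<omega> * ?u1 (W i \<omega>) / q i \<omega> + - ((1 - D n i \<omega>) * ?u0 (W i \<omega>) / (1 - q i \<omega>)))"
      unfolding population_error_def mean0 by simp
    then show ?thesis unfolding p sum.distrib distrib_left .
  qed
  define E where "E n \<omega> = sqrt (real n) * (HJ n \<omega> - \<theta>s) - ?err n \<omega>
      - (?P1 n \<omega> * (1 / B1 n \<omega> - 1) + ?P0 n \<omega> * (1 / B0 n \<omega> - 1))" for n \<omega>
  have Em: "E n \<in> borel_measurable M" for n
    unfolding E_def using err_m(4)[of n] Pm[of n] Bm[of n] by measurable
  text \<open>The expansion is exact when both arms are non-empty; otherwise a weight total \<open>B1\<close> or \<open>B0\<close> is \<open>0\<close>.\<close>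
  have E0: "AE \<omega> in M. B1 n \<omega> \<noteq> 0 \<and> B0 n \<omega> \<noteq> 0 \<longrightarrow> E n \<omega> = 0" for n
    using nz AE_space
  proof eventually_elim
    case (elim \<omega>)
    show ?case
    proof
      assume B: "B1 n \<omega> \<noteq> 0 \<and> B0 n \<omega> \<noteq> 0"
      show "E n \<omega> = 0"
      proof (cases "n = 0")
        case True
        then show ?thesis by (simp add: E_def population_error_def)
      next
        case False
        then have n: "n > 0" by simp
        have w1: "(\<Sum>i<n. D n i \<omega> / q i \<omega>) = real n * B1 n \<omega>"
        proof -
          have "(\<Sum>i<n. (D n i \<omega> - q i \<omega>) * (1 / q i \<omega>)) = (\<Sum>i<n. D n i \<omega> / q i \<omega> - 1)"
          proof (intro sum.cong refl)
            fix i
            have "(d - r) * (1 / r) = d / r - 1" if "r \<noteq> 0" for d r :: real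
              using that by (simp add: field_simps)
            then show "(D n i \<omega> - q i \<omega>) * (1 / q i \<omega>) = D n i \<omega> / q i \<omega> - 1" using elim(1) by blast
          qed
          then show ?thesis unfolding B1_def using n by (simp only: sum_subtractf) (simp add: field_simps)
        qed
        have w0: "(\<Sum>i<n. (1 - D n i \<omega>) / (1 - q i \<omega>)) = real n * B0 n \<omega>"
        proof -
          have "(\<Sum>i<n. (D n i \<omega> - q i \<omega>) * (- 1 / (1 - q i \<omega>))) = (\<Sum>i<n. (1 - D n i \<omega>) / (1 - q i \<omega>) - 1)"
          proof (intro sum.cong refl)
            fix i
            have "(d - r) * (- 1 / s) = (1 - d) / s - 1" if "s \<noteq> 0" "s = 1 - r" for d r s :: real
            proof -
              have r: "r = 1 - s" using that(2) by simp
              show ?thesis unfolding r using that(1) by (simp add: field_simps)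
            qed
            then show "(D n i \<omega> - q i \<omega>) * (- 1 / (1 - q i \<omega>)) = (1 - D n i \<omega>) / (1 - q i \<omega>) - 1" using elim(1) by blast
          qed
          then show ?thesis unfolding B0_def using n by (simp only: sum_subtractf) (simp add: field_simps)
        qed
        have s1: "(\<Sum>i<n. obs n \<omega> i * D n i \<omega> / q i \<omega>) = (\<Sum>i<n. D n i \<omega> * ?u1 (W i \<omega>) / q i \<omega>) + m1 * (real n * B1 n \<omega>)"
          unfolding w1[symmetric] sum_distrib_left sum.distrib[symmetric]
          by (intro sum.cong refl) (simp only: obs[OF _ elim(2)] lessThan_iff, simp add: right_diff_distrib diff_divide_distrib mult.commute)
        have s0: "(\<Sum>i<n. obs n \<omega> i * (1 - D n i \<omega>) / (1 - q i \<omega>))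
            = (\<Sum>i<n. (1 - D n i \<omega>) * ?u0 (W i \<omega>) / (1 - q i \<omega>)) + m0 * (real n * B0 n \<omega>)"
          unfolding w0[symmetric] sum_distrib_left sum.distrib[symmetric]
          by (intro sum.cong refl) (simp only: obs[OF _ elim(2)] lessThan_iff, simp add: right_diff_distrib diff_divide_distrib mult.commute)
        have p1: "?P1 n \<omega> = 1 / sqrt (real n) * (\<Sum>i<n. D n i \<omega> * ?u1 (W i \<omega>) / q i \<omega>)"
          unfolding population_error_def mean0 by simp
        have p0: "?P0 n \<omega> = - (1 / sqrt (real n) * (\<Sum>i<n. (1 - D n i \<omega>) * ?u0 (W i \<omega>) / (1 - q i \<omega>)))"
          unfolding population_error_def mean0 by (simp add: sum_negf)
        have "sqrt (real n) * (HJ n \<omega> - \<theta>s) = ?P1 n \<omega> * (1 / B1 n \<omega>) + ?P0 n \<omega> * (1 / B0 n \<omega>)"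
          unfolding HJ_def hajek_def s1 s0 w1 w0 \<theta>s p1 p0 hajek_ratio[OF n conjunct1[OF B] conjunct2[OF B]] by simp
        then show ?thesis unfolding E_def P_split by (simp add: right_diff_distrib)
      qed
    qed
  qed
  \<comment> \<open>Where a weight mean is 0 its distance to 1 is 1, so the comparison sequence has
    already reached the truncation level there; elsewhere E is 0.\<close>
  have E_null: "null_in_prob M E"
  proof (rule null_in_prob_mono[where K = 1])
    have "null_in_prob M (\<lambda>n \<omega>. \<bar>B1 n \<omega> - 1\<bar>)"
      by (rule null_in_prob_mono[OF _ _ Bn(1), where K = 1]) (use Bm in auto)
    moreover have "null_in_prob M (\<lambda>n \<omega>. \<bar>B0 n \<omega> - 1\<bar>)"
      by (rule null_in_prob_mono[OF _ _ Bn(2), where K = 1]) (use Bm in auto)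
    ultimately show "null_in_prob M (\<lambda>n \<omega>. \<bar>B1 n \<omega> - 1\<bar> + \<bar>B0 n \<omega> - 1\<bar>)"
      using Bm by (intro null_in_prob_add) auto
    show "AE \<omega> in M. min 1 \<bar>E n \<omega>\<bar> \<le> 1 * min 1 \<bar>\<bar>B1 n \<omega> - 1\<bar> + \<bar>B0 n \<omega> - 1\<bar>\<bar>" for n
      using E0[of n]
    proof eventually_elim
      case (elim \<omega>)
      show ?case
      proof (cases "B1 n \<omega> = 0 \<or> B0 n \<omega> = 0")
        case True
        then have "min 1 \<bar>\<bar>B1 n \<omega> - 1\<bar> + \<bar>B0 n \<omega> - 1\<bar>\<bar> = 1" by auto
        then show ?thesis by simp
      qed (use elim in auto)
    qed
  qed (use Bm Em in auto)
  have pe_null: "null_in_prob M (\<lambda>n \<omega>. sqrt (real n) * (HJ n \<omega> - \<theta>s) - ?err n \<omega>)"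
  proof -
    have "null_in_prob M (\<lambda>n \<omega>. E n \<omega> + (?P1 n \<omega> * (1 / B1 n \<omega> - 1) + ?P0 n \<omega> * (1 / B0 n \<omega> - 1)))"
      using Pm Bm Em by (intro null_in_prob_add E_null lin_null) auto
    then show ?thesis by (simp add: E_def)
  qed
  \<comment> \<open>Changing the target from \<open>\<theta>s\<close> to \<open>\<theta>0\<close>
    shifts the Hajek error and its approximation by the same amount sqrt n (\<theta>0 - \<theta>s),
    so one null sequence serves both limits.\<close>
  have shift: "AE \<omega> in M. sqrt (real n) * (HJ n \<omega> - \<theta>0 n \<omega>) - sample_error ?u1 ?u0 n \<omega> = sqrt (real n) * (HJ n \<omega> - \<theta>s) - ?err n \<omega>" for n
    using nz
  proof eventually_elim
    case (elim \<omega>)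
    show ?case
    proof (cases "n = 0")
      case False
      have "?err n \<omega> - sample_error ?u1 ?u0 n \<omega> = 1 / sqrt (real n) * (\<Sum>i<n. (y1 (W i \<omega>) - y0 (W i \<omega>)) - \<theta>s)"
        unfolding population_error_def mean0 se[OF elim] right_diff_distrib[symmetric] sum_subtractf[symmetric]
        by (intro arg_cong2[where f = "(*)"] refl sum.cong) (simp add: \<theta>s)
      also have "\<dots> = sqrt (real n) * (\<theta>0 n \<omega> - \<theta>s)"
        unfolding sqrt_mult_mean[symmetric] \<theta>0_def using False by (simp add: sum_subtractf diff_divide_distrib)
      finally show ?thesis by (simp add: right_diff_distrib)
    qed (simp add: population_error_def sample_error_def)
  qed
  have se_null: "null_in_prob M (\<lambda>n \<omega>. sqrt (real n) * (HJ n \<omega> - \<theta>0 n \<omega>) - sample_error ?u1 ?u0 n \<omega>)"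
    by (rule null_in_prob_cong_AE[OF _ _ pe_null shift]) (use err_m Pm in auto)
  note L' = lim[unfolded design_limits_def, rule_format, OF cen(1)]
  show "converges_to_normal M (\<lambda>n \<omega>. sqrt (real n) * (HJ n \<omega> - \<theta>0 n \<omega>)) (residual_variance y1 y0 \<beta>1 \<beta>0 + \<Sigma>H)"
  proof (rule converges_to_normal_cong[OF _ _ _ _ se_null])
    show "converges_to_normal M (sample_error ?u1 ?u0) (residual_variance y1 y0 \<beta>1 \<beta>0 + \<Sigma>H)"
      using L' unfolding cen(4) \<Sigma>H_def by blast
  qed (use v \<Sigma> err_m Pm in \<open>auto simp: \<Sigma>H_def\<close>)
  show "converges_to_normal M (\<lambda>n \<omega>. sqrt (real n) * (HJ n \<omega> - \<theta>s)) (population_variance y1 y0 \<beta>1 \<beta>0 + \<Sigma>H)"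
  proof (rule converges_to_normal_cong[OF _ _ _ _ pe_null])
    show "converges_to_normal M ?err (population_variance y1 y0 \<beta>1 \<beta>0 + \<Sigma>H)"
      using L' unfolding cen(5) \<Sigma>H_def by blast
  qed (use v \<Sigma> err_m Pm in \<open>auto simp: \<Sigma>H_def\<close>)
qed

end

section \<open>From conditional means given the balancing vectors to residuals\<close>

lemma (in prob_space) integral_cond_exp_zero:
  fixes e :: "'a \<Rightarrow> real" and Z :: "'a \<Rightarrow> 'z::topological_space"
  assumes Z[measurable]: "Z \<in> borel_measurable M" and e: "integrable M e"
    and zero: "AE \<omega> in M. real_cond_exp M (vimage_algebra (space M) Z borel) e \<omega> = 0"
    and f: "f \<in> borel_measurable borel" and int: "integrable M (\<lambda>\<omega>. f (Z \<omega>) * e \<omega>)"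
  shows "(\<integral>\<omega>. f (Z \<omega>) * e \<omega> \<partial>M) = (0 :: real)"
proof -
  let ?F = "vimage_algebra (space M) Z borel"
  have sub: "subalgebra M ?F"
    unfolding subalgebra_def using measurable_sets[OF Z] by (auto simp: sets_vimage_algebra2)
  interpret FX: finite_measure_subalgebra M ?F by unfold_locales (rule sub)
  have fZ: "(\<lambda>\<omega>. f (Z \<omega>)) \<in> borel_measurable ?F"
    by (rule measurable_compose[OF measurable_vimage_algebra1 f]) auto
  have "(\<integral>\<omega>. f (Z \<omega>) * e \<omega> \<partial>M) = (\<integral>\<omega>. f (Z \<omega>) * real_cond_exp M ?F e \<omega> \<partial>M)"
    by (rule FX.real_cond_exp_intg(2)[symmetric, OF int fZ]) (use e in auto)
  also have "\<dots> = (\<integral>\<omega>. 0 \<partial>M)"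
  proof (rule integral_cong_AE)
    show "(\<lambda>\<omega>. f (Z \<omega>) * real_cond_exp M ?F e \<omega>) \<in> borel_measurable M"
      using measurable_from_subalg[OF sub fZ] by measurable
    show "AE \<omega> in M. f (Z \<omega>) * real_cond_exp M ?F e \<omega> = 0" using zero by eventually_elim simp
  qed simp
  finally show ?thesis by simp
qed

text \<open>The regression errors are known only through an equation on the space of M, so their
  measurability is inferred from f before the conditional expectations are compared.\<close>

lemma (in prob_space) cond_exp_zero_cong:
  fixes f e :: "'a \<Rightarrow> real" and Z :: "'a \<Rightarrow> 'z::topological_space"
  assumes Z[measurable]: "Z \<in> borel_measurable M" and f[measurable]: "f \<in> borel_measurable M"
    and eq: "\<And>\<omega>. \<omega> \<in> space M \<Longrightarrow> f \<omega> = e \<omega>"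
    and zero: "AE \<omega> in M. real_cond_exp M (vimage_algebra (space M) Z borel) e \<omega> = 0"
  shows "AE \<omega> in M. real_cond_exp M (vimage_algebra (space M) Z borel) f \<omega> = 0"
proof -
  let ?F = "vimage_algebra (space M) Z borel"
  have sub: "subalgebra M ?F"
    unfolding subalgebra_def using measurable_sets[OF Z] by (auto simp: sets_vimage_algebra2)
  interpret FX: finite_measure_subalgebra M ?F by unfold_locales (rule sub)
  have "e \<in> borel_measurable M" using f measurable_cong[of M f e borel] eq by blast
  then have "AE \<omega> in M. real_cond_exp M ?F f \<omega> = real_cond_exp M ?F e \<omega>"
    by (intro FX.real_cond_exp_cong AE_I2 eq f)
  then show ?thesis using zero by eventually_elim simp
qed

context asymptotic_design
begin

lemma cube_design_limits:
  assumes X2: "integrable M (\<lambda>\<omega>. (norm (X 0 \<omega>))\<^sup>2)"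
    and cube: "\<And>n. cube_method M n X q (\<lambda>i \<omega>. balance1 (q i \<omega>) (X i \<omega>)) (D n)"
  shows "design_limits (\<lambda>_ _. 0)"
  unfolding design_limits_def using cube_limits[OF X2 _ cube] by simp

lemma coin_toss_design_limits:
  assumes X2: "integrable M (\<lambda>\<omega>. (norm (X 0 \<omega>))\<^sup>2)" and coin: "\<And>n. coin_toss M n X q (D n)"
  shows "design_limits (coin_toss_variance M (q 0) (\<lambda>\<omega>. balance0 (q 0 \<omega>) (X 0 \<omega>)))"
  unfolding design_limits_def using coin_toss_limits[OF X2 _ coin_toss_prod[OF coin]] by simp

lemma coin_toss_variance_nonneg: "0 \<le> coin_toss_variance M (q 0) Z b1 b0"
  unfolding coin_toss_variance_def
proof (rule integral_nonneg_AE)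
  show "AE \<omega> in M. 0 \<le> q 0 \<omega> / (1 - q 0 \<omega>) * (Z \<omega> \<bullet> (b1 + b0))\<^sup>2"
    using q_unit[of 0] by eventually_elim auto
qed

text \<open>Both balancing vectors determine the covariate: their last component times one minus their third
  one is \<open>x\<close>.\<close>

lemma residualI:
  fixes Z :: "'a \<Rightarrow> real \<times> real \<times> real \<times> 'b"
  assumes e: "square_integrable e"
    and Z: "Z \<in> borel_measurable M" "AE \<omega> in M. (1 - fst (snd (snd (Z \<omega>)))) *\<^sub>R snd (snd (snd (Z \<omega>))) = X 0 \<omega>"
    and zero: "AE \<omega> in M. real_cond_exp M (vimage_algebra (space M) Z borel) (\<lambda>\<omega>. e (W 0 \<omega>)) \<omega> = 0"
  shows "residual e"
  unfolding residual_def
proof (intro conjI e ballI impI)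
  fix K :: "'b \<Rightarrow> real" assume K[measurable]: "K \<in> borel_measurable borel"
    and int: "integrable M (\<lambda>\<omega>. K (X 0 \<omega>) * e (W 0 \<omega>))"
  define f where "f z = K ((1 - fst (snd (snd z))) *\<^sub>R snd (snd (snd z)))" for z :: "real \<times> real \<times> real \<times> 'b"
  have f: "f \<in> borel_measurable borel"
    unfolding f_def
    by (rule measurable_compose[OF _ K]) (intro borel_measurable_continuous_onI continuous_intros)
  have eq: "AE \<omega> in M. K (X 0 \<omega>) * e (W 0 \<omega>) = f (Z \<omega>) * e (W 0 \<omega>)"
    using Z(2) by eventually_elim (simp add: f_def)
  have fm: "(\<lambda>\<omega>. f (Z \<omega>) * e (W 0 \<omega>)) \<in> borel_measurable M"
    by (intro borel_measurable_times measurable_compose[OF Z(1) f] measurable_compose[OF W_measurable square_integrableD(1)[OF e]])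
  have "(\<integral>\<omega>. K (X 0 \<omega>) * e (W 0 \<omega>) \<partial>M) = (\<integral>\<omega>. f (Z \<omega>) * e (W 0 \<omega>) \<partial>M)"
    by (rule integral_cong_AE[OF borel_measurable_integrable[OF int] fm eq])
  also have "\<dots> = 0"
    by (rule integral_cond_exp_zero[OF Z(1) square_integrableD(3)[OF e] zero f
          integrable_cong_AE_imp[OF int fm eq]])
  finally show "(\<integral>\<omega>. K (X 0 \<omega>) * e (W 0 \<omega>) \<partial>M) = 0" .
qed

text \<open>Translation of the model: outcomes become coordinates of the triple, and conditional
  mean zero given a balancing vector becomes \<open>residual\<close>, as that vector determines the
  covariate almost everywhere.\<close>

lemma linear_outcomes_observed:
  fixes Y0 Y1 :: "nat \<Rightarrow> 'a \<Rightarrow> real"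
  assumes W: "\<And>i \<omega>. W i \<omega> = (Y0 i \<omega>, Y1 i \<omega>, X i \<omega>)"
    and sq: "integrable M (\<lambda>\<omega>. (Y0 0 \<omega>)\<^sup>2)" "integrable M (\<lambda>\<omega>. (Y1 0 \<omega>)\<^sup>2)" "integrable M (\<lambda>\<omega>. (norm (X 0 \<omega>))\<^sup>2)"
    and Y1_eq: "\<And>\<omega>. \<omega> \<in> space M \<Longrightarrow> Y1 0 \<omega> = balance1 (q 0 \<omega>) (X 0 \<omega>) \<bullet> \<beta>1 + \<epsilon>1 \<omega>"
    and Y0_eq: "\<And>\<omega>. \<omega> \<in> space M \<Longrightarrow> Y0 0 \<omega> = balance0 (q 0 \<omega>) (X 0 \<omega>) \<bullet> \<beta>0 + \<epsilon>0 \<omega>"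
    and \<epsilon>1: "AE \<omega> in M. real_cond_exp M (vimage_algebra (space M) (\<lambda>\<omega>. balance1 (q 0 \<omega>) (X 0 \<omega>)) borel) \<epsilon>1 \<omega> = 0"
    and \<epsilon>0: "AE \<omega> in M. real_cond_exp M (vimage_algebra (space M) (\<lambda>\<omega>. balance0 (q 0 \<omega>) (X 0 \<omega>)) borel) \<epsilon>0 \<omega> = 0"
  shows "linear_outcomes (\<lambda>w. fst (snd w)) fst \<beta>1 \<beta>0"
    and "\<And>\<omega>. \<omega> \<in> space M \<Longrightarrow> fst (snd (W 0 \<omega>)) - fit1 \<beta>1 (W 0 \<omega>) = \<epsilon>1 \<omega>"
    and "\<And>\<omega>. \<omega> \<in> space M \<Longrightarrow> fst (W 0 \<omega>) - fit0 \<beta>0 (W 0 \<omega>) = \<epsilon>0 \<omega>"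
proof -
  have "(\<lambda>w :: real \<times> real \<times> 'b. fst (snd w)) \<in> borel_measurable borel" "(\<lambda>w :: real \<times> real \<times> 'b. fst w) \<in> borel_measurable borel"
    by (intro borel_measurable_continuous_onI continuous_intros)+
  then have s1: "square_integrable (\<lambda>w. fst (snd w))" and s0: "square_integrable fst"
    using sq by (auto simp: square_integrable_def W)
  have qX: "pr (W 0 \<omega>) = q 0 \<omega>" "snd (snd (W 0 \<omega>)) = X 0 \<omega>" for \<omega> by (simp_all add: q_def X_def)
  show e1: "fst (snd (W 0 \<omega>)) - fit1 \<beta>1 (W 0 \<omega>) = \<epsilon>1 \<omega>" if "\<omega> \<in> space M" for \<omega>
    using Y1_eq[OF that] unfolding fit1_def qX(1) unfolding qX(2) by (simp add: W)
  show e0: "fst (W 0 \<omega>) - fit0 \<beta>0 (W 0 \<omega>) = \<epsilon>0 \<omega>" if "\<omega> \<in> space M" for \<omega>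
    using Y0_eq[OF that] unfolding fit0_def qX(1) unfolding qX(2) by (simp add: W)
  note fit = covariate_function_fit[OF sq(3)]
  have r1: "square_integrable (\<lambda>w. fst (snd w) - fit1 \<beta>1 w)" and r0: "square_integrable (\<lambda>w. fst w - fit0 \<beta>0 w)"
    by (intro square_integrable_diff s1 s0 covariate_functionD fit)+
  have nz: "AE \<omega> in M. q 0 \<omega> \<noteq> 0 \<and> 1 - q 0 \<omega> \<noteq> 0"
    using overlap[of 0] by eventually_elim (use c_pos in auto)
  have Zm: "(\<lambda>\<omega>. balance1 (q 0 \<omega>) (X 0 \<omega>)) \<in> borel_measurable M"
    unfolding balance1_def by (intro borel_measurable_Pair borel_measurable_scaleR) measurable
  have Zm0: "(\<lambda>\<omega>. balance0 (q 0 \<omega>) (X 0 \<omega>)) \<in> borel_measurable M"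
    unfolding balance0_def by (intro borel_measurable_scaleR Zm) measurable
  have "residual (\<lambda>w. fst (snd w) - fit1 \<beta>1 w)"
  proof (rule residualI[OF r1 Zm])
    show "AE \<omega> in M. (1 - fst (snd (snd (balance1 (q 0 \<omega>) (X 0 \<omega>))))) *\<^sub>R snd (snd (snd (balance1 (q 0 \<omega>) (X 0 \<omega>)))) = X 0 \<omega>"
      using nz by eventually_elim (simp add: balance1_def)
    show "AE \<omega> in M. real_cond_exp M (vimage_algebra (space M) (\<lambda>\<omega>. balance1 (q 0 \<omega>) (X 0 \<omega>)) borel)
        (\<lambda>\<omega>. fst (snd (W 0 \<omega>)) - fit1 \<beta>1 (W 0 \<omega>)) \<omega> = 0"
      by (rule cond_exp_zero_cong[OF Zm _ e1 \<epsilon>1]) (rule measurable_compose[OF W_measurable square_integrableD(1)[OF r1]])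
  qed
  moreover have "residual (\<lambda>w. fst w - fit0 \<beta>0 w)"
  proof (rule residualI[OF r0 Zm0])
    \<comment> \<open>For untreated units the third component is 1 - q and the last one x / q, so
      the recovery formula multiplies x / q by q.\<close>
    show "AE \<omega> in M. (1 - fst (snd (snd (balance0 (q 0 \<omega>) (X 0 \<omega>))))) *\<^sub>R snd (snd (snd (balance0 (q 0 \<omega>) (X 0 \<omega>)))) = X 0 \<omega>"
      using nz by eventually_elim (simp add: balance0_def balance1_def)
    show "AE \<omega> in M. real_cond_exp M (vimage_algebra (space M) (\<lambda>\<omega>. balance0 (q 0 \<omega>) (X 0 \<omega>)) borel)
        (\<lambda>\<omega>. fst (W 0 \<omega>) - fit0 \<beta>0 (W 0 \<omega>)) \<omega> = 0"
      by (rule cond_exp_zero_cong[OF Zm0 _ e0 \<epsilon>0]) (rule measurable_compose[OF W_measurable square_integrableD(1)[OF r0]])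
  qed
  ultimately show "linear_outcomes (\<lambda>w. fst (snd w)) fst \<beta>1 \<beta>0"
    unfolding linear_outcomes_def using s1 s0 by simp
qed

end

section \<open>The limit theorem for both designs and both estimators\<close>

theorem proposition3:
  fixes M :: "'a measure"
    and Y0 Y1 :: "nat \<Rightarrow> 'a \<Rightarrow> real"
    and X :: "nat \<Rightarrow> 'a \<Rightarrow> real ^ 'p"
    and D :: "nat \<Rightarrow> nat \<Rightarrow> 'a \<Rightarrow> real"
    and p :: "real ^ 'p \<Rightarrow> real"
    and c :: real
    and q :: "nat \<Rightarrow> 'a \<Rightarrow> real"
    and Z1 Z0 :: "nat \<Rightarrow> 'a \<Rightarrow> real \<times> real \<times> real \<times> (real ^ 'p)"
    and \<beta>1 \<beta>0 :: "real \<times> real \<times> real \<times> (real ^ 'p)"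
    and \<epsilon>1 \<epsilon>0 :: "nat \<Rightarrow> 'a \<Rightarrow> real"
    and \<theta>HT \<theta>H \<theta>0 :: "nat \<Rightarrow> 'a \<Rightarrow> real"
    and \<theta>star V0 Vstar \<Sigma>0 \<Sigma>H :: real
  assumes prob: "prob_space M"
    \<comment> \<open>(1)\<close>
    and indep: "prob_space.indep_vars M (\<lambda>_. borel) (\<lambda>i \<omega>. (Y0 i \<omega>, Y1 i \<omega>, X i \<omega>)) UNIV"
    and ident: "\<And>i. distr M borel (\<lambda>\<omega>. (Y0 i \<omega>, Y1 i \<omega>, X i \<omega>)) =
                     distr M borel (\<lambda>\<omega>. (Y0 0 \<omega>, Y1 0 \<omega>, X 0 \<omega>))"
    and moments: "integrable M (\<lambda>\<omega>. (Y0 0 \<omega>)\<^sup>2 + (Y1 0 \<omega>)\<^sup>2 + (norm (X 0 \<omega>))\<^sup>2)"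
    \<comment> \<open>(2)\<close>
    and D_measurable: "\<And>n i. i < n \<Longrightarrow> D n i \<in> borel_measurable M"
    and D_binary: "\<And>n i \<omega>. i < n \<Longrightarrow> \<omega> \<in> space M \<Longrightarrow> D n i \<omega> \<in> {0, 1}"
    and unconfounded: "\<And>n. cond_indep_pair M (sigma_upto M n X)
          (Pi\<^sub>M {..<n} (\<lambda>_. borel)) (\<lambda>\<omega>. \<lambda>i\<in>{..<n}. D n i \<omega>)
          (Pi\<^sub>M {..<n} (\<lambda>_. borel)) (\<lambda>\<omega>. \<lambda>i\<in>{..<n}. (Y0 i \<omega>, Y1 i \<omega>))"
    and p_measurable: "p \<in> borel_measurable borel"
    and q: "\<And>i \<omega>. q i \<omega> = p (X i \<omega>)"
    and propensity: "\<And>n i. i < n \<Longrightarrow> AE \<omega> in M.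
          real_cond_exp M (sigma_upto M n X) (indicator {\<omega> \<in> space M. D n i \<omega> = 1}) \<omega> = q i \<omega>"
    and c_pos: "c > 0"
    and overlap: "\<And>i. AE \<omega> in M. q i \<omega> \<in> {c..1 - c}"
    \<comment> \<open>(3)\<close>
    and Z1: "\<And>i \<omega>. Z1 i \<omega> = balance1 (q i \<omega>) (X i \<omega>)"
    and Z0: "\<And>i \<omega>. Z0 i \<omega> = balance0 (q i \<omega>) (X i \<omega>)"
    and Y1_eq: "\<And>i \<omega>. \<omega> \<in> space M \<Longrightarrow> Y1 i \<omega> = Z1 i \<omega> \<bullet> \<beta>1 + \<epsilon>1 i \<omega>"
    and Y0_eq: "\<And>i \<omega>. \<omega> \<in> space M \<Longrightarrow> Y0 i \<omega> = Z0 i \<omega> \<bullet> \<beta>0 + \<epsilon>0 i \<omega>"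
    and \<epsilon>1: "\<And>i. AE \<omega> in M. real_cond_exp M (vimage_algebra (space M) (Z1 i) borel) (\<epsilon>1 i) \<omega> = 0"
    and \<epsilon>0: "\<And>i. AE \<omega> in M. real_cond_exp M (vimage_algebra (space M) (Z0 i) borel) (\<epsilon>0 i) \<omega> = 0"
    \<comment> \<open>notation\<close>
    and \<theta>HT: "\<And>n \<omega>. \<theta>HT n \<omega> = horvitz_thompson n (\<lambda>i. q i \<omega>)
          (observed (\<lambda>i. Y0 i \<omega>) (\<lambda>i. Y1 i \<omega>) (\<lambda>i. D n i \<omega>)) (\<lambda>i. D n i \<omega>)"
    and \<theta>H: "\<And>n \<omega>. \<theta>H n \<omega> = hajek n (\<lambda>i. q i \<omega>)
          (observed (\<lambda>i. Y0 i \<omega>) (\<lambda>i. Y1 i \<omega>) (\<lambda>i. D n i \<omega>)) (\<lambda>i. D n i \<omega>)"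
    and \<theta>0: "\<And>n \<omega>. \<theta>0 n \<omega> = (1 / real n) * (\<Sum>i<n. Y1 i \<omega> - Y0 i \<omega>)"
    and \<theta>star: "\<theta>star = (\<integral>\<omega>. Y1 0 \<omega> - Y0 0 \<omega> \<partial>M)"
    and V0: "V0 = (\<integral>\<omega>. q 0 \<omega> * (1 - q 0 \<omega>) * (\<epsilon>1 0 \<omega> / q 0 \<omega> + \<epsilon>0 0 \<omega> / (1 - q 0 \<omega>))\<^sup>2 \<partial>M)"
    and Vstar: "Vstar = prob_space.variance M (\<lambda>\<omega>. Z1 0 \<omega> \<bullet> \<beta>1 - Z0 0 \<omega> \<bullet> \<beta>0)
          + (\<integral>\<omega>. (\<epsilon>1 0 \<omega>)\<^sup>2 / q 0 \<omega> \<partial>M) + (\<integral>\<omega>. (\<epsilon>0 0 \<omega>)\<^sup>2 / (1 - q 0 \<omega>) \<partial>M)"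
    and \<Sigma>0: "\<Sigma>0 = coin_toss_variance M (q 0) (Z0 0) \<beta>1 \<beta>0"
    and \<Sigma>H: "\<Sigma>H = coin_toss_variance_hajek M (q 0) (Z0 0) \<beta>1 \<beta>0
          (\<integral>\<omega>. Y1 0 \<omega> \<partial>M) (\<integral>\<omega>. Y0 0 \<omega> \<partial>M)"
  shows
    \<comment> \<open>cube method; the Poisson approximation is assumption (4)\<close>
    "((\<forall>n. cube_method M n X q Z1 (D n)) \<and> poisson_approximation M X q D \<longrightarrow>
       (\<forall>\<theta>\<in>{\<theta>HT, \<theta>H}.
         converges_to_normal M (\<lambda>n \<omega>. sqrt (real n) * (\<theta> n \<omega> - \<theta>0 n \<omega>)) V0 \<and>
         converges_to_normal M (\<lambda>n \<omega>. sqrt (real n) * (\<theta> n \<omega> - \<theta>star)) Vstar)) \<and>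
     ((\<forall>n. coin_toss M n X q (D n)) \<longrightarrow>
       (\<forall>(\<theta>, \<Sigma>)\<in>{(\<theta>HT, \<Sigma>0), (\<theta>H, \<Sigma>H)}.
         converges_to_normal M (\<lambda>n \<omega>. sqrt (real n) * (\<theta> n \<omega> - \<theta>0 n \<omega>)) (V0 + \<Sigma>) \<and>
         converges_to_normal M (\<lambda>n \<omega>. sqrt (real n) * (\<theta> n \<omega> - \<theta>star)) (Vstar + \<Sigma>))) \<and>
     \<Sigma>0 \<ge> 0"
proof -
  interpret prob_space M by (rule prob)
  define W where "W i \<omega> = (Y0 i \<omega>, Y1 i \<omega>, X i \<omega>)" for i \<omega>
  have X_W: "X = (\<lambda>i \<omega>. snd (snd (W i \<omega>)))" by (auto simp: W_def)
  have q_W: "q = (\<lambda>i \<omega>. p (snd (snd (W i \<omega>))))" by (intro ext) (simp add: W_def q)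
  have base: "randomized_design M W D p c"
  proof
    show "indep_vars (\<lambda>_. borel) W UNIV" using indep unfolding W_def[abs_def] .
    show "distr M borel (W i) = distr M borel (W 0)" for i using ident[of i] unfolding W_def[abs_def] .
    show "cond_indep_pair M (sigma_upto M n (\<lambda>i \<omega>. snd (snd (W i \<omega>))))
          (Pi\<^sub>M {..<n} (\<lambda>_. borel)) (\<lambda>\<omega>. \<lambda>i\<in>{..<n}. D n i \<omega>)
          (Pi\<^sub>M {..<n} (\<lambda>_. borel)) (\<lambda>\<omega>. \<lambda>i\<in>{..<n}. (fst (W i \<omega>), fst (snd (W i \<omega>))))" for n
      using unconfounded[of n] by (simp add: W_def)
    show "AE \<omega> in M. real_cond_exp M (sigma_upto M n (\<lambda>i \<omega>. snd (snd (W i \<omega>)))) (D n i) \<omega> = p (snd (snd (W i \<omega>)))" if "i < n" for n i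
    proof -
      have Xm: "X i \<in> borel_measurable M" for i
      proof -
        have "W i \<in> borel_measurable M"
          using indep unfolding indep_vars_def W_def[abs_def] by blast
        from measurable_compose[OF this measurable_covariate] show ?thesis by (simp add: W_def)
      qed
      interpret FX: finite_measure_subalgebra M "sigma_upto M n X"
        by unfold_locales (rule subalgebra_sigma_upto[OF Xm])
      note [measurable] = D_measurable[OF that]
      have "AE \<omega> in M. real_cond_exp M (sigma_upto M n X) (D n i) \<omega>
          = real_cond_exp M (sigma_upto M n X) (indicator {\<omega> \<in> space M. D n i \<omega> = 1}) \<omega>"
      proof (rule FX.real_cond_exp_cong)
        show "AE \<omega> in M. D n i \<omega> = indicator {\<omega> \<in> space M. D n i \<omega> = 1} \<omega>"
          using D_binary[OF that] by (intro AE_I2) (auto simp: indicator_def)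
      qed measurable
      then show ?thesis using propensity[OF that] unfolding X_W[symmetric]
        by eventually_elim (simp add: q W_def)
    qed
    show "AE \<omega> in M. p (snd (snd (W i \<omega>))) \<in> {c..1 - c}" for i
      using overlap[of i] by (simp add: q W_def)
  qed (use D_measurable D_binary p_measurable c_pos in auto)
  interpret R: randomized_design M W D p c X q
    by (rule base, rule eq_reflection[OF X_W], rule eq_reflection[OF q_W])
  have W: "W i \<omega> = (Y0 i \<omega>, Y1 i \<omega>, X i \<omega>)" for i \<omega> by (simp add: W_def)
  have [measurable]: "Y0 i \<in> borel_measurable M" "Y1 i \<in> borel_measurable M" for i
    using measurable_compose[OF R.W_measurable measurable_outcomes, of i]
      measurable_compose[OF measurable_compose[OF R.W_measurable measurable_outcomes, of i] borel_measurable_continuous_onI[OF continuous_on_fst[OF continuous_on_id]]]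
      measurable_compose[OF measurable_compose[OF R.W_measurable measurable_outcomes, of i] borel_measurable_continuous_onI[OF continuous_on_snd[OF continuous_on_id]]]
    by (simp_all add: W)
  have sq: "integrable M (\<lambda>\<omega>. (Y0 0 \<omega>)\<^sup>2)" "integrable M (\<lambda>\<omega>. (Y1 0 \<omega>)\<^sup>2)" "integrable M (\<lambda>\<omega>. (norm (X 0 \<omega>))\<^sup>2)"
    by (rule Bochner_Integration.integrable_bound[OF moments]; auto)+
  have Z1': "Z1 = (\<lambda>i \<omega>. balance1 (q i \<omega>) (X i \<omega>))" and Z0': "Z0 = (\<lambda>i \<omega>. balance0 (q i \<omega>) (X i \<omega>))"
    by (intro ext, simp only: Z1, intro ext, simp only: Z0)
  \<comment> \<open>The end common to both designs. \<open>S\<close> gives the additional variance,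
    evaluated at the original coefficients for Horvitz-Thompson and at those of the outcomes centred
    at their means for Hajek.\<close>
  have conclude: "\<forall>(\<theta>, \<Sigma>)\<in>{(\<theta>HT, S \<beta>1 \<beta>0),
        (\<theta>H, S (\<beta>1 - ((\<integral>\<omega>. Y1 0 \<omega> \<partial>M), 0, 0, 0)) (\<beta>0 - (0, (\<integral>\<omega>. Y0 0 \<omega> \<partial>M), 0, 0)))}.
      converges_to_normal M (\<lambda>n \<omega>. sqrt (real n) * (\<theta> n \<omega> - \<theta>0 n \<omega>)) (V0 + \<Sigma>) \<and>
      converges_to_normal M (\<lambda>n \<omega>. sqrt (real n) * (\<theta> n \<omega> - \<theta>star)) (Vstar + \<Sigma>)"
    if A: "asymptotic_design M W D p c \<delta>" and S0: "\<And>b1 b0. 0 \<le> S b1 b0"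
      and lim: "asymptotic_design.design_limits M W D p S" for \<delta> S
  proof -
    interpret A: asymptotic_design M W D p c X q \<delta>
      by (rule A, rule eq_reflection[OF X_W], rule eq_reflection[OF q_W])
    note lin = A.linear_outcomes_observed[OF W sq, of \<beta>1 "\<epsilon>1 0" \<beta>0 "\<epsilon>0 0"]
    have l: "A.linear_outcomes (\<lambda>w. fst (snd w)) fst \<beta>1 \<beta>0"
      and e1: "\<And>\<omega>. \<omega> \<in> space M \<Longrightarrow> fst (snd (W 0 \<omega>)) - A.fit1 \<beta>1 (W 0 \<omega>) = \<epsilon>1 0 \<omega>"
      and e0: "\<And>\<omega>. \<omega> \<in> space M \<Longrightarrow> fst (W 0 \<omega>) - A.fit0 \<beta>0 (W 0 \<omega>) = \<epsilon>0 0 \<omega>"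
      using lin Y1_eq[of _ 0] Y0_eq[of _ 0] \<epsilon>1[of 0] \<epsilon>0[of 0] unfolding Z1' Z0' by blast+
    have fit: "A.fit1 \<beta>1 (W 0 \<omega>) = Z1 0 \<omega> \<bullet> \<beta>1" "A.fit0 \<beta>0 (W 0 \<omega>) = Z0 0 \<omega> \<bullet> \<beta>0" for \<omega>
      by (simp_all add: A.fit1_def A.fit0_def Z1 Z0 W q)
    have v: "A.residual_variance (\<lambda>w. fst (snd w)) fst \<beta>1 \<beta>0 = V0"
      unfolding A.residual_variance_def V0
      by (rule Bochner_Integration.integral_cong) (simp_all only: e1 e0)
    have "(\<integral>\<omega>. (fst (snd (W 0 \<omega>)) - A.fit1 \<beta>1 (W 0 \<omega>))\<^sup>2 / q 0 \<omega> \<partial>M) = (\<integral>\<omega>. (\<epsilon>1 0 \<omega>)\<^sup>2 / q 0 \<omega> \<partial>M)"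
      "(\<integral>\<omega>. (fst (W 0 \<omega>) - A.fit0 \<beta>0 (W 0 \<omega>))\<^sup>2 / (1 - q 0 \<omega>) \<partial>M) = (\<integral>\<omega>. (\<epsilon>0 0 \<omega>)\<^sup>2 / (1 - q 0 \<omega>) \<partial>M)"
      by (rule Bochner_Integration.integral_cong, rule refl, simp only: e1 e0)+
    then have vs: "A.population_variance (\<lambda>w. fst (snd w)) fst \<beta>1 \<beta>0 = Vstar"
      unfolding A.population_variance_def Vstar fit by simp
    note L = A.estimator_limits[OF sq(3) l lim S0, unfolded v vs W fst_conv snd_conv]
    show ?thesis
      using L by (auto simp: \<theta>HT[abs_def] \<theta>H[abs_def] \<theta>0[abs_def] \<theta>star)
  qed
  have design: "asymptotic_design M W D p c \<delta>"
    if "\<And>n. \<delta> n \<in> borel_measurable M" "null_in_prob M \<delta>"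
      "\<And>n i j. i < n \<Longrightarrow> j < n \<Longrightarrow> i \<noteq> j \<Longrightarrow> AE \<omega> in M.
        \<bar>real_cond_exp M (sigma_upto M n X) (\<lambda>\<omega>. (D n i \<omega> - q i \<omega>) * (D n j \<omega> - q j \<omega>)) \<omega>\<bar> \<le> \<delta> n \<omega>" for \<delta>
    using that base unfolding asymptotic_design_def asymptotic_design_axioms_def X_W q_W by blast
  show ?thesis
  proof (intro conjI impI)
    assume H: "(\<forall>n. cube_method M n X q Z1 (D n)) \<and> poisson_approximation M X q D"
    \<comment> \<open>A supremum over finitely many pairs, hence measurable. Its almost sure
      convergence becomes convergence in probability by dominated convergence of the
      truncation.\<close>
    define \<delta> where "\<delta> n \<omega> = (SUP I\<in>{I. I \<subseteq> {..<n} \<and> card I = 2}.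
        \<bar>real_cond_exp M (sigma_upto M n X) (\<lambda>\<omega>. \<Prod>i\<in>I. (D n i \<omega> - q i \<omega>)) \<omega>\<bar>)" for n \<omega>
    have fin: "finite {I. I \<subseteq> {..<n} \<and> card I = 2}" for n :: nat by simp
    have \<delta>m: "\<delta> n \<in> borel_measurable M" for n
      unfolding \<delta>_def
      by (rule borel_measurable_cSUP) (auto intro!: countable_finite fin bdd_above_finite)
    have "AE \<omega> in M. (\<lambda>n. \<delta> n \<omega>) \<longlonglongrightarrow> 0"
      using H unfolding poisson_approximation_def \<delta>_def by auto
    then have "AE \<omega> in M. (\<lambda>n. min 1 \<bar>\<delta> n \<omega>\<bar>) \<longlonglongrightarrow> 0"
    proof eventually_elim
      case (elim \<omega>)
      from tendsto_min[OF tendsto_const[of 1] tendsto_rabs[OF elim]] show ?case by simp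
    qed
    then have "(\<lambda>n. \<integral>\<omega>. min 1 \<bar>\<delta> n \<omega>\<bar> \<partial>M) \<longlonglongrightarrow> (\<integral>\<omega>. 0 \<partial>M)"
      by (intro integral_dominated_convergence[where w = "\<lambda>_. 1"]) (use \<delta>m in auto)
    then have null: "null_in_prob M \<delta>" by (simp add: null_in_prob_def)
    have A: "asymptotic_design M W D p c \<delta>"
    proof (rule design[OF \<delta>m null])
      fix n i j :: nat assume ij: "i < n" "j < n" "i \<noteq> j"
      let ?f = "\<lambda>I \<omega>. \<bar>real_cond_exp M (sigma_upto M n X) (\<lambda>\<omega>. \<Prod>i\<in>I. (D n i \<omega> - q i \<omega>)) \<omega>\<bar>"
      have "{i, j} \<in> {I. I \<subseteq> {..<n} \<and> card I = 2}" using ij by auto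
      then have "?f {i, j} \<omega> \<le> \<delta> n \<omega>" for \<omega>
        unfolding \<delta>_def by (rule cSUP_upper) (intro bdd_above_finite finite_imageI fin)
      then show "AE \<omega> in M. \<bar>real_cond_exp M (sigma_upto M n X) (\<lambda>\<omega>. (D n i \<omega> - q i \<omega>) * (D n j \<omega> - q j \<omega>)) \<omega>\<bar> \<le> \<delta> n \<omega>"
        using ij by simp
    qed
    interpret A: asymptotic_design M W D p c X q \<delta>
      by (rule A, rule eq_reflection[OF X_W], rule eq_reflection[OF q_W])
    \<comment> \<open>No additional variance at any coefficients, so centring changes nothing and
      both estimators share the limits.\<close>
    have "A.design_limits (\<lambda>_ _. 0)"
      using H by (intro A.cube_design_limits sq(3)) (auto simp: Z1')
    from conclude[OF A _ this]
    show "\<forall>\<theta>\<in>{\<theta>HT, \<theta>H}.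
         converges_to_normal M (\<lambda>n \<omega>. sqrt (real n) * (\<theta> n \<omega> - \<theta>0 n \<omega>)) V0 \<and>
         converges_to_normal M (\<lambda>n \<omega>. sqrt (real n) * (\<theta> n \<omega> - \<theta>star)) Vstar"
      by simp
  next
    assume coin: "\<forall>n. coin_toss M n X q (D n)"
    \<comment> \<open>Under a coin toss the conditional covariance of two distinct units is zero
      almost everywhere, so the constant 0 bounds it.\<close>
    have A: "asymptotic_design M W D p c (\<lambda>_ _. 0)"
    proof (rule design)
      show "null_in_prob M (\<lambda>_ _. 0)" by (simp add: null_in_prob_def)
      fix n i j :: nat assume ij: "i < n" "j < n" "i \<noteq> j"
      have one: "(\<lambda>_. 1 :: real) \<in> borel_measurable (sigma_upto M n W)" "integrable M (\<lambda>_. 1 :: real)" by auto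
      have I: "{i, j} \<subseteq> {..<n}" using ij by auto
      show "AE \<omega> in M. \<bar>real_cond_exp M (sigma_upto M n X) (\<lambda>\<omega>. (D n i \<omega> - q i \<omega>) * (D n j \<omega> - q j \<omega>)) \<omega>\<bar> \<le> 0"
        using R.integral_D_pair(2)[OF ij one] R.coin_toss_prod[OF coin[rule_format] I]
        by eventually_elim (use ij in simp)
    qed simp
    interpret A: asymptotic_design M W D p c X q "\<lambda>_ _. 0"
      by (rule A, rule eq_reflection[OF X_W], rule eq_reflection[OF q_W])
    have "A.design_limits (coin_toss_variance M (q 0) (Z0 0))"
      using A.coin_toss_design_limits[OF sq(3) coin[rule_format]] by (simp add: Z0')
    from conclude[OF A A.coin_toss_variance_nonneg this]
    show "\<forall>(\<theta>, \<Sigma>)\<in>{(\<theta>HT, \<Sigma>0), (\<theta>H, \<Sigma>H)}.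
         converges_to_normal M (\<lambda>n \<omega>. sqrt (real n) * (\<theta> n \<omega> - \<theta>0 n \<omega>)) (V0 + \<Sigma>) \<and>
         converges_to_normal M (\<lambda>n \<omega>. sqrt (real n) * (\<theta> n \<omega> - \<theta>star)) (Vstar + \<Sigma>)"
      unfolding \<Sigma>0 \<Sigma>H coin_toss_variance_hajek_def .
  next
    show "\<Sigma>0 \<ge> 0"
      unfolding \<Sigma>0 coin_toss_variance_def
    proof (rule integral_nonneg_AE)
      show "AE \<omega> in M. 0 \<le> q 0 \<omega> / (1 - q 0 \<omega>) * (Z0 0 \<omega> \<bullet> (\<beta>1 + \<beta>0))\<^sup>2"
        using overlap[of 0] by eventually_elim (use c_pos in auto)
    qed
  qed
qed

end
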